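(* For $M\in\{2,3,4,5,6,8,9\}$ the function $h_M$ (see context), holomorphic near $0$, satisfies the following degree-$N$ modular equations for all $t$ in a neighborhood of $0$. In each, with $t=t_{NM}(\tau)$, the argument of $h_M$ on the left is $t_M(\tau)$ and the argument on the right is $t_M(N\tau)$; $f\circ g$ denotes the composition $f(g(t))$, and each right-hand prefactor is the branch equal to $1$ at $t=0$. $M=2$: $N=2$: $h_2(t(t+16))=2(t+16)^{-1/4}h_2\bigl(\frac{t^2}{t+16}\bigr)$. $N=3$: $h_2\bigl(\frac{t(t+8)^3}{t+9}\bigr)=3(t+9)^{-1/2}h_2\bigl(\frac{t^3(t+8)}{(t+9)^3}\bigr)$. $N=4$: $h_2\bigl(t(t+16)\circ t(t+8)\bigr)=4[(t+4)(t+8)^2]^{-1/4}h_2\bigl(\frac{t^2}{t+16}\circ\frac{t^2}{t+4}\bigr)$. $N=5$: $h_2\bigl(\frac{t(t+4)^5}{t+5}\bigr)=5(t+5)^{-1}h_2\bigl(\frac{t^5(t+4)}{(t+5)^5}\bigr)$. $N=6$: $h_2\bigl(\frac{t(t+8)^3}{t+9}\circ t(t+6)=t(t+16)\circ\frac{t(t+4)^3}{t+3}\bigr)=6[(t+2)(t+3)(t+6)^3]^{-1/4}h_2\bigl(\frac{t^3(t+8)}{(t+9)^3}\circ\frac{t^2}{t+2}=\frac{t^2}{t+16}\circ\frac{t^3(t+4)}{(t+3)^3}\bigr)$. $N=8$: $h_2\bigl(t(t+16)\circ t(t+8)\circ t(t+4)\bigr)=8[(t+2)(t+4)^4(t^2+4t+8)]^{-1/4}h_2\bigl(\frac{t^2}{t+16}\circ\frac{t^2}{t+4}\circ\frac{t^2}{t+2}\bigr)$.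 $N=9$: $h_2\bigl(\frac{t(t+8)^3}{t+9}\circ t(t^2+6t+12)\bigr)=9(t+3)^{-2}h_2\bigl(\frac{t^3(t+8)}{(t+9)^3}\circ\frac{t^3}{t^2+3t+3}\bigr)$. $M=3$: $N=2$: $h_3\bigl(\frac{t(t+9)^2}{t+8}\bigr)=2(t+8)^{-1/3}h_3\bigl(\frac{t^2(t+9)}{(t+8)^2}\bigr)$. $N=3$: $h_3(t(t^2+9t+27))=3(t^2+9t+27)^{-1/3}h_3\bigl(\frac{t^3}{t^2+9t+27}\bigr)$. $N=4$: $h_3\bigl(\frac{t(t+9)^2}{t+8}\circ t(t+6)\bigr)=4(t+4)^{-1}h_3\bigl(\frac{t^2(t+9)}{(t+8)^2}\circ\frac{t^2}{t+2}\bigr)$. $N=6$: $h_3\bigl(t(t^2+9t+27)\circ\frac{t(t+3)^2}{t+2}=\frac{t(t+9)^2}{t+8}\circ t(t^2+6t+12)\bigr)=6\bigl[\frac{(t^2+3t+3)(t^2+6t+12)^2}{t+2}\bigr]^{-1/3}h_3\bigl(\frac{t^3}{t^2+9t+27}\circ\frac{t^2(t+3)}{(t+2)^2}=\frac{t^2(t+9)}{(t+8)^2}\circ\frac{t^3}{t^2+3t+3}\bigr)$. $M=4$: $N=2$: $h_4(t(t+8))=2(t+4)^{-1/2}h_4\bigl(\frac{t^2}{t+4}\bigr)$. $N=3$: $h_4\bigl(\frac{t(t+4)^3}{t+3}\bigr)=3(t+3)^{-1}h_4\bigl(\frac{t^3(t+4)}{(t+3)^3}\bigr)$. $N=4$: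 $h_4\bigl(t(t+8)\circ t(t+4)\bigr)=4[(t+2)(t^2+4t+8)]^{-1/2}h_4\bigl(\frac{t^2}{t+4}\circ\frac{t^2}{t+2}\bigr)$. $M=5$: $N=2$: $h_5\bigl(\frac{t(t+5)^2}{t+4}\bigr)=2(t+4)^{-1/2}h_5\bigl(\frac{t^2(t+5)}{(t+4)^2}\bigr)$. $N=5$: $h_5\bigl(t(t^4+5t^3+15t^2+25t+25)\bigr)=5[t^4+5t^3+15t^2+25t+25]^{-1/2}h_5\bigl(\frac{t^5}{t^4+5t^3+15t^2+25t+25}\bigr)$. $M=6$: $N=2$: $h_6(t(t+6))=2(t+2)^{-1}h_6\bigl(\frac{t^2}{t+2}\bigr)$. $N=3$: $h_6(t(t^2+6t+12))=3(t^2+3t+3)^{-1}h_6\bigl(\frac{t^3}{t^2+3t+3}\bigr)$. $M=8$, $N=2$: $h_8(t(t+4))=2(t+2)^{-1}h_8\bigl(\frac{t^2}{t+2}\bigr)$. $M=9$, $N=2$: $h_9\bigl(\frac{t(t+3)^2}{t+2}\bigr)=2(t+2)^{-1}h_9\bigl(\frac{t^2(t+3)}{(t+2)^2}\bigr)$.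
   Context: $j$ is the elliptic modular invariant $j(\tau)=q^{-1}+744+\cdots$, $q=e^{2\pi i\tau}$, $\tau$ in the upper half plane $\mathcal H$. The modular curve $X_0(N)=\Gamma_0(N)\setminus\mathcal H^*$ has genus zero for $N\in S=\{2,3,4,5,6,7,8,9,10,12,13,16,18,25\}$. Write $[m]$ for $\eta(m\tau)$, $\eta$ the Dedekind eta function. The canonical Hauptmodul $t_N$ (a generator of the function field of $X_0(N)$, with a simple zero at the cusp $i\infty$ and a simple pole at the cusp $0$) is: $t_2=2^{12}[2]^{24}/[1]^{24}$, $t_3=3^6[3]^{12}/[1]^{12}$, $t_4=2^8[4]^8/[1]^8$, $t_5=5^3[5]^6/[1]^6$, $t_6=2^33^2[2][6]^5/([1]^5[3])$, $t_7=7^2[7]^4/[1]^4$, $t_8=2^5[2]^2[8]^4/([1]^4[4]^2)$, $t_9=3^3[9]^3/[1]^3$, $t_{10}=2^2\cdot5\,[2][10]^3/([1]^3[5])$, $t_{12}=2^2\cdot3\,[2]^2[3][12]^3/([1]^3[4][6]^2)$, $t_{13}=13[13]^2/[1]^2$, $t_{16}=2^3[2][16]^2/([1]^2[8])$, $t_{18}=2\cdot3\,[2][3][18]^2/([1]^2[6][9])$, $t_{25}=5[25]/[1]$. Since $t_N$ generates the function field of $X_0(N)$, $j=P_N(t_N)/Q_N(t_N)$ with coprime polynomials $P_N,Q_N$, and $Q_N(0)=0$. The function $h_N$ is defined near $t=0$ by $h_N(t)=[P_N(t)/P_N(0)]^{-1/12}\,{}_2F_1\bigl(\tfrac1{12},\tfrac5{12};1;12^3Q_N(t)/P_N(t)\bigr)$,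 the branch of the power being $1$ at $t=0$. An expression "$h_M(A=B)$" means that the two rational functions $A$ and $B$ of $t$ coincide, and $h_M$ is evaluated at their common value. *)

theory Defs
  imports "HOL-Complex_Analysis.Complex_Analysis"
begin

definition nome :: "complex \<Rightarrow> complex" where
  "nome \<tau> = exp (2 * of_real pi * \<i> * \<tau>)"

definition dedekind_eta :: "complex \<Rightarrow> complex" where
  "dedekind_eta \<tau> = exp (2 * of_real pi * \<i> * \<tau> / 24) * (\<Prod>n. 1 - nome \<tau> ^ Suc n)"

definition eisenstein_E4 :: "complex \<Rightarrow> complex" where
  "eisenstein_E4 \<tau> = 1 + 240 * (\<Sum>n. of_nat (\<Sum>d | d dvd Suc n. d ^ 3) * nome \<tau> ^ Suc n)"

text \<open>The elliptic modular invariant \<open>E\<^sub>4\<^sup>3 / \<Delta>\<close> with \<open>\<Delta> = \<eta>\<^sup>2\<^sup>4\<close>; in this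
  normalization its expansion is \<open>q\<^sup>-\<^sup>1 + 744 + \<dots>\<close>.\<close>

definition modular_j :: "complex \<Rightarrow> complex" where
  "modular_j \<tau> = eisenstein_E4 \<tau> ^ 3 / dedekind_eta \<tau> ^ 24"

text \<open>The canonical Hauptmoduln of \<open>X\<^sub>0(N)\<close> for the levels \<open>N\<close> other than 1 at which the curve
  has genus zero. The value 0 at any other \<open>N\<close> is a dummy.\<close>

definition hauptmodul :: "nat \<Rightarrow> complex \<Rightarrow> complex" where
  "hauptmodul N \<tau> = (let e = (\<lambda>m::nat. dedekind_eta (of_nat m * \<tau>)) in
     if N = 2 then 2^12 * e 2^24 / e 1^24
     else if N = 3 then 3^6 * e 3^12 / e 1^12
     else if N = 4 then 2^8 * e 4^8 / e 1^8
     else if N = 5 then 5^3 * e 5^6 / e 1^6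
     else if N = 6 then 2^3 * 3^2 * e 2 * e 6^5 / (e 1^5 * e 3)
     else if N = 7 then 7^2 * e 7^4 / e 1^4
     else if N = 8 then 2^5 * e 2^2 * e 8^4 / (e 1^4 * e 4^2)
     else if N = 9 then 3^3 * e 9^3 / e 1^3
     else if N = 10 then 2^2 * 5 * e 2 * e 10^3 / (e 1^3 * e 5)
     else if N = 12 then 2^2 * 3 * e 2^2 * e 3 * e 12^3 / (e 1^3 * e 4 * e 6^2)
     else if N = 13 then 13 * e 13^2 / e 1^2
     else if N = 16 then 2^3 * e 2 * e 16^2 / (e 1^2 * e 8)
     else if N = 18 then 2 * 3 * e 2 * e 3 * e 18^2 / (e 1^2 * e 6 * e 9)
     else if N = 25 then 5 * e 25 / e 1
     else 0)"

text \<open>The pair \<open>(P\<^sub>N, Q\<^sub>N)\<close> with \<open>j = P\<^sub>N(t\<^sub>N) / Q\<^sub>N(t\<^sub>N)\<close> in lowest terms is determined up to a common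
  nonzero constant factor, on which \<open>h\<^sub>N\<close> below does not depend, so that any choice will do.\<close>

definition j_presentation :: "nat \<Rightarrow> complex poly \<Rightarrow> complex poly \<Rightarrow> bool" where
  "j_presentation N P Q \<longleftrightarrow> coprime P Q \<and>
     (\<forall>\<tau>. Im \<tau> > 0 \<longrightarrow> poly Q (hauptmodul N \<tau>) \<noteq> 0 \<and>
        modular_j \<tau> = poly P (hauptmodul N \<tau>) / poly Q (hauptmodul N \<tau>))"

definition j_polys :: "nat \<Rightarrow> complex poly \<times> complex poly" where
  "j_polys N = (SOME (P, Q). j_presentation N P Q)"

definition j_num :: "nat \<Rightarrow> complex poly" where
  "j_num N = fst (j_polys N)"

definition j_den :: "nat \<Rightarrow> complex poly" where
  "j_den N = snd (j_polys N)"

text \<open>The sum of the Gauss series \<open>\<^sub>2F\<^sub>1(a, b; c; z)\<close>, significant for \<open>norm z < 1\<close>.\<close>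

definition hyp2f1 :: "complex \<Rightarrow> complex \<Rightarrow> complex \<Rightarrow> complex \<Rightarrow> complex" where
  "hyp2f1 a b c z = eval_fps (fps_hypergeo [a, b] [c] 1) z"

text \<open>The base of the power is 1 at \<open>t = 0\<close>, so that near 0 the principal branch is the branch
  with value 1 at \<open>t = 0\<close>. Only the germ of \<open>h\<^sub>N\<close> at 0 is meaningful.\<close>

definition h :: "nat \<Rightarrow> complex \<Rightarrow> complex" where
  "h N t = (poly (j_num N) t / poly (j_num N) 0) powr (- 1 / 12) *
     hyp2f1 (1/12) (5/12) 1 (12 ^ 3 * poly (j_den N) t / poly (j_num N) t)"

text \<open>The degree-\<open>N\<close> modular equation \<open>h\<^sub>M(A(t)) = C(t) h\<^sub>M(B(t))\<close> near 0, where \<open>A\<close> and \<open>B\<close> express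
  \<open>t\<^sub>M(\<tau>)\<close> and \<open>t\<^sub>M(N\<tau>)\<close> in terms of \<open>t\<^sub>N\<^sub>M(\<tau>)\<close>. The prefactor \<open>C\<close> has to be
  the branch with value 1 at \<open>t = 0\<close>.\<close>

definition modular_equation ::
  "nat \<Rightarrow> nat \<Rightarrow> (complex \<Rightarrow> complex) \<Rightarrow> (complex \<Rightarrow> complex) \<Rightarrow> (complex \<Rightarrow> complex) \<Rightarrow> bool" where
  "modular_equation M N A C B \<longleftrightarrow>
     (\<forall>\<tau>. Im \<tau> > 0 \<longrightarrow>
        hauptmodul M \<tau> = A (hauptmodul (N * M) \<tau>) \<and>
        hauptmodul M (of_nat N * \<tau>) = B (hauptmodul (N * M) \<tau>)) \<and>
     C analytic_on {0} \<and> C 0 = 1 \<and>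
     (\<forall>\<^sub>F t in nhds 0. h M (A t) = C t * h M (B t))"

text \<open>Equality of rational functions, given as functions that take junk values at their poles:
  agreement at all but finitely many points (equivalent to equality in the field of rational functions).\<close>

definition same_rational :: "(complex \<Rightarrow> complex) \<Rightarrow> (complex \<Rightarrow> complex) \<Rightarrow> bool" where
  "same_rational A B \<longleftrightarrow> (\<forall>\<^sub>\<infinity>t. A t = B t)"

end

theory Submission
  imports Defs "HOL-Computational_Algebra.Fundamental_Theorem_Algebra"
begin

text \<open>
  All functions are viewed as functions of the nome \<open>q\<close>. By the triple product identity, Euler
  products and their cubes are theta series, and dissecting these series modulo 2, 3 and 5 shows that for
  suitable constants \<open>c\<close> the functions \<open>t\<^sub>N + c\<close> (and a few quadratic and quartic polynomials in \<open>t\<^sub>N\<close>) are eta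
  quotients. The relations between \<open>t\<^sub>M(\<tau>)\<close>, \<open>t\<^sub>M(N\<tau>)\<close> and \<open>t\<^sub>N\<^sub>M(\<tau>)\<close> thereby become identities
  between monomials.

  The heat equation for the triple product yields Ramanujan's equation \<open>12 q dP/dq = P\<^sup>2 - E\<^sub>4\<close>, where \<open>P\<close> is the
  Eisenstein series of weight 2. With the evaluation of \<open>E\<^sub>4\<close> in terms of \<open>t\<^sub>2\<close> it follows that \<open>E\<^sub>4\<^sup>1\<^sup>/\<^sup>4\<close>
  and the hypergeometric function at \<open>1728/j\<close> satisfy the same linear differential equation of order 2 near \<open>q = 0\<close>, so they
  agree there. Hence \<open>h\<^sub>M(t\<^sub>M)\<^sup>1\<^sup>2\<close> is an explicit eta quotient. The 12th powers of both sides of a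
  modular equation are then equal, and both sides are 1 at \<open>t = 0\<close>.
\<close>

section \<open>Euler products\<close>

text \<open>No theory of modular forms enters: there is no valence formula and no dimension count,
  so every identity has to come from rearranging absolutely convergent series or from a functional
  equation in \<open>q\<close>. Why \<open>h_M\<close> collapses: write
  \<open>P / Q = j = E4^3 / \<Delta>\<close>. The twelfth power of the prefactor is
  \<open>P(0) / P\<close>, that of the hypergeometric factor is \<open>E4^3\<close>, and so
  \<open>h_M(t_M)^12 = P(0) \<Delta> / Q(t_M)\<close>. The form of weight 4 has cancelled, and
  \<open>Q(t_M)\<close>, being without zeros on the upper half plane, is an eta quotient. A modular
  equation then asserts only that a quotient of two such expressions, at \<open>\<tau>\<close> and
  \<open>N \<tau>\<close>, is a power of an explicit function of \<open>t_NM\<close>. Two further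
  obstacles shape the proof. The pair \<open>j_polys\<close> is picked by \<open>SOME\<close>, so
  presentations of \<open>j\<close> have to be shown unique up to a constant. And the claims concern
  small \<open>t\<close>, whereas the identities live in \<open>q\<close>, so \<open>t_N\<close> has
  to be an open map at \<open>q = 0\<close>.\<close>

definition qpoch :: "complex \<Rightarrow> complex \<Rightarrow> complex" where
  "qpoch a q = (\<Prod>n. 1 - a * q ^ n)"

text \<open>The Dedekind eta function without its factor \<open>q^(1/24)\<close>. Dropping that
  factor leaves a single-valued function on the unit disc, holomorphic also at
  \<open>q = 0\<close>.\<close>

definition eul :: "complex \<Rightarrow> complex" where
  "eul q = qpoch q q"

lemma abs_convergent_qpoch:
  fixes a q :: complex
  assumes "norm q < 1"
  shows "abs_convergent_prod (\<lambda>n. 1 - a * q ^ n)"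
  unfolding abs_convergent_prod_conv_summable
  using summable_mult[of "\<lambda>n. norm q ^ n" "norm a"] assms
  by (simp add: norm_mult norm_power summable_geometric)

lemma convergent_qpoch:
  fixes a q :: complex
  assumes "norm q < 1"
  shows "convergent_prod (\<lambda>n. 1 - a * q ^ n)"
  using abs_convergent_qpoch[OF assms, of a] by (rule abs_convergent_prod_imp_convergent_prod)

lemma has_prod_qpoch:
  assumes "norm q < 1"
  shows "(\<lambda>n. 1 - a * q ^ n) has_prod qpoch a q"
  unfolding qpoch_def using convergent_qpoch[OF assms, of a] by (rule convergent_prod_has_prod)

lemma qpoch_LIMSEQ:
  assumes "norm q < 1"
  shows "(\<lambda>m. \<Prod>n<m. 1 - a * q ^ n) \<longlonglongrightarrow> qpoch a q"
  by (rule has_prod_imp_tendsto'[OF has_prod_qpoch[OF assms, of a]])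

lemma qpoch_eq_0_iff:
  assumes "norm q < 1"
  shows "qpoch a q = 0 \<longleftrightarrow> (\<exists>n. a * q ^ n = 1)"
proof -
  have "qpoch a q = 0 \<longleftrightarrow> (\<exists>n. 0 = 1 - a * q ^ n)"
    using has_prod_eq_0_iff[OF has_prod_qpoch[OF assms, of a]] by (simp add: image_iff)
  thus ?thesis by (metis eq_iff_diff_eq_0)
qed

lemma norm_power_lt_1:
  assumes "norm (q :: complex) < 1" "k > 0"
  shows "norm (q ^ k) < 1"
  using assms by (simp add: norm_power power_less_one_iff)

lemma qpoch_nonzero:
  assumes "norm q < 1" "norm a < 1"
  shows "qpoch a q \<noteq> 0"
proof -
  have "norm (a * q ^ n) < 1" for n
  proof -
    have "norm (a * q ^ n) \<le> norm a * 1"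
      unfolding norm_mult norm_power using assms
      by (intro mult_left_mono power_le_one) auto
    thus ?thesis using assms by simp
  qed
  thus ?thesis unfolding qpoch_eq_0_iff[OF assms(1)]
    by (metis norm_one less_irrefl)
qed

lemma eul_nonzero: "norm q < 1 \<Longrightarrow> eul q \<noteq> 0"
  unfolding eul_def by (rule qpoch_nonzero)

lemma eul_0 [simp]: "eul 0 = 1"
  by (simp add: eul_def qpoch_def)

lemma qpoch_shift:
  assumes "norm q < 1"
  shows "qpoch a q = (1 - a) * qpoch (a * q) q"
proof -
  have "(\<lambda>m. \<Prod>n<Suc m. 1 - a * q ^ n) \<longlonglongrightarrow> qpoch a q"
    using qpoch_LIMSEQ[OF assms] by (rule LIMSEQ_Suc)
  moreover have "(\<Prod>n<Suc m. 1 - a * q ^ n) = (1 - a) * (\<Prod>n<m. 1 - (a * q) * q ^ n)" for m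
    by (subst prod.lessThan_Suc_shift) (simp add: mult_ac)
  moreover have "(\<lambda>m. (1 - a) * (\<Prod>n<m. 1 - (a * q) * q ^ n)) \<longlonglongrightarrow> (1 - a) * qpoch (a * q) q"
    by (intro tendsto_intros qpoch_LIMSEQ assms)
  ultimately show ?thesis using LIMSEQ_unique by simp
qed

lemma prod_lessThan_mult:
  fixes f :: "nat \<Rightarrow> 'a :: comm_monoid_mult"
  shows "(\<Prod>n<m * k. f n) = (\<Prod>r<k. \<Prod>i<m. f (r + k * i))"
proof (induction m)
  case (Suc m)
  have "(\<Prod>n<Suc m * k. f n) = (\<Prod>n\<in>{..<m * k} \<union> {m * k..<m * k + k}. f n)"
    by (rule prod.cong) auto
  also have "\<dots> = (\<Prod>n<m * k. f n) * (\<Prod>n\<in>{m * k..<m * k + k}. f n)"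
    by (rule prod.union_disjoint) auto
  also have "(\<Prod>n\<in>{m * k..<m * k + k}. f n) = (\<Prod>r<k. f (r + k * m))"
    by (rule prod.reindex_bij_witness[of _ "\<lambda>r. r + k * m" "\<lambda>n. n - k * m"]) (auto simp: mult.commute)
  finally show ?case by (simp add: Suc.IH prod.distrib)
qed auto

text \<open>The exponents are sorted by residue: \<open>n = r + k * i\<close>. Partial products of
  length \<open>m * k\<close> split exactly, and finitely many limits may be multiplied.\<close>

lemma qpoch_split:
  assumes "norm q < 1" "k > 0"
  shows "qpoch a q = (\<Prod>r<k. qpoch (a * q ^ r) (q ^ k))"
proof -
  have "(\<lambda>m. \<Prod>n<m * k. 1 - a * q ^ n) \<longlonglongrightarrow> qpoch a q"
    using filterlim_compose[OF qpoch_LIMSEQ[OF assms(1), of a], of "\<lambda>m. m * k"]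
      mult_nat_right_at_top[of k] assms by (simp add: o_def)
  moreover have "(\<Prod>n<m * k. 1 - a * q ^ n) = (\<Prod>r<k. \<Prod>i<m. 1 - (a * q ^ r) * (q ^ k) ^ i)" for m
    by (subst prod_lessThan_mult) (simp add: power_add power_mult mult.assoc)
  moreover have "(\<lambda>m. \<Prod>r<k. \<Prod>i<m. 1 - (a * q ^ r) * (q ^ k) ^ i)
      \<longlonglongrightarrow> (\<Prod>r<k. qpoch (a * q ^ r) (q ^ k))"
    by (intro tendsto_prod qpoch_LIMSEQ norm_power_lt_1 assms)
  ultimately show ?thesis using LIMSEQ_unique by simp
qed

text \<open>The roots are multiplied out factor by factor inside the partial products. They enter
  only through their polynomial identity, which serves square, cube and fifth roots alike.\<close>

lemma qpoch_roots:
  assumes "norm q < 1" and roots: "\<And>x. (\<Prod>j<p. 1 - x * w j) = 1 - x ^ p" and "p > 0"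
  shows "(\<Prod>j<p. qpoch (a * w j) q) = qpoch (a ^ p) (q ^ p)"
proof -
  have "(\<lambda>m. \<Prod>j<p. \<Prod>n<m. 1 - (a * w j) * q ^ n) \<longlonglongrightarrow> (\<Prod>j<p. qpoch (a * w j) q)"
    by (intro tendsto_prod qpoch_LIMSEQ assms)
  moreover have "(\<Prod>j<p. \<Prod>n<m. 1 - (a * w j) * q ^ n) = (\<Prod>n<m. 1 - a ^ p * (q ^ p) ^ n)" for m
  proof -
    have "(\<Prod>j<p. \<Prod>n<m. 1 - (a * w j) * q ^ n) = (\<Prod>n<m. \<Prod>j<p. 1 - (a * q ^ n) * w j)"
      by (subst prod.swap) (simp add: mult_ac)
    thus ?thesis by (simp add: roots power_mult_distrib flip: power_mult) (simp add: mult.commute)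
  qed
  ultimately show ?thesis
    using LIMSEQ_unique qpoch_LIMSEQ[OF norm_power_lt_1[OF assms(1,3)], of "a ^ p"] by simp
qed

lemma qpoch_minus:
  assumes "norm q < 1"
  shows "qpoch a q * qpoch (- a) q = qpoch (a ^ 2) (q ^ 2)"
proof -
  have "(\<Prod>j<2. qpoch (a * (- 1) ^ j) q) = qpoch (a ^ 2) (q ^ 2)"
    by (rule qpoch_roots) (use assms in \<open>auto simp: lessThan_Suc numeral_2_eq_2 algebra_simps\<close>)
  thus ?thesis by (simp add: lessThan_Suc numeral_2_eq_2 mult.commute)
qed

text \<open>In the split of \<open>qpoch q q\<close> the class of exponents divisible by
  \<open>k\<close> is again an Euler product, in \<open>q ^ k\<close>.\<close>

lemma eul_split:
  assumes "norm q < 1" "k > 0"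
  shows "eul q = eul (q ^ k) * (\<Prod>r\<in>{1..<k}. qpoch (q ^ r) (q ^ k))"
proof -
  have "eul q = (\<Prod>r<k. qpoch (q ^ Suc r) (q ^ k))"
    unfolding eul_def by (subst qpoch_split[OF assms]) simp
  also have "\<dots> = (\<Prod>r\<in>{1..<Suc k}. qpoch (q ^ r) (q ^ k))"
    by (rule prod.reindex_bij_witness[of _ "\<lambda>r. r - 1" Suc]) auto
  also have "{1..<Suc k} = insert k {1..<k}" using assms by auto
  finally show ?thesis by (simp add: eul_def)
qed

text \<open>The hypothesis says that \<open>j \<mapsto> w j ^ r\<close> enumerates the \<open>p\<close>-th roots of unity for every
  \<open>r\<close> prime to \<open>p\<close>, so \<open>p\<close> is a prime and \<open>w\<close> enumerates the \<open>p\<close>-th roots of unity.\<close>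

lemma prod_eul_roots:
  assumes q: "norm q < 1" and p: "p > 0"
    and roots: "\<And>r x. r \<in> {1..<p} \<Longrightarrow> (\<Prod>j<p. 1 - x * w j ^ r) = 1 - x ^ p"
    and w: "\<And>j. w j ^ p = 1"
  shows "(\<Prod>j<p. eul (w j * q)) * eul (q ^ (p * p)) = eul (q ^ p) ^ (p + 1)"
proof -
  have nw: "norm (w j) = 1" for j
  proof -
    have "norm (w j) ^ p = 1" by (metis w norm_power norm_one)
    thus ?thesis using p by (metis gr0_implies_Suc norm_ge_zero power_eq_1_iff nat.simps(3) abs_of_nonneg real_norm_def)
  qed
  have "eul (w j * q) = eul (q ^ p) * (\<Prod>r\<in>{1..<p}. qpoch (q ^ r * w j ^ r) (q ^ p))" for j
    using eul_split[of "w j * q" p] q p nw w by (simp add: norm_mult power_mult_distrib mult.commute)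
  hence "(\<Prod>j<p. eul (w j * q))
      = eul (q ^ p) ^ p * (\<Prod>r\<in>{1..<p}. \<Prod>j<p. qpoch (q ^ r * w j ^ r) (q ^ p))"
    by (simp add: prod.distrib) (rule disjI2, rule prod.swap)
  also have "(\<Prod>r\<in>{1..<p}. \<Prod>j<p. qpoch (q ^ r * w j ^ r) (q ^ p))
      = (\<Prod>r\<in>{1..<p}. qpoch ((q ^ p) ^ r) ((q ^ p) ^ p))"
  proof (rule prod.cong)
    fix r assume "r \<in> {1..<p}"
    then show "(\<Prod>j<p. qpoch (q ^ r * w j ^ r) (q ^ p)) = qpoch ((q ^ p) ^ r) ((q ^ p) ^ p)"
      using qpoch_roots[OF norm_power_lt_1[OF q p] roots p, of r "q ^ r"]
      by (simp add: mult.commute flip: power_mult)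
  qed auto
  finally have "(\<Prod>j<p. eul (w j * q)) * eul (q ^ (p * p)) = eul (q ^ p) ^ p *
      (eul ((q ^ p) ^ p) * (\<Prod>r\<in>{1..<p}. qpoch ((q ^ p) ^ r) ((q ^ p) ^ p)))"
    by (simp flip: power_mult)
  \<comment> \<open>The bracket is the splitting of \<open>eul (q ^ p)\<close> into residue classes
    modulo \<open>p\<close>, read backwards.\<close>
  also have "\<dots> = eul (q ^ p) ^ p * eul (q ^ p)"
    using eul_split[OF norm_power_lt_1[OF q p] p] by simp
  finally show ?thesis by simp
qed

lemma holomorphic_eul: "eul holomorphic_on ball 0 1"
proof (rule holomorphic_uniform_sequence)
  show "(\<lambda>q. \<Prod>n<m. 1 - q * q ^ n) holomorphic_on ball 0 1" for m :: nat
    by (intro holomorphic_intros)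
  fix x :: complex assume x: "x \<in> ball 0 1"
  \<comment> \<open>Half the distance to the unit circle: the closed disc around \<open>x\<close>
    stays within norm \<open>(1 + norm x) / 2 < 1\<close>, which gives one geometric majorant for
    all factors.\<close>
  define d where "d = (1 - norm x) / 2"
  have d: "d > 0" using x by (simp add: d_def)
  have bd: "norm q \<le> (1 + norm x) / 2" if "q \<in> cball x d" for q
  proof -
    have "norm q \<le> norm x + norm (q - x)" using norm_triangle_sub by blast
    with that show ?thesis by (simp add: dist_norm norm_minus_commute d_def field_simps)
  qed
  have lt: "(1 + norm x) / 2 < 1" using x by simp
  have sub: "cball x d \<subseteq> ball 0 1" using bd lt by (fastforce simp: dist_norm)
  have "uniformly_convergent_on (cball x d) (\<lambda>N q. \<Sum>n<N. norm ((1 - q * q ^ n) - 1))"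
  proof (rule Weierstrass_m_test')
    fix n q assume "q \<in> cball x d"
    show "norm (norm ((1 - q * q ^ n) - 1)) \<le> ((1 + norm x) / 2) ^ Suc n"
      using power_mono[OF bd[OF \<open>q \<in> cball x d\<close>], of "Suc n"]
      by (simp add: norm_mult norm_power)
  next
    show "summable (\<lambda>n. ((1 + norm x) / 2) ^ Suc n)"
      using summable_geometric[of "(1 + norm x) / 2"] lt
      by (subst summable_Suc_iff) auto
  qed
  hence "uniformly_convergent_on (cball x d) (\<lambda>m q. \<Prod>n<m. 1 - q * q ^ n)"
    by (intro uniformly_convergent_on_prod') (auto intro!: continuous_intros)
  then obtain l where l: "uniform_limit (cball x d) (\<lambda>m q. \<Prod>n<m. 1 - q * q ^ n) l sequentially"
    by (auto simp: uniformly_convergent_on_def)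
  have "l q = eul q" if "q \<in> cball x d" for q
    using tendsto_uniform_limitI[OF l that] qpoch_LIMSEQ[of q q] sub that LIMSEQ_unique
    unfolding eul_def by (metis dist_0_norm mem_ball subsetD)
  with l have "uniform_limit (cball x d) (\<lambda>m q. \<Prod>n<m. 1 - q * q ^ n) eul sequentially"
    using uniform_limit_cong' by (metis (no_types, lifting))
  with d sub show "\<exists>d>0. cball x d \<subseteq> ball 0 1
      \<and> uniform_limit (cball x d) (\<lambda>m q. \<Prod>n<m. 1 - q * q ^ n) eul sequentially" by blast
qed auto

section \<open>The triple product and dissections of theta series\<close>

lemma summable_on_int_split:
  fixes f :: "int \<Rightarrow> real"
  assumes "summable (\<lambda>n. f (int n))" "summable (\<lambda>n. f (- int n))" "\<And>n. f n \<ge> 0"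
  shows "f summable_on UNIV"
proof -
  have "(f \<circ> int) summable_on UNIV" "(f \<circ> (\<lambda>n. - int n)) summable_on UNIV"
    using assms by (auto simp: o_def summable_on_UNIV_nonneg_real_iff)
  hence "f summable_on range int" "f summable_on range (\<lambda>n. - int n)"
    by (simp_all add: summable_on_reindex inj_on_def)
  hence "f summable_on (range int \<union> range (\<lambda>n. - int n))"
    by (rule summable_on_union)
  also have "range int \<union> range (\<lambda>n. - int n) = UNIV"
  proof -
    have "x \<in> range int \<union> range (\<lambda>n. - int n)" for x
      by (cases x rule: int_cases2) auto
    thus ?thesis by blast
  qed
  finally show ?thesis .
qed

lemma int_triangular: "int (n * (n - 1) div 2) = int n * (int n - 1) div 2"
  by (cases n) (simp_all add: zdiv_int algebra_simps)

text \<open>The ratio of consecutive terms is \<open>r ^ n * s\<close>, which tends to 0 however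
  large \<open>s\<close> is.\<close>

lemma summable_theta_nat:
  fixes r s :: real
  assumes "0 < r" "r < 1" "s > 0"
  shows "summable (\<lambda>n. r ^ (n * (n - 1) div 2) * s ^ n)"
proof -
  have "(\<lambda>n. r ^ n * s) \<longlonglongrightarrow> 0 * s"
    by (intro tendsto_intros LIMSEQ_realpow_zero) (use assms in auto)
  hence "\<forall>\<^sub>F n in sequentially. r ^ n * s < 1 / 2"
    by (intro order_tendstoD) auto
  then obtain N where N: "\<And>n. n \<ge> N \<Longrightarrow> r ^ n * s < 1 / 2"
    by (auto simp: eventually_sequentially)
  show ?thesis
  proof (rule summable_ratio_test)
    fix n assume "N \<le> n"
    have "Suc n * (Suc n - 1) div 2 = n * (n - 1) div 2 + n"
    proof -
      have "Suc n * (Suc n - 1) = n * (n - 1) + n * 2" by (cases n) (auto simp: algebra_simps)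
      thus ?thesis by simp
    qed
    hence "norm (r ^ (Suc n * (Suc n - 1) div 2) * s ^ Suc n) = (r ^ n * s) * (r ^ (n * (n - 1) div 2) * s ^ n)"
      using assms by (simp add: power_add mult_ac abs_mult)
    also have "\<dots> \<le> (1 / 2) * (r ^ (n * (n - 1) div 2) * s ^ n)"
      using N[OF \<open>N \<le> n\<close>] assms by (intro mult_right_mono) auto
    finally show "norm (r ^ (Suc n * (Suc n - 1) div 2) * s ^ Suc n) \<le> 1 / 2 * norm (r ^ (n * (n - 1) div 2) * s ^ n)"
      using assms by (simp add: abs_mult)
  qed simp
qed

text \<open>Changing the sign of \<open>n\<close> turns \<open>s\<close> into \<open>r / s\<close>,
  so both halves are instances of the one-sided series.\<close>

lemma summable_theta:
  fixes r s :: real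
  assumes "0 < r" "r < 1" "s > 0"
  shows "(\<lambda>n::int. r powi (n * (n - 1) div 2) * s powi n) summable_on UNIV"
proof (rule summable_on_int_split)
  show "summable (\<lambda>n. r powi (int n * (int n - 1) div 2) * s powi int n)"
    using summable_theta_nat[OF assms] by (simp flip: int_triangular)
  have "summable (\<lambda>n. r ^ (n * (n - 1) div 2) * (r / s) ^ n)"
    using assms by (intro summable_theta_nat) auto
  moreover have "r powi (- int n * (- int n - 1) div 2) * s powi - int n = r ^ (n * (n - 1) div 2) * (r / s) ^ n" for n
  proof -
    have "- int n * (- int n - 1) = int n * (int n - 1) + int n * 2" by (simp add: algebra_simps)
    hence "- int n * (- int n - 1) div 2 = int n * (int n - 1) div 2 + int n" by simp
    also have "int n * (int n - 1) div 2 = int (n * (n - 1) div 2)"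
      by (rule int_triangular [symmetric])
    finally have "r powi (- int n * (- int n - 1) div 2) = r ^ (n * (n - 1) div 2) * r ^ n"
      by (simp only: of_nat_add [symmetric] power_int_of_nat power_add)
    thus ?thesis by (simp add: power_int_minus power_divide field_simps)
  qed
  ultimately show "summable (\<lambda>n. r powi (- int n * (- int n - 1) div 2) * s powi - int n)" by simp
qed (use assms in auto)

text \<open>Tannery's theorem carried from the naturals to the integers along
  \<open>int_decode\<close>; it justifies the limit in the finite triple product.\<close>

lemma has_sum_dominated:
  fixes F :: "nat \<Rightarrow> int \<Rightarrow> complex"
  assumes lim: "\<And>n. (\<lambda>m. F m n) \<longlonglongrightarrow> G n"
    and bound: "\<And>m n. norm (F m n) \<le> B n" and B: "B summable_on UNIV"
    and L: "(\<lambda>m. infsum (F m) UNIV) \<longlonglongrightarrow> L"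
  shows "(G has_sum L) UNIV"
proof -
  have bij: "bij_betw int_decode UNIV UNIV" by (simp add: bij_int_decode)
  have Bnn: "B n \<ge> 0" for n using bound[of 0 n] norm_ge_zero order_trans by blast
  have sB: "summable (\<lambda>k. B (int_decode k))"
    using B summable_on_reindex_bij_betw[OF bij, of B] Bnn by (simp add: summable_on_UNIV_nonneg_real_iff)
  have "summable (\<lambda>k. norm (G (int_decode k))) \<and>
        (\<lambda>m. \<Sum>k. F m (int_decode k)) \<longlonglongrightarrow> (\<Sum>k. G (int_decode k))"
    using tannerys_theorem[of "\<lambda>k m. F m (int_decode k)" "\<lambda>k. G (int_decode k)" sequentially "\<lambda>k. B (int_decode k)"]
      lim bound sB by (simp add: always_eventually split_beta)
  moreover have "(\<Sum>k. F m (int_decode k)) = infsum (F m) UNIV" for m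
  proof -
    have sF: "summable (\<lambda>k. norm (F m (int_decode k)))"
      using sB by (rule summable_comparison_test[rotated]) (auto intro!: bound)
    have "((\<lambda>k. F m (int_decode k)) has_sum (\<Sum>k. F m (int_decode k))) UNIV"
      by (rule norm_summable_imp_has_sum[OF sF summable_sums[OF summable_norm_cancel[OF sF]]])
    thus ?thesis using has_sum_reindex_bij_betw[OF bij, of "F m"] by (simp add: infsumI)
  qed
  ultimately have "summable (\<lambda>k. norm (G (int_decode k)))" "(\<Sum>k. G (int_decode k)) = L"
    using L LIMSEQ_unique by auto
  hence "((\<lambda>k. G (int_decode k)) has_sum L) UNIV"
    by (metis norm_summable_imp_has_sum summable_norm_cancel summable_sums)
  thus ?thesis using has_sum_reindex_bij_betw[OF bij, of G] by simp
qed

section \<open>The q-binomial theorem and the triple product identity\<close>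

context
  fixes q :: complex
  assumes q: "norm q < 1" "q \<noteq> 0"
begin

private definition P where "P n = (\<Prod>k<n. 1 - q * q ^ k)"
text \<open>Gaussian binomial coefficients, \<open>P n\<close> being
  \<open>(1 - q) ... (1 - q ^ n)\<close>. The value 0 above the diagonal lets the Pascal rule hold
  at its edge \<open>k = n\<close>.\<close>

private definition gb where "gb n k = (if k \<le> n then P n / (P k * P (n - k)) else 0)"

private lemma P_nz: "P n \<noteq> 0"
proof -
  have "q * q ^ k \<noteq> 1" for k
    using q norm_power_lt_1[of q "Suc k"] by (metis norm_one less_irrefl power_Suc zero_less_Suc)
  thus ?thesis by (simp add: P_def)
qed

private lemma P_Suc: "P (Suc n) = P n * (1 - q * q ^ n)"
  by (simp add: P_def mult.commute)

private lemma P_0: "P 0 = 1" by (simp add: P_def)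

private lemma gb_pascal:
  assumes "k \<le> n"
  shows "gb (Suc n) (Suc k) = gb n (Suc k) + q ^ (n - k) * gb n k"
proof (cases "k = n")
  case True
  thus ?thesis using P_nz by (simp add: gb_def P_0)
next
  case False
  then obtain d where n: "n = k + Suc d" using assms by (metis less_imp_Suc_add le_neq_implies_less add_Suc_right)
  have nz: "1 - q * q ^ k \<noteq> 0" "1 - q * q ^ d \<noteq> 0"
    using P_nz[of "Suc k"] P_nz[of "Suc d"] by (auto simp: P_Suc)
  have "q ^ (n - k) = q * q ^ d" "q * q ^ n = (q * q ^ k) * (q * q ^ d)"
    by (simp_all add: n power_add)
  moreover have "gb (Suc n) (Suc k) = P n * (1 - q * q ^ n) / (P k * (1 - q * q ^ k) * (P d * (1 - q * q ^ d)))"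
    "gb n (Suc k) = P n / (P k * (1 - q * q ^ k) * P d)"
    "gb n k = P n / (P k * (P d * (1 - q * q ^ d)))"
    by (simp_all add: gb_def n P_Suc)
  moreover have key: "p * (1 - A * B) / (u * (1 - A) * (v * (1 - B))) = p / (u * (1 - A) * v) + B * (p / (u * (v * (1 - B))))"
    if "u \<noteq> 0" "v \<noteq> 0" "1 - A \<noteq> 0" "1 - B \<noteq> 0" for p u v A B :: complex
    using that by (simp add: divide_simps) (simp add: algebra_simps)
  note key[OF P_nz[of k] P_nz[of d] nz, of "P n"]
  ultimately show ?thesis by (simp only:)
qed

private lemma tri_Suc: "Suc j * j div 2 = j * (j - 1) div 2 + j"
proof -
  have "Suc j * j = j * (j - 1) + j * 2" by (cases j) (auto simp: algebra_simps)
  thus ?thesis by simp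
qed

text \<open>Induction on the number of factors: multiplying by \<open>1 - x * q ^ n\<close> acts on
  the coefficients as the Pascal rule does, because the triangular exponent grows by
  \<open>j\<close> from \<open>j\<close> to \<open>Suc j\<close>.\<close>

private lemma q_binomial:
  "(\<Prod>k<n. 1 - x * q ^ k) = (\<Sum>j\<le>n. gb n j * (- 1) ^ j * q ^ (j * (j - 1) div 2) * x ^ j)"
proof (induction n)
  case 0
  thus ?case by (simp add: gb_def P_0)
next
  case (Suc n)
  define c where "c n j = gb n j * (- 1) ^ j * q ^ (j * (j - 1) div 2)" for n j
  have c0: "c n 0 = 1" for n using P_nz by (simp add: c_def gb_def P_0)
  have cs: "c (Suc n) (Suc j) = c n (Suc j) - q ^ n * c n j" if "j \<le> n" for j
  proof -
    have "Suc j * j div 2 + (n - j) = j * (j - 1) div 2 + n"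
      unfolding tri_Suc using that by simp
    hence "q ^ (Suc j * j div 2) * q ^ (n - j) = q ^ (j * (j - 1) div 2) * q ^ n"
      by (metis power_add)
    thus ?thesis using gb_pascal[OF that] unfolding c_def
      by (simp add: algebra_simps)
  qed
  have "(\<Prod>k<Suc n. 1 - x * q ^ k) = (\<Sum>j\<le>n. c n j * x ^ j) * (1 - x * q ^ n)"
    using Suc by (simp add: c_def)
  also have "\<dots> = (\<Sum>j\<le>Suc n. c n j * x ^ j) - (\<Sum>j\<le>n. q ^ n * c n j * x ^ Suc j)"
  proof -
    have "(\<Sum>j\<le>n. q ^ n * c n j * x ^ Suc j) = x * q ^ n * (\<Sum>j\<le>n. c n j * x ^ j)"
      by (simp add: sum_distrib_left mult_ac)
    moreover have "c n (Suc n) = 0" by (simp add: c_def gb_def)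
    ultimately show ?thesis by (simp add: algebra_simps)
  qed
  also have "(\<Sum>j\<le>Suc n. c n j * x ^ j) = 1 + (\<Sum>j\<le>n. c n (Suc j) * x ^ Suc j)"
    by (subst sum.atMost_Suc_shift) (simp add: c0)
  also have "1 + (\<Sum>j\<le>n. c n (Suc j) * x ^ Suc j) - (\<Sum>j\<le>n. q ^ n * c n j * x ^ Suc j)
      = 1 + (\<Sum>j\<le>n. c (Suc n) (Suc j) * x ^ Suc j)"
    by (simp add: cs left_diff_distrib sum_subtractf)
  also have "\<dots> = (\<Sum>j\<le>Suc n. c (Suc n) j * x ^ j)"
    by (subst sum.atMost_Suc_shift) (simp add: c0)
  finally show ?case by (simp add: c_def)
qed

text \<open>The q-binomial theorem for \<open>2 * m\<close> factors, centred by
  \<open>x = z / q ^ m\<close>. The upper half of the factors is the first product; each factor of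
  the lower half becomes one of the second once \<open>- z / q ^ Suc k\<close> is pulled out.
  \<open>K\<close> collects what was pulled out, and \<open>j = m + n\<close> centres the
  sum.\<close>

private lemma finite_jtp:
  assumes z: "z \<noteq> 0"
  shows "(\<Prod>k<m. 1 - z * q ^ k) * (\<Prod>k<m. 1 - q / z * q ^ k) =
    (\<Sum>n\<in>{- int m..int m}. gb (2 * m) (nat (int m + n)) * ((- 1) powi n * q powi (n * (n - 1) div 2) * z powi n))"
proof -
  define x where "x = z / q ^ m"
  define K where "K = (- z) ^ m / q ^ (m * (m + 1) div 2)"
  have K: "K \<noteq> 0" using z q by (simp add: K_def)
  have "(\<Prod>k<2 * m. 1 - x * q ^ k) = (\<Prod>k<m. 1 - x * q ^ k) * (\<Prod>k<m. 1 - x * q ^ (k + m))"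
  proof -
    have "(\<Prod>k<2 * m. 1 - x * q ^ k) = (\<Prod>k\<in>{..<m} \<union> {m..<2 * m}. 1 - x * q ^ k)"
      by (rule prod.cong) auto
    also have "\<dots> = (\<Prod>k<m. 1 - x * q ^ k) * (\<Prod>k\<in>{m..<2 * m}. 1 - x * q ^ k)"
      by (rule prod.union_disjoint) auto
    also have "(\<Prod>k\<in>{m..<2 * m}. 1 - x * q ^ k) = (\<Prod>k<m. 1 - x * q ^ (k + m))"
      by (rule prod.reindex_bij_witness[of _ "\<lambda>k. k + m" "\<lambda>k. k - m"]) auto
    finally show ?thesis .
  qed
  also have "(\<Prod>k<m. 1 - x * q ^ (k + m)) = (\<Prod>k<m. 1 - z * q ^ k)"
    using q by (simp add: x_def power_add)
  also have "(\<Prod>k<m. 1 - x * q ^ k) = (\<Prod>k<m. 1 - x * q ^ (m - Suc k))"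
    by (rule prod.nat_diff_reindex [symmetric])
  also have "\<dots> = (\<Prod>k<m. (- z / q ^ Suc k) * (1 - q / z * q ^ k))"
  proof (rule prod.cong)
    fix k assume "k \<in> {..<m}"
    hence "q ^ m = q ^ (m - Suc k) * q ^ Suc k" by (simp flip: power_add power_Suc)
    thus "1 - x * q ^ (m - Suc k) = (- z / q ^ Suc k) * (1 - q / z * q ^ k)"
      using q z by (simp add: x_def field_simps)
  qed auto
  also have "\<dots> = (\<Prod>k<m. - z / q ^ Suc k) * (\<Prod>k<m. 1 - q / z * q ^ k)"
    by (rule prod.distrib)
  also have "(\<Prod>k<m. - z / q ^ Suc k) = (- z) ^ m / q ^ (m * (m + 1) div 2)"
  proof (induction m)
    case (Suc m)
    have "Suc m * (Suc m + 1) = m * (m + 1) + Suc m * 2" by simp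
    hence "Suc m * (Suc m + 1) div 2 = m * (m + 1) div 2 + Suc m" by simp
    hence "(- z) ^ Suc m / q ^ (Suc m * (Suc m + 1) div 2) = (- z) ^ m / q ^ (m * (m + 1) div 2) * (- z / q ^ Suc m)"
      by (simp only: power_add power_Suc times_divide_times_eq mult_ac)
    thus ?case using Suc by simp
  qed simp
  also have "\<dots> = K" by (simp add: K_def)
  finally have "K * ((\<Prod>k<m. 1 - z * q ^ k) * (\<Prod>k<m. 1 - q / z * q ^ k))
      = (\<Sum>j\<le>2 * m. gb (2 * m) j * (- 1) ^ j * q ^ (j * (j - 1) div 2) * x ^ j)"
    by (simp only: q_binomial mult_ac)
  also have "\<dots> = (\<Sum>n\<in>{- int m..int m}. K * (gb (2 * m) (nat (int m + n)) *
      ((- 1) powi n * q powi (n * (n - 1) div 2) * z powi n)))"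
  proof (rule sum.reindex_bij_witness[of _ "\<lambda>n. nat (int m + n)" "\<lambda>j. int j - int m"])
    fix j assume j: "j \<in> {..2 * m}"
    define n where "n = int j - int m"
    have jn: "int j = n + int m" by (simp add: n_def)
    note e1 = int_triangular[of j]
    have e2: "int (m * (m + 1) div 2) = int m * (int m + 1) div 2"
      by (simp add: zdiv_int algebra_simps)
    \<comment> \<open>The bookkeeping of powers of \<open>q\<close> is this identity of doubled
      triangular numbers; the cross term \<open>m * j\<close> is supplied by the denominator of
      \<open>x ^ j\<close>.\<close>
    have "int j * (int j - 1) + int m * (int m + 1) = n * (n - 1) + 2 * (int m * int j)"
      unfolding jn by (simp add: algebra_simps)
    moreover have "even (int j * (int j - 1))" "even (int m * (int m + 1))" "even (n * (n - 1))" by auto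
    ultimately have e3: "int j * (int j - 1) div 2 + int m * (int m + 1) div 2 = n * (n - 1) div 2 + int m * int j"
      by (elim evenE) simp
    have "q powi (int (j * (j - 1) div 2) + int (m * (m + 1) div 2)) = q powi (n * (n - 1) div 2 + int (m * j))"
      using e1 e2 e3 by simp
    hence "q ^ (j * (j - 1) div 2) * q ^ (m * (m + 1) div 2) = q powi (n * (n - 1) div 2) * q ^ (m * j)"
      using q by (simp only: power_int_add power_int_of_nat simp_thms)
    moreover have "(- 1) powi n * (- 1) ^ m = ((- 1) :: complex) ^ j" "z powi n * z ^ m = z ^ j"
      using z power_int_add[of "-1 :: complex" n "int m"] power_int_add[of z n "int m"]
      by (simp_all flip: jn)
    moreover have "(- z) ^ m = (- 1) ^ m * z ^ m" by (metis power_minus)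
    ultimately have "(- 1) ^ j * q ^ (j * (j - 1) div 2) * x ^ j = K * ((- 1) powi n * q powi (n * (n - 1) div 2) * z powi n)"
      unfolding K_def x_def using q by (simp add: power_divide field_simps flip: power_mult)
    thus "K * (gb (2 * m) (nat (int m + (int j - int m))) * ((- 1) powi (int j - int m) *
        q powi ((int j - int m) * (int j - int m - 1) div 2) * z powi (int j - int m)))
       = gb (2 * m) j * (- 1) ^ j * q ^ (j * (j - 1) div 2) * x ^ j"
      by (simp add: n_def mult_ac)
  qed auto
  finally show ?thesis using K by (simp flip: sum_distrib_left)
qed

text \<open>Let \<open>m\<close> grow in the finite form. The Gaussian binomials around the centre
  tend to \<open>1 / eul q\<close>, and all of them are bounded because \<open>P n\<close> and its
  inverse converge, so dominated convergence applies with a multiple of the theta series as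
  majorant.\<close>

theorem jacobi_triple:
  assumes z: "z \<noteq> 0"
  shows "((\<lambda>n::int. (- 1) powi n * q powi (n * (n - 1) div 2) * z powi n) has_sum
           (eul q * qpoch z q * qpoch (q / z) q)) UNIV"
proof -
  define T where "T n = (- 1) powi n * q powi (n * (n - 1) div 2) * z powi n" for n
  define F where "F m n = (if n \<in> {- int m..int m} then gb (2 * m) (nat (int m + n)) else 0) * T n" for m n
  have Plim: "P \<longlonglongrightarrow> eul q"
    using qpoch_LIMSEQ[OF q(1), of q] by (simp add: P_def[abs_def] eul_def)
  have enz: "eul q \<noteq> 0" using q by (simp add: eul_nonzero)
  obtain C where C: "\<And>n. norm (P n) \<le> C" "C > 0"
    using convergent_imp_Bseq[of P] Plim by (auto simp: convergent_def Bseq_def)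
  have "(\<lambda>n. inverse (P n)) \<longlonglongrightarrow> inverse (eul q)"
    using Plim enz by (rule tendsto_inverse)
  then obtain D where D: "\<And>n. norm (inverse (P n)) \<le> D" "D > 0"
    using convergent_imp_Bseq[of "\<lambda>n. inverse (P n)"] by (auto simp: convergent_def Bseq_def)
  have gb_bound: "norm (gb n k) \<le> C * D * D" for n k
  proof (cases "k \<le> n")
    case True
    have "norm (gb n k) = norm (P n) * norm (inverse (P k)) * norm (inverse (P (n - k)))"
      using True by (simp add: gb_def norm_divide norm_mult norm_inverse divide_simps)
    also have "\<dots> \<le> C * D * D" using C D by (intro mult_mono) auto
    finally show ?thesis .
  qed (use C D in \<open>simp add: gb_def\<close>)
  have "(T has_sum (qpoch z q * qpoch (q / z) q * eul q)) UNIV"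
  proof -
    have "((\<lambda>n. inverse (eul q) * T n) has_sum (qpoch z q * qpoch (q / z) q)) UNIV"
    proof (rule has_sum_dominated)
      fix n :: int
      have "(\<lambda>m. gb (2 * m) (nat (int m + n)) * T n) \<longlonglongrightarrow> inverse (eul q) * T n"
      proof (rule tendsto_mult_right)
        have ev: "\<forall>\<^sub>F m in sequentially. m \<ge> nat \<bar>n\<bar>" by (rule eventually_ge_at_top)
        have f1: "filterlim (\<lambda>m. 2 * m) at_top (sequentially :: nat filter)"
          by (rule filterlim_subseq) (auto simp: strict_mono_def)
        have f2: "filterlim (\<lambda>m. nat (int m + n)) at_top (sequentially :: nat filter)"
          unfolding filterlim_at_top
        proof
          fix Z
          show "\<forall>\<^sub>F m in sequentially. Z \<le> nat (int m + n)"
            using eventually_ge_at_top[of "Z + nat \<bar>n\<bar>"] by eventually_elim linarith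
        qed
        have f3: "filterlim (\<lambda>m. nat (int m - n)) at_top (sequentially :: nat filter)"
          unfolding filterlim_at_top
        proof
          fix Z
          show "\<forall>\<^sub>F m in sequentially. Z \<le> nat (int m - n)"
            using eventually_ge_at_top[of "Z + nat \<bar>n\<bar>"] by eventually_elim linarith
        qed
        have "(\<lambda>m. P (2 * m) / (P (nat (int m + n)) * P (nat (int m - n)))) \<longlonglongrightarrow> eul q / (eul q * eul q)"
          using enz by (intro tendsto_intros filterlim_compose[OF Plim] f1 f2 f3) auto
        also have "eul q / (eul q * eul q) = inverse (eul q)" using enz by (simp add: field_simps)
        finally show "(\<lambda>m. gb (2 * m) (nat (int m + n))) \<longlonglongrightarrow> inverse (eul q)"
        proof (rule Lim_transform_eventually)
          show "\<forall>\<^sub>F m in sequentially. P (2 * m) / (P (nat (int m + n)) * P (nat (int m - n))) =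
              gb (2 * m) (nat (int m + n))"
            using ev
          proof eventually_elim
            case (elim m)
            hence "2 * m - nat (int m + n) = nat (int m - n)" "nat (int m + n) \<le> 2 * m" by linarith+
            thus ?case by (simp add: gb_def)
          qed
        qed
      qed
      thus "(\<lambda>m. F m n) \<longlonglongrightarrow> inverse (eul q) * T n"
      proof (rule Lim_transform_eventually)
        show "\<forall>\<^sub>F m in sequentially. gb (2 * m) (nat (int m + n)) * T n = F m n"
          using eventually_ge_at_top[of "nat \<bar>n\<bar>"] by eventually_elim (auto simp: F_def)
      qed
      show "norm (F m n) \<le> C * D * D * (norm q powi (n * (n - 1) div 2) * norm z powi n)" for m
      proof -
        have "norm (F m n) = norm (if n \<in> {- int m..int m} then gb (2 * m) (nat (int m + n)) else 0) * norm (T n)"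
          by (simp add: F_def norm_mult)
        also have "\<dots> \<le> (C * D * D) * norm (T n)"
          using gb_bound C D by (intro mult_right_mono) auto
        also have "norm (T n) = norm q powi (n * (n - 1) div 2) * norm z powi n"
          by (simp add: T_def norm_mult norm_power_int)
        finally show ?thesis .
      qed
    next
      show "(\<lambda>n. C * D * D * (norm q powi (n * (n - 1) div 2) * norm z powi n)) summable_on UNIV"
        using q z by (intro summable_on_cmult_right summable_theta) auto
    next
      have "infsum (F m) UNIV = (\<Prod>k<m. 1 - z * q ^ k) * (\<Prod>k<m. 1 - q / z * q ^ k)" for m
      proof -
        have "infsum (F m) UNIV = infsum (F m) {- int m..int m}"
          by (rule infsum_cong_neutral) (auto simp: F_def)
        also have "\<dots> = (\<Prod>k<m. 1 - z * q ^ k) * (\<Prod>k<m. 1 - q / z * q ^ k)"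
          unfolding finite_jtp[OF z] by (simp add: F_def T_def)
        finally show ?thesis .
      qed
      moreover have "(\<lambda>m. (\<Prod>k<m. 1 - z * q ^ k) * (\<Prod>k<m. 1 - q / z * q ^ k)) \<longlonglongrightarrow> qpoch z q * qpoch (q / z) q"
        by (intro tendsto_mult qpoch_LIMSEQ q)
      ultimately show "(\<lambda>m. infsum (F m) UNIV) \<longlonglongrightarrow> qpoch z q * qpoch (q / z) q" by simp
    qed
    hence "((\<lambda>n. eul q * (inverse (eul q) * T n)) has_sum (eul q * (qpoch z q * qpoch (q / z) q))) UNIV"
      by (rule has_sum_cmult_right)
    moreover have "(\<lambda>n. eul q * (inverse (eul q) * T n)) = T" using enz by auto
    ultimately have "(T has_sum (eul q * (qpoch z q * qpoch (q / z) q))) UNIV" by simp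
    thus ?thesis by (simp only: mult_ac)
  qed
  thus ?thesis unfolding T_def by (simp only: mult_ac)
qed

end

text \<open>Each class may be parametrised from any representative \<open>\<rho> r\<close>. Taking
  \<open>- 1\<close> for the last class makes the exponents come out directly in terms of
  \<open>m * (m - 1)\<close>, or as the mirror image of the class of 1.\<close>

lemma has_sum_mod:
  fixes f :: "int \<Rightarrow> complex"
  assumes k: "k > 0"
    and sum: "\<And>r. r \<in> {0..<k} \<Longrightarrow> ((\<lambda>m. f (k * m + \<rho> r)) has_sum S r) UNIV"
    and rep: "\<And>r. r \<in> {0..<k} \<Longrightarrow> \<rho> r mod k = r"
  shows "(f has_sum (\<Sum>r\<in>{0..<k}. S r)) UNIV"
proof -
  have "(f has_sum (\<Sum>r\<in>{0..<k}. S r)) (\<Union>r\<in>{0..<k}. {n. n mod k = r})"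
  proof (rule sum_has_sum)
    fix r assume r: "r \<in> {0..<k}"
    have "bij_betw (\<lambda>m. k * m + \<rho> r) UNIV {n. n mod k = r}"
    proof (rule bij_betw_byWitness[where f' = "\<lambda>n. (n - \<rho> r) div k"])
      show "\<forall>n\<in>{n. n mod k = r}. k * ((n - \<rho> r) div k) + \<rho> r = n"
      proof safe
        fix n assume "r = n mod k"
        hence "n mod k = \<rho> r mod k" using rep[OF r] by simp
        hence "k dvd n - \<rho> r" by (simp add: mod_eq_dvd_iff)
        thus "k * ((n - \<rho> (n mod k)) div k) + \<rho> (n mod k) = n" using \<open>r = n mod k\<close> by simp
      qed
    qed (use k rep[OF r] in \<open>auto simp: mod_add_eq\<close>)
    thus "(f has_sum S r) {n. n mod k = r}"
      using sum[OF r] has_sum_reindex_bij_betw by blast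
  qed auto
  also have "(\<Union>r\<in>{0..<k}. {n. n mod k = r}) = UNIV" using k by auto
  finally show ?thesis .
qed

lemma has_sum_mod2:
  fixes f :: "int \<Rightarrow> complex"
  assumes "((\<lambda>m. f (2 * m)) has_sum A) UNIV" "((\<lambda>m. f (2 * m - 1)) has_sum B) UNIV"
  shows "(f has_sum (A + B)) UNIV"
proof -
  define \<rho> :: "int \<Rightarrow> int" where "\<rho> = (\<lambda>r. if r = 0 then 0 else -1)"
  define S where "S = (\<lambda>r :: int. if r = 0 then A else B)"
  have "{0..<2::int} = {0, 1}" by auto
  moreover have "(f has_sum (\<Sum>r\<in>{0..<2}. S r)) UNIV"
  proof (rule has_sum_mod)
    fix r :: int assume "r \<in> {0..<2}"
    hence "r = 0 \<or> r = 1" by auto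
    thus "((\<lambda>m. f (2 * m + \<rho> r)) has_sum S r) UNIV" "\<rho> r mod 2 = r"
      using assms by (auto simp: \<rho>_def S_def)
  qed simp
  ultimately show ?thesis by (simp add: S_def)
qed

lemma has_sum_mod3:
  fixes f :: "int \<Rightarrow> complex"
  assumes "((\<lambda>m. f (3 * m)) has_sum A) UNIV" "((\<lambda>m. f (3 * m + 1)) has_sum B) UNIV"
    "((\<lambda>m. f (3 * m - 1)) has_sum C) UNIV"
  shows "(f has_sum (A + B + C)) UNIV"
proof -
  define \<rho> :: "int \<Rightarrow> int" where "\<rho> = (\<lambda>r. if r = 0 then 0 else if r = 1 then 1 else -1)"
  define S where "S = (\<lambda>r :: int. if r = 0 then A else if r = 1 then B else C)"
  have "{0..<3::int} = {0, 1, 2}" by auto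
  moreover have "(f has_sum (\<Sum>r\<in>{0..<3}. S r)) UNIV"
  proof (rule has_sum_mod)
    fix r :: int assume "r \<in> {0..<3}"
    hence "r = 0 \<or> r = 1 \<or> r = 2" by auto
    thus "((\<lambda>m. f (3 * m + \<rho> r)) has_sum S r) UNIV" "\<rho> r mod 3 = r"
      using assms by (auto simp: \<rho>_def S_def)
  qed simp
  ultimately show ?thesis by (simp add: S_def add.assoc)
qed

lemma has_sum_times:
  fixes f :: "'a \<Rightarrow> complex" and g :: "'b \<Rightarrow> complex"
  assumes "(f has_sum A) UNIV" "(g has_sum B) UNIV"
  shows "((\<lambda>(x, y). f x * g y) has_sum (A * B)) UNIV"
proof -
  have f: "(\<lambda>x. norm (f x)) summable_on UNIV" and g: "(\<lambda>x. norm (g x)) summable_on UNIV"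
    using assms has_sum_imp_summable summable_on_iff_abs_summable_on_complex by blast+
  have s: "(\<lambda>z. norm ((\<lambda>(x, y). f x * g y) z)) summable_on Sigma UNIV (\<lambda>_. UNIV)"
    by (rule Infinite_Sum.abs_summable_on_Sigma_iff[THEN iffD2])
      (auto simp: norm_mult infsum_cmult_right' abs_mult intro!: summable_on_cmult_right summable_on_cmult_left f g infsum_nonneg)
  have "((\<lambda>(x, y). f x * g y) has_sum (A * B)) (Sigma UNIV (\<lambda>_. UNIV))"
  proof (rule has_sum_SigmaI[where g = "\<lambda>x. f x * B"])
    show "(\<lambda>(x, y). f x * g y) summable_on Sigma UNIV (\<lambda>_. UNIV)"
      by (rule abs_summable_summable[OF s])
  qed (auto intro!: has_sum_cmult_right has_sum_cmult_left assms)
  thus ?thesis by simp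
qed

lemma minus_one_powi: "(- 1 :: complex) powi n = (if even n then 1 else - 1)"
  by simp

context
  fixes q :: complex
  assumes q: "norm q < 1" "q \<noteq> 0"
begin

text \<open>The triple product in base \<open>q ^ a\<close> at \<open>z = q ^ c\<close>. The
  exponent is prescribed through its double, so that an instance is checked by polynomial arithmetic
  even when the exponent has halves.\<close>

lemma theta_minus:
  assumes "a > 0" "c \<le> a" "\<And>n. 2 * e n = int a * (n * (n - 1)) + 2 * int c * n"
  shows "((\<lambda>n. (- 1) powi n * q powi e n) has_sum
    (eul (q ^ a) * qpoch (q ^ c) (q ^ a) * qpoch (q ^ (a - c)) (q ^ a))) UNIV"
proof -
  have "e n = int a * (n * (n - 1) div 2) + int c * n" for n
  proof -
    have "even (n * (n - 1))" by simp
    thus ?thesis using assms(3)[of n] by (elim evenE) simp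
  qed
  hence "q powi e n = (q ^ a) powi (n * (n - 1) div 2) * (q ^ c) powi n" for n
    using q by (simp add: power_int_add power_int_mult)
  moreover have "q ^ a / q ^ c = q ^ (a - c)"
    using assms q by (simp add: power_diff)
  ultimately show ?thesis
    using jacobi_triple[of "q ^ a" "q ^ c"] q assms by (simp add: norm_power_lt_1 mult.assoc)
qed

text \<open>Replacing \<open>z\<close> by its negative cancels the alternating sign.\<close>

lemma theta_plus:
  assumes "a > 0" "c \<le> a" "\<And>n. 2 * e n = int a * (n * (n - 1)) + 2 * int c * n"
  shows "((\<lambda>n. q powi e n) has_sum
    (eul (q ^ a) * qpoch (- (q ^ c)) (q ^ a) * qpoch (- (q ^ (a - c))) (q ^ a))) UNIV"
proof -
  have e: "e n = int a * (n * (n - 1) div 2) + int c * n" for n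
  proof -
    have "even (n * (n - 1))" by simp
    thus ?thesis using assms(3)[of n] by (elim evenE) simp
  qed
  hence "q powi e n = (-1) powi n * (q ^ a) powi (n * (n - 1) div 2) * (- (q ^ c)) powi n" for n
  proof -
    have "(-1) powi n * (- (q ^ c)) powi n = (q ^ c) powi n"
      by (simp flip: power_int_mult_distrib)
    thus ?thesis using q by (simp add: e power_int_add power_int_mult)
  qed
  moreover have "q ^ a / - (q ^ c) = - (q ^ (a - c))"
    using assms q by (simp add: power_diff)
  ultimately show ?thesis
    using jacobi_triple[of "q ^ a" "- (q ^ c)"] q assms by (simp add: norm_power_lt_1 mult.assoc)
qed

end

section \<open>Theta products as quotients of Euler functions\<close>

context
  fixes q :: complex
  assumes q: "norm q < 1"
begin

lemma eul_pow_nonzero [simp]: "k > 0 \<Longrightarrow> eul (q ^ k) \<noteq> 0"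
  using q by (intro eul_nonzero norm_power_lt_1)

lemma eul_nonzero' [simp]: "eul q \<noteq> 0"
  using q by (rule eul_nonzero)

lemma qpoch_odd: "qpoch q (q ^ 2) = eul q / eul (q ^ 2)"
proof -
  have "{1..<2::nat} = {1}" by auto
  thus ?thesis using eul_split[OF q, of 2] by (simp add: field_simps)
qed

lemma theta_eval_2_1: "eul (q ^ 2) * qpoch q (q ^ 2) * qpoch q (q ^ 2) = eul q ^ 2 / eul (q ^ 2)"
  by (simp add: qpoch_odd power2_eq_square[of "eul q"])

lemma qpoch_minus_odd: "qpoch (- q) (q ^ 2) = eul (q ^ 2) ^ 2 / (eul q * eul (q ^ 4))"
proof -
  have q2: "norm (q ^ 2) < 1" using q by (simp add: norm_power_lt_1)
  have "qpoch q (q ^ 2) * qpoch (- q) (q ^ 2) = qpoch (q ^ 2) (q ^ 4)"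
    using qpoch_minus[OF q2, of q] by (simp flip: power_mult)
  also have "\<dots> = eul (q ^ 2) / eul (q ^ 4)"
  proof -
    have "{1..<2::nat} = {1}" by auto
    thus ?thesis using eul_split[OF q2, of 2] q by (simp add: field_simps flip: power_mult)
  qed
  finally show ?thesis by (simp add: qpoch_odd field_simps power2_eq_square[of "eul x" for x])
qed

lemma qpoch_minus_self: "qpoch (- q) q = eul (q ^ 2) / eul q"
  using qpoch_minus[OF q, of q] unfolding eul_def [symmetric] by (simp add: field_simps)

lemma qpoch_minus_1: "qpoch (- 1) q = 2 * eul (q ^ 2) / eul q"
  using qpoch_shift[OF q, of "- 1"] by (simp add: qpoch_minus_self)

text \<open>Inclusion and exclusion modulo 6: removing from \<open>eul q\<close> the even classes
  and the class of 3 leaves those of 1 and 5.\<close>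

lemma theta_eval_6_1: "eul (q ^ 6) * qpoch q (q ^ 6) * qpoch (q ^ 5) (q ^ 6)
    = eul q * eul (q ^ 6) ^ 2 / (eul (q ^ 2) * eul (q ^ 3))"
proof -
  have q2: "norm (q ^ 2) < 1" and q3: "norm (q ^ 3) < 1" using q by (simp_all add: norm_power_lt_1)
  have "{Suc 0..<6} = {1, 2, 3, 4, 5}" "{Suc 0..<3} = {1, 2}" "{Suc 0..<2} = {1}" by auto
  hence eqs: "eul q = eul (q ^ 6) * (qpoch q (q ^ 6) * (qpoch (q ^ 2) (q ^ 6) * (qpoch (q ^ 3) (q ^ 6) * (qpoch (q ^ 4) (q ^ 6) * qpoch (q ^ 5) (q ^ 6)))))"
    "eul (q ^ 2) = eul (q ^ 6) * (qpoch (q ^ 2) (q ^ 6) * qpoch (q ^ 4) (q ^ 6))"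
    "eul (q ^ 3) = eul (q ^ 6) * qpoch (q ^ 3) (q ^ 6)"
    using eul_split[OF q, of 6] eul_split[OF q2, of 3] eul_split[OF q3, of 2]
    by (simp_all flip: power_mult)
  have "eul (q ^ 6) * qpoch q (q ^ 6) * qpoch (q ^ 5) (q ^ 6) * (eul (q ^ 2) * eul (q ^ 3)) = eul q * eul (q ^ 6) ^ 2"
    unfolding eqs by algebra
  thus ?thesis by (simp add: nonzero_eq_divide_eq)
qed

text \<open>When \<open>qpoch (- q) q\<close> is split modulo 3, the class of the multiples of 3 has
  a known value; the other two classes are the ones wanted.\<close>

lemma theta_eval_minus_3_1: "eul (q ^ 3) * qpoch (- q) (q ^ 3) * qpoch (- (q ^ 2)) (q ^ 3)
    = eul (q ^ 2) * eul (q ^ 3) ^ 2 / (eul q * eul (q ^ 6))"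
proof -
  have q3: "norm (q ^ 3) < 1" using q by (simp_all add: norm_power_lt_1)
  have "qpoch (- q) q = (\<Prod>r\<in>{0, 1, 2}. qpoch (- (q ^ Suc r)) (q ^ 3))"
    using qpoch_split[OF q, of 3 "- q"] by (simp add: lessThan_nat_numeral lessThan_Suc insert_commute)
  hence 1: "qpoch (- q) q = qpoch (- q) (q ^ 3) * (qpoch (- (q ^ 2)) (q ^ 3) * qpoch (- (q ^ 3)) (q ^ 3))"
    by (simp add: eval_nat_numeral)
  have 2: "qpoch (- (q ^ 3)) (q ^ 3) = eul (q ^ 6) / eul (q ^ 3)"
    using qpoch_minus[OF q3, of "q ^ 3"] unfolding eul_def [symmetric]
    using q by (simp add: field_simps flip: power_mult)
  have "eul (q ^ 2) * eul (q ^ 3) = eul q * eul (q ^ 6) * (qpoch (- q) (q ^ 3) * qpoch (- (q ^ 2)) (q ^ 3))"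
    using 1 unfolding 2 qpoch_minus_self by (simp add: field_simps)
  hence "eul (q ^ 3) * qpoch (- q) (q ^ 3) * qpoch (- (q ^ 2)) (q ^ 3) * (eul q * eul (q ^ 6)) = eul (q ^ 2) * eul (q ^ 3) ^ 2"
    by algebra
  thus ?thesis by (simp add: nonzero_eq_divide_eq)
qed

text \<open>Inclusion and exclusion modulo 10. The residues 1, 3, 7, 9 are kept together: this full
  product over the units is what the even classes and the class of 5 leave over, and it is what the
  dissection modulo 5 produces.\<close>

lemma theta_eval_10: "qpoch q (q ^ 10) * qpoch (q ^ 3) (q ^ 10) * qpoch (q ^ 7) (q ^ 10) * qpoch (q ^ 9) (q ^ 10)
    = eul q * eul (q ^ 10) / (eul (q ^ 2) * eul (q ^ 5))"
proof -
  have q2: "norm (q ^ 2) < 1" and q5: "norm (q ^ 5) < 1" using q by (simp_all add: norm_power_lt_1)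
  have "{Suc 0..<10} = {1, 2, 3, 4, 5, 6, 7, 8, 9}" "{Suc 0..<5} = {1, 2, 3, 4}" "{Suc 0..<2} = {1}" by auto
  hence eqs: "eul q = eul (q ^ 10) * (qpoch q (q ^ 10) * (qpoch (q ^ 2) (q ^ 10) * (qpoch (q ^ 3) (q ^ 10) *
      (qpoch (q ^ 4) (q ^ 10) * (qpoch (q ^ 5) (q ^ 10) * (qpoch (q ^ 6) (q ^ 10) * (qpoch (q ^ 7) (q ^ 10) *
      (qpoch (q ^ 8) (q ^ 10) * qpoch (q ^ 9) (q ^ 10)))))))))"
    "eul (q ^ 2) = eul (q ^ 10) * (qpoch (q ^ 2) (q ^ 10) * (qpoch (q ^ 4) (q ^ 10) * (qpoch (q ^ 6) (q ^ 10) * qpoch (q ^ 8) (q ^ 10))))"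
    "eul (q ^ 5) = eul (q ^ 10) * qpoch (q ^ 5) (q ^ 10)"
    using eul_split[OF q, of 10] eul_split[OF q2, of 5] eul_split[OF q5, of 2]
    by (simp_all flip: power_mult)
  have "qpoch q (q ^ 10) * qpoch (q ^ 3) (q ^ 10) * qpoch (q ^ 7) (q ^ 10) * qpoch (q ^ 9) (q ^ 10) * (eul (q ^ 2) * eul (q ^ 5))
     = eul q * eul (q ^ 10)"
    unfolding eqs by (simp only: mult_ac)
  thus ?thesis by (simp add: nonzero_eq_divide_eq)
qed

lemma theta_eval_minus_5: "qpoch (- q) (q ^ 5) * qpoch (- (q ^ 2)) (q ^ 5) * qpoch (- (q ^ 3)) (q ^ 5) * qpoch (- (q ^ 4)) (q ^ 5)
    = eul (q ^ 2) * eul (q ^ 5) / (eul q * eul (q ^ 10))"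
proof -
  have q5: "norm (q ^ 5) < 1" using q by (simp_all add: norm_power_lt_1)
  have "qpoch (- q) q = (\<Prod>r\<in>{0, 1, 2, 3, 4}. qpoch (- (q ^ Suc r)) (q ^ 5))"
    using qpoch_split[OF q, of 5 "- q"] by (simp add: lessThan_nat_numeral lessThan_Suc insert_commute)
  hence 1: "qpoch (- q) q = qpoch (- q) (q ^ 5) * (qpoch (- (q ^ 2)) (q ^ 5) * (qpoch (- (q ^ 3)) (q ^ 5) *
      (qpoch (- (q ^ 4)) (q ^ 5) * qpoch (- (q ^ 5)) (q ^ 5))))"
    by (simp add: eval_nat_numeral)
  have 2: "qpoch (- (q ^ 5)) (q ^ 5) = eul (q ^ 10) / eul (q ^ 5)"
    using qpoch_minus[OF q5, of "q ^ 5"] unfolding eul_def [symmetric]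
    using q by (simp add: field_simps flip: power_mult)
  have "eul (q ^ 2) * eul (q ^ 5) = eul q * eul (q ^ 10) * (qpoch (- q) (q ^ 5) * qpoch (- (q ^ 2)) (q ^ 5) * qpoch (- (q ^ 3)) (q ^ 5) * qpoch (- (q ^ 4)) (q ^ 5))"
    using 1 unfolding 2 qpoch_minus_self by (simp add: field_simps)
  thus ?thesis by (simp add: field_simps)
qed

end

context
  fixes q :: complex
  assumes q: "norm q < 1" "q \<noteq> 0"
begin

text \<open>Ramanujan's \<open>\<phi>(-q)\<close>: the case \<open>a = 2\<close>,
  \<open>c = 1\<close>, in which the two products coincide.\<close>

lemma phi_minus: "((\<lambda>n. (- 1) powi n * q powi (n * n)) has_sum (eul q ^ 2 / eul (q ^ 2))) UNIV"
  using theta_minus[OF q, of 2 1 "\<lambda>n. n * n"] theta_eval_2_1[OF q(1)]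
  by (simp add: algebra_simps)

lemma phi_plus: "((\<lambda>n. q powi (n * n)) has_sum (eul (q ^ 2) ^ 5 / (eul q ^ 2 * eul (q ^ 4) ^ 2))) UNIV"
proof -
  have "eul (q ^ 2) * qpoch (- q) (q ^ 2) * qpoch (- q) (q ^ 2) = eul (q ^ 2) ^ 5 / (eul q ^ 2 * eul (q ^ 4) ^ 2)"
  proof -
    have "A * (A ^ 2 / (B * C)) * (A ^ 2 / (B * C)) = A ^ 5 / (B ^ 2 * C ^ 2)" for A B C :: complex
      by (simp add: eval_nat_numeral mult_ac)
    thus ?thesis using q by (simp add: qpoch_minus_odd)
  qed
  thus ?thesis using theta_plus[OF q, of 2 1 "\<lambda>n. n * n"]
    by (simp add: algebra_simps)
qed

text \<open>Twice Ramanujan's \<open>\<psi>(q)\<close>: the sum over all integers meets every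
  triangular number twice, at \<open>n\<close> and \<open>1 - n\<close>.\<close>

lemma psi_sum: "((\<lambda>n. q powi (n * (n - 1) div 2)) has_sum (2 * eul (q ^ 2) ^ 2 / eul q)) UNIV"
proof -
  have "eul q * qpoch (- 1) q * qpoch (- q) q = 2 * eul (q ^ 2) ^ 2 / eul q"
    using q by (simp add: qpoch_minus_1 qpoch_minus_self field_simps power2_eq_square)
  thus ?thesis using theta_plus[OF q, of 1 0 "\<lambda>n. n * (n - 1) div 2"] by simp
qed

end

section \<open>Dissections of phi and psi modulo 2, 3 and 5\<close>

context
  fixes q :: complex
  assumes q: "norm q < 1" "q \<noteq> 0"
begin

lemma q_pow: "k > 0 \<Longrightarrow> norm (q ^ k) < 1" "q ^ k \<noteq> 0"
  using q by (auto intro: norm_power_lt_1)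

lemma powi_pow: "(q ^ k) powi n = q powi (int k * n)"
  by (simp add: power_int_mult)

text \<open>Even indices give the squares \<open>4 m^2\<close>, with sign plus; an odd square is
  eight times a triangular number plus 1, with sign minus.\<close>

lemma phi_dissection_2:
  "eul q ^ 2 / eul (q ^ 2) = eul (q ^ 8) ^ 5 / (eul (q ^ 4) ^ 2 * eul (q ^ 16) ^ 2) - 2 * q * eul (q ^ 16) ^ 2 / eul (q ^ 8)"
proof -
  define f where "f n = (- 1) powi n * q powi (n * n)" for n :: int
  have "f (2 * m) = (q ^ 4) powi (m * m)" for m by (simp add: f_def powi_pow)
  hence A: "((\<lambda>m. f (2 * m)) has_sum (eul (q ^ 8) ^ 5 / (eul (q ^ 4) ^ 2 * eul (q ^ 16) ^ 2))) UNIV"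
    using phi_plus[of "q ^ 4"] q q_pow by (simp flip: power_mult)
  have "f (2 * m - 1) = - q * (q ^ 8) powi (m * (m - 1) div 2)" for m
  proof -
    have "even (m * (m - 1))" by simp
    then obtain k where k: "m * (m - 1) = 2 * k" by blast
    hence "(2 * m - 1) * (2 * m - 1) = 8 * k + 1" by (simp add: algebra_simps)
    thus ?thesis using k q by (simp add: f_def powi_pow power_int_add_1)
  qed
  hence B: "((\<lambda>m. f (2 * m - 1)) has_sum (- q * (2 * eul (q ^ 16) ^ 2 / eul (q ^ 8)))) UNIV"
    using has_sum_cmult_right[OF psi_sum[of "q ^ 8"], of "- q"] q q_pow by (simp flip: power_mult)
  show ?thesis
    using has_sum_unique[OF phi_minus[OF q, folded f_def] has_sum_mod2[OF A B]] by (simp add: mult.assoc)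
qed

text \<open>The classes of 1 and -1 modulo 3 are mirror images and give the same series, whence the
  factor 2.\<close>

lemma phi_dissection_3:
  "eul q ^ 2 / eul (q ^ 2) = eul (q ^ 9) ^ 2 / eul (q ^ 18)
     - 2 * q * (eul (q ^ 3) * eul (q ^ 18) ^ 2 / (eul (q ^ 6) * eul (q ^ 9)))"
proof -
  define f where "f n = (- 1) powi n * q powi (n * n)" for n :: int
  define w where "w = eul (q ^ 3) * eul (q ^ 18) ^ 2 / (eul (q ^ 6) * eul (q ^ 9))"
  have w: "w = eul (q ^ 18) * qpoch (q ^ 3) (q ^ 18) * qpoch (q ^ 15) (q ^ 18)"
    using theta_eval_6_1[of "q ^ 3"] q q_pow by (simp add: w_def flip: power_mult)
  have "f (3 * m) = (- 1) powi m * (q ^ 9) powi (m * m)" for m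
    by (simp add: f_def powi_pow minus_one_powi)
  hence A: "((\<lambda>m. f (3 * m)) has_sum (eul (q ^ 9) ^ 2 / eul (q ^ 18))) UNIV"
    using phi_minus[of "q ^ 9"] q q_pow by (simp flip: power_mult)
  have "f (3 * m + 1) = - q * ((- 1) powi m * q powi (9 * m * m + 6 * m))" for m
  proof -
    have "(3 * m + 1) * (3 * m + 1) = (9 * m * m + 6 * m) + 1" by (simp add: algebra_simps)
    hence "q powi ((3 * m + 1) * (3 * m + 1)) = q * q powi (9 * m * m + 6 * m)"
      using q by (simp add: power_int_add_1')
    thus ?thesis by (simp add: f_def minus_one_powi)
  qed
  hence B: "((\<lambda>m. f (3 * m + 1)) has_sum (- q * w)) UNIV"
    using has_sum_cmult_right[OF theta_minus[OF q, of 18 15 "\<lambda>m. 9 * m * m + 6 * m"], of "- q"]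
    by (simp add: w algebra_simps)
  have "f (3 * m - 1) = - q * ((- 1) powi m * q powi (9 * m * m - 6 * m))" for m
  proof -
    have "(3 * m - 1) * (3 * m - 1) = (9 * m * m - 6 * m) + 1" by (simp add: algebra_simps)
    hence "q powi ((3 * m - 1) * (3 * m - 1)) = q * q powi (9 * m * m - 6 * m)"
      using q by (simp add: power_int_add_1')
    thus ?thesis by (simp add: f_def minus_one_powi)
  qed
  hence C: "((\<lambda>m. f (3 * m - 1)) has_sum (- q * w)) UNIV"
    using has_sum_cmult_right[OF theta_minus[OF q, of 18 3 "\<lambda>m. 9 * m * m - 6 * m"], of "- q"]
    by (simp add: w algebra_simps)
  show ?thesis
    using has_sum_unique[OF phi_minus[OF q, folded f_def] has_sum_mod3[OF A B C]]
    by (simp add: w_def mult.assoc)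
qed

text \<open>The reflection \<open>n \<mapsto> 1 - n\<close> exchanges the classes of 0 and 1; on the
  class of -1 the exponent is nine times a triangular number plus 1.\<close>

lemma psi_dissection_3:
  "eul (q ^ 2) ^ 2 / eul q = eul (q ^ 6) * eul (q ^ 9) ^ 2 / (eul (q ^ 3) * eul (q ^ 18))
     + q * (eul (q ^ 18) ^ 2 / eul (q ^ 9))"
proof -
  define f where "f n = q powi (n * (n - 1) div 2)" for n :: int
  define w where "w = eul (q ^ 6) * eul (q ^ 9) ^ 2 / (eul (q ^ 3) * eul (q ^ 18))"
  have w: "w = eul (q ^ 9) * qpoch (- (q ^ 3)) (q ^ 9) * qpoch (- (q ^ 6)) (q ^ 9)"
    using theta_eval_minus_3_1[of "q ^ 3"] q q_pow by (simp add: w_def flip: power_mult)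
  have tri: "2 * (n * (n - 1) div 2) = n * (n - 1)" for n :: int by simp
  have A: "((\<lambda>m. f (3 * m)) has_sum w) UNIV"
    unfolding f_def
    using theta_plus[OF q, of 9 3 "\<lambda>m. 3 * m * (3 * m - 1) div 2"] tri
    by (simp add: w algebra_simps)
  have B: "((\<lambda>m. f (3 * m + 1)) has_sum w) UNIV"
    unfolding f_def
    using theta_plus[OF q, of 9 6 "\<lambda>m. (3 * m + 1) * (3 * m + 1 - 1) div 2"] tri
    by (simp add: w algebra_simps)
  have "f (3 * m - 1) = q * (q ^ 9) powi (m * (m - 1) div 2)" for m
  proof -
    have "even (m * (m - 1))" by simp
    then obtain k where k: "m * (m - 1) = 2 * k" by blast
    hence "(3 * m - 1) * (3 * m - 1 - 1) = 2 * (9 * k + 1)" by (simp add: algebra_simps)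
    thus ?thesis using k q by (simp add: f_def powi_pow power_int_add_1)
  qed
  hence C: "((\<lambda>m. f (3 * m - 1)) has_sum (q * (2 * eul (q ^ 18) ^ 2 / eul (q ^ 9)))) UNIV"
    using has_sum_cmult_right[OF psi_sum[of "q ^ 9"], of q] q q_pow by (simp flip: power_mult)
  show ?thesis
  proof -
    have "2 * (eul (q ^ 2) ^ 2 / eul q) = 2 * (w + q * (eul (q ^ 18) ^ 2 / eul (q ^ 9)))"
      using has_sum_unique[OF psi_sum[OF q, folded f_def] has_sum_mod3[OF A B C]] by (simp add: mult.left_commute)
    thus ?thesis unfolding w_def by (simp only: mult_cancel_left) simp
  qed
qed

text \<open>The classes of \<open>\<int>[\<i>]\<close> modulo \<open>2 + \<i>\<close>, where \<open>\<i>\<close> is congruent to 3; multiplication by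
  \<open>\<i>\<close> permutes the four nonzero classes.\<close>

lemma has_sum_gaussian_classes:
  fixes f :: "int \<times> int \<Rightarrow> complex"
  assumes rot: "\<And>x y. f (b - y, x) = f (x, y)" and bc: "5 dvd b + 2 * c"
    and 0: "(f has_sum A) {(x, y). (x + 3 * y - c) mod 5 = 0}"
    and 1: "(f has_sum B) {(x, y). (x + 3 * y - c) mod 5 = 1}"
  shows "(f has_sum (A + 4 * B)) UNIV"
proof -
  define K where "K k = {(x, y). (x + 3 * y - c) mod 5 = k}" for k :: int
  have step: "(f has_sum S) (K (3 * k mod 5))" if "(f has_sum S) (K k)" "k \<in> {0..<5}" for k S
  proof -
    obtain t where t: "b + 2 * c = 5 * t" using bc by blast
    have mem: "(b - y, x) \<in> K (3 * k mod 5) \<longleftrightarrow> (x, y) \<in> K k" for x y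
    proof -
      have "b - y + 3 * x - c = 3 * (x + 3 * y - c) + 5 * (t - 2 * y)" using t by (simp add: algebra_simps)
      hence "(b - y + 3 * x - c) mod 5 = 3 * (x + 3 * y - c) mod 5" by (simp only: mod_mult_self2)
      moreover have "3 * u mod 5 = 3 * k mod 5 \<longleftrightarrow> u mod 5 = k" for u
      proof -
        have "5 dvd 3 * w \<longleftrightarrow> 5 dvd w" for w :: int by presburger
        hence "3 * u mod 5 = 3 * k mod 5 \<longleftrightarrow> u mod 5 = k mod 5"
          by (simp only: mod_eq_dvd_iff right_diff_distrib [symmetric])
        thus ?thesis using that(2) by simp
      qed
      ultimately show ?thesis by (simp only: K_def mem_Collect_eq case_prod_conv)
    qed
    have "bij_betw (\<lambda>(x, y). (b - y, x)) (K k) (K (3 * k mod 5))"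
    proof (rule bij_betw_byWitness[where f' = "\<lambda>(x, y). (y, b - x)"])
      show "(\<lambda>(x, y). (b - y, x)) ` K k \<subseteq> K (3 * k mod 5)" using mem by auto
      show "(\<lambda>(x, y). (y, b - x)) ` K (3 * k mod 5) \<subseteq> K k"
      proof clarify
        fix x y assume "(x, y) \<in> K (3 * k mod 5)"
        thus "(y, b - x) \<in> K k" using mem[of "b - x" y] by simp
      qed
    qed auto
    moreover have "((\<lambda>z. f (case z of (x, y) \<Rightarrow> (b - y, x))) has_sum S) (K k)"
      using that rot by (simp add: case_prod_unfold)
    ultimately show ?thesis using has_sum_reindex_bij_betw by blast
  qed
  define S where "S k = (if k = 0 then A else B)" for k :: int
  have K1: "(f has_sum B) (K 1)" using 1 by (simp add: K_def)
  \<comment> \<open>The nonzero classes are visited in the order 1, 3, 4, 2, the powers of 3 modulo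
    5.\<close>
  have K3: "(f has_sum B) (K 3)" using step[OF K1] by simp
  have K4: "(f has_sum B) (K 4)" using step[OF K3] by simp
  have K2: "(f has_sum B) (K 2)" using step[OF K4] by simp
  have five: "{0..<5::int} = {0, 1, 2, 3, 4}" by auto
  have "(f has_sum (\<Sum>k\<in>{0..<5}. S k)) (\<Union>k\<in>{0..<5}. K k)"
  proof (rule sum_has_sum)
    fix k :: int assume "k \<in> {0..<5}"
    hence "k = 0 \<or> k = 1 \<or> k = 2 \<or> k = 3 \<or> k = 4" by auto
    thus "(f has_sum S k) (K k)" using 0 K1 K2 K3 K4 by (auto simp: S_def K_def)
  qed (auto simp: K_def)
  also have "(\<Union>k\<in>{0..<5}. K k) = UNIV"
  proof -
    have "z \<in> (\<Union>k\<in>{0..<5}. K k)" for z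
      by (rule UN_I[of "(fst z + 3 * snd z - c) mod 5"]) (simp_all add: K_def case_prod_unfold)
    thus ?thesis by blast
  qed
  finally show ?thesis by (simp add: five S_def)
qed

text \<open>The substitution is multiplication by \<open>2 + \<i>\<close> followed by the shift
  \<open>a + b \<i>\<close>. Its image is one coset of an ideal of index 5, and it is inverted by
  multiplication with \<open>(2 - \<i>) / 5\<close>.\<close>

lemma has_sum_gaussian_class:
  fixes f :: "int \<times> int \<Rightarrow> complex"
  assumes "((\<lambda>(m, n). f (2 * m - n + a, m + 2 * n + b)) has_sum S) UNIV"
    and k: "(a + 3 * b - c) mod 5 = k"
  shows "(f has_sum S) {(x, y). (x + 3 * y - c) mod 5 = k}"
proof -
  have "bij_betw (\<lambda>(m, n). (2 * m - n + a, m + 2 * n + b)) UNIV {(x, y). (x + 3 * y - c) mod 5 = k}"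
  proof (rule bij_betw_byWitness[where f' = "\<lambda>(x, y). ((2 * (x - a) + (y - b)) div 5, (2 * (y - b) - (x - a)) div 5)"])
    have inv: "2 * ((2 * (x - a) + (y - b)) div 5) - (2 * (y - b) - (x - a)) div 5 + a = x \<and>
      (2 * (x - a) + (y - b)) div 5 + 2 * ((2 * (y - b) - (x - a)) div 5) + b = y"
      if "(x + 3 * y - c) mod 5 = k" for x y
    proof -
      have "(x + 3 * y - c) mod 5 = (a + 3 * b - c) mod 5" using that k by simp
      then obtain t where "(x + 3 * y - c) - (a + 3 * b - c) = 5 * t"
        by (metis mod_eq_dvd_iff dvdE)
      hence x: "x = a + 3 * b - 3 * y + 5 * t" by simp
      have "2 * (x - a) + (y - b) = 5 * (b - y + 2 * t)" "2 * (y - b) - (x - a) = 5 * (y - b - t)"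
        using x by (simp_all add: algebra_simps)
      thus ?thesis using x by simp
    qed
    show "\<forall>z\<in>{(x, y). (x + 3 * y - c) mod 5 = k}. (case case z of (x, y) \<Rightarrow>
        ((2 * (x - a) + (y - b)) div 5, (2 * (y - b) - (x - a)) div 5) of
        (m, n) \<Rightarrow> (2 * m - n + a, m + 2 * n + b)) = z"
      using inv by auto
    have "(2 * m - n + a) + 3 * (m + 2 * n + b) - c = (a + 3 * b - c) + 5 * (m + n)" for m n
      by (simp add: algebra_simps)
    hence "((2 * m - n + a) + 3 * (m + 2 * n + b) - c) mod 5 = k" for m n using k by (simp only: mod_mult_self2)
    thus "(\<lambda>(m, n). (2 * m - n + a, m + 2 * n + b)) ` UNIV \<subseteq> {(x, y). (x + 3 * y - c) mod 5 = k}"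
      by auto
  qed auto
  from has_sum_reindex_bij_betw[OF this, of f S] assms(1) show ?thesis
    by (simp add: case_prod_unfold)
qed

text \<open>The square of the theta series is the sum of \<open>(-1)^N q^N\<close> over Gaussian
  integers of norm \<open>N\<close>. Multiples of \<open>2 + \<i>\<close> reproduce it in
  \<open>q ^ 5\<close>; the four other classes agree by rotation, and the class of 1 factors into
  two theta series.\<close>

lemma phi_dissection_5:
  "(eul q ^ 2 / eul (q ^ 2)) ^ 2 = (eul (q ^ 5) ^ 2 / eul (q ^ 10)) ^ 2
     - 4 * q * (eul q * eul (q ^ 10) ^ 3 / (eul (q ^ 2) * eul (q ^ 5)))"
proof -
  define f where "f = (\<lambda>(x, y). ((- 1) powi x * q powi (x * x)) * ((- 1) powi y * q powi (y * y)))"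
  have fsum: "(f has_sum (eul q ^ 2 / eul (q ^ 2)) ^ 2) UNIV"
    unfolding f_def power2_eq_square[of "eul q ^ 2 / eul (q ^ 2)"]
    by (intro has_sum_times phi_minus q)
  have "f (2 * m - n + 0, m + 2 * n + 0) = ((- 1) powi m * (q ^ 5) powi (m * m)) * ((- 1) powi n * (q ^ 5) powi (n * n))" for m n
  proof -
    have "(2 * m - n) * (2 * m - n) + (m + 2 * n) * (m + 2 * n) = 5 * (m * m) + 5 * (n * n)"
      by (simp add: algebra_simps)
    hence "q powi ((2 * m - n) * (2 * m - n)) * q powi ((m + 2 * n) * (m + 2 * n)) = q powi (5 * (m * m)) * q powi (5 * (n * n))"
      using q by (simp flip: power_int_add)
    thus ?thesis by (simp add: f_def powi_pow minus_one_powi)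
  qed
  hence A: "(f has_sum (eul (q ^ 5) ^ 2 / eul (q ^ 10)) ^ 2) {(x, y). (x + 3 * y - 0) mod 5 = 0}"
    using has_sum_times[OF phi_minus phi_minus, of "q ^ 5" "q ^ 5"] q q_pow
    by (intro has_sum_gaussian_class[of f 0 0]) (simp_all add: power2_eq_square[of "_ / _"] flip: power_mult)
  define g where "g c = eul (q ^ 10) * qpoch (q ^ c) (q ^ 10) * qpoch (q ^ (10 - c)) (q ^ 10)" for c
  have "f (2 * m - n + 1, m + 2 * n + 0) = - q * (((- 1) powi m * q powi (5 * m * m + 4 * m)) * ((- 1) powi n * q powi (5 * n * n - 2 * n)))" for m n
  proof -
    have "(2 * m - n + 1) * (2 * m - n + 1) + (m + 2 * n) * (m + 2 * n) = (5 * m * m + 4 * m) + (5 * n * n - 2 * n) + 1"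
      by (simp add: algebra_simps)
    hence "q powi ((2 * m - n + 1) * (2 * m - n + 1)) * q powi ((m + 2 * n) * (m + 2 * n)) = q powi (5 * m * m + 4 * m) * q powi (5 * n * n - 2 * n) * q"
      using q by (simp add: power_int_add_1 flip: power_int_add)
    thus ?thesis by (simp add: f_def minus_one_powi)
  qed
  moreover have "((\<lambda>z. - q * (case z of (m, n) \<Rightarrow> ((- 1) powi m * q powi (5 * m * m + 4 * m)) * ((- 1) powi n * q powi (5 * n * n - 2 * n))))
      has_sum (- q * (g 9 * g 3))) UNIV"
    unfolding g_def
    by (intro has_sum_cmult_right has_sum_times theta_minus q) (auto simp: algebra_simps)
  ultimately have B: "(f has_sum (- q * (g 9 * g 3))) {(x, y). (x + 3 * y - 0) mod 5 = 1}"
    by (intro has_sum_gaussian_class[of f 1 0]) (simp_all add: case_prod_unfold)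
  have "(f has_sum ((eul (q ^ 5) ^ 2 / eul (q ^ 10)) ^ 2 + 4 * (- q * (g 9 * g 3)))) UNIV"
    by (rule has_sum_gaussian_classes[OF _ _ A B, of 0]) (simp_all add: f_def minus_one_powi mult_ac)
  moreover have "g 9 * g 3 = eul q * eul (q ^ 10) ^ 3 / (eul (q ^ 2) * eul (q ^ 5))"
  proof -
    have "g 9 * g 3 = eul (q ^ 10) ^ 2 * (qpoch q (q ^ 10) * qpoch (q ^ 3) (q ^ 10) * qpoch (q ^ 7) (q ^ 10) * qpoch (q ^ 9) (q ^ 10))"
      by (simp add: g_def power2_eq_square[of "eul x" for x])
    thus ?thesis unfolding theta_eval_10[OF q(1)] by (simp add: power2_eq_square[of "eul x" for x] power3_eq_cube[of "eul x" for x])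
  qed
  ultimately show ?thesis using has_sum_unique[OF fsum] by simp
qed

text \<open>As for \<open>\<phi>\<close>, but the exponent is now symmetric about
  \<open>(1 + \<i>) / 2\<close>, so the rotation is \<open>(x, y) \<mapsto> (1 - y, x)\<close>. With
  \<open>\<i> = 3\<close> this centre has residue 2, that is -3, modulo 5, which explains the shift
  by 3.\<close>

lemma psi_dissection_5:
  "(eul (q ^ 2) ^ 2 / eul q) ^ 2 = q * (eul (q ^ 10) ^ 2 / eul (q ^ 5)) ^ 2
     + eul (q ^ 2) * eul (q ^ 5) ^ 3 / (eul q * eul (q ^ 10))"
proof -
  define f where "f = (\<lambda>(x, y). q powi (x * (x - 1) div 2) * q powi (y * (y - 1) div 2))"
  have fsum: "(f has_sum (2 * eul (q ^ 2) ^ 2 / eul q) ^ 2) UNIV"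
    unfolding f_def power2_eq_square[of "2 * eul (q ^ 2) ^ 2 / eul q"]
    by (intro has_sum_times psi_sum q)
  have f_eq: "f (x, y) = q powi k" if "x * (x - 1) + y * (y - 1) = 2 * k" for x y k
  proof -
    have "even (x * (x - 1))" "even (y * (y - 1))" by simp_all
    then obtain i j where ij: "x * (x - 1) = 2 * i" "y * (y - 1) = 2 * j" by (elim evenE)
    with that have "k = i + j" by simp
    thus ?thesis using q ij by (simp add: f_def power_int_add)
  qed
  have tri: "2 * (n * (n - 1) div 2) = n * (n - 1)" for n :: int by simp
  have "f (2 * m - n + 0, m + 2 * n + (- 1)) = q * ((q ^ 5) powi (m * (m - 1) div 2) * (q ^ 5) powi (n * (n - 1) div 2))" for m n
  proof -
    have "(2 * m - n + 0) * (2 * m - n + 0 - 1) + (m + 2 * n + (- 1)) * (m + 2 * n + (- 1) - 1)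
        = 5 * (m * (m - 1)) + 5 * (n * (n - 1)) + 2"
      by (simp add: algebra_simps)
    also have "\<dots> = 2 * (5 * (m * (m - 1) div 2) + 5 * (n * (n - 1) div 2) + 1)"
    proof -
      have "even (m * (m - 1))" "even (n * (n - 1))" by simp_all
      then obtain i j where "m * (m - 1) = 2 * i" "n * (n - 1) = 2 * j" by (elim evenE)
      thus ?thesis by simp
    qed
    finally have "f (2 * m - n + 0, m + 2 * n + (- 1)) = q powi (5 * (m * (m - 1) div 2) + 5 * (n * (n - 1) div 2) + 1)"
      by (rule f_eq)
    thus ?thesis using q by (simp add: powi_pow power_int_add)
  qed
  hence A: "(f has_sum (q * (2 * eul (q ^ 10) ^ 2 / eul (q ^ 5)) ^ 2)) {(x, y). (x + 3 * y - (- 3)) mod 5 = 0}"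
    using has_sum_cmult_right[OF has_sum_times[OF psi_sum psi_sum, of "q ^ 5" "q ^ 5"], of q] q q_pow
    by (intro has_sum_gaussian_class[of f 0 "- 1"])
      (simp_all add: power2_eq_square[of "_ / _"] case_prod_unfold flip: power_mult)
  define g where "g c = eul (q ^ 5) * qpoch (- (q ^ c)) (q ^ 5) * qpoch (- (q ^ (5 - c))) (q ^ 5)" for c
  have ev: "even (5 * m * m - m)" "even (5 * n * n + 3 * n)" for m n :: int by auto
  have "f (2 * m - n + 0, m + 2 * n + 1) = q powi ((5 * m * m - m) div 2) * q powi ((5 * n * n + 3 * n) div 2)" for m n
  proof -
    have "(2 * m - n + 0) * (2 * m - n + 0 - 1) + (m + 2 * n + 1) * (m + 2 * n + 1 - 1)
        = (5 * m * m - m) + (5 * n * n + 3 * n)"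
      by (simp add: algebra_simps)
    also have "\<dots> = 2 * ((5 * m * m - m) div 2 + (5 * n * n + 3 * n) div 2)"
      using ev(1)[of m] ev(2)[of n] by (elim evenE) simp
    finally have "f (2 * m - n + 0, m + 2 * n + 1) = q powi ((5 * m * m - m) div 2 + (5 * n * n + 3 * n) div 2)"
      by (rule f_eq)
    thus ?thesis using q by (simp add: power_int_add)
  qed
  moreover have "((\<lambda>(m, n). q powi ((5 * m * m - m) div 2) * q powi ((5 * n * n + 3 * n) div 2)) has_sum (g 2 * g 4)) UNIV"
    unfolding g_def using ev
    by (intro has_sum_times theta_plus q) (auto simp: algebra_simps)
  ultimately have B: "(f has_sum (g 2 * g 4)) {(x, y). (x + 3 * y - (- 3)) mod 5 = 1}"
    by (intro has_sum_gaussian_class[of f 0 1]) (simp_all add: case_prod_unfold)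
  have "(f has_sum (q * (2 * eul (q ^ 10) ^ 2 / eul (q ^ 5)) ^ 2 + 4 * (g 2 * g 4))) UNIV"
    by (rule has_sum_gaussian_classes[OF _ _ A B, of 1]) (simp_all add: f_def algebra_simps)
  moreover have "g 2 * g 4 = eul (q ^ 2) * eul (q ^ 5) ^ 3 / (eul q * eul (q ^ 10))"
  proof -
    have "g 2 * g 4 = eul (q ^ 5) ^ 2 * (qpoch (- q) (q ^ 5) * qpoch (- (q ^ 2)) (q ^ 5) * qpoch (- (q ^ 3)) (q ^ 5) * qpoch (- (q ^ 4)) (q ^ 5))"
      by (simp add: g_def power2_eq_square[of "eul x" for x])
    thus ?thesis unfolding theta_eval_minus_5[OF q(1)] by (simp add: power2_eq_square[of "eul x" for x] power3_eq_cube[of "eul x" for x])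
  qed
  ultimately have main: "(2 * eul (q ^ 2) ^ 2 / eul q) ^ 2 = q * (2 * eul (q ^ 10) ^ 2 / eul (q ^ 5)) ^ 2
     + 4 * (eul (q ^ 2) * eul (q ^ 5) ^ 3 / (eul q * eul (q ^ 10)))"
    using has_sum_unique[OF fsum] by simp
  have e: "(2 * x / y) ^ 2 = 4 * (x / y) ^ 2" for x y :: complex
    by (simp add: power_divide power_mult_distrib)
  have c: "x = q * y + z" if "4 * x = q * (4 * y) + 4 * z" for x y z
  proof -
    have "4 * x = 4 * (q * y + z)" using that by (simp add: algebra_simps)
    thus ?thesis by (simp only: mult_cancel_left) simp
  qed
  show ?thesis by (rule c) (rule main[unfolded e])
qed

end

section \<open>Derivatives of the theta series and Eisenstein series\<close>

text \<open>Weierstrass's theorem along the filter of finite subsets: uniform convergence on a disc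
  carries over to the derivatives.\<close>

lemma has_sum_has_field_derivative:
  fixes f :: "'i \<Rightarrow> complex \<Rightarrow> complex"
  assumes r: "r > 0"
    and bound: "\<And>i z. z \<in> cball z0 r \<Longrightarrow> norm (f i z) \<le> M i" and M: "M summable_on I"
    and sum: "\<And>z. z \<in> cball z0 r \<Longrightarrow> ((\<lambda>i. f i z) has_sum F z) I"
    and der: "\<And>i z. z \<in> cball z0 r \<Longrightarrow> (f i has_field_derivative f' i z) (at z)"
  obtains D where "(F has_field_derivative D) (at z0)" "((\<lambda>i. f' i z0) has_sum D) I"
proof -
  let ?G = "finite_subsets_at_top I"
  have U: "uniform_limit (cball z0 r) (\<lambda>X z. \<Sum>i\<in>X. f i z) F ?G"
    by (rule Weierstrass_m_test_general'[OF bound sum M])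
  have E: "\<forall>\<^sub>F X in ?G. continuous_on (cball z0 r) (\<lambda>z. \<Sum>i\<in>X. f i z) \<and>
      (\<forall>w\<in>ball z0 r. ((\<lambda>z. \<Sum>i\<in>X. f i z) has_field_derivative (\<Sum>i\<in>X. f' i w)) (at w))"
  proof (intro always_eventually allI conjI ballI)
    fix X
    show "continuous_on (cball z0 r) (\<lambda>z. \<Sum>i\<in>X. f i z)"
      by (intro continuous_on_sum) (meson DERIV_isCont continuous_at_imp_continuous_on der)
    show "((\<lambda>z. \<Sum>i\<in>X. f i z) has_field_derivative (\<Sum>i\<in>X. f' i w)) (at w)" if "w \<in> ball z0 r" for w
      using that by (intro DERIV_sum der) auto
  qed
  obtain g' where g': "\<And>w. w \<in> ball z0 r \<Longrightarrow> (F has_field_derivative g' w) (at w) \<and>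
      ((\<lambda>X. \<Sum>i\<in>X. f' i w) \<longlongrightarrow> g' w) ?G"
    by (rule has_complex_derivative_uniform_limit[OF E U _ r]) (auto simp: finite_subsets_at_top_neq_bot)
  from g'[of z0] r that[of "g' z0"] show ?thesis by (simp add: has_sum_def)
qed

text \<open>The operator \<open>q d/dq\<close> multiplies coefficients by exponents. Absolute
  convergence at the point \<open>\<rho>\<close> between \<open>norm q\<close> and 1 supplies the
  majorant near \<open>q\<close>.\<close>

lemma has_sum_powi_derivative:
  fixes c :: "'i \<Rightarrow> complex" and e :: "'i \<Rightarrow> int"
  assumes e: "\<And>n. e n \<ge> 0"
    and F: "\<And>q. norm q < 1 \<Longrightarrow> q \<noteq> 0 \<Longrightarrow> ((\<lambda>n. c n * q powi e n) has_sum F q) I"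
    and q: "norm q < 1" "q \<noteq> 0"
  obtains D where "(F has_field_derivative D) (at q)" "((\<lambda>n. c n * of_int (e n) * q powi e n) has_sum (q * D)) I"
proof -
  define r where "r = min (norm q / 2) ((1 - norm q) / 2)"
  define \<rho> where "\<rho> = (1 + norm q) / 2"
  have r: "r > 0" and \<rho>: "0 < \<rho>" "\<rho> < 1" using q by (auto simp: r_def \<rho>_def add_pos_pos)
  have "(\<lambda>n. norm (c n * of_real \<rho> powi e n)) summable_on I"
    using F[of "of_real \<rho>"] \<rho> has_sum_imp_summable summable_on_iff_abs_summable_on_complex by fastforce
  hence M: "(\<lambda>n. norm (c n) * \<rho> powi e n) summable_on I"
    using \<rho> by (simp add: norm_mult norm_power_int)
  have z: "norm z \<le> \<rho>" "z \<noteq> 0" if "z \<in> cball q r" for z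
  proof -
    have d: "norm (z - q) \<le> r" using that by (simp add: dist_norm norm_minus_commute)
    have "norm z \<le> norm q + norm (z - q)" by (metis add.commute diff_add_cancel norm_triangle_ineq)
    thus "norm z \<le> \<rho>" using d by (simp add: r_def \<rho>_def field_simps)
    have "norm q > 0" using q by simp
    moreover have "norm (z - q) \<le> norm q / 2" using d by (simp add: r_def)
    ultimately have "norm (z - q) < norm q" by linarith
    thus "z \<noteq> 0" by auto
  qed
  obtain D where D: "(F has_field_derivative D) (at q)" "((\<lambda>n. c n * (of_int (e n) * q powi (e n - 1))) has_sum D) I"
  proof (rule has_sum_has_field_derivative[OF r])
    show "norm (c n * z powi e n) \<le> norm (c n) * \<rho> powi e n" if "z \<in> cball q r" for n z
      unfolding norm_mult norm_power_int
      using z(1)[OF that] e \<rho> by (intro mult_left_mono power_int_mono) auto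
    show "((\<lambda>n. c n * z powi e n) has_sum F z) I" if "z \<in> cball q r" for z
      using z[OF that] \<rho> by (intro F) auto
    show "((\<lambda>z. c n * z powi e n) has_field_derivative c n * (of_int (e n) * z powi (e n - 1))) (at z)"
      if "z \<in> cball q r" for n z
      using z[OF that] by (auto intro!: derivative_eq_intros)
  qed (use M in auto)
  have "((\<lambda>n. q * (c n * (of_int (e n) * q powi (e n - 1)))) has_sum (q * D)) I"
    by (rule has_sum_cmult_right[OF D(2)])
  also have "(\<lambda>n. q * (c n * (of_int (e n) * q powi (e n - 1)))) = (\<lambda>n. c n * of_int (e n) * q powi e n)"
    using q by (auto simp: power_int_diff mult_ac)
  finally show ?thesis using that D(1) by blast
qed

section \<open>The odd theta function and its heat equation\<close>

lemma summable_theta_exp: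
  fixes r S :: real
  assumes "0 < r" "r < 1"
  shows "(\<lambda>n::int. r powi (n * (n - 1) div 2) * exp (S * \<bar>of_int (2 * n - 1)\<bar>)) summable_on UNIV"
proof (rule summable_on_comparison_test)
  let ?B = "\<lambda>T n. exp (- T) * (r powi (n * (n - 1) div 2) * exp (2 * T) powi n)"
  show "(\<lambda>n. ?B S n + ?B (- S) n) summable_on UNIV"
    using assms by (intro summable_on_add summable_on_cmult_right summable_theta) auto
  have eq: "?B T n = r powi (n * (n - 1) div 2) * exp (T * of_int (2 * n - 1))" for T n
    by (simp add: exp_power_int algebra_simps flip: exp_add)
  show "r powi (n * (n - 1) div 2) * exp (S * \<bar>of_int (2 * n - 1)\<bar>) \<le> ?B S n + ?B (- S) n" for n
  proof -
    have "exp (S * \<bar>k\<bar>) \<le> exp (S * k) + exp (- S * k)" for k by (cases "k \<ge> 0") auto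
    thus ?thesis unfolding eq distrib_left[symmetric] using assms by (intro mult_left_mono) auto
  qed
qed (use assms in auto)

lemma abs_power_le_exp: "\<bar>x :: real\<bar> ^ j \<le> exp (of_nat j * \<bar>x\<bar>)"
proof -
  have "\<bar>x\<bar> \<le> exp \<bar>x\<bar>" using exp_ge_add_one_self[of "\<bar>x\<bar>"] by linarith
  hence "\<bar>x\<bar> ^ j \<le> exp \<bar>x\<bar> ^ j" by (intro power_mono) auto
  thus ?thesis by (simp add: exp_of_nat_mult)
qed

lemma tri_nonneg: "(n :: int) * (n - 1) div 2 \<ge> 0"
proof -
  have "n * (n - 1) \<ge> 0" by (cases "n \<le> 0") (auto simp: mult_nonpos_nonpos)
  thus ?thesis by simp
qed

text \<open>The triple product series at \<open>z = exp (2 * v)\<close>, multiplied by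
  \<open>exp (- v)\<close>: the frequencies become the odd numbers \<open>2 * n - 1\<close>, and the
  sum becomes odd in \<open>v\<close>. The index \<open>j\<close> counts derivatives in
  \<open>v\<close>.\<close>

definition theta_term :: "nat \<Rightarrow> complex \<Rightarrow> complex \<Rightarrow> int \<Rightarrow> complex" where
  "theta_term j q v n = (- 1) powi n * q powi (n * (n - 1) div 2) * of_int (2 * n - 1) ^ j * exp (of_int (2 * n - 1) * v)"

definition theta_d :: "nat \<Rightarrow> complex \<Rightarrow> complex \<Rightarrow> complex" where
  "theta_d j q v = (\<Sum>\<^sub>\<infinity>n. theta_term j q v n)"

lemma norm_theta_term_le:
  assumes "norm v \<le> S"
  shows "norm (theta_term j q v n) \<le> norm q powi (n * (n - 1) div 2) * exp ((of_nat j + S) * \<bar>of_int (2 * n - 1)\<bar>)"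
proof -
  define k where "k = real_of_int (2 * n - 1)"
  have "norm (theta_term j q v n) = norm q powi (n * (n - 1) div 2) * (\<bar>k\<bar> ^ j * exp (k * Re v))"
  proof -
    have "of_int (2 * n - 1) = complex_of_real k" by (simp add: k_def)
    thus ?thesis unfolding theta_term_def
      by (simp only: norm_mult norm_power_int norm_power norm_exp_eq_Re norm_of_real) simp
  qed
  also have "\<dots> \<le> norm q powi (n * (n - 1) div 2) * (exp (of_nat j * \<bar>k\<bar>) * exp (\<bar>k\<bar> * S))"
  proof (intro mult_left_mono mult_mono abs_power_le_exp)
    have "k * Re v \<le> \<bar>k\<bar> * \<bar>Re v\<bar>" by (metis abs_ge_self abs_mult)
    also have "\<dots> \<le> \<bar>k\<bar> * S" using abs_Re_le_cmod[of v] assms by (intro mult_left_mono) auto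
    finally show "exp (k * Re v) \<le> exp (\<bar>k\<bar> * S)" by simp
  qed auto
  also have "exp (of_nat j * \<bar>k\<bar>) * exp (\<bar>k\<bar> * S) = exp ((of_nat j + S) * \<bar>k\<bar>)"
    by (simp add: algebra_simps flip: exp_add)
  finally show ?thesis by (simp add: k_def)
qed

context
  fixes q :: complex
  assumes q: "norm q < 1" "q \<noteq> 0"
begin

lemma theta_d_has_sum: "(theta_term j q v has_sum theta_d j q v) UNIV"
proof -
  have s: "(\<lambda>n. norm (theta_term j q v n)) summable_on UNIV"
    by (rule summable_on_comparison_test[OF summable_theta_exp norm_theta_term_le[OF order.refl]]) (use q in auto)
  show ?thesis unfolding theta_d_def by (rule has_sum_infsum[OF abs_summable_summable[OF s]])
qed

lemma theta_d_deriv: "(theta_d j q has_field_derivative theta_d (Suc j) q v) (at v)"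
proof -
  obtain D where D: "(theta_d j q has_field_derivative D) (at v)" "(theta_term (Suc j) q v has_sum D) UNIV"
  proof (rule has_sum_has_field_derivative[OF zero_less_one])
    show "norm (theta_term j q z n) \<le> norm q powi (n * (n - 1) div 2) * exp ((of_nat j + (norm v + 1)) * \<bar>of_int (2 * n - 1)\<bar>)"
      if "z \<in> cball v 1" for n z
    proof (rule norm_theta_term_le)
      show "norm z \<le> norm v + 1"
        using norm_triangle_ineq2[of z v] that by (simp add: dist_norm norm_minus_commute)
    qed
    show "((\<lambda>z. theta_term j q z n) has_field_derivative theta_term (Suc j) q z n) (at z)" for n z
      unfolding theta_term_def by (auto intro!: derivative_eq_intros simp: mult_ac)
    show "(\<lambda>n. norm q powi (n * (n - 1) div 2) * exp ((of_nat j + (norm v + 1)) * \<bar>of_int (2 * n - 1)\<bar>)) summable_on UNIV"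
      by (rule summable_theta_exp) (use q in auto)
    show "((\<lambda>n. theta_term j q z n) has_sum theta_d j q z) UNIV" for z
      by (rule theta_d_has_sum)
  qed
  have "D = theta_d (Suc j) q v" using D(2) theta_d_has_sum by (rule has_sum_unique)
  thus ?thesis using D by simp
qed

text \<open>The simple zero at \<open>v = 0\<close> is split off as \<open>sinh v\<close>; the
  remaining factor is even, with value \<open>eul q ^ 3\<close> at 0.\<close>

lemma theta_d_product: "theta_d 0 q v = - 2 * sinh v * (eul q * qpoch (q * exp (2 * v)) q * qpoch (q * exp (- 2 * v)) q)"
proof -
  have "((\<lambda>n. exp (- v) * ((- 1) powi n * q powi (n * (n - 1) div 2) * exp (2 * v) powi n)) has_sum
      (exp (- v) * (eul q * qpoch (exp (2 * v)) q * qpoch (q / exp (2 * v)) q))) UNIV"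
    by (intro has_sum_cmult_right jacobi_triple q) auto
  also have "(\<lambda>n. exp (- v) * ((- 1) powi n * q powi (n * (n - 1) div 2) * exp (2 * v) powi n)) = theta_term 0 q v"
    by (auto simp: theta_term_def exp_power_int algebra_simps simp flip: exp_add)
  finally have "theta_d 0 q v = exp (- v) * (eul q * qpoch (exp (2 * v)) q * qpoch (q / exp (2 * v)) q)"
    using has_sum_unique theta_d_has_sum by blast
  also have "qpoch (exp (2 * v)) q = (1 - exp (2 * v)) * qpoch (q * exp (2 * v)) q"
    using qpoch_shift[OF q(1), of "exp (2 * v)"] by (simp add: mult.commute)
  also have "q / exp (2 * v) = q * exp (- 2 * v)" by (simp add: exp_minus field_simps)
  also have "exp (- v) * (eul q * ((1 - exp (2 * v)) * qpoch (q * exp (2 * v)) q) * qpoch (q * exp (- 2 * v)) q)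
      = (exp (- v) - exp (- v) * exp (2 * v)) * (eul q * qpoch (q * exp (2 * v)) q * qpoch (q * exp (- 2 * v)) q)"
    by (simp add: algebra_simps)
  also have "exp (- v) - exp (- v) * exp (2 * v) = - 2 * sinh v"
    by (simp add: sinh_field_def flip: exp_add)
  finally show ?thesis .
qed

text \<open>Since \<open>(2 * n - 1)^2 - 1\<close> is eight times the triangular exponent, the
  second derivative in \<open>v\<close> minus the identity acts as \<open>8 q d/dq\<close>.\<close>

lemma theta_d_heat:
  obtains D where "((\<lambda>q. theta_d j q 0) has_field_derivative D) (at q)"
    "8 * (q * D) = theta_d (j + 2) q 0 - theta_d j q 0"
proof -
  obtain D where D: "((\<lambda>q. theta_d j q 0) has_field_derivative D) (at q)"
    "((\<lambda>n. ((- 1) powi n * of_int (2 * n - 1) ^ j) * of_int (n * (n - 1) div 2) * q powi (n * (n - 1) div 2)) has_sum (q * D)) UNIV"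
  proof (rule has_sum_powi_derivative[where c = "\<lambda>n. (- 1) powi n * of_int (2 * n - 1) ^ j"
        and e = "\<lambda>n. n * (n - 1) div 2" and F = "\<lambda>q. theta_d j q 0" and I = UNIV])
    fix q :: complex assume q: "norm q < 1" "q \<noteq> 0"
    have "theta_term j q 0 = (\<lambda>n. (- 1) powi n * of_int (2 * n - 1) ^ j * q powi (n * (n - 1) div 2))"
      by (auto simp: theta_term_def mult_ac)
    moreover have "(\<lambda>n. norm (theta_term j q 0 n)) summable_on UNIV"
      by (rule summable_on_comparison_test[OF summable_theta_exp norm_theta_term_le[OF order.refl]]) (use q in auto)
    ultimately show "((\<lambda>n. (- 1) powi n * of_int (2 * n - 1) ^ j * q powi (n * (n - 1) div 2)) has_sum theta_d j q 0) UNIV"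
      unfolding theta_d_def by (metis has_sum_infsum abs_summable_summable)
  qed (use q tri_nonneg in auto)
  have "((\<lambda>n. theta_term (j + 2) q 0 n - theta_term j q 0 n) has_sum (theta_d (j + 2) q 0 - theta_d j q 0)) UNIV"
    using has_sum_add[OF theta_d_has_sum[of "j + 2" 0] has_sum_uminusI[OF theta_d_has_sum[of j 0]]] by simp
  also have "(\<lambda>n. theta_term (j + 2) q 0 n - theta_term j q 0 n) =
    (\<lambda>n. 8 * (((- 1) powi n * of_int (2 * n - 1) ^ j) * of_int (n * (n - 1) div 2) * q powi (n * (n - 1) div 2)))"
  proof
    fix n :: int
    have "even (n * (n - 1))" by simp
    then obtain k where k: "n * (n - 1) = 2 * k" by blast
    have "(2 * n - 1) ^ 2 - 1 = 8 * k" using k by (simp add: power2_eq_square algebra_simps)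
    hence "complex_of_int ((2 * n - 1) ^ 2 - 1) = 8 * of_int k" by (metis of_int_mult of_int_numeral)
    hence X: "complex_of_int (2 * n - 1) ^ 2 = 8 * of_int k + 1" by (simp add: algebra_simps)
    have e: "n * (n - 1) div 2 = k" using k by simp
    show "theta_term (j + 2) q 0 n - theta_term j q 0 n = 8 * (((- 1) powi n * of_int (2 * n - 1) ^ j) * of_int (n * (n - 1) div 2) * q powi (n * (n - 1) div 2))"
      unfolding e theta_term_def power_add X by (simp add: algebra_simps)
  qed
  finally have "8 * (q * D) = theta_d (j + 2) q 0 - theta_d j q 0"
    using has_sum_unique has_sum_cmult_right[OF D(2), of 8] by blast
  with D(1) that show ?thesis by blast
qed

end

section \<open>Logarithms of Euler products as Lambert series\<close>

lemma summable_power_times_geometric: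
  fixes \<rho> :: real
  assumes "0 < \<rho>" "\<rho> < 1"
  shows "summable (\<lambda>k. of_nat k ^ j * \<rho> ^ k)"
proof -
  \<comment> \<open>Small enough that \<open>\<rho> * exp (j * \<epsilon>)\<close> stays below 1:
    the power of \<open>k\<close> is absorbed into \<open>exp (j * \<epsilon> * k)\<close> at the
    price of a constant.\<close>
  define \<epsilon> where "\<epsilon> = - ln \<rho> / (2 * (of_nat j + 1))"
  have \<epsilon>: "\<epsilon> > 0" using assms by (simp add: \<epsilon>_def divide_neg_pos)
  define s where "s = \<rho> * exp (of_nat j * \<epsilon>)"
  have "ln \<rho> + of_nat j * \<epsilon> = ln \<rho> * (1 - of_nat j / (2 * (of_nat j + 1)))"
    by (simp add: \<epsilon>_def algebra_simps)
  also have "\<dots> < 0"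
    using assms by (intro mult_neg_pos) (auto simp: field_simps)
  finally have "exp (ln \<rho> + of_nat j * \<epsilon>) < 1" by simp
  hence s: "0 < s" "s < 1" using assms by (simp_all add: s_def exp_add)
  have bound: "of_nat k ^ j * \<rho> ^ k \<le> (1 / \<epsilon>) ^ j * s ^ k" for k
  proof -
    have "(\<epsilon> * of_nat k) ^ j \<le> exp (of_nat j * (\<epsilon> * of_nat k))"
      using abs_power_le_exp[of "\<epsilon> * of_nat k" j] \<epsilon> by simp
    hence "of_nat k ^ j \<le> (1 / \<epsilon>) ^ j * exp (of_nat j * \<epsilon>) ^ k"
      using \<epsilon> by (simp add: power_mult_distrib power_divide field_simps flip: exp_of_nat_mult)
    hence "of_nat k ^ j * \<rho> ^ k \<le> (1 / \<epsilon>) ^ j * exp (of_nat j * \<epsilon>) ^ k * \<rho> ^ k"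
      using assms by (intro mult_right_mono) auto
    thus ?thesis by (simp add: s_def power_mult_distrib mult_ac)
  qed
  have "summable (\<lambda>k. (1 / \<epsilon>) ^ j * s ^ k)"
    using s by (intro summable_mult summable_geometric) auto
  thus ?thesis
    by (rule summable_comparison_test[rotated]) (use assms bound in \<open>auto intro!: exI[of _ 0]\<close>)
qed

lemma summable_on_times_nonneg:
  fixes a :: "'a \<Rightarrow> real" and b :: "'b \<Rightarrow> real"
  assumes "a summable_on UNIV" "b summable_on UNIV" "\<And>x. a x \<ge> 0" "\<And>x. b x \<ge> 0"
  shows "(\<lambda>(x, y). a x * b y) summable_on UNIV"
proof -
  have "((\<lambda>x. complex_of_real (a x)) has_sum of_real (infsum a UNIV)) UNIV"
    "((\<lambda>x. complex_of_real (b x)) has_sum of_real (infsum b UNIV)) UNIV"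
    using assms by (auto intro!: has_sum_of_real)
  hence "(\<lambda>(x, y). complex_of_real (a x) * complex_of_real (b y)) summable_on UNIV"
    using has_sum_times has_sum_imp_summable by blast
  hence "(\<lambda>z. norm ((\<lambda>(x, y). complex_of_real (a x) * complex_of_real (b y)) z)) summable_on UNIV"
    using summable_on_iff_abs_summable_on_complex by blast
  moreover have "(\<lambda>z. norm ((\<lambda>(x, y). complex_of_real (a x) * complex_of_real (b y)) z)) = (\<lambda>(x, y). a x * b y)"
    using assms by (auto simp: norm_mult)
  ultimately show ?thesis by simp
qed

text \<open>The logarithm of \<open>qpoch (q * exp w) q\<close> as a double series, differentiated
  \<open>j\<close> times in \<open>w\<close>. The quotient \<open>k^j / k\<close> treats
  \<open>j = 0\<close> uniformly. At \<open>w = 0\<close> the cases \<open>j = 2\<close> and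
  \<open>j = 4\<close> are, up to sign, the generating series of the divisor sums
  \<open>\<sigma>_1\<close> and \<open>\<sigma>_3\<close>.\<close>

definition lambert_term :: "nat \<Rightarrow> complex \<Rightarrow> complex \<Rightarrow> nat \<times> nat \<Rightarrow> complex" where
  "lambert_term j q w = (\<lambda>(n, k). - (q ^ (Suc n * Suc k) * of_nat (Suc k) ^ j / of_nat (Suc k) * exp (of_nat (Suc k) * w)))"

definition lambert :: "nat \<Rightarrow> complex \<Rightarrow> complex \<Rightarrow> complex" where
  "lambert j q w = infsum (lambert_term j q w) UNIV"

lemma norm_lambert_term_le:
  assumes q: "norm q < 1" and \<rho>: "norm (q * exp w) \<le> \<rho>"
  shows "norm (lambert_term j q w (n, k)) \<le> norm q ^ n * (of_nat (Suc k) ^ j * \<rho> ^ Suc k)"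
proof -
  have "norm (lambert_term j q w (n, k)) = norm q ^ (n * Suc k) * (of_nat (Suc k) ^ j / of_nat (Suc k)) * norm (q * exp w) ^ Suc k"
    unfolding lambert_term_def case_prod_conv
    by (simp only: norm_minus_cancel norm_mult norm_divide norm_power norm_of_nat power_mult_distrib
        exp_of_nat_mult mult_Suc power_add) (simp add: mult_ac)
  also have "\<dots> \<le> norm q ^ n * of_nat (Suc k) ^ j * \<rho> ^ Suc k"
  proof (intro mult_mono power_mono \<rho>)
    show "norm q ^ (n * Suc k) \<le> norm q ^ n"
      using q by (intro power_decreasing) auto
    show "of_nat (Suc k) ^ j / of_nat (Suc k) \<le> real (Suc k) ^ j"
      by (simp add: divide_le_eq mult_le_cancel_left1 mult_left_le)
  qed (use order_trans[OF norm_ge_zero \<rho>] in auto)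
  finally show ?thesis by (simp add: mult_ac)
qed

context
  fixes q :: complex
  assumes q: "norm q < 1" "q \<noteq> 0"
begin

lemma summable_lambert_bound:
  assumes "0 < \<rho>" "\<rho> < 1"
  shows "(\<lambda>(n, k). norm q ^ n * (of_nat (Suc k) ^ j * \<rho> ^ Suc k)) summable_on (UNIV :: (nat \<times> nat) set)"
proof (rule summable_on_times_nonneg)
  show "(\<lambda>n. norm q ^ n) summable_on UNIV"
    using q by (subst summable_on_UNIV_nonneg_real_iff) (auto intro: summable_geometric)
  show "(\<lambda>k. of_nat (Suc k) ^ j * \<rho> ^ Suc k) summable_on UNIV"
    using assms summable_Suc_iff[of "\<lambda>k. of_nat k ^ j * \<rho> ^ k"] summable_power_times_geometric[OF assms, of j]
    by (subst summable_on_UNIV_nonneg_real_iff) auto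
qed (use assms in auto)

lemma lambert_has_sum:
  assumes "norm (q * exp w) < 1"
  shows "(lambert_term j q w has_sum lambert j q w) UNIV"
proof -
  have \<rho>: "0 < norm (q * exp w)" using q by simp
  have s: "(\<lambda>z. norm (lambert_term j q w z)) summable_on UNIV"
    by (rule summable_on_comparison_test[OF summable_lambert_bound[OF \<rho> assms, of j]])
      (use norm_lambert_term_le[OF q(1) order.refl, where j = j and w = w] in auto)
  show ?thesis unfolding lambert_def by (rule has_sum_infsum[OF abs_summable_summable[OF s]])
qed

lemma lambert_deriv:
  assumes "norm (q * exp w) < 1"
  shows "(lambert j q has_field_derivative lambert (Suc j) q w) (at w)"
proof -
  define \<rho> where "\<rho> = (1 + norm (q * exp w)) / 2"
  have \<rho>: "0 < \<rho>" "\<rho> < 1" "norm (q * exp w) < \<rho>" using assms by (simp_all add: \<rho>_def add_pos_nonneg)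
  have "open {z. norm (q * exp z) < \<rho>}" by (intro open_Collect_less continuous_intros)
  then obtain r where r: "r > 0" "cball w r \<subseteq> {z. norm (q * exp z) < \<rho>}"
    using \<rho>(3) by (metis (mono_tags, lifting) mem_Collect_eq open_contains_cball)
  obtain D where D: "(lambert j q has_field_derivative D) (at w)" "(lambert_term (Suc j) q w has_sum D) UNIV"
  proof (rule has_sum_has_field_derivative[OF r(1)])
    show "norm (lambert_term j q z i) \<le> (\<lambda>(n, k). norm q ^ n * (of_nat (Suc k) ^ j * \<rho> ^ Suc k)) i" if "z \<in> cball w r" for i z
    proof -
      have "norm (q * exp z) \<le> \<rho>" using r(2) that by (auto intro: less_imp_le)
      from norm_lambert_term_le[OF q(1) this, where j = j] show ?thesis by (cases i) simp
    qed
    show "((\<lambda>i. lambert_term j q z i) has_sum lambert j q z) UNIV" if "z \<in> cball w r" for z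
      using r(2) that \<rho>(2) by (intro lambert_has_sum) auto
    show "((\<lambda>z. lambert_term j q z i) has_field_derivative lambert_term (Suc j) q z i) (at z)" for i z
    proof (cases i)
      case (Pair n k)
      define c where "c = complex_of_nat (Suc k)"
      have "c \<noteq> 0" unfolding c_def by (rule of_nat_neq_0)
      thus ?thesis unfolding Pair lambert_term_def case_prod_conv c_def[symmetric]
        by (auto intro!: derivative_eq_intros)
    qed
  qed (use summable_lambert_bound[OF \<rho>(1,2), of j] in auto)
  thus ?thesis using has_sum_unique[OF D(2) lambert_has_sum[OF assms]] by simp
qed

text \<open>Summed over \<open>k\<close> first, the double series gives the logarithms
  \<open>Ln (1 - y n)\<close> of the factors; absolute summability permits this order.\<close>

lemma qpoch_eq_exp_lambert:
  assumes w: "norm (q * exp w) < 1"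
  shows "qpoch (q * exp w) q = exp (lambert 0 q w)"
proof -
  define y where "y n = q * exp w * q ^ n" for n
  have y: "norm (y n) < 1" for n
  proof -
    have "norm (y n) = norm (q * exp w) * norm q ^ n" by (simp only: y_def norm_mult norm_power)
    also have "\<dots> \<le> norm (q * exp w) * 1" using q by (intro mult_left_mono power_le_one) auto
    finally show ?thesis using w by simp
  qed
  have "((\<lambda>n. Ln (1 - y n)) has_sum lambert 0 q w) UNIV"
  proof -
    have "((\<lambda>k. lambert_term 0 q w (n, k)) has_sum Ln (1 - y n)) UNIV" for n
    proof (rule norm_summable_imp_has_sum)
      have lt: "lambert_term 0 q w (n, k) = - (y n ^ Suc k) / of_nat (Suc k)" for k
        unfolding lambert_term_def case_prod_conv y_def
        by (simp only: power_mult power_mult_distrib exp_of_nat_mult power_0) (simp add: mult_ac power_mult_distrib)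
      have "(\<lambda>k. - (y n ^ k) / of_nat k) sums Ln (1 - y n)"
        using Ln_series'[of "- y n"] y by simp
      hence "(\<lambda>k. - (y n ^ Suc k) / of_nat (Suc k)) sums Ln (1 - y n)"
        by (subst sums_Suc_iff) simp
      thus "(\<lambda>k. lambert_term 0 q w (n, k)) sums Ln (1 - y n)" unfolding lt .
      have "norm (lambert_term 0 q w (n, k)) \<le> norm (y n) ^ Suc k" for k
      proof -
        have "a / real (Suc k) \<le> a" if "a \<ge> 0" for a using that by (simp add: field_simps)
        thus ?thesis unfolding lt by (simp only: norm_divide norm_minus_cancel norm_power norm_of_nat) simp
      qed
      moreover have "summable (\<lambda>k. norm (y n) ^ Suc k)"
        using summable_geometric[of "norm (y n)"] y[of n] by (subst summable_Suc_iff) simp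
      ultimately show "summable (\<lambda>k. norm (lambert_term 0 q w (n, k)))"
        by (intro summable_comparison_test[OF _ \<open>summable (\<lambda>k. norm (y n) ^ Suc k)\<close>] exI[of _ 0]) simp
    qed
    thus ?thesis
      by (rule has_sum_SigmaD[where f = "lambert_term 0 q w" and B = "\<lambda>_. UNIV", rotated])
        (use lambert_has_sum[OF w, of 0] in simp)
  qed
  hence "(\<lambda>n. Ln (1 - y n)) sums lambert 0 q w" by (rule has_sum_imp_sums)
  hence "(\<lambda>m. exp (\<Sum>n<m. Ln (1 - y n))) \<longlonglongrightarrow> exp (lambert 0 q w)"
    unfolding sums_def by (rule tendsto_exp)
  moreover have "exp (\<Sum>n<m. Ln (1 - y n)) = (\<Prod>n<m. 1 - q * exp w * q ^ n)" for m
  proof -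
    have "1 - y n \<noteq> 0" for n using y[of n] by auto
    thus ?thesis by (simp add: exp_sum) (simp add: y_def)
  qed
  ultimately show ?thesis
    using LIMSEQ_unique[OF qpoch_LIMSEQ[OF q(1), of "q * exp w"]] by simp
qed

text \<open>\<open>R\<close> is the even cofactor of \<open>- 2 * sinh v\<close> in the theta
  function, and for \<open>j \<ge> 1\<close> the function \<open>S j\<close> is the
  \<open>j\<close>-th derivative of its logarithm. On the open set \<open>U\<close> both Lambert
  series converge.\<close>

private definition R where "R v = eul q * exp (lambert 0 q (2 * v)) * exp (lambert 0 q (- 2 * v))"
private definition S where "S j v = 2 ^ j * (lambert j q (2 * v) + (- 1) ^ j * lambert j q (- 2 * v))"
private definition U where "U = {v. norm (q * exp (2 * v)) < 1} \<inter> {v. norm (q * exp (- 2 * v)) < 1}"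

private definition "S1 = S 1"
private definition "S2 = S 2"
private definition "S3 = S 3"
private definition "S4 = S 4"
private definition "S5 = S 5"

private lemma open_U: "open U"
  unfolding U_def by (intro open_Int open_Collect_less continuous_intros)

private lemma zero_in_U: "0 \<in> U" using q by (simp add: U_def)

private lemma S_deriv: "v \<in> U \<Longrightarrow> (S j has_field_derivative S (Suc j) v) (at v)"
proof -
  assume v: "v \<in> U"
  have 1: "((\<lambda>v. lambert j q (2 * v)) has_field_derivative lambert (Suc j) q (2 * v) * 2) (at v)"
    using v by (intro DERIV_chain2[OF lambert_deriv]) (auto simp: U_def intro!: derivative_eq_intros)
  have 2: "((\<lambda>v. lambert j q (- 2 * v)) has_field_derivative lambert (Suc j) q (- 2 * v) * (- 2)) (at v)"
    using v by (intro DERIV_chain2[OF lambert_deriv]) (auto simp: U_def intro!: derivative_eq_intros)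
  show ?thesis unfolding S_def[abs_def]
    by (rule derivative_eq_intros 1 2 refl)+ (simp add: algebra_simps)
qed

private lemma R_deriv: "v \<in> U \<Longrightarrow> (R has_field_derivative R v * S1 v) (at v)"
proof -
  assume v: "v \<in> U"
  have 1: "((\<lambda>v. lambert 0 q (2 * v)) has_field_derivative lambert (Suc 0) q (2 * v) * 2) (at v)"
    using v by (intro DERIV_chain2[OF lambert_deriv]) (auto simp: U_def intro!: derivative_eq_intros)
  have 2: "((\<lambda>v. lambert 0 q (- 2 * v)) has_field_derivative lambert (Suc 0) q (- 2 * v) * (- 2)) (at v)"
    using v by (intro DERIV_chain2[OF lambert_deriv]) (auto simp: U_def intro!: derivative_eq_intros)
  show ?thesis unfolding R_def[abs_def] S_def S1_def
    by (rule derivative_eq_intros 1 2 refl)+ (simp add: algebra_simps)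
qed

private lemma theta_0: "v \<in> U \<Longrightarrow> theta_d 0 q v = - 2 * R v * (1 * sinh v + 0 * cosh v)"
  by (simp add: theta_d_product[OF q] R_def U_def qpoch_eq_exp_lambert)

text \<open>Because \<open>R' = R * S1\<close>, differentiation preserves the shape
  \<open>R * (A * sinh + B * cosh)\<close>. Higher derivatives of the theta function thus reduce to
  updating the pair \<open>(A, B)\<close>.\<close>

private lemma theta_step:
  assumes "\<And>v. v \<in> U \<Longrightarrow> theta_d j q v = - 2 * R v * (A v * sinh v + B v * cosh v)"
    and "\<And>v. v \<in> U \<Longrightarrow> (A has_field_derivative A' v) (at v)"
    and "\<And>v. v \<in> U \<Longrightarrow> (B has_field_derivative B' v) (at v)"
    and v: "v \<in> U"
    and "A' v + A v * S1 v + B v = A2" and "B' v + B v * S1 v + A v = B2"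
  shows "theta_d (Suc j) q v = - 2 * R v * (A2 * sinh v + B2 * cosh v)"
proof -
  have "((\<lambda>v. - 2 * R v * (A v * sinh v + B v * cosh v)) has_field_derivative
      (- 2 * R v * ((A' v + A v * S1 v + B v) * sinh v + (B' v + B v * S1 v + A v) * cosh v))) (at v)"
    by (rule derivative_eq_intros R_deriv[OF v] assms(2)[OF v] assms(3)[OF v] refl)+ (simp add: algebra_simps)
  hence "(theta_d j q has_field_derivative
      (- 2 * R v * ((A' v + A v * S1 v + B v) * sinh v + (B' v + B v * S1 v + A v) * cosh v))) (at v)"
    by (rule has_field_derivative_transform_within_open[OF _ open_U v]) (simp add: assms(1))
  from DERIV_unique[OF theta_d_deriv[OF q] this] show ?thesis using assms(5,6) by simp
qed

private lemma theta_1: "v \<in> U \<Longrightarrow> theta_d 1 q v = - 2 * R v * (S1 v * sinh v + 1 * cosh v)"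
  unfolding One_nat_def
  by (rule theta_step[OF theta_0, where A' = "\<lambda>_. 0" and B' = "\<lambda>_. 0"]) (auto intro!: derivative_eq_intros)

private lemma S_derivs:
  assumes "v \<in> U"
  shows "(S1 has_field_derivative S2 v) (at v)" "(S2 has_field_derivative S3 v) (at v)"
    "(S3 has_field_derivative S4 v) (at v)" "(S4 has_field_derivative S5 v) (at v)"
  using S_deriv[OF assms, of 1] S_deriv[OF assms, of 2] S_deriv[OF assms, of 3] S_deriv[OF assms, of 4]
  by (simp_all add: S1_def S2_def S3_def S4_def S5_def eval_nat_numeral)

private lemma theta_2: "v \<in> U \<Longrightarrow> theta_d 2 q v = - 2 * R v * ((S2 v + S1 v ^ 2 + 1) * sinh v + (2 * S1 v) * cosh v)"
proof -
  assume v: "v \<in> U"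
  have "theta_d (Suc 1) q v = - 2 * R v * ((S2 v + S1 v ^ 2 + 1) * sinh v + (2 * S1 v) * cosh v)"
    by (rule theta_step[OF theta_1, where A' = S2 and B' = "\<lambda>_. 0"])
      (auto intro!: derivative_eq_intros S_derivs v simp: power2_eq_square)
  thus ?thesis by (simp add: eval_nat_numeral)
qed

private lemma theta_3: "v \<in> U \<Longrightarrow> theta_d 3 q v = - 2 * R v *
    ((S3 v + 3 * S1 v * S2 v + S1 v ^ 3 + 3 * S1 v) * sinh v + (3 * S2 v + 3 * S1 v ^ 2 + 1) * cosh v)"
proof -
  assume v: "v \<in> U"
  have "theta_d (Suc 2) q v = - 2 * R v *
    ((S3 v + 3 * S1 v * S2 v + S1 v ^ 3 + 3 * S1 v) * sinh v + (3 * S2 v + 3 * S1 v ^ 2 + 1) * cosh v)"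
    by (rule theta_step[OF theta_2, where A' = "\<lambda>v. S3 v + 2 * S1 v * S2 v" and B' = "\<lambda>v. 2 * S2 v"])
      (auto intro!: derivative_eq_intros S_derivs v simp: algebra_simps power2_eq_square power3_eq_cube)
  thus ?thesis by (simp add: eval_nat_numeral)
qed

private lemma theta_4: "v \<in> U \<Longrightarrow> theta_d 4 q v = - 2 * R v *
    ((S4 v + 3 * S2 v ^ 2 + 4 * S1 v * S3 v + 6 * S1 v ^ 2 * S2 v + S1 v ^ 4 + 6 * S2 v + 6 * S1 v ^ 2 + 1) * sinh v
     + (4 * S3 v + 12 * S1 v * S2 v + 4 * S1 v ^ 3 + 4 * S1 v) * cosh v)"
proof -
  assume v: "v \<in> U"
  have "theta_d (Suc 3) q v = - 2 * R v *
    ((S4 v + 3 * S2 v ^ 2 + 4 * S1 v * S3 v + 6 * S1 v ^ 2 * S2 v + S1 v ^ 4 + 6 * S2 v + 6 * S1 v ^ 2 + 1) * sinh v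
     + (4 * S3 v + 12 * S1 v * S2 v + 4 * S1 v ^ 3 + 4 * S1 v) * cosh v)"
    by (rule theta_step[OF theta_3, where A' = "\<lambda>v. S4 v + 3 * S2 v ^ 2 + 3 * S1 v * S3 v + 3 * S1 v ^ 2 * S2 v + 3 * S2 v"
          and B' = "\<lambda>v. 3 * S3 v + 6 * S1 v * S2 v"])
      (auto intro!: derivative_eq_intros S_derivs v simp: algebra_simps eval_nat_numeral)
  thus ?thesis by (simp add: eval_nat_numeral)
qed

private lemma S_odd_0: "S1 0 = 0" "S3 0 = 0"
  by (simp_all add: S_def S1_def S3_def)

private lemma R_0: "R 0 = eul q ^ 3"
  using qpoch_eq_exp_lambert[of 0] q by (simp add: R_def power3_eq_cube flip: eul_def)

text \<open>At \<open>v = 0\<close> only the coefficient of \<open>cosh\<close> survives, and the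
  odd derivatives \<open>S1\<close> and \<open>S3\<close> vanish by symmetry; a polynomial in
  \<open>S2\<close> and \<open>S4\<close> is left.\<close>

theorem theta_d_values:
  "theta_d 1 q 0 = - 2 * eul q ^ 3"
  "theta_d 3 q 0 = - 2 * eul q ^ 3 * (1 + 24 * lambert 2 q 0)"
  "theta_d 5 q 0 = - 2 * eul q ^ 3 * (1 + 80 * lambert 2 q 0 + 960 * lambert 2 q 0 ^ 2 + 160 * lambert 4 q 0)"
proof -
  have S2: "S2 0 = 8 * lambert 2 q 0" and S4: "S4 0 = 32 * lambert 4 q 0" by (simp_all add: S_def S2_def S4_def)
  show "theta_d 1 q 0 = - 2 * eul q ^ 3"
    using theta_1[OF zero_in_U] by (simp add: R_0)
  show "theta_d 3 q 0 = - 2 * eul q ^ 3 * (1 + 24 * lambert 2 q 0)"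
    using theta_3[OF zero_in_U] by (simp add: R_0 S_odd_0 S2)
  \<comment> \<open>The first summand stands for the \<open>sinh\<close> part, which vanishes at 0
    whatever its coefficient is; the second is the \<open>cosh\<close> coefficient at 0.\<close>
  have "theta_d (Suc 4) q 0 = - 2 * R 0 * ((0 :: complex) * sinh 0 + 0 * cosh 0) - 2 * R 0 * (5 * S4 0 + 15 * S2 0 ^ 2 + 10 * S2 0 + 1)"
  proof -
    let ?A = "\<lambda>v. S4 v + 3 * S2 v ^ 2 + 4 * S1 v * S3 v + 6 * S1 v ^ 2 * S2 v + S1 v ^ 4 + 6 * S2 v + 6 * S1 v ^ 2 + 1"
    let ?B = "\<lambda>v. 4 * S3 v + 12 * S1 v * S2 v + 4 * S1 v ^ 3 + 4 * S1 v"
    have B: "(?B has_field_derivative 4 * S4 v + 12 * (S2 v * S2 v + S1 v * S3 v) + 12 * S1 v ^ 2 * S2 v + 4 * S2 v) (at v)" if "v \<in> U" for v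
      by (auto intro!: derivative_eq_intros S_derivs that simp: algebra_simps eval_nat_numeral)
    have A: "(?A has_field_derivative S5 v + 6 * S2 v * S3 v + 4 * (S2 v * S3 v + S1 v * S4 v) +
        6 * (2 * S1 v * S2 v * S2 v + S1 v ^ 2 * S3 v) + 4 * S1 v ^ 3 * S2 v + 6 * S3 v + 12 * S1 v * S2 v) (at v)" if "v \<in> U" for v
      by (auto intro!: derivative_eq_intros S_derivs that simp: algebra_simps eval_nat_numeral)
    have "theta_d (Suc 4) q 0 = - 2 * R 0 * ((S5 0 + 10 * S2 0 * S3 0 + 6 * S3 0) * sinh 0 + (5 * S4 0 + 15 * S2 0 ^ 2 + 10 * S2 0 + 1) * cosh 0)"
      by (rule theta_step[OF theta_4 A B zero_in_U]) (auto simp: S_odd_0 algebra_simps power2_eq_square)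
    thus ?thesis by simp
  qed
  moreover have "Suc 4 = 5" by simp
  ultimately show "theta_d 5 q 0 = - 2 * eul q ^ 3 * (1 + 80 * lambert 2 q 0 + 960 * lambert 2 q 0 ^ 2 + 160 * lambert 4 q 0)"
    by (simp add: R_0 S2 S4 power2_eq_square algebra_simps)
qed

end

section \<open>Ramanujan's equation and the four-square identity\<close>

definition dlog_eul :: "complex \<Rightarrow> complex" where
  "dlog_eul q = q * deriv eul q / eul q"

text \<open>The Eisenstein series of weight 2 as 24 times the logarithmic derivative of eta. In this
  form it is visibly holomorphic at \<open>q = 0\<close>.\<close>

definition euler_P :: "complex \<Rightarrow> complex" where
  "euler_P q = 1 + 24 * dlog_eul q"

text \<open>The minus sign compensates the one in \<open>lambert_term\<close>: the usual coefficient
  of the divisor sums is +240.\<close>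

definition euler_E4 :: "complex \<Rightarrow> complex" where
  "euler_E4 q = 1 - 240 * lambert 4 q 0"

lemma eul_has_field_derivative:
  assumes "norm q < 1"
  shows "(eul has_field_derivative deriv eul q) (at q)"
  using holomorphic_derivI[OF holomorphic_eul open_ball, of q] assms by simp

lemma eul_pow_has_field_derivative:
  assumes "norm q < 1" "q \<noteq> 0" "k > 0"
  shows "((\<lambda>q. eul (q ^ k)) has_field_derivative eul (q ^ k) * (of_nat k * dlog_eul (q ^ k)) / q) (at q)"
proof -
  have "((\<lambda>q. eul (q ^ k)) has_field_derivative deriv eul (q ^ k) * (of_nat k * q ^ (k - 1))) (at q)"
    using norm_power_lt_1[OF assms(1,3)]
    by (intro DERIV_chain2[OF eul_has_field_derivative]) (auto intro!: derivative_eq_intros)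
  moreover have "q ^ k = q * q ^ (k - 1)" using assms by (metis power_eq_if not_gr0)
  ultimately show ?thesis
    using assms eul_pow_nonzero[OF assms(1,3)] by (simp add: dlog_eul_def field_simps)
qed

lemma holomorphic_dlog_eul: "dlog_eul holomorphic_on ball 0 1"
  unfolding dlog_eul_def[abs_def]
  by (intro holomorphic_intros holomorphic_eul holomorphic_deriv) (auto simp: eul_nonzero)

lemma holomorphic_euler_P: "euler_P holomorphic_on ball 0 1"
  unfolding euler_P_def[abs_def] by (intro holomorphic_intros holomorphic_dlog_eul)

lemma euler_P_has_field_derivative:
  assumes "norm q < 1"
  shows "(euler_P has_field_derivative deriv euler_P q) (at q)"
  using holomorphic_derivI[OF holomorphic_euler_P open_ball, of q] assms by simp

text \<open>The heat equation is used twice. Applied to the first derivative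
  \<open>- 2 * eul q ^ 3\<close> it gives the third as \<open>euler_P\<close> times this value;
  applied to the third it expresses the fifth through \<open>q dP/dq\<close>. Comparison with the
  values read off from the product brings in the Lambert series.\<close>

theorem ramanujan_P:
  assumes q: "norm q < 1" "q \<noteq> 0"
  shows "12 * (q * deriv euler_P q) = euler_P q ^ 2 - euler_E4 q"
proof -
  have op: "open (ball 0 1 - {0 :: complex})" by auto
  have mem: "q \<in> ball 0 1 - {0}" using q by simp
  note d = eul_has_field_derivative[OF q(1)]
  have nz: "eul q \<noteq> 0" using q by (simp add: eul_nonzero)
  have dP: "24 * (q * deriv eul q) = eul q * (euler_P q - 1)"
    using nz by (simp add: euler_P_def dlog_eul_def)
  have M3: "theta_d 3 z 0 = - 2 * eul z ^ 3 * euler_P z" if z: "norm z < 1" "z \<noteq> 0" for z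
  proof -
    obtain D where D: "((\<lambda>q. theta_d 1 q 0) has_field_derivative D) (at z)" "8 * (z * D) = theta_d 3 z 0 - theta_d 1 z 0"
      using theta_d_heat[OF z, of 1] by (auto simp: numeral_3_eq_3)
    have "((\<lambda>q. - 2 * eul q ^ 3) has_field_derivative - 2 * (3 * eul z ^ 2 * deriv eul z)) (at z)"
      using eul_has_field_derivative[OF z(1)] by (auto intro!: derivative_eq_intros)
    hence "((\<lambda>q. theta_d 1 q 0) has_field_derivative - 2 * (3 * eul z ^ 2 * deriv eul z)) (at z)"
      by (rule has_field_derivative_transform_within_open[OF _ op]) (use z in \<open>auto simp: theta_d_values(1)[unfolded One_nat_def]\<close>)
    hence "D = - 2 * (3 * eul z ^ 2 * deriv eul z)" using D(1) DERIV_unique by blast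
    hence "theta_d 3 z 0 = - 2 * eul z ^ 3 - 48 * eul z ^ 2 * (z * deriv eul z)"
      using D(2) theta_d_values(1)[OF z] by (simp add: algebra_simps)
    moreover have "24 * (z * deriv eul z) = eul z * (euler_P z - 1)"
      using z by (simp add: euler_P_def dlog_eul_def eul_nonzero)
    ultimately show ?thesis by algebra
  qed
  obtain D where D: "((\<lambda>q. theta_d 3 q 0) has_field_derivative D) (at q)" "8 * (q * D) = theta_d 5 q 0 - theta_d 3 q 0"
    using theta_d_heat[OF q, of 3] by (auto simp: eval_nat_numeral)
  have "((\<lambda>q. - 2 * eul q ^ 3 * euler_P q) has_field_derivative
      - 2 * (3 * eul q ^ 2 * deriv eul q * euler_P q + eul q ^ 3 * deriv euler_P q)) (at q)"
    using d euler_P_has_field_derivative[OF q(1)] by (auto intro!: derivative_eq_intros simp: algebra_simps)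
  hence "((\<lambda>q. theta_d 3 q 0) has_field_derivative
      - 2 * (3 * eul q ^ 2 * deriv eul q * euler_P q + eul q ^ 3 * deriv euler_P q)) (at q)"
    by (rule has_field_derivative_transform_within_open[OF _ op mem]) (auto simp: M3)
  hence Deq: "D = - 2 * (3 * eul q ^ 2 * deriv eul q * euler_P q + eul q ^ 3 * deriv euler_P q)"
    using D(1) DERIV_unique by blast
  have "8 * (q * D) = - 16 * (3 * eul q ^ 2 * (q * deriv eul q) * euler_P q + eul q ^ 3 * (q * deriv euler_P q))"
    unfolding Deq by (simp add: algebra_simps)
  also have "\<dots> = - 2 * eul q ^ 3 * (euler_P q ^ 2 - euler_P q + 8 * (q * deriv euler_P q))"
    using dP by algebra
  finally have "- 2 * eul q ^ 3 * (euler_P q ^ 2 + 8 * (q * deriv euler_P q)) = theta_d 5 q 0"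
    using D(2) M3[OF q] by algebra
  also have "\<dots> = - 2 * eul q ^ 3 * (1 + 80 * lambert 2 q 0 + 960 * lambert 2 q 0 ^ 2 + 160 * lambert 4 q 0)"
    by (rule theta_d_values(3)[OF q])
  finally have c1: "- 2 * eul q ^ 3 * (euler_P q ^ 2 + 8 * (q * deriv euler_P q)) = - 2 * eul q ^ 3 * (1 + 80 * lambert 2 q 0 + 960 * lambert 2 q 0 ^ 2 + 160 * lambert 4 q 0)" .
  have nz2: "- 2 * eul q ^ 3 \<noteq> 0" using nz by simp
  have 1: "euler_P q ^ 2 + 8 * (q * deriv euler_P q) = 1 + 80 * lambert 2 q 0 + 960 * lambert 2 q 0 ^ 2 + 160 * lambert 4 q 0"
    using c1 mult_left_cancel[OF nz2] by blast
  \<comment> \<open>Two evaluations of the third derivative identify \<open>euler_P\<close> with its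
    Lambert series.\<close>
  have "- 2 * eul q ^ 3 * euler_P q = - 2 * eul q ^ 3 * (1 + 24 * lambert 2 q 0)"
    by (rule trans[OF M3[OF q, symmetric] theta_d_values(2)[OF q]])
  hence 2: "euler_P q = 1 + 24 * lambert 2 q 0"
    using mult_left_cancel[OF nz2] by blast
  have 3: "euler_E4 q = 1 - 240 * lambert 4 q 0" by (simp add: euler_E4_def)
  have "8 * (12 * (q * deriv euler_P q)) = 8 * (euler_P q ^ 2 - euler_E4 q)" using 1 2 3 by algebra
  thus ?thesis by (simp only: mult_cancel_left) simp
qed

text \<open>Jacobi's identity for the cube of the Euler product; the terms at \<open>n\<close> and
  \<open>1 - n\<close> coincide, hence the factor 2.\<close>

lemma eul_cube_sum:
  assumes q: "norm q < 1" "q \<noteq> 0"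
  shows "((\<lambda>n. (- 1) powi n * of_int (2 * n - 1) * q powi (n * (n - 1) div 2)) has_sum (- 2 * eul q ^ 3)) UNIV"
proof -
  have "theta_term 1 q 0 = (\<lambda>n. (- 1) powi n * of_int (2 * n - 1) * q powi (n * (n - 1) div 2))"
    by (auto simp: theta_term_def mult_ac)
  thus ?thesis using theta_d_has_sum[OF q, of 1 0] theta_d_values(1)[OF q] by simp
qed

text \<open>Jacobi's four-square theorem: the left side is \<open>\<phi>(-q)^4\<close>. The sixth
  power of \<open>eul q\<close>, as the square of Jacobi's series, is a double sum with weight
  \<open>(2m - 1)(2n - 1)\<close>. Split by the parity of \<open>m + n\<close>, both halves equal
  one combination \<open>W\<close> of \<open>\<Phi>\<close>, \<open>\<Psi>\<close> and their
  derivatives, and these are eta quotients with known logarithmic derivatives.\<close>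

theorem phi_minus_fourth_power:
  assumes q: "norm q < 1" "q \<noteq> 0"
  shows "eul q ^ 8 / eul (q ^ 2) ^ 4 = 1 + 8 * dlog_eul q - 48 * dlog_eul (q ^ 2) + 64 * dlog_eul (q ^ 4)"
proof -
  have op: "open (ball 0 1 - {0 :: complex})" by auto
  have mem: "q \<in> ball 0 1 - {0}" using q by simp
  define \<Psi> where "\<Psi> z = 2 * eul (z ^ 4) ^ 2 / eul (z ^ 2)" for z
  define \<Phi> where "\<Phi> z = eul (z ^ 2) ^ 5 / (eul z ^ 2 * eul (z ^ 4) ^ 2)" for z
  have nz: "eul q \<noteq> 0" "eul (q ^ 2) \<noteq> 0" "eul (q ^ 4) \<noteq> 0" using q by simp_all
  have d1: "(eul has_field_derivative eul q * dlog_eul q / q) (at q)"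
    using eul_pow_has_field_derivative[OF q, of 1] by simp
  have d2: "((\<lambda>q. eul (q ^ 2)) has_field_derivative eul (q ^ 2) * (2 * dlog_eul (q ^ 2)) / q) (at q)"
    using eul_pow_has_field_derivative[OF q, of 2] by simp
  have d4: "((\<lambda>q. eul (q ^ 4)) has_field_derivative eul (q ^ 4) * (4 * dlog_eul (q ^ 4)) / q) (at q)"
    using eul_pow_has_field_derivative[OF q, of 4] by simp
  obtain D\<Psi> where D\<Psi>: "(\<Psi> has_field_derivative D\<Psi>) (at q)"
    "((\<lambda>n. 1 * of_int (n * (n - 1)) * q powi (n * (n - 1))) has_sum (q * D\<Psi>)) UNIV"
  proof (rule has_sum_powi_derivative[where c = "\<lambda>_. 1" and e = "\<lambda>n. n * (n - 1)" and F = \<Psi> and I = UNIV])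
    show "n * (n - 1) \<ge> 0" for n :: int by (cases "n \<le> 0") (auto simp: mult_nonpos_nonpos)
    show "((\<lambda>n. 1 * z powi (n * (n - 1))) has_sum \<Psi> z) UNIV" if "norm z < 1" "z \<noteq> 0" for z
    proof -
      have "(z ^ 2) powi (n * (n - 1) div 2) = z powi (n * (n - 1))" for n :: int
        by (simp add: powi_pow[OF that])
      thus ?thesis using psi_sum[of "z ^ 2"] that by (simp add: \<Psi>_def norm_power_lt_1 flip: power_mult)
    qed
  qed (use q in auto)
  obtain D\<Phi> where D\<Phi>: "(\<Phi> has_field_derivative D\<Phi>) (at q)"
    "((\<lambda>n. 1 * of_int (n * n) * q powi (n * n)) has_sum (q * D\<Phi>)) UNIV"
  proof (rule has_sum_powi_derivative[where c = "\<lambda>_. 1" and e = "\<lambda>n. n * n" and F = \<Phi> and I = UNIV])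
    show "((\<lambda>n. 1 * z powi (n * n)) has_sum \<Phi> z) UNIV" if "norm z < 1" "z \<noteq> 0" for z
      using phi_plus[OF that] by (simp add: \<Phi>_def)
  qed (use q in auto)
  have "(\<Psi> has_field_derivative \<Psi> q * (8 * dlog_eul (q ^ 4) - 2 * dlog_eul (q ^ 2)) / q) (at q)"
    unfolding \<Psi>_def
    by (rule derivative_eq_intros d2 d4 refl nz)+ (use nz q in \<open>simp add: field_simps power2_eq_square\<close>)
  hence \<Psi>': "q * D\<Psi> = \<Psi> q * (8 * dlog_eul (q ^ 4) - 2 * dlog_eul (q ^ 2))"
    using DERIV_unique[OF D\<Psi>(1)] q by simp
  have "(\<Phi> has_field_derivative \<Phi> q * (10 * dlog_eul (q ^ 2) - 2 * dlog_eul q - 8 * dlog_eul (q ^ 4)) / q) (at q)"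
    unfolding \<Phi>_def
    by (rule derivative_eq_intros d1 d2 d4 refl nz)+ (use nz q in \<open>simp_all add: field_simps eval_nat_numeral\<close>)
  hence \<Phi>': "q * D\<Phi> = \<Phi> q * (10 * dlog_eul (q ^ 2) - 2 * dlog_eul q - 8 * dlog_eul (q ^ 4))"
    using DERIV_unique[OF D\<Phi>(1)] q by simp
  have \<Psi>s: "((\<lambda>n. q powi (n * (n - 1))) has_sum \<Psi> q) UNIV"
  proof -
    have "(q ^ 2) powi (n * (n - 1) div 2) = q powi (n * (n - 1))" for n :: int
      by (simp add: powi_pow[OF q])
    thus ?thesis using psi_sum[of "q ^ 2"] q by (simp add: \<Psi>_def norm_power_lt_1 flip: power_mult)
  qed
  have \<Phi>s: "((\<lambda>n. q powi (n * n)) has_sum \<Phi> q) UNIV" using phi_plus[OF q] by (simp add: \<Phi>_def)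
  \<comment> \<open>As \<open>4 i (i - 1) + 1 = (2i - 1)^2\<close>, the weight of \<open>W\<close>
    is \<open>(2i - 1)^2 - 4 k^2\<close>, which is \<open>(2m - 1)(2n - 1)\<close> for
    \<open>m = i + k\<close> and \<open>n = i - k\<close>.\<close>
  define W where "W = (4 * (q * D\<Psi>) + \<Psi> q) * \<Phi> q - 4 * (\<Psi> q * (q * D\<Phi>))"
  define g where "g = (\<lambda>(i, k). of_int ((2 * i - 1) ^ 2 - 4 * k ^ 2) * q powi (i * (i - 1) + k * k))"
  have g: "(g has_sum W) UNIV"
  proof -
    have 1: "((\<lambda>n. 4 * (of_int (n * (n - 1)) * q powi (n * (n - 1))) + q powi (n * (n - 1))) has_sum (4 * (q * D\<Psi>) + \<Psi> q)) UNIV"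
      using has_sum_add[OF has_sum_cmult_right[OF D\<Psi>(2), of 4] \<Psi>s] by (simp only: mult_1)
    have "((\<lambda>z. (\<lambda>(i, k). (4 * (of_int (i * (i - 1)) * q powi (i * (i - 1))) + q powi (i * (i - 1))) * q powi (k * k)) z +
        - (4 * (\<lambda>(i, k). q powi (i * (i - 1)) * (1 * of_int (k * k) * q powi (k * k))) z))
       has_sum ((4 * (q * D\<Psi>) + \<Psi> q) * \<Phi> q + - (4 * (\<Psi> q * (q * D\<Phi>))))) UNIV"
      by (intro has_sum_add has_sum_uminusI has_sum_cmult_right has_sum_times 1 \<Psi>s \<Phi>s D\<Phi>(2))
    also have "(\<lambda>z. (\<lambda>(i, k). (4 * (of_int (i * (i - 1)) * q powi (i * (i - 1))) + q powi (i * (i - 1))) * q powi (k * k)) z +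
        - (4 * (\<lambda>(i, k). q powi (i * (i - 1)) * (1 * of_int (k * k) * q powi (k * k))) z)) = g"
    proof
      fix z :: "int \<times> int"
      obtain i k where z: "z = (i, k)" by (cases z)
      have "q powi (i * (i - 1) + k * k) = q powi (i * (i - 1)) * q powi (k * k)"
        using q by (simp add: power_int_add)
      moreover have "(4 * (of_int (i * (i - 1)) * A) + A) * B + - (4 * (A * (1 * of_int (k * k) * B)))
          = of_int ((2 * i - 1) ^ 2 - 4 * k ^ 2) * (A * B)" for A B :: complex
        by (simp add: power2_eq_square algebra_simps)
      ultimately show "(\<lambda>(i, k). (4 * (of_int (i * (i - 1)) * q powi (i * (i - 1))) + q powi (i * (i - 1))) * q powi (k * k)) z +
        - (4 * (\<lambda>(i, k). q powi (i * (i - 1)) * (1 * of_int (k * k) * q powi (k * k))) z) = g z"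
        unfolding g_def z by (simp only: case_prod_conv)
    qed
    finally show ?thesis by (simp add: W_def)
  qed
  define f where "f = (\<lambda>(m, n). ((- 1) powi m * of_int (2 * m - 1) * q powi (m * (m - 1) div 2)) *
    ((- 1) powi n * of_int (2 * n - 1) * q powi (n * (n - 1) div 2)))"
  have f: "(f has_sum (4 * eul q ^ 6)) UNIV"
    using has_sum_times[OF eul_cube_sum[OF q] eul_cube_sum[OF q]] by (simp add: f_def flip: power_add)
  have f_eq: "f (m, n) = (- 1) powi (m + n) * of_int ((2 * m - 1) * (2 * n - 1)) * q powi k"
    if "m * (m - 1) + n * (n - 1) = 2 * k" for m n k
  proof -
    have "even (m * (m - 1))" "even (n * (n - 1))" by simp_all
    then obtain i j where ij: "m * (m - 1) = 2 * i" "n * (n - 1) = 2 * j" by (elim evenE)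
    with that have "k = i + j" by simp
    thus ?thesis using q ij by (simp add: f_def power_int_add)
  qed
  have "(f has_sum W) {(m, n). even (m + n)}"
  proof -
    have "bij_betw (\<lambda>(i, k). (i + k, i - k)) UNIV {(m, n). even (m + n :: int)}"
    proof (rule bij_betw_byWitness[where f' = "\<lambda>(m, n). ((m + n) div 2, (m - n) div 2)"])
      have "(m + n) div 2 + (m - n) div 2 = m \<and> (m + n) div 2 - (m - n) div 2 = n" if mn: "even (m + n)" for m n :: int
      proof -
        obtain t where "m + n = 2 * t" using mn by blast
        hence "m = 2 * t - n" by simp
        hence "m + n = 2 * t" "m - n = 2 * (t - n)" by simp_all
        hence "(m + n) div 2 = t" "(m - n) div 2 = t - n" by (metis nonzero_mult_div_cancel_left zero_neq_numeral)+
        thus ?thesis using \<open>m = 2 * t - n\<close> by simp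
      qed
      thus "\<forall>z\<in>{(m, n). even (m + n :: int)}. (\<lambda>(i, k). (i + k, i - k)) ((\<lambda>(m, n). ((m + n) div 2, (m - n) div 2)) z) = z"
        by (simp add: case_prod_unfold del: even_add)
    qed auto
    moreover have "f (i + k, i - k) = g (i, k)" for i k
    proof -
      have "f (i + k, i - k) = (- 1) powi ((i + k) + (i - k)) * of_int ((2 * (i + k) - 1) * (2 * (i - k) - 1)) * q powi (i * (i - 1) + k * k)"
        by (rule f_eq) (simp add: algebra_simps)
      also have "(2 * (i + k) - 1) * (2 * (i - k) - 1) = (2 * i - 1) ^ 2 - 4 * k ^ 2" by (simp add: power2_eq_square algebra_simps)
      finally show ?thesis by (simp add: g_def)
    qed
    ultimately show ?thesis
      using has_sum_reindex_bij_betw[of "\<lambda>(i, k). (i + k, i - k)" UNIV "{(m, n). even (m + n)}" f W] g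
      by (simp add: case_prod_unfold)
  qed
  moreover have "(f has_sum W) {(m, n). odd (m + n)}"
  proof -
    \<comment> \<open>For odd \<open>m + n\<close> take \<open>m = i + k\<close> and
      \<open>n = k - i + 1\<close>: the weight changes sign, and so does the power of -1.\<close>
    have "bij_betw (\<lambda>(i, k). (i + k, k - i + 1)) UNIV {(m, n). odd (m + n :: int)}"
    proof (rule bij_betw_byWitness[where f' = "\<lambda>(m, n). ((m - n + 1) div 2, (m + n - 1) div 2)"])
      have "(m - n + 1) div 2 + (m + n - 1) div 2 = m \<and> (m + n - 1) div 2 - (m - n + 1) div 2 + 1 = n" if mn: "odd (m + n)" for m n :: int
      proof -
        obtain t where "m + n = 2 * t + 1" using mn by (rule oddE)
        hence "m = 2 * t + 1 - n" by simp
        hence "m + n - 1 = 2 * t" "m - n + 1 = 2 * (t + 1 - n)" by simp_all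
        hence "(m + n - 1) div 2 = t" "(m - n + 1) div 2 = t + 1 - n" by (metis nonzero_mult_div_cancel_left zero_neq_numeral)+
        thus ?thesis using \<open>m = 2 * t + 1 - n\<close> by simp
      qed
      thus "\<forall>z\<in>{(m, n). odd (m + n :: int)}. (\<lambda>(i, k). (i + k, k - i + 1)) ((\<lambda>(m, n). ((m - n + 1) div 2, (m + n - 1) div 2)) z) = z"
        by (simp add: case_prod_unfold del: even_add)
    qed auto
    moreover have "f (i + k, k - i + 1) = g (i, k)" for i k
    proof -
      have "f (i + k, k - i + 1) = (- 1) powi ((i + k) + (k - i + 1)) * of_int ((2 * (i + k) - 1) * (2 * (k - i + 1) - 1)) * q powi (i * (i - 1) + k * k)"
        by (rule f_eq) (simp add: algebra_simps)
      also have "(2 * (i + k) - 1) * (2 * (k - i + 1) - 1) = - ((2 * i - 1) ^ 2 - 4 * k ^ 2)" by (simp add: power2_eq_square algebra_simps)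
      finally show ?thesis by (simp add: g_def)
    qed
    ultimately show ?thesis
      using has_sum_reindex_bij_betw[of "\<lambda>(i, k). (i + k, k - i + 1)" UNIV "{(m, n). odd (m + n)}" f W] g
      by (simp add: case_prod_unfold)
  qed
  ultimately have "(f has_sum (W + W)) ({(m, n). even (m + n)} \<union> {(m, n). odd (m + n)})"
    by (rule has_sum_Un_disjoint) auto
  also have "{(m, n). even (m + n :: int)} \<union> {(m, n). odd (m + n)} = UNIV" by auto
  finally have "4 * eul q ^ 6 = 2 * W" using has_sum_unique[OF f] by simp
  hence "4 * eul q ^ 6 = 2 * (\<Psi> q * \<Phi> q) * (1 + 8 * dlog_eul q - 48 * dlog_eul (q ^ 2) + 64 * dlog_eul (q ^ 4))"
    unfolding W_def \<Psi>' \<Phi>' by (simp add: algebra_simps)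
  also have "\<Psi> q * \<Phi> q = 2 * eul (q ^ 2) ^ 4 / eul q ^ 2"
    using nz by (simp add: \<Psi>_def \<Phi>_def field_simps eval_nat_numeral)
  finally have "4 * (eul q ^ 6 * eul q ^ 2) = 4 * (eul (q ^ 2) ^ 4 * (1 + 8 * dlog_eul q - 48 * dlog_eul (q ^ 2) + 64 * dlog_eul (q ^ 4)))"
    using nz by (simp add: field_simps)
  hence "eul q ^ 6 * eul q ^ 2 = eul (q ^ 2) ^ 4 * (1 + 8 * dlog_eul q - 48 * dlog_eul (q ^ 2) + 64 * dlog_eul (q ^ 4))"
    by (simp only: mult_cancel_left) simp
  thus ?thesis using nz by (simp add: field_simps flip: power_add)
qed

section \<open>The Eisenstein series of weight 4 in level 2\<close>

lemma disc_zero: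
  assumes f: "f holomorphic_on ball 0 1" and r: "r > 0" and z: "\<And>w. norm w < r \<Longrightarrow> f w = 0" and q: "norm q < 1"
  shows "f q = (0 :: complex)"
proof (rule analytic_continuation_open[of "ball 0 (min r 1)" "ball 0 1" f "\<lambda>_. 0"])
  show "ball 0 (min r 1) \<noteq> ({} :: complex set)" using r by auto
qed (use assms in auto)

text \<open>Holomorphic functions on the disc have no zero divisors. This discards those factors of
  a reducible relation that do not vanish at the cusp \<open>q = 0\<close>.\<close>

lemma disc_cancel:
  fixes f g :: "complex \<Rightarrow> complex"
  assumes f: "f holomorphic_on ball 0 1" and g: "g holomorphic_on ball 0 1" and g0: "g 0 \<noteq> 0"
    and fg: "\<And>w. norm w < 1 \<Longrightarrow> f w * g w = 0" and q: "norm q < 1"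
  shows "f q = 0"
proof -
  have "isCont g 0"
    using holomorphic_on_imp_continuous_on[OF g] by (simp add: continuous_on_eq_continuous_at)
  then obtain r where r: "r > 0" "\<And>w. dist w 0 < r \<Longrightarrow> g w \<noteq> 0"
    using continuous_at_avoid[of 0 g 0] g0 by (auto simp: dist_commute)
  show ?thesis
  proof (rule disc_zero[OF f _ _ q])
    show "f w = 0" if "norm w < min r 1" for w using fg[of w] r(2)[of w] that by simp
  qed (use r in auto)
qed

context
  fixes q :: complex
  assumes q: "norm q < 1" "q \<noteq> 0"
begin

text \<open>The product over roots of unity for \<open>p = 2\<close>. It transports identities from
  \<open>q\<close> to \<open>- q\<close> without leaving Euler products.\<close>

lemma eul_minus: "eul (- q) = eul (q ^ 2) ^ 3 / (eul q * eul (q ^ 4))"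
proof -
  have two: "{..<2::nat} = {0, 1}" by auto
  have "(\<Prod>j<2. eul ((- 1) ^ j * q)) * eul (q ^ (2 * 2)) = eul (q ^ 2) ^ (2 + 1)"
  proof (rule prod_eul_roots)
    show "(\<Prod>j<2. 1 - x * ((- 1) ^ j) ^ r) = 1 - x ^ 2" if "r \<in> {1..<2}" for r and x :: complex
    proof -
      have "r = 1" using that by auto
      thus ?thesis by (simp add: two algebra_simps power2_eq_square)
    qed
  qed (use q in \<open>auto simp: power_mult_distrib simp flip: power_mult\<close>)
  thus ?thesis using q by (simp add: two field_simps power3_eq_cube[of "eul x" for x])
qed

lemma phi_dissection_2': "eul (q ^ 2) ^ 5 / (eul q ^ 2 * eul (q ^ 4) ^ 2)
   = eul (q ^ 8) ^ 5 / (eul (q ^ 4) ^ 2 * eul (q ^ 16) ^ 2) + 2 * q * eul (q ^ 16) ^ 2 / eul (q ^ 8)"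
proof -
  have "eul (- q) ^ 2 / eul (q ^ 2) = eul (q ^ 2) ^ 5 / (eul q ^ 2 * eul (q ^ 4) ^ 2)"
    using q by (simp add: eul_minus field_simps eval_nat_numeral)
  thus ?thesis using phi_dissection_2[of "- q"] q by simp
qed

end

text \<open>With \<open>s^2 = q\<close>, multiply the dissections of \<open>\<phi>(-s)\<close> and
  \<open>\<phi>(s)\<close>: on the left \<open>\<phi>(s) \<phi>(-s) = \<phi>(-s^2)^2\<close>, on the
  right stands a difference of squares in which only \<open>s^2\<close> occurs.\<close>

lemma phi_square_dissection:
  assumes q: "norm q < 1" "q \<noteq> 0"
  shows "eul q ^ 4 / eul (q ^ 2) ^ 2 = eul (q ^ 4) ^ 10 / (eul (q ^ 2) ^ 4 * eul (q ^ 8) ^ 4) - 4 * q * eul (q ^ 8) ^ 4 / eul (q ^ 4) ^ 2"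
proof -
  define s where "s = csqrt q"
  have s: "s ^ 2 = q" by (simp add: s_def)
  have ns: "norm s < 1" "s \<noteq> 0"
  proof -
    have "norm s ^ 2 < 1 ^ 2" using q s by (simp flip: norm_power)
    thus "norm s < 1" by (rule power_less_imp_less_base) simp
    show "s \<noteq> 0" using s q by auto
  qed
  have p: "s ^ 4 = q ^ 2" "s ^ 8 = q ^ 4" "s ^ 16 = q ^ 8" unfolding s[symmetric] by (simp_all flip: power_mult)
  have nz: "eul s \<noteq> 0" "eul q \<noteq> 0" "eul (q ^ 2) \<noteq> 0" "eul (q ^ 4) \<noteq> 0" "eul (q ^ 8) \<noteq> 0"
    using q ns by simp_all
  define A where "A = eul (q ^ 4) ^ 5 / (eul (q ^ 2) ^ 2 * eul (q ^ 8) ^ 2)"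
  define B where "B = eul (q ^ 8) ^ 2 / eul (q ^ 4)"
  have "eul s ^ 2 / eul q = A - 2 * s * B" "eul q ^ 5 / (eul s ^ 2 * eul (q ^ 2) ^ 2) = A + 2 * s * B"
    using phi_dissection_2[OF ns] phi_dissection_2'[OF ns] unfolding s p by (simp_all add: A_def B_def)
  hence "(eul s ^ 2 / eul q) * (eul q ^ 5 / (eul s ^ 2 * eul (q ^ 2) ^ 2)) = (A - 2 * s * B) * (A + 2 * s * B)"
    by simp
  also have "\<dots> = A ^ 2 - 4 * q * B ^ 2" unfolding s[symmetric] by algebra
  also have "(eul s ^ 2 / eul q) * (eul q ^ 5 / (eul s ^ 2 * eul (q ^ 2) ^ 2)) = eul q ^ 4 / eul (q ^ 2) ^ 2"
    using nz by (simp add: field_simps eval_nat_numeral)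
  finally show ?thesis by (simp add: A_def B_def power_divide power_mult_distrib flip: power_mult)
qed

lemma phi_square_dissection':
  assumes q: "norm q < 1" "q \<noteq> 0"
  shows "eul (q ^ 2) ^ 10 / (eul q ^ 4 * eul (q ^ 4) ^ 4) = eul (q ^ 4) ^ 10 / (eul (q ^ 2) ^ 4 * eul (q ^ 8) ^ 4) + 4 * q * eul (q ^ 8) ^ 4 / eul (q ^ 4) ^ 2"
proof -
  have "eul (- q) ^ 4 / eul (q ^ 2) ^ 2 = eul (q ^ 2) ^ 10 / (eul q ^ 4 * eul (q ^ 4) ^ 4)"
    using q by (simp add: eul_minus power_divide power_mult_distrib field_simps flip: power_mult power_add)
  thus ?thesis using phi_square_dissection[of "- q"] q by simp
qed

text \<open>The same trick once more yields Jacobi's identity between the fourth powers of the three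
  theta constants, here cleared of denominators.\<close>

lemma phi_fourth_dissection:
  assumes q: "norm q < 1" "q \<noteq> 0"
  shows "eul q ^ 16 * eul (q ^ 4) ^ 8 + 16 * q * eul q ^ 8 * eul (q ^ 4) ^ 16 = eul (q ^ 2) ^ 24"
proof -
  define s where "s = csqrt q"
  have s: "s ^ 2 = q" by (simp add: s_def)
  have ns: "norm s < 1" "s \<noteq> 0"
  proof -
    have "norm s ^ 2 < 1 ^ 2" using q s by (simp flip: norm_power)
    thus "norm s < 1" by (rule power_less_imp_less_base) simp
    show "s \<noteq> 0" using s q by auto
  qed
  have p: "s ^ 4 = q ^ 2" "s ^ 8 = q ^ 4" unfolding s[symmetric] by (simp_all flip: power_mult)
  have nz: "eul s \<noteq> 0" "eul q \<noteq> 0" "eul (q ^ 2) \<noteq> 0" "eul (q ^ 4) \<noteq> 0"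
    using q ns by simp_all
  define A where "A = eul (q ^ 2) ^ 10 / (eul q ^ 4 * eul (q ^ 4) ^ 4)"
  define B where "B = eul (q ^ 4) ^ 4 / eul (q ^ 2) ^ 2"
  have "eul s ^ 4 / eul q ^ 2 = A - 4 * s * B" "eul q ^ 10 / (eul s ^ 4 * eul (q ^ 2) ^ 4) = A + 4 * s * B"
    using phi_square_dissection[OF ns] phi_square_dissection'[OF ns] unfolding s p by (simp_all add: A_def B_def)
  hence "(eul s ^ 4 / eul q ^ 2) * (eul q ^ 10 / (eul s ^ 4 * eul (q ^ 2) ^ 4)) = (A - 4 * s * B) * (A + 4 * s * B)"
    by simp
  also have "\<dots> = A ^ 2 - 16 * q * B ^ 2" unfolding s[symmetric] by algebra
  also have "(eul s ^ 4 / eul q ^ 2) * (eul q ^ 10 / (eul s ^ 4 * eul (q ^ 2) ^ 4)) = eul q ^ 8 / eul (q ^ 2) ^ 4"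
    using nz by (simp add: field_simps flip: power_add)
  finally have "eul q ^ 8 / eul (q ^ 2) ^ 4 = eul (q ^ 2) ^ 20 / (eul q ^ 8 * eul (q ^ 4) ^ 8) - 16 * q * (eul (q ^ 4) ^ 8 / eul (q ^ 2) ^ 4)"
    by (simp add: A_def B_def power_divide power_mult_distrib flip: power_mult)
  thus ?thesis using nz by (simp add: field_simps flip: power_add)
qed

text \<open>The value \<open>l\<close> is the logarithmic derivative of \<open>f\<close> with respect to \<open>\<tau>\<close>, up to the factor \<open>2\<pi>i\<close>.\<close>

definition has_ldv :: "(complex \<Rightarrow> complex) \<Rightarrow> complex \<Rightarrow> complex \<Rightarrow> bool" where
  "has_ldv f l q \<longleftrightarrow> (f has_field_derivative f q * l / q) (at q)"

named_theorems ldv_intros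

lemma has_ldv_const [ldv_intros]: "has_ldv (\<lambda>_. c) 0 q"
  by (simp add: has_ldv_def)

lemma has_ldv_ident [ldv_intros]: "q \<noteq> 0 \<Longrightarrow> has_ldv (\<lambda>q. q) 1 q"
  by (simp add: has_ldv_def)

lemma has_ldv_mult [ldv_intros]: "has_ldv f l q \<Longrightarrow> has_ldv g m q \<Longrightarrow> has_ldv (\<lambda>q. f q * g q) (l + m) q"
  unfolding has_ldv_def
  by (drule (1) DERIV_mult') (simp add: algebra_simps add_divide_distrib)

lemma has_ldv_divide [ldv_intros]:
  assumes "has_ldv f l q" "has_ldv g m q" "g q \<noteq> 0"
  shows "has_ldv (\<lambda>q. f q / g q) (l - m) q"
proof -
  have "((\<lambda>q. f q / g q) has_field_derivative (f q * l / q * g q - f q * (g q * m / q)) / (g q * g q)) (at q)"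
    using assms unfolding has_ldv_def by (intro DERIV_divide) auto
  also have "(f q * l / q * g q - f q * (g q * m / q)) / (g q * g q) = f q / g q * (l - m) / q"
    using assms(3) by (cases "q = 0") (simp_all add: field_simps)
  finally show ?thesis by (simp add: has_ldv_def)
qed

lemma has_ldv_power [ldv_intros]: "has_ldv f l q \<Longrightarrow> has_ldv (\<lambda>q. f q ^ n) (of_nat n * l) q"
proof (induction n)
  case 0
  thus ?case using has_ldv_const[of 1 q] by simp
next
  case (Suc n)
  show ?case using has_ldv_mult[OF Suc.prems Suc.IH[OF Suc.prems]] by (simp add: algebra_simps)
qed

lemma has_ldv_eul [ldv_intros]: "norm q < 1 \<Longrightarrow> q \<noteq> 0 \<Longrightarrow> has_ldv eul (dlog_eul q) q"
  using eul_pow_has_field_derivative[of q 1] by (simp add: has_ldv_def)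

lemma has_ldv_eul_pow [ldv_intros]:
  "norm q < 1 \<Longrightarrow> q \<noteq> 0 \<Longrightarrow> k > 0 \<Longrightarrow> has_ldv (\<lambda>q. eul (q ^ k)) (of_nat k * dlog_eul (q ^ k)) q"
  using eul_pow_has_field_derivative[of q k] by (simp add: has_ldv_def)

context
begin

text \<open>\<open>x\<close> and \<open>t\<close> are the Hauptmoduln of levels 4 and 2,
  \<open>V\<close> is \<open>\<phi>(-q)^4\<close> and \<open>w\<close> its square; \<open>X\<close>
  is the logarithmic derivative of \<open>x\<close>, and \<open>G\<close> is
  \<open>2 P(q^2) - P(q)\<close>.\<close>

private definition x where "x q = 256 * q * eul (q ^ 4) ^ 8 / eul q ^ 8"
private definition V where "V q = eul q ^ 8 / eul (q ^ 2) ^ 4"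
private definition t where "t q = 4096 * q * eul (q ^ 2) ^ 24 / eul q ^ 24"
private definition w where "w q = eul q ^ 16 / eul (q ^ 2) ^ 8"
private definition G where "G q = 1 + 48 * dlog_eul (q ^ 2) - 24 * dlog_eul q"
private definition X where "X q = 1 + 32 * dlog_eul (q ^ 4) - 8 * dlog_eul q"

private lemma x16:
  assumes q: "norm q < 1" "q \<noteq> 0"
  shows "x q + 16 = 16 * eul (q ^ 2) ^ 24 / (eul q ^ 16 * eul (q ^ 4) ^ 8)"
proof -
  have "x q * (eul q ^ 16 * eul (q ^ 4) ^ 8) = 256 * q * eul q ^ 8 * eul (q ^ 4) ^ 16"
    using q by (simp add: x_def field_simps flip: power_add)
  hence "(x q + 16) * (eul q ^ 16 * eul (q ^ 4) ^ 8) = 16 * eul (q ^ 2) ^ 24"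
    unfolding phi_fourth_dissection[OF q, symmetric] by (simp add: algebra_simps)
  thus ?thesis using q by (simp add: nonzero_eq_divide_eq)
qed

private lemma tx: assumes q: "norm q < 1" "q \<noteq> 0" shows "t q = x q * (x q + 16)"
  unfolding x16[OF q] using q by (simp add: x_def t_def field_simps flip: power_add)

private lemma x_deriv: assumes q: "norm q < 1" "q \<noteq> 0" shows "(x has_field_derivative x q * X q / q) (at q)"
proof -
  have "has_ldv x (0 + 1 + of_nat 8 * (of_nat 4 * dlog_eul (q ^ 4)) - of_nat 8 * dlog_eul q) q"
    unfolding x_def[abs_def] using q by (intro ldv_intros) auto
  thus ?thesis by (simp add: has_ldv_def X_def)
qed

private lemma V_deriv: assumes q: "norm q < 1" "q \<noteq> 0"
  shows "(V has_field_derivative V q * (8 * dlog_eul q - 8 * dlog_eul (q ^ 2)) / q) (at q)"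
proof -
  have "has_ldv V (of_nat 8 * dlog_eul q - of_nat 4 * (of_nat 2 * dlog_eul (q ^ 2))) q"
    unfolding V_def[abs_def] using q by (intro ldv_intros) auto
  thus ?thesis by (simp add: has_ldv_def)
qed

text \<open>The function \<open>z = 1 + 16 / x\<close> is itself an eta quotient, with logarithmic
  derivative \<open>- V\<close> by the four-square identity. Differentiating
  \<open>1 + 16 / x\<close> instead brings in \<open>X\<close>.\<close>

private lemma X_eq: assumes q: "norm q < 1" "q \<noteq> 0" shows "X q = V q * (x q + 16) / 16"
proof -
  have op: "open (ball 0 1 - {0 :: complex})" by auto
  have mem: "q \<in> ball 0 1 - {0}" using q by simp
  define z where "z q = eul (q ^ 2) ^ 24 / (16 * q * eul q ^ 8 * eul (q ^ 4) ^ 16)" for q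
  have nz: "eul q \<noteq> 0" "eul (q ^ 2) \<noteq> 0" "eul (q ^ 4) \<noteq> 0" using q by simp_all
  have xnz: "x q \<noteq> 0" using nz q by (simp add: x_def)
  have zx: "z u = 1 + 16 / x u" if u: "norm u < 1" "u \<noteq> 0" for u
  proof -
    have "x u \<noteq> 0" using u by (simp add: x_def)
    hence "1 + 16 / x u = (x u + 16) / x u" by (simp add: field_simps)
    also have "\<dots> = z u" unfolding x16[OF u] using u by (simp add: x_def z_def field_simps flip: power_add)
    finally show ?thesis ..
  qed
  have "has_ldv z (of_nat 24 * (of_nat 2 * dlog_eul (q ^ 2)) -
      (0 + 1 + of_nat 8 * dlog_eul q + of_nat 16 * (of_nat 4 * dlog_eul (q ^ 4)))) q"
    unfolding z_def[abs_def] using q by (intro ldv_intros) auto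
  hence "(z has_field_derivative z q * (48 * dlog_eul (q ^ 2) - 8 * dlog_eul q - 64 * dlog_eul (q ^ 4) - 1) / q) (at q)"
    by (simp add: has_ldv_def algebra_simps)
  moreover have "48 * dlog_eul (q ^ 2) - 8 * dlog_eul q - 64 * dlog_eul (q ^ 4) - 1 = - V q"
    using phi_minus_fourth_power[OF q] by (simp add: V_def)
  ultimately have 1: "(z has_field_derivative z q * (- V q) / q) (at q)" by simp
  have "((\<lambda>u. 1 + 16 / x u) has_field_derivative - 16 * X q / (x q * q)) (at q)"
    by (rule derivative_eq_intros x_deriv[OF q] refl xnz)+ (use xnz q in \<open>simp_all add: field_simps\<close>)
  hence "(z has_field_derivative - 16 * X q / (x q * q)) (at q)"
    by (rule has_field_derivative_transform_within_open[OF _ op mem]) (use zx in auto)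
  hence "z q * (- V q) / q = - 16 * X q / (x q * q)" using 1 DERIV_unique by blast
  hence "z q * x q * V q = 16 * X q" using q xnz by (simp add: field_simps)
  moreover have "z q * x q = x q + 16" using zx[OF q] xnz by (simp add: field_simps)
  ultimately have "(x q + 16) * V q = 16 * X q" by simp
  thus ?thesis by (simp add: mult.commute)
qed

private lemma G_eq: assumes q: "norm q < 1" "q \<noteq> 0" shows "G q = V q * (x q + 8) / 8"
proof -
  have "G q = 2 * X q - V q"
    using phi_minus_fourth_power[OF q] by (simp add: G_def X_def V_def)
  also have "\<dots> = V q * (x q + 8) / 8" unfolding X_eq[OF q] by (simp add: field_simps)
  finally show ?thesis .
qed

private lemma wV: "w q = V q ^ 2" by (simp add: w_def V_def power_divide flip: power_mult)

private lemma G_square: assumes q: "norm q < 1" "q \<noteq> 0" shows "G q ^ 2 = w q * (1 + t q / 64)"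
  by (simp add: G_eq[OF q] wV tx[OF q] power_divide power_mult_distrib) (simp add: field_simps power2_eq_square)

text \<open>The square of \<open>G\<close> depends on \<open>x\<close> only through
  \<open>(x + 8)^2 = t + 64\<close>, which is why the answer lives in level 2.\<close>

lemma euler_P_2_square:
  assumes q: "norm q < 1" "q \<noteq> 0"
  shows "(2 * euler_P (q ^ 2) - euler_P q) ^ 2 = eul q ^ 16 / eul (q ^ 2) ^ 8 * (1 + 64 * q * eul (q ^ 2) ^ 24 / eul q ^ 24)"
proof -
  have "2 * euler_P (q ^ 2) - euler_P q = G q" by (simp add: G_def euler_P_def)
  thus ?thesis by (simp add: G_square[OF q] w_def t_def)
qed

text \<open>\<open>G\<close> is differentiated in two ways: through Ramanujan's equation at
  \<open>q\<close> and \<open>q ^ 2\<close>, which introduces the series of weight 4, and through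
  its closed form \<open>V * (x + 8) / 8\<close>.\<close>

private lemma E4_diff: assumes q: "norm q < 1" "q \<noteq> 0"
  shows "4 * euler_E4 (q ^ 2) - euler_E4 q = 3 * w q * (1 - t q / 64)"
proof -
  have op: "open (ball 0 1 - {0 :: complex})" by auto
  have mem: "q \<in> ball 0 1 - {0}" using q by simp
  have q2: "norm (q ^ 2) < 1" "q ^ 2 \<noteq> 0" using q by (simp_all add: norm_power_lt_1)
  have GP: "G u = 2 * euler_P (u ^ 2) - euler_P u" for u by (simp add: G_def euler_P_def)
  have "((\<lambda>u. 2 * euler_P (u ^ 2) - euler_P u) has_field_derivative
      2 * (deriv euler_P (q ^ 2) * (2 * q)) - deriv euler_P q) (at q)"
  proof (intro DERIV_diff DERIV_cmult euler_P_has_field_derivative[OF q(1)])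
    show "((\<lambda>u. euler_P (u ^ 2)) has_field_derivative deriv euler_P (q ^ 2) * (2 * q)) (at q)"
      by (rule DERIV_chain2[where f = euler_P and g = "\<lambda>u. u ^ 2", OF euler_P_has_field_derivative[OF q2(1)]])
        (auto intro!: derivative_eq_intros)
  qed
  hence 1: "(G has_field_derivative 2 * (deriv euler_P (q ^ 2) * (2 * q)) - deriv euler_P q) (at q)"
    by (simp add: GP[abs_def])
  have "((\<lambda>u. V u * (x u + 8) / 8) has_field_derivative
      (V q * (8 * dlog_eul q - 8 * dlog_eul (q ^ 2)) / q * (x q + 8) + V q * (x q * X q / q)) / 8) (at q)"
    by (rule DERIV_cdivide) (auto intro!: derivative_eq_intros x_deriv[OF q] V_deriv[OF q])
  hence "(G has_field_derivative
      (V q * (8 * dlog_eul q - 8 * dlog_eul (q ^ 2)) / q * (x q + 8) + V q * (x q * X q / q)) / 8) (at q)"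
    by (rule has_field_derivative_transform_within_open[OF _ op mem]) (use G_eq in auto)
  from DERIV_unique[OF 1 this]
  have "q * (2 * (deriv euler_P (q ^ 2) * (2 * q)) - deriv euler_P q)
     = (V q * (x q + 8) / 8) * (8 * dlog_eul q - 8 * dlog_eul (q ^ 2)) + V q * X q * x q / 8"
    using q by (simp add: field_simps)
  also have "\<dots> = G q * (euler_P q - G q) / 6 + w q * t q / 128"
  proof -
    have c1: "8 * dlog_eul q - 8 * dlog_eul (q ^ 2) = (euler_P q - G q) / 6" by (simp add: G_def euler_P_def)
    have c2: "V q * X q * x q / 8 = w q * t q / 128"
      by (simp add: X_eq[OF q] wV tx[OF q] power2_eq_square)
    show ?thesis unfolding G_eq[OF q, symmetric] c1 c2 by simp
  qed
  finally have DG: "4 * (q ^ 2 * deriv euler_P (q ^ 2)) - q * deriv euler_P q = G q * (euler_P q - G q) / 6 + w q * t q / 128"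
    by (simp add: power2_eq_square algebra_simps)
  have 2: "12 * (q ^ 2 * deriv euler_P (q ^ 2)) = euler_P (q ^ 2) ^ 2 - euler_E4 (q ^ 2)"
    by (rule ramanujan_P[OF q2])
  have 3: "12 * (q * deriv euler_P q) = euler_P q ^ 2 - euler_E4 q" by (rule ramanujan_P[OF q])
  have 4: "2 * euler_P (q ^ 2) = G q + euler_P q" by (simp add: GP)
  have DG': "384 * (4 * (q ^ 2 * deriv euler_P (q ^ 2)) - q * deriv euler_P q) = 64 * G q * (euler_P q - G q) + 3 * w q * t q"
    unfolding DG by simp
  have "32 * (4 * euler_E4 (q ^ 2) - euler_E4 q) = 96 * G q ^ 2 - 3 * w q * t q"
    using DG' 2 3 4 by algebra
  also have "\<dots> = 32 * (3 * w q * (1 - t q / 64))" unfolding G_square[OF q] by (simp add: field_simps)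
  finally show ?thesis by (simp only: mult_cancel_left) simp
qed

text \<open>The candidate for the series of weight 4; it obeys the relation between \<open>q\<close>
  and \<open>q ^ 2\<close> found in \<open>E4_diff\<close>.\<close>

private definition F where "F q = w q * (1 + t q / 16)"

private lemma F_square: assumes q: "norm q < 1" "q \<noteq> 0" shows "F (q ^ 2) = w q * (1 + t q / 256)"
proof -
  have nz: "eul q \<noteq> 0" "eul (q ^ 2) \<noteq> 0" "eul (q ^ 4) \<noteq> 0" using q by simp_all
  have "F (q ^ 2) = eul (q ^ 2) ^ 16 / eul (q ^ 4) ^ 8 * (1 + 256 * q ^ 2 * eul (q ^ 4) ^ 24 / eul (q ^ 2) ^ 24)"
    by (simp add: F_def w_def t_def flip: power_mult)
  also have "\<dots> = w q * ((x q + 16) / 16 + x q ^ 2 / 256)"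
    unfolding x16[OF q] using nz by (simp add: w_def x_def field_simps flip: power_add power_mult)
  also have "(x q + 16) / 16 + x q ^ 2 / 256 = 1 + t q / 256" unfolding tx[OF q] by (simp add: field_simps power2_eq_square)
  finally show ?thesis .
qed

text \<open>The difference \<open>d\<close> of the two sides satisfies \<open>d(q) = 4 d(q\<^sup>2)\<close>, which forces all its Taylor coefficients to vanish.\<close>

theorem euler_E4_eq:
  assumes q: "norm q < 1" "q \<noteq> 0"
  shows "euler_E4 q = eul q ^ 16 / eul (q ^ 2) ^ 8 + 256 * q * eul (q ^ 2) ^ 16 / eul q ^ 8"
proof -
  \<comment> \<open>Written with \<open>euler_P\<close> and its derivative, not with
    \<open>euler_E4\<close>, the difference is holomorphic at 0 from the outset.\<close>
  define d where "d u = euler_P u ^ 2 - 12 * (u * deriv euler_P u) - F u" for u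
  have dE: "d u = euler_E4 u - F u" if "norm u < 1" "u \<noteq> 0" for u
    using ramanujan_P[OF that] by (simp add: d_def)
  have d0: "d 0 = 0" by (simp add: d_def F_def w_def t_def euler_P_def dlog_eul_def)
  have dd: "d u = 4 * d (u ^ 2)" if u: "norm u < 1" for u
  proof (cases "u = 0")
    case False
    have u2: "norm (u ^ 2) < 1" "u ^ 2 \<noteq> 0" using u False by (simp_all add: norm_power_lt_1)
    have "F u - 4 * F (u ^ 2) = - 3 * w u * (1 - t u / 64)"
      unfolding F_square[OF u False] by (simp add: F_def field_simps)
    thus ?thesis using E4_diff[OF u False] dE[OF u False] dE[OF u2] by algebra
  qed (simp add: d0)
  have e2: "(\<lambda>u. eul (u ^ 2)) holomorphic_on ball 0 1"
    by (rule holomorphic_on_compose_gen[OF _ holomorphic_eul, unfolded o_def])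
      (auto intro!: holomorphic_intros simp: norm_power_lt_1 norm_power power_less_one_iff)
  have dh: "d holomorphic_on ball 0 1"
    unfolding d_def F_def w_def t_def
    by (intro holomorphic_intros holomorphic_euler_P holomorphic_deriv holomorphic_eul e2 open_ball) auto
  obtain C where C: "\<And>u. norm u \<le> 1 / 8 \<Longrightarrow> norm (d u) \<le> C * norm u" "C \<ge> 0"
  proof -
    obtain B where B: "\<And>u. u \<in> cball 0 (1 / 8) \<Longrightarrow> norm (deriv d u) \<le> B"
    proof -
      have "deriv d holomorphic_on ball 0 1" using dh by (intro holomorphic_deriv) auto
      hence "continuous_on (cball 0 (1 / 8)) (deriv d)"
        by (rule continuous_on_subset[OF holomorphic_on_imp_continuous_on]) auto
      hence "compact (deriv d ` cball 0 (1 / 8))" by (intro compact_continuous_image) auto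
      thus ?thesis using that by (meson bounded_iff compact_imp_bounded imageI)
    qed
    have "norm (d u - d 0) \<le> B * norm (u - 0)" if "norm u \<le> 1 / 8" for u
    proof (rule field_differentiable_bound[of "cball 0 (1 / 8)" d "deriv d"])
      show "(d has_field_derivative deriv d z) (at z within cball 0 (1 / 8))" if "z \<in> cball 0 (1 / 8)" for z
        by (rule has_field_derivative_at_within[OF holomorphic_derivI[OF dh open_ball]]) (use that in simp)
      show "norm (deriv d z) \<le> B" if "z \<in> cball 0 (1 / 8)" for z using that by (rule B)
      show "u \<in> cball 0 (1 / 8)" using that by simp
    qed simp_all
    moreover have "B \<ge> 0" by (rule order_trans[OF norm_ge_zero B[of 0]]) simp
    ultimately show ?thesis using that[of B] d0 by simp
  qed
  \<comment> \<open>For \<open>norm u \<le> 1 / 8\<close> one has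
    \<open>4 * norm u ^ 2 \<le> norm u / 2\<close>, so every use of
    \<open>d u = 4 * d (u ^ 2)\<close> halves the linear bound.\<close>
  have "norm (d u) \<le> C / 2 ^ n * norm u" if "norm u \<le> 1 / 8" for u n
    using that
  proof (induction n arbitrary: u)
    case (Suc n)
    have "norm u ^ 2 \<le> norm u * (1 / 8)"
      using mult_left_mono[OF Suc.prems norm_ge_zero[of u]] by (simp add: power2_eq_square)
    also have "\<dots> \<le> 1 / 8" using Suc.prems by simp
    finally have "norm (u ^ 2) \<le> 1 / 8" by (simp add: norm_power)
    from Suc.IH[OF this] have "4 * norm (d (u ^ 2)) \<le> 4 * (C / 2 ^ n * norm (u ^ 2))" by simp
    also have "\<dots> \<le> 4 * (C / 2 ^ n * (norm u * (1 / 8)))"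
      using \<open>norm u ^ 2 \<le> norm u * (1 / 8)\<close> C(2) by (intro mult_left_mono) (auto simp: norm_power)
    finally show ?case using dd[of u] Suc.prems by (simp add: norm_mult)
  qed (use C in simp)
  hence small: "d u = 0" if "norm u < 1 / 8" for u
  proof -
    have "(\<lambda>n. C / 2 ^ n * norm u) \<longlonglongrightarrow> 0 * norm u"
      by (intro tendsto_mult_right) (use LIMSEQ_divide_realpow_zero[of 2 C] in simp)
    hence "norm (d u) \<le> 0"
      using \<open>\<And>u n. norm u \<le> 1 / 8 \<Longrightarrow> norm (d u) \<le> C / 2 ^ n * norm u\<close>[of u] that
      by (intro LIMSEQ_le_const[of _ 0]) auto
    thus ?thesis by simp
  qed
  have "d q = 0" by (rule disc_zero[OF dh, where r = "1 / 8"]) (use small q in auto)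
  hence "euler_E4 q = F q" using dE[OF q] by simp
  also have "\<dots> = eul q ^ 16 / eul (q ^ 2) ^ 8 + 256 * q * eul (q ^ 2) ^ 16 / eul q ^ 8"
    using q by (simp add: F_def w_def t_def field_simps flip: power_add)
  finally show ?thesis .
qed

end

section \<open>Dissections modulo 5\<close>

lemma pentagonal:
  assumes q: "norm q < 1" "q \<noteq> 0"
  shows "((\<lambda>n. (- 1) powi n * q powi (n * (3 * n - 1) div 2)) has_sum eul q) UNIV"
proof -
  have "{1..<3::nat} = {1, 2}" by auto
  hence "eul q = eul (q ^ 3) * qpoch q (q ^ 3) * qpoch (q ^ 2) (q ^ 3)"
    using eul_split[OF q(1), of 3] by simp
  moreover have "2 * (n * (3 * n - 1) div 2) = int 3 * (n * (n - 1)) + 2 * int 1 * n" for n :: int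
  proof -
    have "even (n * (3 * n - 1))" by simp
    thus ?thesis by (simp add: algebra_simps)
  qed
  ultimately show ?thesis
    using theta_minus[OF q, of 3 1 "\<lambda>n. n * (3 * n - 1) div 2"] by simp
qed

text \<open>Replacing \<open>q\<close> by \<open>w * q\<close> multiplies the part with exponents in
  class \<open>j\<close> by \<open>w ^ j\<close>; the parts themselves do not depend on
  \<open>w\<close>.\<close>

lemma root_unity_dissection:
  fixes c :: "int \<Rightarrow> complex" and e :: "int \<Rightarrow> int"
  assumes F: "\<And>w. w ^ 5 = 1 \<Longrightarrow> ((\<lambda>n. c n * (w * q) powi e n) has_sum F w) UNIV"
    and w: "w ^ 5 = 1"
  shows "F w = (\<Sum>j<5. w ^ j * (\<Sum>\<^sub>\<infinity>n\<in>{n. e n mod 5 = int j}. c n * q powi e n))"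
proof -
  have s: "(\<lambda>n. c n * q powi e n) summable_on UNIV" using F[of 1] has_sum_imp_summable by auto
  have wnz: "w \<noteq> 0" using w by auto
  have "((\<lambda>n. c n * (w * q) powi e n) has_sum (\<Sum>j<5. w ^ j * (\<Sum>\<^sub>\<infinity>n\<in>{n. e n mod 5 = int j}. c n * q powi e n)))
      (\<Union>j\<in>{..<5}. {n. e n mod 5 = int j})"
  proof (rule sum_has_sum)
    fix j :: nat
    have "((\<lambda>n. w ^ j * (c n * q powi e n)) has_sum (w ^ j * (\<Sum>\<^sub>\<infinity>n\<in>{n. e n mod 5 = int j}. c n * q powi e n))) {n. e n mod 5 = int j}"
      by (intro has_sum_cmult_right has_sum_infsum summable_on_subset[OF s]) auto
    also have "?this \<longleftrightarrow> ((\<lambda>n. c n * (w * q) powi e n) has_sum (w ^ j * (\<Sum>\<^sub>\<infinity>n\<in>{n. e n mod 5 = int j}. c n * q powi e n))) {n. e n mod 5 = int j}"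
    proof (rule has_sum_cong)
      fix n assume "n \<in> {n. e n mod 5 = int j}"
      hence "int j = e n mod 5" by simp
      hence "e n = 5 * (e n div 5) + int j" by simp
      hence "w powi e n = w powi (5 * (e n div 5) + int j)" by simp
      also have "\<dots> = (w ^ 5) powi (e n div 5) * w ^ j"
        using wnz by (simp add: power_int_add power_int_mult)
      finally have "w powi e n = (w ^ 5) powi (e n div 5) * w ^ j" .
      thus "w ^ j * (c n * q powi e n) = c n * (w * q) powi e n"
        using w by (simp add: power_int_mult_distrib)
    qed
    finally show "((\<lambda>n. c n * (w * q) powi e n) has_sum (w ^ j * (\<Sum>\<^sub>\<infinity>n\<in>{n. e n mod 5 = int j}. c n * q powi e n))) {n. e n mod 5 = int j}" .
  qed auto
  also have "(\<Union>j\<in>{..<5}. {n. e n mod 5 = int j}) = UNIV"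
  proof -
    have "n \<in> (\<Union>j\<in>{..<5}. {n. e n mod 5 = int j})" for n
      by (rule UN_I[of "nat (e n mod 5)"]) (auto simp: nat_less_iff)
    thus ?thesis by blast
  qed
  finally show ?thesis using has_sum_unique F[OF w] by blast
qed

lemma sum_lessThan_5: "(\<Sum>j<5. f j) = f 0 + f 1 + f 2 + f 3 + f (4 :: nat)"
  by (simp add: eval_nat_numeral)

lemma prod_lessThan_5: "(\<Prod>j<5. f j) = f 0 * f 1 * f 2 * f 3 * f (4 :: nat)"
  by (simp add: eval_nat_numeral)

definition zeta5 :: complex where "zeta5 = exp (2 * of_real pi * \<i> / 5)"

lemma zeta5_power [simp]: "zeta5 ^ 5 = 1"
proof -
  have "zeta5 ^ 5 = exp (of_nat 5 * (2 * of_real pi * \<i> / 5))" by (simp only: zeta5_def exp_of_nat_mult)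
  also have "of_nat 5 * (2 * of_real pi * \<i> / 5) = 2 * of_real pi * \<i>" by simp
  also have "exp (2 * of_real pi * \<i>) = 1" by (rule exp_two_pi_i)
  finally show ?thesis .
qed

lemma zeta5_power_power: "(zeta5 ^ j) ^ 5 = 1"
proof -
  have "(zeta5 ^ j) ^ 5 = (zeta5 ^ 5) ^ j" by (simp only: power_mult [symmetric] mult.commute)
  thus ?thesis by simp
qed

lemma zeta5_sum: "1 + zeta5 + zeta5 ^ 2 + zeta5 ^ 3 + zeta5 ^ 4 = 0"
proof -
  have "zeta5 \<noteq> 1"
  proof
    assume "zeta5 = 1"
    then obtain n :: int where "Im (2 * of_real pi * \<i> / 5) = of_int (2 * n) * pi"
      unfolding zeta5_def exp_eq_1 by blast
    hence "5 * real_of_int n = 1" by (simp add: field_simps)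
    hence "5 * n = 1" by (metis of_int_1 of_int_eq_iff of_int_mult of_int_numeral)
    thus False by presburger
  qed
  moreover have "(zeta5 - 1) * (1 + zeta5 + zeta5 ^ 2 + zeta5 ^ 3 + zeta5 ^ 4) = zeta5 ^ 5 - 1" by algebra
  ultimately show ?thesis by simp
qed

text \<open>Pairing each root with its inverse leaves quadratics with middle coefficients
  \<open>u\<close> and \<open>v\<close>, the two roots of \<open>y^2 + y - 1\<close>. Assuming only
  the cyclotomic relation lets \<open>z\<close> be any primitive fifth root.\<close>

lemma prod_fifth_roots:
  fixes z x :: complex
  assumes z: "1 + z + z ^ 2 + z ^ 3 + z ^ 4 = 0"
  shows "(1 - x) * (1 - x * z) * (1 - x * z ^ 2) * (1 - x * z ^ 3) * (1 - x * z ^ 4) = 1 - x ^ 5"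
proof -
  define u v where "u = z + z ^ 4" and "v = z ^ 2 + z ^ 3"
  have uv: "u + v = - 1" "u * v = - 1" unfolding u_def v_def using z by algebra+
  have "(1 - x * z) * (1 - x * z ^ 4) = 1 - u * x + x ^ 2" "(1 - x * z ^ 2) * (1 - x * z ^ 3) = 1 - v * x + x ^ 2"
    unfolding u_def v_def using z by algebra+
  hence "(1 - x) * (1 - x * z) * (1 - x * z ^ 2) * (1 - x * z ^ 3) * (1 - x * z ^ 4)
      = (1 - x) * (1 - u * x + x ^ 2) * (1 - v * x + x ^ 2)" by algebra
  also have "\<dots> = 1 - x ^ 5" using uv by algebra
  finally show ?thesis .
qed

text \<open>Pentagonal numbers lie in the classes 0, 1, 2 modulo 5, and those in class 1 are
  \<open>1 + 25 e\<close> with \<open>e\<close> again pentagonal.\<close>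

lemma eul_dissection_5:
  assumes q: "norm q < 1" "q \<noteq> 0"
  obtains a c where "\<And>w. w ^ 5 = 1 \<Longrightarrow> eul (w * q) = a - w * (q * eul (q ^ 25)) + w ^ 2 * c"
proof -
  define c :: "int \<Rightarrow> complex" where "c = (\<lambda>n. (- 1) powi n)"
  define e :: "int \<Rightarrow> int" where "e = (\<lambda>n. n * (3 * n - 1) div 2)"
  define s where "s j = (\<Sum>\<^sub>\<infinity>n\<in>{n. e n mod 5 = int j}. c n * q powi e n)" for j
  have wn: "norm (w * q) < 1" "w * q \<noteq> 0" if "w ^ 5 = 1" for w
  proof -
    have "norm w ^ 5 = 1" using that by (metis norm_power norm_one)
    hence "norm w = 1" by (metis norm_ge_zero power_eq_1_iff zero_neq_numeral abs_of_nonneg real_norm_def)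
    thus "norm (w * q) < 1" "w * q \<noteq> 0" using q by (auto simp: norm_mult)
  qed
  have e5: "e (5 * m + r) = 5 * (m * (15 * m + 6 * r - 1) div 2) + e r" for m r
  proof -
    have 1: "even (m * (15 * m + 6 * r - 1))" "even (r * (3 * r - 1))" by simp_all
    have "(5 * m + r) * (3 * (5 * m + r) - 1) = 5 * (m * (15 * m + 6 * r - 1)) + r * (3 * r - 1)"
      by (simp add: algebra_simps)
    thus ?thesis unfolding e_def using 1 by (elim evenE) simp
  qed
  have emod: "e n mod 5 = e (n mod 5) mod 5" for n
  proof -
    have "n = 5 * (n div 5) + n mod 5" by simp
    hence "e n = 5 * (n div 5 * (15 * (n div 5) + 6 * (n mod 5) - 1) div 2) + e (n mod 5)" using e5 by metis
    thus ?thesis by simp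
  qed
  have ev: "e 0 mod 5 = 0" "e 1 mod 5 = 1" "e 2 mod 5 = 0" "e 3 mod 5 = 2" "e 4 mod 5 = 2" by (simp_all add: e_def)
  have cases5: "n mod 5 = 0 \<or> n mod 5 = 1 \<or> n mod 5 = 2 \<or> n mod 5 = 3 \<or> n mod 5 = 4" for n :: int by presburger
  have "e n mod 5 \<noteq> 3" "e n mod 5 \<noteq> 4" for n using cases5[of n] ev by (auto simp: emod[of n])
  hence s34: "s 3 = 0" "s 4 = 0" by (simp_all add: s_def)
  have "{n. e n mod 5 = 1} = {n. n mod 5 = 1}"
  proof -
    have "e n mod 5 = 1 \<longleftrightarrow> n mod 5 = 1" for n using cases5[of n] ev by (auto simp: emod[of n])
    thus ?thesis by simp
  qed
  moreover have "((\<lambda>n. c n * q powi e n) has_sum (- q * eul (q ^ 25))) {n. n mod 5 = 1}"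
  proof -
    have 1: "bij_betw (\<lambda>m. 5 * m + 1) UNIV {n :: int. n mod 5 = 1}"
    proof (rule bij_betw_byWitness[where f' = "\<lambda>n. n div 5"])
      show "\<forall>n\<in>{n :: int. n mod 5 = 1}. 5 * (n div 5) + 1 = n" by (auto, presburger)
    qed auto
    have "eul (q ^ 25) = eul (q ^ 75) * qpoch (q ^ 50) (q ^ 75) * qpoch (q ^ 25) (q ^ 75)"
    proof -
      have "{1..<3::nat} = {1, 2}" by auto
      thus ?thesis using eul_split[OF norm_power_lt_1[OF q(1), of 25], of 3] by (simp flip: power_mult)
    qed
    moreover have "2 * ((75 * m * m + 25 * m) div 2) = 75 * (m * (m - 1)) + 2 * 50 * m" for m :: int
    proof -
      have "even (75 * m * m + 25 * m)" by simp
      thus ?thesis by (simp add: algebra_simps)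
    qed
    ultimately have 2: "((\<lambda>m. - q * ((- 1) powi m * q powi ((75 * m * m + 25 * m) div 2))) has_sum (- q * eul (q ^ 25))) UNIV"
      using has_sum_cmult_right[OF theta_minus[OF q, of 75 50 "\<lambda>m. (75 * m * m + 25 * m) div 2"], of "- q"] by simp
    have "c (5 * m + 1) * q powi e (5 * m + 1) = - q * ((- 1) powi m * q powi ((75 * m * m + 25 * m) div 2))" for m
    proof -
      have ev: "even (75 * m * m + 25 * m)" by simp
      have "(5 * m + 1) * (3 * (5 * m + 1) - 1) = (75 * m * m + 25 * m) + 2" by (simp add: algebra_simps)
      hence "e (5 * m + 1) = (75 * m * m + 25 * m) div 2 + 1" unfolding e_def using ev by (elim evenE) simp
      thus ?thesis using q by (simp add: c_def power_int_add_1' minus_one_powi)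
    qed
    with 2 show ?thesis using has_sum_reindex_bij_betw[OF 1, of "\<lambda>n. c n * q powi e n"] by simp
  qed
  ultimately have s1: "s 1 = - q * eul (q ^ 25)" by (simp add: s_def infsumI)
  have "eul (w * q) = s 0 - w * (q * eul (q ^ 25)) + w ^ 2 * s 2" if "w ^ 5 = 1" for w
    using root_unity_dissection[of c q e "\<lambda>w. eul (w * q)", OF _ that, folded s_def] pentagonal wn
    by (simp add: sum_lessThan_5 s34 s1[unfolded One_nat_def] c_def e_def)
  thus ?thesis using that by blast
qed

text \<open>Triangular numbers lie in the classes 0, 1, 3 modulo 5, so in Jacobi's series for the
  cube the terms in \<open>w^2\<close> and \<open>w^4\<close> are absent.\<close>

lemma eul_cube_dissection_5:
  assumes q: "norm q < 1" "q \<noteq> 0"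
  obtains a b d where "\<And>w. w ^ 5 = 1 \<Longrightarrow> eul (w * q) ^ 3 = a + w * b + w ^ 3 * d"
proof -
  define c :: "int \<Rightarrow> complex" where "c = (\<lambda>n. (- 1) powi n * of_int (2 * n - 1))"
  define e :: "int \<Rightarrow> int" where "e = (\<lambda>n. n * (n - 1) div 2)"
  define s where "s j = (\<Sum>\<^sub>\<infinity>n\<in>{n. e n mod 5 = int j}. c n * q powi e n)" for j
  have wn: "norm (w * q) < 1" "w * q \<noteq> 0" if "w ^ 5 = 1" for w
  proof -
    have "norm w ^ 5 = 1" using that by (metis norm_power norm_one)
    hence "norm w = 1" by (metis norm_ge_zero power_eq_1_iff zero_neq_numeral abs_of_nonneg real_norm_def)
    thus "norm (w * q) < 1" "w * q \<noteq> 0" using q by (auto simp: norm_mult)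
  qed
  have emod: "e n mod 5 = e (n mod 5) mod 5" for n
  proof -
    define m r where "m = n div 5" and "r = n mod 5"
    have n: "n = 5 * m + r" by (simp add: m_def r_def)
    have 1: "even (m * (5 * m + 2 * r - 1))" "even (r * (r - 1))" by simp_all
    have "(5 * m + r) * ((5 * m + r) - 1) = 5 * (m * (5 * m + 2 * r - 1)) + r * (r - 1)"
      by (simp add: algebra_simps)
    hence "e n = 5 * (m * (5 * m + 2 * r - 1) div 2) + e r" unfolding e_def n using 1 by (elim evenE) simp
    thus ?thesis by (simp add: r_def)
  qed
  have ev: "e 0 mod 5 = 0" "e 1 mod 5 = 0" "e 2 mod 5 = 1" "e 3 mod 5 = 3" "e 4 mod 5 = 1" by (simp_all add: e_def)
  have cases5: "n mod 5 = 0 \<or> n mod 5 = 1 \<or> n mod 5 = 2 \<or> n mod 5 = 3 \<or> n mod 5 = 4" for n :: int by presburger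
  have "e n mod 5 \<noteq> 2" "e n mod 5 \<noteq> 4" for n using cases5[of n] ev by (auto simp: emod[of n])
  hence s24: "s 2 = 0" "s 4 = 0" by (simp_all add: s_def)
  have "- 2 * eul (w * q) ^ 3 = s 0 + w * s 1 + w ^ 3 * s 3" if "w ^ 5 = 1" for w
    using root_unity_dissection[of c q e "\<lambda>w. - 2 * eul (w * q) ^ 3", OF _ that, folded s_def] eul_cube_sum wn
    by (simp add: sum_lessThan_5 s24 c_def e_def)
  note h = this
  have "eul (w * q) ^ 3 = (- s 0 / 2) + w * (- s 1 / 2) + w ^ 3 * (- s 3 / 2)" if "w ^ 5 = 1" for w
  proof -
    have "eul (w * q) ^ 3 = - (1 / 2) * (- 2 * eul (w * q) ^ 3)" by simp
    also have "\<dots> = (- s 0 / 2) + w * (- s 1 / 2) + w ^ 3 * (- s 3 / 2)"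
      unfolding h[OF that] by (simp add: algebra_simps add_divide_distrib)
    finally show ?thesis .
  qed
  thus ?thesis using that by blast
qed

lemma prod_eul_zeta5:
  assumes q: "norm q < 1"
  shows "eul q * eul (zeta5 * q) * eul (zeta5 ^ 2 * q) * eul (zeta5 ^ 3 * q) * eul (zeta5 ^ 4 * q) * eul (q ^ 25) = eul (q ^ 5) ^ 6"
proof -
  have "(\<Prod>j<5. eul (zeta5 ^ j * q)) * eul (q ^ (5 * 5)) = eul (q ^ 5) ^ (5 + 1)"
  proof (rule prod_eul_roots)
    fix r :: nat and x :: complex assume "r \<in> {1..<5}"
    hence "r = 1 \<or> r = 2 \<or> r = 3 \<or> r = 4" by auto
    moreover have "1 + zeta5 ^ 1 + (zeta5 ^ 1) ^ 2 + (zeta5 ^ 1) ^ 3 + (zeta5 ^ 1) ^ 4 = 0"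
      "1 + zeta5 ^ 2 + (zeta5 ^ 2) ^ 2 + (zeta5 ^ 2) ^ 3 + (zeta5 ^ 2) ^ 4 = 0"
      "1 + zeta5 ^ 3 + (zeta5 ^ 3) ^ 2 + (zeta5 ^ 3) ^ 3 + (zeta5 ^ 3) ^ 4 = 0"
      "1 + zeta5 ^ 4 + (zeta5 ^ 4) ^ 2 + (zeta5 ^ 4) ^ 3 + (zeta5 ^ 4) ^ 4 = 0"
      using zeta5_sum by algebra+
    ultimately have "1 + zeta5 ^ r + (zeta5 ^ r) ^ 2 + (zeta5 ^ r) ^ 3 + (zeta5 ^ r) ^ 4 = 0"
      by blast
    from prod_fifth_roots[OF this, of x] show "(\<Prod>j<5. 1 - x * (zeta5 ^ j) ^ r) = 1 - x ^ 5"
      unfolding prod_lessThan_5 by (simp add: mult.commute[of r] flip: power_mult)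
  next
    show "(zeta5 ^ j) ^ 5 = 1" for j by (rule zeta5_power_power)
  qed (use q in auto)
  thus ?thesis by (simp add: prod_lessThan_5)
qed

text \<open>Write \<open>eul (w q) = a + b w + c w^2\<close> for fifth roots of unity
  \<open>w\<close>. The cube has no term in \<open>w^2\<close>, so \<open>a (a c + b^2) = 0\<close>,
  and \<open>a\<close> cancels because \<open>a(0) = 1\<close>. The product over all
  \<open>w\<close> is then \<open>a^5 + 11 b^5 + c^5\<close>, which under \<open>a c = - b^2\<close>
  is a polynomial in \<open>a + b + c = eul q\<close> and \<open>b = - q eul (q^25)\<close>.\<close>

theorem eul_level_25:
  assumes q: "norm q < 1" "q \<noteq> 0"
  shows "eul (q ^ 5) ^ 6 = eul q ^ 5 * eul (q ^ 25) + 5 * q * eul q ^ 4 * eul (q ^ 25) ^ 2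
     + 15 * q ^ 2 * eul q ^ 3 * eul (q ^ 25) ^ 3 + 25 * q ^ 3 * eul q ^ 2 * eul (q ^ 25) ^ 4 + 25 * q ^ 4 * eul q * eul (q ^ 25) ^ 5"
proof -
  let ?z = zeta5
  \<comment> \<open>Averages over the roots of unity replace the constants obtained from
    \<open>eul_dissection_5\<close>: they are visibly holomorphic in \<open>u\<close>, as the
    cancellation of \<open>a\<close> demands.\<close>
  define a where "a u = (eul u + eul (?z * u) + eul (?z ^ 2 * u) + eul (?z ^ 3 * u) + eul (?z ^ 4 * u)) / 5" for u
  define c where "c u = (eul u + ?z ^ 3 * eul (?z * u) + ?z * eul (?z ^ 2 * u) + ?z ^ 4 * eul (?z ^ 3 * u) + ?z ^ 2 * eul (?z ^ 4 * u)) / 5" for u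
  define b where "b u = - (u * eul (u ^ 25))" for u
  note zp = zeta5_power_power
  have nz: "norm ?z = 1" by (simp add: zeta5_def)
  have dis: "eul (w * u) = a u + w * b u + w ^ 2 * c u" if u: "norm u < 1" "u \<noteq> 0" and w: "w ^ 5 = 1" for u w
  proof -
    obtain a' c' where ac: "\<And>w. w ^ 5 = 1 \<Longrightarrow> eul (w * u) = a' - w * (u * eul (u ^ 25)) + w ^ 2 * c'"
      using eul_dissection_5[OF u] by blast
    have e: "eul u = a' + b u + c'" "eul (?z * u) = a' + ?z * b u + ?z ^ 2 * c'"
      "eul (?z ^ 2 * u) = a' + ?z ^ 2 * b u + ?z ^ 4 * c'" "eul (?z ^ 3 * u) = a' + ?z ^ 3 * b u + ?z ^ 6 * c'"
      "eul (?z ^ 4 * u) = a' + ?z ^ 4 * b u + ?z ^ 8 * c'"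
      using ac[of 1] ac[of ?z] ac[OF zp[of 2]] ac[OF zp[of 3]] ac[OF zp[of 4]] by (simp_all add: b_def flip: power_mult)
    have "5 * a u = 5 * a'" unfolding a_def e using zeta5_sum by simp algebra
    moreover have "5 * c u = 5 * c'" unfolding c_def e using zeta5_sum by simp algebra
    ultimately show ?thesis using ac[OF w] by (simp add: b_def)
  qed
  have aH: "a u * (a u * c u + b u ^ 2) = 0" if u: "norm u < 1" for u
  proof (cases "u = 0")
    case True
    have "5 * c 0 = 0" unfolding c_def using zeta5_sum by simp algebra
    thus ?thesis using True by (simp add: b_def)
  next
    case False
    obtain a' b' d' where abd: "\<And>w. w ^ 5 = 1 \<Longrightarrow> eul (w * u) ^ 3 = a' + w * b' + w ^ 3 * d'"
      using eul_cube_dissection_5[OF u False] by blast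
    have e: "(a u + w * b u + w ^ 2 * c u) ^ 3 = a' + w * b' + w ^ 3 * d'" if "w ^ 5 = 1" for w
      using abd[OF that] dis[OF u False that] by simp
    define C0 where "C0 = a u ^ 3 + 3 * b u * c u ^ 2 - a'"
    define C1 where "C1 = 3 * a u ^ 2 * b u + c u ^ 3 - b'"
    define C2 where "C2 = 3 * a u * (a u * c u + b u ^ 2)"
    define C3 where "C3 = b u ^ 3 + 6 * a u * b u * c u - d'"
    define C4 where "C4 = 3 * a u * c u ^ 2 + 3 * b u ^ 2 * c u"
    have P: "C0 + C1 * w + C2 * w ^ 2 + C3 * w ^ 3 + C4 * w ^ 4 = 0" if "w ^ 5 = 1" for w
    proof -
      have "(a u + w * b u + w ^ 2 * c u) ^ 3 - (a' + w * b' + w ^ 3 * d')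
        = C0 + C1 * w + C2 * w ^ 2 + C3 * w ^ 3 + C4 * w ^ 4 + (w ^ 5 - 1) * (3 * b u * c u ^ 2 + w * c u ^ 3)"
        unfolding C0_def C1_def C2_def C3_def C4_def by algebra
      thus ?thesis using e[OF that] that by simp
    qed
    have P1: "C0 + C1 + C2 + C3 + C4 = 0" using P[of 1] by simp
    have P2: "C0 + C1 * ?z + C2 * ?z ^ 2 + C3 * ?z ^ 3 + C4 * ?z ^ 4 = 0" using P[of ?z] by simp
    have P3: "C0 + C1 * ?z ^ 2 + C2 * ?z ^ 4 + C3 * ?z ^ 6 + C4 * ?z ^ 8 = 0" using P[OF zp[of 2]] by (simp flip: power_mult)
    have P4: "C0 + C1 * ?z ^ 3 + C2 * ?z ^ 6 + C3 * ?z ^ 9 + C4 * ?z ^ 12 = 0" using P[OF zp[of 3]] by (simp flip: power_mult)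
    have P5: "C0 + C1 * ?z ^ 4 + C2 * ?z ^ 8 + C3 * ?z ^ 12 + C4 * ?z ^ 16 = 0" using P[OF zp[of 4]] by (simp flip: power_mult)
    \<comment> \<open>Fourier inversion over the five roots: the weights are the powers
      \<open>z^(-2j)\<close> with exponents reduced modulo 5, and they isolate the coefficient of
      \<open>w^2\<close>.\<close>
    have "5 * C2 = (C0 + C1 + C2 + C3 + C4) + ?z ^ 3 * (C0 + C1 * ?z + C2 * ?z ^ 2 + C3 * ?z ^ 3 + C4 * ?z ^ 4)
        + ?z * (C0 + C1 * ?z ^ 2 + C2 * ?z ^ 4 + C3 * ?z ^ 6 + C4 * ?z ^ 8)
        + ?z ^ 4 * (C0 + C1 * ?z ^ 3 + C2 * ?z ^ 6 + C3 * ?z ^ 9 + C4 * ?z ^ 12)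
        + ?z ^ 2 * (C0 + C1 * ?z ^ 4 + C2 * ?z ^ 8 + C3 * ?z ^ 12 + C4 * ?z ^ 16)"
      using zeta5_sum by algebra
    hence "C2 = 0" unfolding P1 P2 P3 P4 P5 by simp
    thus ?thesis by (simp add: C2_def)
  qed
  have comp: "(\<lambda>u. eul (k * u)) holomorphic_on ball 0 1" if "norm k = 1" for k
    by (rule holomorphic_on_compose_gen[OF _ holomorphic_eul, unfolded o_def])
      (use that in \<open>auto intro!: holomorphic_intros simp: norm_mult\<close>)
  have comp25: "(\<lambda>u. eul (u ^ 25)) holomorphic_on ball 0 1"
    by (rule holomorphic_on_compose_gen[OF _ holomorphic_eul, unfolded o_def])
      (auto intro!: holomorphic_intros simp: norm_power power_less_one_iff)
  have hol: "a holomorphic_on ball 0 1" "b holomorphic_on ball 0 1" "c holomorphic_on ball 0 1"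
    unfolding a_def b_def c_def
    by (intro holomorphic_intros holomorphic_eul comp comp25; simp add: norm_power nz)+
  have "a q * c q + b q ^ 2 = 0"
  proof (rule disc_cancel[of "\<lambda>u. a u * c u + b u ^ 2" a])
    show "a 0 \<noteq> 0" by (simp add: a_def)
    show "(a u * c u + b u ^ 2) * a u = 0" if "norm u < 1" for u using aH[OF that] by (simp add: mult.commute)
  qed (use q hol in \<open>auto intro!: holomorphic_intros\<close>)
  hence ac: "a q * c q = - (b q ^ 2)" by (simp add: add_eq_0_iff)
  have e: "eul q = a q + b q + c q" "eul (?z * q) = a q + ?z * b q + ?z ^ 2 * c q"
      "eul (?z ^ 2 * q) = a q + ?z ^ 2 * b q + ?z ^ 4 * c q" "eul (?z ^ 3 * q) = a q + ?z ^ 3 * b q + ?z ^ 6 * c q"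
      "eul (?z ^ 4 * q) = a q + ?z ^ 4 * b q + ?z ^ 8 * c q"
    using dis[OF q, of 1] dis[OF q, of ?z] dis[OF q zp[of 2]] dis[OF q zp[of 3]] dis[OF q zp[of 4]]
    by (simp_all flip: power_mult)
  have p14: "eul (?z * q) * eul (?z ^ 4 * q) = a q ^ 2 + b q ^ 2 + c q ^ 2 + (a q * b q + b q * c q) * (?z + ?z ^ 4) + a q * c q * (?z ^ 2 + ?z ^ 3)"
    unfolding e using zeta5_sum by algebra
  have p23: "eul (?z ^ 2 * q) * eul (?z ^ 3 * q) = a q ^ 2 + b q ^ 2 + c q ^ 2 + (a q * b q + b q * c q) * (?z ^ 2 + ?z ^ 3) + a q * c q * (?z + ?z ^ 4)"
    unfolding e using zeta5_sum by algebra
  define u v where "u = ?z + ?z ^ 4" and "v = ?z ^ 2 + ?z ^ 3"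
  have uv: "u + v = - 1" "u * v = - 1" unfolding u_def v_def using zeta5_sum by algebra+
  have "eul (q ^ 5) ^ 6 = eul q * (eul (?z * q) * eul (?z ^ 4 * q)) * (eul (?z ^ 2 * q) * eul (?z ^ 3 * q)) * eul (q ^ 25)"
    using prod_eul_zeta5[OF q(1)] by (simp add: mult_ac)
  also have "\<dots> = (a q ^ 5 + 11 * b q ^ 5 + c q ^ 5) * eul (q ^ 25)"
    unfolding p14 p23 e(1) u_def[symmetric] v_def[symmetric] using uv ac by algebra
  also have "a q ^ 5 + 11 * b q ^ 5 + c q ^ 5 = (a q + b q + c q) ^ 5 - 5 * b q * (a q + b q + c q) ^ 4 + 15 * b q ^ 2 * (a q + b q + c q) ^ 3
      - 25 * b q ^ 3 * (a q + b q + c q) ^ 2 + 25 * b q ^ 4 * (a q + b q + c q)"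
    using ac by algebra
  also have "a q + b q + c q = eul q" by (rule e(1) [symmetric])
  also have "b q = - (q * eul (q ^ 25))" by (simp add: b_def)
  finally have "eul (q ^ 5) ^ 6 = (eul q ^ 5 - 5 * - (q * eul (q ^ 25)) * eul q ^ 4 + 15 * (- (q * eul (q ^ 25))) ^ 2 * eul q ^ 3 -
    25 * (- (q * eul (q ^ 25))) ^ 3 * eul q ^ 2 + 25 * (- (q * eul (q ^ 25))) ^ 4 * eul q) * eul (q ^ 25)" .
  moreover have "(E ^ 5 - 5 * - (q * G) * E ^ 4 + 15 * (- (q * G)) ^ 2 * E ^ 3 - 25 * (- (q * G)) ^ 3 * E ^ 2 + 25 * (- (q * G)) ^ 4 * E) * G
    = E ^ 5 * G + 5 * q * E ^ 4 * G ^ 2 + 15 * q ^ 2 * E ^ 3 * G ^ 3 + 25 * q ^ 3 * E ^ 2 * G ^ 4 + 25 * q ^ 4 * E * G ^ 5" for E G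
    by algebra
  ultimately show ?thesis by (simp only:)
qed

section \<open>Algebraic relations between the Hauptmoduln\<close>

text \<open>The Hauptmodul as a function of the nome: the fractional powers of \<open>q\<close> in
  each eta quotient combine to the single factor \<open>q\<close>. Only the levels that occur as
  \<open>M\<close> or \<open>N M\<close> are kept.\<close>

definition hauptq :: "nat \<Rightarrow> complex \<Rightarrow> complex" where
  "hauptq N q = (let e = (\<lambda>m::nat. eul (q ^ m)) in q * (
     if N = 2 then 2^12 * e 2^24 / e 1^24
     else if N = 3 then 3^6 * e 3^12 / e 1^12
     else if N = 4 then 2^8 * e 4^8 / e 1^8
     else if N = 5 then 5^3 * e 5^6 / e 1^6
     else if N = 6 then 2^3 * 3^2 * e 2 * e 6^5 / (e 1^5 * e 3)
     else if N = 8 then 2^5 * e 2^2 * e 8^4 / (e 1^4 * e 4^2)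
     else if N = 9 then 3^3 * e 9^3 / e 1^3
     else if N = 10 then 2^2 * 5 * e 2 * e 10^3 / (e 1^3 * e 5)
     else if N = 12 then 2^2 * 3 * e 2^2 * e 3 * e 12^3 / (e 1^3 * e 4 * e 6^2)
     else if N = 16 then 2^3 * e 2 * e 16^2 / (e 1^2 * e 8)
     else if N = 18 then 2 * 3 * e 2 * e 3 * e 18^2 / (e 1^2 * e 6 * e 9)
     else if N = 25 then 5 * e 25 / e 1
     else 0))"

lemma hauptq_simps:
  "hauptq 2 q = 4096 * q * eul (q ^ 2) ^ 24 / eul q ^ 24"
  "hauptq 3 q = 729 * q * eul (q ^ 3) ^ 12 / eul q ^ 12"
  "hauptq 4 q = 256 * q * eul (q ^ 4) ^ 8 / eul q ^ 8"
  "hauptq 5 q = 125 * q * eul (q ^ 5) ^ 6 / eul q ^ 6"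
  "hauptq 6 q = 72 * q * eul (q ^ 2) * eul (q ^ 6) ^ 5 / (eul q ^ 5 * eul (q ^ 3))"
  "hauptq 8 q = 32 * q * eul (q ^ 2) ^ 2 * eul (q ^ 8) ^ 4 / (eul q ^ 4 * eul (q ^ 4) ^ 2)"
  "hauptq 9 q = 27 * q * eul (q ^ 9) ^ 3 / eul q ^ 3"
  "hauptq 10 q = 20 * q * eul (q ^ 2) * eul (q ^ 10) ^ 3 / (eul q ^ 3 * eul (q ^ 5))"
  "hauptq 12 q = 12 * q * eul (q ^ 2) ^ 2 * eul (q ^ 3) * eul (q ^ 12) ^ 3 / (eul q ^ 3 * eul (q ^ 4) * eul (q ^ 6) ^ 2)"
  "hauptq 16 q = 8 * q * eul (q ^ 2) * eul (q ^ 16) ^ 2 / (eul q ^ 2 * eul (q ^ 8))"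
  "hauptq 18 q = 6 * q * eul (q ^ 2) * eul (q ^ 3) * eul (q ^ 18) ^ 2 / (eul q ^ 2 * eul (q ^ 6) * eul (q ^ 9))"
  "hauptq 25 q = 5 * q * eul (q ^ 25) / eul q"
  by (simp_all add: hauptq_def)

lemma holomorphic_eul_pow [holomorphic_intros]: "k > 0 \<Longrightarrow> (\<lambda>u. eul (u ^ k)) holomorphic_on ball 0 1"
  by (rule holomorphic_on_compose_gen[OF _ holomorphic_eul, unfolded o_def])
    (auto intro!: holomorphic_intros simp: norm_power power_less_one_iff)

section \<open>Cube roots of unity and level 18\<close>

definition zeta3 :: complex where "zeta3 = Complex (- 1 / 2) (sqrt 3 / 2)"

lemma zeta3_sum: "1 + zeta3 + zeta3 ^ 2 = 0"
  by (simp add: zeta3_def complex_eq_iff power2_eq_square)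

lemma zeta3_power: "zeta3 ^ 3 = 1"
  using zeta3_sum by algebra

lemma norm_zeta3: "norm zeta3 = 1"
proof -
  have "norm zeta3 ^ 3 = 1" by (metis norm_power norm_one zeta3_power)
  thus ?thesis by (metis norm_ge_zero power_eq_1_iff zero_neq_numeral abs_of_nonneg real_norm_def)
qed

lemma prod_lessThan_3: "(\<Prod>j<3. f j) = f 0 * f 1 * f (2 :: nat)"
  by (simp add: eval_nat_numeral)

lemma prod_cube_roots:
  fixes z x :: complex
  assumes "1 + z + z ^ 2 = 0"
  shows "(1 - x) * (1 - x * z) * (1 - x * z ^ 2) = 1 - x ^ 3"
  using assms by algebra

text \<open>Both primitive roots are covered, because replacing \<open>q\<close> by
  \<open>zeta3 q\<close> replaces \<open>q^2\<close> by \<open>zeta3^2 q^2\<close>.\<close>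

lemma prod_eul_zeta3:
  assumes q: "norm q < 1" and k: "k \<in> {1, 2}"
  shows "eul q * eul (zeta3 ^ k * q) * eul (zeta3 ^ (2 * k) * q) = eul (q ^ 3) ^ 4 / eul (q ^ 9)"
proof -
  have "(\<Prod>j<3. eul ((zeta3 ^ k) ^ j * q)) * eul (q ^ (3 * 3)) = eul (q ^ 3) ^ (3 + 1)"
  proof (rule prod_eul_roots)
    fix r :: nat and x :: complex assume "r \<in> {1..<3}"
    hence "k * r = 1 \<or> k * r = 2 \<or> k * r = 4" using k by auto
    moreover have "1 + zeta3 ^ 1 + (zeta3 ^ 1) ^ 2 = 0" "1 + zeta3 ^ 2 + (zeta3 ^ 2) ^ 2 = 0" "1 + zeta3 ^ 4 + (zeta3 ^ 4) ^ 2 = 0"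
      using zeta3_sum by algebra+
    ultimately have z: "1 + zeta3 ^ (k * r) + (zeta3 ^ (k * r)) ^ 2 = 0" by auto
    have "(1 - x) * (1 - x * zeta3 ^ (k * r)) * (1 - x * (zeta3 ^ (k * r)) ^ 2) = 1 - x ^ 3"
      using z by (rule prod_cube_roots)
    thus "(\<Prod>j<3. 1 - x * ((zeta3 ^ k) ^ j) ^ r) = 1 - x ^ 3"
      unfolding prod_lessThan_3 by (simp add: mult_ac flip: power_mult)
  next
    show "((zeta3 ^ k) ^ j) ^ 3 = 1" for j
    proof -
      have "((zeta3 ^ k) ^ j) ^ 3 = (zeta3 ^ 3) ^ (k * j)" by (simp only: power_mult [symmetric] mult_ac)
      thus ?thesis by (simp add: zeta3_power)
    qed
  qed (use q in auto)
  thus ?thesis using q by (simp add: prod_lessThan_3 field_simps flip: power_mult; algebra)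
qed

context
  fixes q :: complex
  assumes q: "norm q < 1" "q \<noteq> 0"
begin

lemma zeta3_times: "norm (zeta3 ^ k * q) < 1" "zeta3 ^ k * q \<noteq> 0"
  using q norm_zeta3 by (auto simp: norm_mult norm_power)

lemma zeta3_times_power_3: "(zeta3 ^ k * q) ^ (3 * m) = q ^ (3 * m)"
proof -
  have "(zeta3 ^ k) ^ (3 * m) = (zeta3 ^ 3) ^ (k * m)" by (simp only: power_mult [symmetric] mult_ac)
  thus ?thesis by (simp add: power_mult_distrib zeta3_power)
qed

lemma zeta3_times_powers:
  "(zeta3 ^ k * q) ^ 3 = q ^ 3" "(zeta3 ^ k * q) ^ 6 = q ^ 6" "(zeta3 ^ k * q) ^ 9 = q ^ 9" "(zeta3 ^ k * q) ^ 18 = q ^ 18"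
  "(zeta3 ^ k * q) ^ 2 = zeta3 ^ (2 * k) * q ^ 2"
  using zeta3_times_power_3[of k 1] zeta3_times_power_3[of k 2] zeta3_times_power_3[of k 3] zeta3_times_power_3[of k 6]
  by (simp_all add: power_mult_distrib mult.commute flip: power_mult)

text \<open>Multiply the dissection modulo 3 at \<open>q\<close>, \<open>zeta3 q\<close> and
  \<open>zeta3^2 q\<close>: the linear factors combine to a difference of cubes, the Euler products
  to functions of \<open>q ^ 3\<close>.\<close>

lemma phi_cubes: "(eul (q ^ 9) ^ 2 / eul (q ^ 18)) ^ 3 - 8 * (q * (eul (q ^ 3) * eul (q ^ 18) ^ 2 / (eul (q ^ 6) * eul (q ^ 9)))) ^ 3
  = eul (q ^ 3) ^ 8 * eul (q ^ 18) / (eul (q ^ 9) ^ 2 * eul (q ^ 6) ^ 4)"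
proof -
  define A where "A = eul (q ^ 9) ^ 2 / eul (q ^ 18)"
  define X where "X = q * (eul (q ^ 3) * eul (q ^ 18) ^ 2 / (eul (q ^ 6) * eul (q ^ 9)))"
  have d: "eul (zeta3 ^ k * q) ^ 2 / eul (zeta3 ^ (2 * k) * q ^ 2) = A - 2 * zeta3 ^ k * X" for k
    using phi_dissection_3[OF zeta3_times[of k], unfolded zeta3_times_powers] by (simp add: A_def X_def mult_ac)
  have q2: "norm (q ^ 2) < 1" using q by (simp add: norm_power_lt_1)
  have "A ^ 3 - 8 * X ^ 3 = (A - 2 * zeta3 ^ 0 * X) * (A - 2 * zeta3 ^ 1 * X) * (A - 2 * zeta3 ^ 2 * X)"
    using zeta3_sum by (simp only: power_0 power_one_right) algebra
  also have "\<dots> = (eul q * eul (zeta3 ^ 1 * q) * eul (zeta3 ^ (2 * 1) * q)) ^ 2 / (eul (q ^ 2) * eul (zeta3 ^ 2 * q ^ 2) * eul (zeta3 ^ (2 * 2) * q ^ 2))"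
    unfolding d[symmetric] by (simp add: power_mult_distrib)
  also have "\<dots> = (eul (q ^ 3) ^ 4 / eul (q ^ 9)) ^ 2 / (eul (q ^ 6) ^ 4 / eul (q ^ 18))"
    using prod_eul_zeta3[OF q(1), of 1] prod_eul_zeta3[OF q2, of 2] by (simp flip: power_mult)
  finally show ?thesis using q by (simp add: A_def X_def power_divide mult_ac flip: power_mult)
qed

lemma psi_cubes: "(eul (q ^ 6) * eul (q ^ 9) ^ 2 / (eul (q ^ 3) * eul (q ^ 18))) ^ 3 + (q * (eul (q ^ 18) ^ 2 / eul (q ^ 9))) ^ 3
  = eul (q ^ 6) ^ 8 * eul (q ^ 9) / (eul (q ^ 18) ^ 2 * eul (q ^ 3) ^ 4)"
proof -
  define A where "A = eul (q ^ 6) * eul (q ^ 9) ^ 2 / (eul (q ^ 3) * eul (q ^ 18))"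
  define X where "X = q * (eul (q ^ 18) ^ 2 / eul (q ^ 9))"
  have d: "eul (zeta3 ^ (2 * k) * q ^ 2) ^ 2 / eul (zeta3 ^ k * q) = A + zeta3 ^ k * X" for k
    using psi_dissection_3[OF zeta3_times[of k], unfolded zeta3_times_powers] by (simp add: A_def X_def mult_ac)
  have q2: "norm (q ^ 2) < 1" using q by (simp add: norm_power_lt_1)
  have "A ^ 3 + X ^ 3 = (A + zeta3 ^ 0 * X) * (A + zeta3 ^ 1 * X) * (A + zeta3 ^ 2 * X)"
    using zeta3_sum by (simp only: power_0 power_one_right) algebra
  also have "\<dots> = (eul (q ^ 2) * eul (zeta3 ^ 2 * q ^ 2) * eul (zeta3 ^ (2 * 2) * q ^ 2)) ^ 2 / (eul q * eul (zeta3 ^ 1 * q) * eul (zeta3 ^ (2 * 1) * q))"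
    unfolding d[symmetric] by (simp add: power_mult_distrib)
  also have "\<dots> = (eul (q ^ 6) ^ 4 / eul (q ^ 18)) ^ 2 / (eul (q ^ 3) ^ 4 / eul (q ^ 9))"
    using prod_eul_zeta3[OF q(1), of 1] prod_eul_zeta3[OF q2, of 2] by (simp flip: power_mult)
  finally show ?thesis using q by (simp add: A_def X_def power_divide mult_ac flip: power_mult)
qed

text \<open>In the dissection \<open>\<phi> = A - 2 X\<close> one has
  \<open>t = 6 X / \<phi>\<close>, so \<open>t + 3\<close> is \<open>3 A / \<phi>\<close>, and
  \<open>t^2 + 3 t + 3\<close> is, up to scale, the cofactor of \<open>\<phi>\<close> in
  \<open>A^3 - 8 X^3\<close>. The dissection of \<open>\<psi>\<close> gives the other two factors in
  the same way.\<close>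

lemma haupt_18_factors:
  defines "t \<equiv> hauptq 18 q"
  shows "t + 3 = 3 * eul (q ^ 2) * eul (q ^ 9) ^ 2 / (eul q ^ 2 * eul (q ^ 18))"
    and "t + 2 = 2 * eul (q ^ 2) ^ 3 * eul (q ^ 3) / (eul q ^ 3 * eul (q ^ 6))"
    and "t ^ 2 + 3 * t + 3 = 3 * eul (q ^ 3) ^ 8 * eul (q ^ 18) * eul (q ^ 2) ^ 3 / (eul (q ^ 9) ^ 2 * eul (q ^ 6) ^ 4 * eul q ^ 6)"
    and "t ^ 2 + 6 * t + 12 = 12 * eul (q ^ 6) ^ 6 * eul (q ^ 9) / (eul (q ^ 18) ^ 2 * eul (q ^ 3) ^ 2 * eul q ^ 3)"
proof -
  define \<phi> where "\<phi> = eul q ^ 2 / eul (q ^ 2)"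
  define A where "A = eul (q ^ 9) ^ 2 / eul (q ^ 18)"
  define X where "X = q * (eul (q ^ 3) * eul (q ^ 18) ^ 2 / (eul (q ^ 6) * eul (q ^ 9)))"
  have nz: "\<phi> \<noteq> 0" using q by (simp add: \<phi>_def)
  have \<phi>: "\<phi> = A - 2 * X" using phi_dissection_3[OF q] by (simp add: \<phi>_def A_def X_def)
  have t: "t = 6 * X / \<phi>" using q by (simp add: t_def hauptq_simps X_def \<phi>_def field_simps; algebra)
  have t3: "t + 3 = 3 * A / \<phi>" using nz by (simp add: t field_simps) (simp add: \<phi> algebra_simps)
  thus t3': "t + 3 = 3 * eul (q ^ 2) * eul (q ^ 9) ^ 2 / (eul q ^ 2 * eul (q ^ 18))"
    using q by (simp add: A_def \<phi>_def field_simps; algebra)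
  have "t ^ 2 + 3 * t + 3 = 3 * (A ^ 2 + 2 * A * X + 4 * X ^ 2) / \<phi> ^ 2"
  proof -
    have "A = \<phi> + 2 * X" using \<phi> by simp
    thus ?thesis using nz by (simp add: t field_simps power2_eq_square; algebra)
  qed
  also have "\<dots> = 3 * (A ^ 3 - 8 * X ^ 3) / \<phi> ^ 3"
  proof -
    have "A ^ 3 - 8 * X ^ 3 = (A ^ 2 + 2 * A * X + 4 * X ^ 2) * \<phi>" unfolding \<phi> by algebra
    thus ?thesis using nz by (simp add: power3_eq_cube power2_eq_square)
  qed
  also have "\<dots> = 3 * (eul (q ^ 3) ^ 8 * eul (q ^ 18) / (eul (q ^ 9) ^ 2 * eul (q ^ 6) ^ 4)) / \<phi> ^ 3"
    unfolding A_def X_def phi_cubes ..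
  finally show "t ^ 2 + 3 * t + 3 = 3 * eul (q ^ 3) ^ 8 * eul (q ^ 18) * eul (q ^ 2) ^ 3 / (eul (q ^ 9) ^ 2 * eul (q ^ 6) ^ 4 * eul q ^ 6)"
    using q by (simp add: \<phi>_def power_divide flip: power_mult)
  define \<psi> where "\<psi> = eul (q ^ 2) ^ 2 / eul q"
  define C where "C = eul (q ^ 6) * eul (q ^ 9) ^ 2 / (eul (q ^ 3) * eul (q ^ 18))"
  define Y where "Y = q * (eul (q ^ 18) ^ 2 / eul (q ^ 9))"
  \<comment> \<open>The scale at which the two parts of \<open>\<psi>\<close> become
    \<open>t * K / 6\<close> and \<open>(t + 3) * K / 3\<close>; their sum is
    \<open>(t + 2) * K / 2\<close>.\<close>
  define K where "K = eul q ^ 2 * eul (q ^ 6) / (eul (q ^ 2) * eul (q ^ 3))"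
  have Knz: "K \<noteq> 0" "\<psi> \<noteq> 0" using q by (simp_all add: K_def \<psi>_def)
  have \<psi>: "\<psi> = C + Y" using psi_dissection_3[OF q] by (simp add: \<psi>_def C_def Y_def)
  have tY: "t = 6 * Y / K" using q by (simp add: t_def hauptq_simps Y_def K_def field_simps; algebra)
  have tC: "t + 3 = 3 * C / K" unfolding t3' using q by (simp add: C_def K_def field_simps; algebra)
  have Y: "Y = t * K / 6" unfolding tY using Knz by simp
  have C: "C = (t + 3) * K / 3" unfolding tC using Knz by simp
  have "t + 2 = 2 * \<psi> / K" unfolding \<psi> Y C using Knz by (simp add: field_simps; algebra)
  thus "t + 2 = 2 * eul (q ^ 2) ^ 3 * eul (q ^ 3) / (eul q ^ 3 * eul (q ^ 6))"
    using q by (simp add: \<psi>_def K_def field_simps eval_nat_numeral; algebra)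
  have "t ^ 2 + 6 * t + 12 = 12 * (C ^ 2 - C * Y + Y ^ 2) / K ^ 2"
    unfolding Y C using Knz by (simp add: field_simps power2_eq_square; algebra)
  also have "\<dots> = 12 * (C ^ 3 + Y ^ 3) / (\<psi> * K ^ 2)"
  proof -
    have "C ^ 3 + Y ^ 3 = \<psi> * (C ^ 2 - C * Y + Y ^ 2)" unfolding \<psi> by algebra
    thus ?thesis using Knz by simp
  qed
  also have "\<dots> = 12 * (eul (q ^ 6) ^ 8 * eul (q ^ 9) / (eul (q ^ 18) ^ 2 * eul (q ^ 3) ^ 4)) / (\<psi> * K ^ 2)"
    unfolding C_def Y_def psi_cubes ..
  also have "\<dots> = 12 * eul (q ^ 6) ^ 6 * eul (q ^ 9) / (eul (q ^ 18) ^ 2 * eul (q ^ 3) ^ 2 * eul q ^ 3)"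
    using q by (simp add: \<psi>_def K_def field_simps flip: power_add; algebra)
  finally show "t ^ 2 + 6 * t + 12 = 12 * eul (q ^ 6) ^ 6 * eul (q ^ 9) / (eul (q ^ 18) ^ 2 * eul (q ^ 3) ^ 2 * eul q ^ 3)" .
qed

lemma haupt_6_18:
  defines "t \<equiv> hauptq 18 q"
  shows "hauptq 6 q = t * (t ^ 2 + 6 * t + 12)" "hauptq 6 (q ^ 3) = t ^ 3 / (t ^ 2 + 3 * t + 3)"
proof -
  show "hauptq 6 q = t * (t ^ 2 + 6 * t + 12)"
    unfolding t_def haupt_18_factors(4) using q by (simp add: hauptq_simps field_simps flip: power_add; algebra)
  show "hauptq 6 (q ^ 3) = t ^ 3 / (t ^ 2 + 3 * t + 3)"
    unfolding t_def haupt_18_factors(3) using q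
    by (simp add: hauptq_simps power_mult_distrib power_divide field_simps flip: power_add power_mult; algebra)
qed

text \<open>For the quadratic in level 9, clearing \<open>t + 2\<close> makes the numerator a
  product of the two quadratics of level 18, whose eta quotients are known.\<close>

lemma haupt_9_18:
  defines "t \<equiv> hauptq 18 q"
  shows "hauptq 9 q = t * (t + 3) ^ 2 / (t + 2)" "hauptq 9 (q ^ 2) = t ^ 2 * (t + 3) / (t + 2) ^ 2"
    "hauptq 9 q ^ 2 + 9 * hauptq 9 q + 27 = 27 * eul (q ^ 3) ^ 12 / (eul (q ^ 9) ^ 3 * eul q ^ 9)"
proof -
  show 1: "hauptq 9 q = t * (t + 3) ^ 2 / (t + 2)"
    unfolding t_def haupt_18_factors(1,2) using q
    by (simp add: hauptq_simps power_mult_distrib power_divide field_simps flip: power_add power_mult; algebra)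
  show "hauptq 9 (q ^ 2) = t ^ 2 * (t + 3) / (t + 2) ^ 2"
    unfolding t_def haupt_18_factors(1,2) using q
    by (simp add: hauptq_simps power_mult_distrib power_divide field_simps flip: power_add power_mult; algebra)
  have "t + 2 \<noteq> 0" unfolding t_def haupt_18_factors using q by simp
  hence "hauptq 9 q ^ 2 + 9 * hauptq 9 q + 27 = (t ^ 2 + 6 * t + 12) * (t ^ 2 + 3 * t + 3) ^ 2 / (t + 2) ^ 2"
  proof -
    assume nz: "t + 2 \<noteq> 0"
    have "hauptq 9 q ^ 2 + 9 * hauptq 9 q + 27 = ((t * (t + 3) ^ 2) ^ 2 + 9 * (t * (t + 3) ^ 2) * (t + 2) + 27 * (t + 2) ^ 2) / (t + 2) ^ 2"
      unfolding 1 using nz by (simp add: add_divide_distrib power_divide power2_eq_square)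
    also have "(t * (t + 3) ^ 2) ^ 2 + 9 * (t * (t + 3) ^ 2) * (t + 2) + 27 * (t + 2) ^ 2 = (t ^ 2 + 6 * t + 12) * (t ^ 2 + 3 * t + 3) ^ 2"
      by algebra
    finally show ?thesis .
  qed
  also have "\<dots> = 27 * eul (q ^ 3) ^ 12 / (eul (q ^ 9) ^ 3 * eul q ^ 9)"
    unfolding t_def haupt_18_factors using q
    by (simp add: power_mult_distrib power_divide field_simps flip: power_add power_mult; algebra)
  finally show "hauptq 9 q ^ 2 + 9 * hauptq 9 q + 27 = 27 * eul (q ^ 3) ^ 12 / (eul (q ^ 9) ^ 3 * eul q ^ 9)" .
qed

lemma haupt_3_9:
  defines "t \<equiv> hauptq 9 q"
  shows "hauptq 3 q = t * (t ^ 2 + 9 * t + 27)" "hauptq 3 (q ^ 3) = t ^ 3 / (t ^ 2 + 9 * t + 27)"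
proof -
  show "hauptq 3 q = t * (t ^ 2 + 9 * t + 27)"
    unfolding t_def haupt_9_18(3) using q by (simp add: hauptq_simps field_simps; algebra)
  show "hauptq 3 (q ^ 3) = t ^ 3 / (t ^ 2 + 9 * t + 27)"
    unfolding t_def haupt_9_18(3) using q
    by (simp add: hauptq_simps power_mult_distrib power_divide field_simps flip: power_mult; algebra)
qed

end

text \<open>Descent from level 18. At \<open>q\<close> itself \<open>t_6 + 8 = (t_18 + 2)^3\<close>.
  For \<open>t_6 + 9\<close> the relation for \<open>q ^ 3\<close> is read at a cube root
  \<open>s\<close> of \<open>q\<close>, where the numerator becomes
  \<open>(t_18 + 3)^3\<close>.\<close>

lemma haupt_6_factors:
  assumes q: "norm q < 1" "q \<noteq> 0"
  shows "hauptq 6 q + 8 = 8 * eul (q ^ 2) ^ 9 * eul (q ^ 3) ^ 3 / (eul q ^ 9 * eul (q ^ 6) ^ 3)"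
    "hauptq 6 q + 9 = 9 * eul (q ^ 3) ^ 8 * eul (q ^ 2) ^ 4 / (eul (q ^ 6) ^ 4 * eul q ^ 8)"
proof -
  have "hauptq 6 q + 8 = (hauptq 18 q + 2) ^ 3" unfolding haupt_6_18(1)[OF q] by algebra
  thus "hauptq 6 q + 8 = 8 * eul (q ^ 2) ^ 9 * eul (q ^ 3) ^ 3 / (eul q ^ 9 * eul (q ^ 6) ^ 3)"
    unfolding haupt_18_factors[OF q] by (simp add: power_mult_distrib power_divide flip: power_mult)
  define s where "s = exp (Ln q / 3)"
  have "s ^ 3 = exp (of_nat 3 * (Ln q / 3))" by (simp only: s_def exp_of_nat_mult)
  hence s: "s ^ 3 = q" using q by simp
  have ns: "norm s < 1" "s \<noteq> 0"
  proof -
    have "norm s ^ 3 < 1 ^ 3" using q s by (simp flip: norm_power)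
    thus "norm s < 1" by (rule power_less_imp_less_base) simp
  qed (simp add: s_def)
  let ?t = "hauptq 18 s"
  have nz: "?t ^ 2 + 3 * ?t + 3 \<noteq> 0" unfolding haupt_18_factors[OF ns] using ns by simp
  have "hauptq 6 q + 9 = ?t ^ 3 / (?t ^ 2 + 3 * ?t + 3) + 9"
    using haupt_6_18(2)[OF ns] by (simp add: s)
  also have "\<dots> = (?t + 3) ^ 3 / (?t ^ 2 + 3 * ?t + 3)"
  proof -
    have "(?t + 3) ^ 3 = ?t ^ 3 + 9 * (?t ^ 2 + 3 * ?t + 3)" by algebra
    moreover have "a / D + 9 = (a + 9 * D) / D" if "D \<noteq> 0" for a D :: complex
      using that by (simp add: add_divide_distrib)
    ultimately show ?thesis using nz by (simp only: not_False_eq_True)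
  qed
  also have "\<dots> = 9 * eul (s ^ 9) ^ 8 * eul (s ^ 6) ^ 4 / (eul (s ^ 18) ^ 4 * eul (s ^ 3) ^ 8)"
    unfolding haupt_18_factors[OF ns] using ns
    by (simp add: power_mult_distrib power_divide field_simps flip: power_add power_mult; algebra)
  also have "\<dots> = 9 * eul (q ^ 3) ^ 8 * eul (q ^ 2) ^ 4 / (eul (q ^ 6) ^ 4 * eul q ^ 8)"
    unfolding s[symmetric] by (simp flip: power_mult)
  finally show "hauptq 6 q + 9 = 9 * eul (q ^ 3) ^ 8 * eul (q ^ 2) ^ 4 / (eul (q ^ 6) ^ 4 * eul q ^ 8)" .
qed

lemma haupt_2_6:
  assumes q: "norm q < 1" "q \<noteq> 0"
  defines "t \<equiv> hauptq 6 q"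
  shows "hauptq 2 q = t * (t + 8) ^ 3 / (t + 9)" "hauptq 2 (q ^ 3) = t ^ 3 * (t + 8) / (t + 9) ^ 3"
proof -
  show "hauptq 2 q = t * (t + 8) ^ 3 / (t + 9)"
    unfolding t_def haupt_6_factors[OF q] using q
    by (simp add: hauptq_simps power_mult_distrib power_divide field_simps flip: power_mult; algebra)
  show "hauptq 2 (q ^ 3) = t ^ 3 * (t + 8) / (t + 9) ^ 3"
    unfolding t_def haupt_6_factors[OF q] using q
    by (simp add: hauptq_simps power_mult_distrib power_divide field_simps flip: power_mult; algebra)
qed

lemma haupt_3_6:
  assumes q: "norm q < 1" "q \<noteq> 0"
  defines "t \<equiv> hauptq 6 q"
  shows "hauptq 3 q = t * (t + 9) ^ 2 / (t + 8)" "hauptq 3 (q ^ 2) = t ^ 2 * (t + 9) / (t + 8) ^ 2"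
proof -
  show "hauptq 3 q = t * (t + 9) ^ 2 / (t + 8)"
    unfolding t_def haupt_6_factors[OF q] using q
    by (simp add: hauptq_simps power_mult_distrib power_divide field_simps flip: power_mult; algebra)
  show "hauptq 3 (q ^ 2) = t ^ 2 * (t + 9) / (t + 8) ^ 2"
    unfolding t_def haupt_6_factors[OF q] using q
    by (simp add: hauptq_simps power_mult_distrib power_divide field_simps flip: power_mult; algebra)
qed

text \<open>With \<open>\<phi>(-q) = A - 2 B\<close> and \<open>t = 8 B / \<phi>(-q)\<close>, the
  factors \<open>t + 4\<close> and \<open>t + 2\<close> correspond to \<open>A\<close> and
  \<open>A + 2 B = \<phi>(q)\<close>. The quadratic corresponds to \<open>A^2 + 4 B^2\<close>, which
  is the dissection of \<open>\<phi>(q^2)^2\<close>.\<close>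

lemma haupt_16_factors:
  assumes q: "norm q < 1" "q \<noteq> 0"
  defines "t \<equiv> hauptq 16 q"
  shows "t + 4 = 4 * eul (q ^ 8) ^ 5 * eul (q ^ 2) / (eul (q ^ 4) ^ 2 * eul (q ^ 16) ^ 2 * eul q ^ 2)"
    "t + 2 = 2 * eul (q ^ 2) ^ 6 / (eul q ^ 4 * eul (q ^ 4) ^ 2)"
    "t ^ 2 + 4 * t + 8 = 8 * eul (q ^ 4) ^ 10 / (eul q ^ 4 * eul (q ^ 2) ^ 2 * eul (q ^ 8) ^ 4)"
proof -
  define \<phi> where "\<phi> = eul q ^ 2 / eul (q ^ 2)"
  define A where "A = eul (q ^ 8) ^ 5 / (eul (q ^ 4) ^ 2 * eul (q ^ 16) ^ 2)"
  define B where "B = q * eul (q ^ 16) ^ 2 / eul (q ^ 8)"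
  have nz: "\<phi> \<noteq> 0" using q by (simp add: \<phi>_def)
  have \<phi>: "\<phi> = A - 2 * B" using phi_dissection_2[OF q] by (simp add: \<phi>_def A_def B_def)
  have t: "t = 8 * B / \<phi>" using q by (simp add: t_def hauptq_simps B_def \<phi>_def field_simps)
  have "t + 4 = 4 * A / \<phi>" using nz by (simp add: t field_simps) (simp add: \<phi> algebra_simps)
  thus "t + 4 = 4 * eul (q ^ 8) ^ 5 * eul (q ^ 2) / (eul (q ^ 4) ^ 2 * eul (q ^ 16) ^ 2 * eul q ^ 2)"
    using q by (simp add: A_def \<phi>_def field_simps)
  have "t + 2 = 2 * (A + 2 * B) / \<phi>" using nz by (simp add: t field_simps) (simp add: \<phi> algebra_simps)
  also have "A + 2 * B = eul (q ^ 2) ^ 5 / (eul q ^ 2 * eul (q ^ 4) ^ 2)"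
    using phi_dissection_2'[OF q] by (simp add: A_def B_def)
  also have "2 * (eul (q ^ 2) ^ 5 / (eul q ^ 2 * eul (q ^ 4) ^ 2)) / \<phi> = 2 * eul (q ^ 2) ^ 6 / (eul q ^ 4 * eul (q ^ 4) ^ 2)"
    using q by (simp add: \<phi>_def field_simps; algebra)
  finally show "t + 2 = 2 * eul (q ^ 2) ^ 6 / (eul q ^ 4 * eul (q ^ 4) ^ 2)" .
  have "t ^ 2 + 4 * t + 8 = 8 * (A ^ 2 + 4 * B ^ 2) / \<phi> ^ 2"
  proof -
    have "A = \<phi> + 2 * B" using \<phi> by simp
    thus ?thesis using nz by (simp add: t field_simps power2_eq_square)
  qed
  also have "A ^ 2 + 4 * B ^ 2 = eul (q ^ 4) ^ 10 / (eul (q ^ 2) ^ 4 * eul (q ^ 8) ^ 4)"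
    using phi_square_dissection'[of "q ^ 2"] q
    by (simp add: A_def B_def norm_power_lt_1 power_divide power_mult_distrib flip: power_mult)
  also have "8 * (eul (q ^ 4) ^ 10 / (eul (q ^ 2) ^ 4 * eul (q ^ 8) ^ 4)) / \<phi> ^ 2
      = 8 * eul (q ^ 4) ^ 10 / (eul q ^ 4 * eul (q ^ 2) ^ 2 * eul (q ^ 8) ^ 4)"
    using q by (simp add: \<phi>_def power_divide field_simps flip: power_mult; algebra)
  finally show "t ^ 2 + 4 * t + 8 = 8 * eul (q ^ 4) ^ 10 / (eul q ^ 4 * eul (q ^ 2) ^ 2 * eul (q ^ 8) ^ 4)" .
qed

text \<open>With \<open>t = t_16\<close> and \<open>t_8 = t (t + 4)\<close> one has
  \<open>t_8 + 4 = (t + 2)^2\<close> and \<open>t_8 + 8 = t^2 + 4 t + 8\<close>, so the factors of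
  level 8 are inherited from level 16.\<close>

lemma haupt_8_factors:
  assumes q: "norm q < 1" "q \<noteq> 0"
  shows "hauptq 8 q + 8 = 8 * eul (q ^ 4) ^ 10 / (eul q ^ 4 * eul (q ^ 2) ^ 2 * eul (q ^ 8) ^ 4)"
    "hauptq 8 q + 4 = 4 * eul (q ^ 2) ^ 12 / (eul q ^ 8 * eul (q ^ 4) ^ 4)"
    "hauptq 8 q = hauptq 16 q * (hauptq 16 q + 4)"
    "hauptq 8 (q ^ 2) = hauptq 16 q ^ 2 / (hauptq 16 q + 2)"
proof -
  show 1: "hauptq 8 q = hauptq 16 q * (hauptq 16 q + 4)"
    unfolding haupt_16_factors[OF q] using q by (simp add: hauptq_simps field_simps; algebra)
  show "hauptq 8 (q ^ 2) = hauptq 16 q ^ 2 / (hauptq 16 q + 2)"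
    unfolding haupt_16_factors[OF q] using q
    by (simp add: hauptq_simps power_mult_distrib power_divide field_simps flip: power_mult; algebra)
  have "hauptq 8 q + 8 = hauptq 16 q ^ 2 + 4 * hauptq 16 q + 8" unfolding 1 by algebra
  thus "hauptq 8 q + 8 = 8 * eul (q ^ 4) ^ 10 / (eul q ^ 4 * eul (q ^ 2) ^ 2 * eul (q ^ 8) ^ 4)"
    unfolding haupt_16_factors[OF q] .
  have "hauptq 8 q + 4 = (hauptq 16 q + 2) ^ 2" unfolding 1 by algebra
  thus "hauptq 8 q + 4 = 4 * eul (q ^ 2) ^ 12 / (eul q ^ 8 * eul (q ^ 4) ^ 4)"
    unfolding haupt_16_factors[OF q] by (simp add: power_divide power_mult_distrib flip: power_mult)
qed

lemma haupt_4_8: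
  assumes q: "norm q < 1" "q \<noteq> 0"
  defines "t \<equiv> hauptq 8 q"
  shows "hauptq 4 q = t * (t + 8)" "hauptq 4 (q ^ 2) = t ^ 2 / (t + 4)"
    "hauptq 4 q + 16 = 16 * eul (q ^ 2) ^ 24 / (eul q ^ 16 * eul (q ^ 4) ^ 8)"
proof -
  show 1: "hauptq 4 q = t * (t + 8)"
    unfolding t_def haupt_8_factors(1,2)[OF q] using q by (simp add: hauptq_simps field_simps; algebra)
  show "hauptq 4 (q ^ 2) = t ^ 2 / (t + 4)"
    unfolding t_def haupt_8_factors(1,2)[OF q] using q
    by (simp add: hauptq_simps power_mult_distrib power_divide field_simps flip: power_mult; algebra)
  have "hauptq 4 q + 16 = (t + 4) ^ 2" unfolding 1 by algebra
  thus "hauptq 4 q + 16 = 16 * eul (q ^ 2) ^ 24 / (eul q ^ 16 * eul (q ^ 4) ^ 8)"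
    unfolding t_def haupt_8_factors(1,2)[OF q] by (simp add: power_divide power_mult_distrib flip: power_mult)
qed

lemma haupt_2_4:
  assumes q: "norm q < 1" "q \<noteq> 0"
  defines "t \<equiv> hauptq 4 q"
  shows "hauptq 2 q = t * (t + 16)" "hauptq 2 (q ^ 2) = t ^ 2 / (t + 16)"
proof -
  show "hauptq 2 q = t * (t + 16)"
    unfolding t_def haupt_4_8(3)[OF q] using q by (simp add: hauptq_simps field_simps; algebra)
  show "hauptq 2 (q ^ 2) = t ^ 2 / (t + 16)"
    unfolding t_def haupt_4_8(3)[OF q] using q
    by (simp add: hauptq_simps power_mult_distrib power_divide field_simps flip: power_mult; algebra)
qed

text \<open>The pattern of level 18 with squared theta series: \<open>\<phi>^2 = A - 4 X\<close> and
  \<open>t = 20 X / \<phi>^2\<close>, while \<open>K\<close> scales the two parts of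
  \<open>\<psi>^2\<close> to \<open>t * K / 20\<close> and \<open>(t + 5) * K / 5\<close>, with sum
  \<open>(t + 4) * K / 4\<close>.\<close>

lemma haupt_10_factors:
  assumes q: "norm q < 1" "q \<noteq> 0"
  defines "t \<equiv> hauptq 10 q"
  shows "t + 5 = 5 * eul (q ^ 2) ^ 2 * eul (q ^ 5) ^ 4 / (eul q ^ 4 * eul (q ^ 10) ^ 2)"
    "t + 4 = 4 * eul (q ^ 2) ^ 5 * eul (q ^ 5) / (eul q ^ 5 * eul (q ^ 10))"
proof -
  define \<phi> where "\<phi> = (eul q ^ 2 / eul (q ^ 2)) ^ 2"
  define A where "A = (eul (q ^ 5) ^ 2 / eul (q ^ 10)) ^ 2"
  define X where "X = q * (eul q * eul (q ^ 10) ^ 3 / (eul (q ^ 2) * eul (q ^ 5)))"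
  have nz: "\<phi> \<noteq> 0" using q by (simp add: \<phi>_def)
  have \<phi>: "\<phi> = A - 4 * X" using phi_dissection_5[OF q] by (simp add: \<phi>_def A_def X_def)
  have t: "t = 20 * X / \<phi>" using q by (simp add: t_def hauptq_simps X_def \<phi>_def power_divide field_simps flip: power_mult; algebra)
  have "t + 5 = 5 * A / \<phi>" using nz by (simp add: t field_simps) (simp add: \<phi> algebra_simps)
  thus t5: "t + 5 = 5 * eul (q ^ 2) ^ 2 * eul (q ^ 5) ^ 4 / (eul q ^ 4 * eul (q ^ 10) ^ 2)"
    using q by (simp add: A_def \<phi>_def power_divide field_simps flip: power_mult)
  define \<psi> where "\<psi> = (eul (q ^ 2) ^ 2 / eul q) ^ 2"
  define D where "D = q * (eul (q ^ 10) ^ 2 / eul (q ^ 5)) ^ 2"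
  define C where "C = eul (q ^ 2) * eul (q ^ 5) ^ 3 / (eul q * eul (q ^ 10))"
  define K where "K = eul q ^ 3 * eul (q ^ 10) / (eul (q ^ 2) * eul (q ^ 5))"
  have Knz: "K \<noteq> 0" using q by (simp add: K_def)
  have \<psi>: "\<psi> = D + C" using psi_dissection_5[OF q] by (simp add: \<psi>_def C_def D_def)
  have tD: "t = 20 * D / K" using q by (simp add: t_def hauptq_simps D_def K_def power_divide field_simps flip: power_mult; algebra)
  have tC: "t + 5 = 5 * C / K" unfolding t5 using q by (simp add: C_def K_def field_simps; algebra)
  have D: "D = t * K / 20" unfolding tD using Knz by simp
  have C: "C = (t + 5) * K / 5" unfolding tC using Knz by simp
  have "t + 4 = 4 * \<psi> / K" unfolding \<psi> D C using Knz by (simp add: field_simps)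
  also have "4 * \<psi> / K = 4 * eul (q ^ 2) ^ 5 * eul (q ^ 5) / (eul q ^ 5 * eul (q ^ 10))"
    using q by (simp add: \<psi>_def K_def power_divide field_simps flip: power_mult; algebra)
  finally show "t + 4 = 4 * eul (q ^ 2) ^ 5 * eul (q ^ 5) / (eul q ^ 5 * eul (q ^ 10))" .
qed

lemma haupt_2_10:
  assumes q: "norm q < 1" "q \<noteq> 0"
  defines "t \<equiv> hauptq 10 q"
  shows "hauptq 2 q = t * (t + 4) ^ 5 / (t + 5)" "hauptq 2 (q ^ 5) = t ^ 5 * (t + 4) / (t + 5) ^ 5"
proof -
  show "hauptq 2 q = t * (t + 4) ^ 5 / (t + 5)"
    unfolding t_def haupt_10_factors[OF q] using q
    by (simp add: hauptq_simps power_mult_distrib power_divide field_simps flip: power_mult; algebra)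
  show "hauptq 2 (q ^ 5) = t ^ 5 * (t + 4) / (t + 5) ^ 5"
    unfolding t_def haupt_10_factors[OF q] using q
    by (simp add: hauptq_simps power_mult_distrib power_divide field_simps flip: power_mult; algebra)
qed

lemma haupt_5_10:
  assumes q: "norm q < 1" "q \<noteq> 0"
  defines "t \<equiv> hauptq 10 q"
  shows "hauptq 5 q = t * (t + 5) ^ 2 / (t + 4)" "hauptq 5 (q ^ 2) = t ^ 2 * (t + 5) / (t + 4) ^ 2"
proof -
  show "hauptq 5 q = t * (t + 5) ^ 2 / (t + 4)"
    unfolding t_def haupt_10_factors[OF q] using q
    by (simp add: hauptq_simps power_mult_distrib power_divide field_simps flip: power_mult; algebra)
  show "hauptq 5 (q ^ 2) = t ^ 2 * (t + 5) / (t + 4) ^ 2"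
    unfolding t_def haupt_10_factors[OF q] using q
    by (simp add: hauptq_simps power_mult_distrib power_divide field_simps flip: power_mult; algebra)
qed

lemma haupt_25_factor:
  assumes q: "norm q < 1" "q \<noteq> 0"
  defines "t \<equiv> hauptq 25 q"
  shows "t ^ 4 + 5 * t ^ 3 + 15 * t ^ 2 + 25 * t + 25 = 25 * eul (q ^ 5) ^ 6 / (eul q ^ 5 * eul (q ^ 25))"
proof -
  have nz: "eul q \<noteq> 0" "eul (q ^ 25) \<noteq> 0" using q by simp_all
  have "(t ^ 4 + 5 * t ^ 3 + 15 * t ^ 2 + 25 * t + 25) * (eul q ^ 5 * eul (q ^ 25)) = 25 * eul (q ^ 5) ^ 6"
    unfolding eul_level_25[OF q] t_def hauptq_simps using nz
    by (simp add: power_divide power_mult_distrib field_simps; algebra)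
  thus ?thesis using nz by (simp add: nonzero_eq_divide_eq)
qed

lemma haupt_5_25:
  assumes q: "norm q < 1" "q \<noteq> 0"
  defines "t \<equiv> hauptq 25 q"
  shows "hauptq 5 q = t * (t ^ 4 + 5 * t ^ 3 + 15 * t ^ 2 + 25 * t + 25)"
    "hauptq 5 (q ^ 5) = t ^ 5 / (t ^ 4 + 5 * t ^ 3 + 15 * t ^ 2 + 25 * t + 25)"
proof -
  show "hauptq 5 q = t * (t ^ 4 + 5 * t ^ 3 + 15 * t ^ 2 + 25 * t + 25)"
    unfolding t_def haupt_25_factor[OF q] using q
    by (simp add: hauptq_simps power_mult_distrib power_divide field_simps flip: power_mult; algebra)
  show "hauptq 5 (q ^ 5) = t ^ 5 / (t ^ 4 + 5 * t ^ 3 + 15 * t ^ 2 + 25 * t + 25)"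
    unfolding t_def haupt_25_factor[OF q] using q
    by (simp add: hauptq_simps power_mult_distrib power_divide field_simps flip: power_mult; algebra)
qed

text \<open>The Hauptmoduln \<open>x\<close> and \<open>y\<close> of level 6 at \<open>\<tau>\<close> and \<open>2\<tau>\<close> satisfy a multiplicative relation,
  since \<open>x\<close>, \<open>x + 8\<close>, \<open>x + 9\<close> and the corresponding values for \<open>y\<close> are eta quotients. That relation is a reducible
  polynomial in \<open>t\<close>, where \<open>x + 9 = (t + 3)\<^sup>2\<close>, and only the factor \<open>y (t + 2) - t\<^sup>2\<close> vanishes at the cusp.\<close>

lemma haupt_12_factors:
  assumes q: "norm q < 1" "q \<noteq> 0"
  defines "t \<equiv> hauptq 12 q"
  shows "t + 3 = 3 * eul (q ^ 2) ^ 2 * eul (q ^ 3) ^ 4 / (eul q ^ 4 * eul (q ^ 6) ^ 2)"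
    "t + 2 = 2 * eul (q ^ 2) ^ 9 * eul (q ^ 3) ^ 2 * eul (q ^ 12) / (eul q ^ 6 * eul (q ^ 6) ^ 3 * eul (q ^ 4) ^ 3)"
    "hauptq 6 q = t * (t + 6)" "hauptq 6 (q ^ 2) = t ^ 2 / (t + 2)"
proof -
  \<comment> \<open>An explicit square root of \<open>x + 9\<close>, shifted so as to vanish at 0.
    That it is the Hauptmodul of level 12 comes out only at the end.\<close>
  define T where "T u = 3 * eul (u ^ 2) ^ 2 * eul (u ^ 3) ^ 4 / (eul u ^ 4 * eul (u ^ 6) ^ 2) - 3" for u
  define U where "U u = 2 * eul (u ^ 2) ^ 9 * eul (u ^ 3) ^ 2 * eul (u ^ 12) / (eul u ^ 6 * eul (u ^ 6) ^ 3 * eul (u ^ 4) ^ 3)" for u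
  define x where "x = hauptq 6"
  define y where "y u = hauptq 6 (u ^ 2)" for u
  have y_eq: "y u = 72 * u ^ 2 * eul (u ^ 4) * eul (u ^ 12) ^ 5 / (eul (u ^ 2) ^ 5 * eul (u ^ 6))" for u
    by (simp add: y_def hauptq_simps flip: power_mult)
  have T_hol: "T holomorphic_on ball 0 1" and U_hol: "U holomorphic_on ball 0 1"
    and x_hol: "x holomorphic_on ball 0 1" and y_hol: "y holomorphic_on ball 0 1"
    unfolding T_def U_def x_def y_eq hauptq_simps
    by (auto intro!: holomorphic_intros holomorphic_eul)
  have at_0: "T 0 = 0" "U 0 = 2" "x 0 = 0" "y 0 = 0"
    by (simp_all add: T_def U_def x_def y_def hauptq_simps)
  have x9: "x u + 9 = (T u + 3) ^ 2" and R: "x u ^ 2 * (x u + 9) * (y u + 8) = y u * (y u + 9) ^ 2 * (x u + 8) ^ 2"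
    and U3: "U u ^ 3 * (y u + 8) = (x u + 8) ^ 2" and nz: "y u + 8 \<noteq> 0"
    if u: "norm u < 1" "u \<noteq> 0" for u
  proof -
    have u2: "norm (u ^ 2) < 1" "u ^ 2 \<noteq> 0" using u by (simp_all add: norm_power_lt_1)
    note f = haupt_6_factors[OF u, folded x_def] haupt_6_factors[OF u2, folded y_def]
    show "x u + 9 = (T u + 3) ^ 2"
      unfolding f using u by (simp add: T_def power_divide power_mult_distrib field_simps flip: power_mult)
    show "y u + 8 \<noteq> 0" unfolding f using u u2 by simp
    show "x u ^ 2 * (x u + 9) * (y u + 8) = y u * (y u + 9) ^ 2 * (x u + 8) ^ 2"
      unfolding f using u u2
      by (simp add: x_def y_def hauptq_simps power_divide power_mult_distrib field_simps flip: power_mult; algebra)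
    show "U u ^ 3 * (y u + 8) = (x u + 8) ^ 2"
      unfolding f using u u2
      by (simp add: U_def power_divide power_mult_distrib field_simps flip: power_mult; algebra)
  qed
  have xT: "x u = T u * (T u + 6)" if u: "norm u < 1" for u
  proof (cases "u = 0")
    case False
    have "x u = (T u + 3) ^ 2 - 9" using x9[OF u False] by (simp add: eq_diff_eq)
    thus ?thesis by algebra
  qed (simp add: at_0)
  \<comment> \<open>The factors to be discarded have the values 36 and 72 at 0.\<close>
  have yT: "y u * (T u + 2) - T u ^ 2 = 0" if u: "norm u < 1" for u
  proof (rule disc_cancel[OF _ _ _ _ u, where f = "\<lambda>u. y u * (T u + 2) - T u ^ 2"
        and g = "\<lambda>u. (y u * (T u + 4) + (T u + 6) ^ 2) * (y u * (x u + 8) + 8 * (x u + 9))"])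
    fix u :: complex assume u: "norm u < 1"
    show "(y u * (T u + 2) - T u ^ 2) * ((y u * (T u + 4) + (T u + 6) ^ 2) * (y u * (x u + 8) + 8 * (x u + 9))) = 0"
    proof (cases "u = 0")
      case False
      have "(y u * (T u + 2) - T u ^ 2) * ((y u * (T u + 4) + (T u + 6) ^ 2) * (y u * (x u + 8) + 8 * (x u + 9)))
        = y u * (y u + 9) ^ 2 * (x u + 8) ^ 2 - x u ^ 2 * (x u + 9) * (y u + 8)"
        unfolding xT[OF u] by algebra
      thus ?thesis using R[OF u False] by simp
    qed (simp add: at_0)
  qed (auto simp: at_0 intro!: holomorphic_intros T_hol x_hol y_hol)
  \<comment> \<open>By the relation just found \<open>T + 2\<close> and \<open>U\<close> have equal
    cubes; both are 2 at 0, which excludes the other cube roots.\<close>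
  have TU: "T u + 2 - U u = 0" if u: "norm u < 1" for u
  proof (rule disc_cancel[OF _ _ _ _ u, where f = "\<lambda>u. T u + 2 - U u"
        and g = "\<lambda>u. (T u + 2) ^ 2 + (T u + 2) * U u + U u ^ 2"])
    fix u :: complex assume u: "norm u < 1"
    show "(T u + 2 - U u) * ((T u + 2) ^ 2 + (T u + 2) * U u + U u ^ 2) = 0"
    proof (cases "u = 0")
      case False
      have "(y u + 8) * (T u + 2) = (T u + 4) ^ 2" using yT[OF u] by algebra
      moreover have "x u + 8 = (T u + 2) * (T u + 4)" unfolding xT[OF u] by algebra
      ultimately have "(y u + 8) * (T u + 2) ^ 3 = (y u + 8) * U u ^ 3" using U3[OF u False] by algebra
      hence "(T u + 2) ^ 3 = U u ^ 3" using nz[OF u False] by simp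
      thus ?thesis by algebra
    qed (simp add: at_0)
  qed (auto simp: at_0 intro!: holomorphic_intros T_hol U_hol)
  have u2: "norm (q ^ 2) < 1" "q ^ 2 \<noteq> 0" using q by (simp_all add: norm_power_lt_1)
  have Unz: "U q \<noteq> 0" and T3: "T q + 3 \<noteq> 0" using q by (simp_all add: U_def T_def)
  have y9: "y q + 9 = 9 * eul (q ^ 6) ^ 8 * eul (q ^ 4) ^ 4 / (eul (q ^ 12) ^ 4 * eul (q ^ 2) ^ 8)"
    using haupt_6_factors(2)[OF u2] by (simp add: y_def flip: power_mult)
  have TU': "T q + 2 = U q" using TU[OF q(1)] by simp
  \<comment> \<open>This provides an eta quotient for \<open>T + 6\<close>, by which
    \<open>t\<close> is recognised as \<open>x / (T + 6) = T\<close>.\<close>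
  have "(y q + 9) * U q = (T q + 3) * (T q + 6)" unfolding TU'[symmetric] using yT[OF q(1)] by algebra
  hence T6: "T q + 6 = (y q + 9) * U q / (T q + 3)" using T3 by (simp add: field_simps)
  have T6nz: "T q + 6 \<noteq> 0" unfolding T6 y9 using Unz T3 q by simp
  have "t * (T q + 6) = x q"
    unfolding T6 y9 using q
    by (simp add: t_def hauptq_simps x_def U_def T_def field_simps; algebra)
  hence "t = T q" using T6nz xT[OF q(1)] by simp
  show "t + 3 = 3 * eul (q ^ 2) ^ 2 * eul (q ^ 3) ^ 4 / (eul q ^ 4 * eul (q ^ 6) ^ 2)"
    unfolding \<open>t = T q\<close> T_def by simp
  show "t + 2 = 2 * eul (q ^ 2) ^ 9 * eul (q ^ 3) ^ 2 * eul (q ^ 12) / (eul q ^ 6 * eul (q ^ 6) ^ 3 * eul (q ^ 4) ^ 3)"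
    unfolding \<open>t = T q\<close> TU' by (simp add: U_def)
  show "hauptq 6 q = t * (t + 6)" using xT[OF q(1)] by (simp add: \<open>t = T q\<close> x_def)
  show "hauptq 6 (q ^ 2) = t ^ 2 / (t + 2)"
    using yT[OF q(1)] Unz unfolding TU'[symmetric] by (simp add: \<open>t = T q\<close> y_def nonzero_eq_divide_eq)
qed

lemma haupt_12_factor_4:
  assumes q: "norm q < 1" "q \<noteq> 0"
  shows "hauptq 12 q + 4 = 4 * eul (q ^ 4) ^ 3 * eul (q ^ 3) / (eul q ^ 3 * eul (q ^ 12))"
proof -
  have nz: "hauptq 12 q + 2 \<noteq> 0" unfolding haupt_12_factors[OF q] using q by simp
  have "(hauptq 12 q + 4) * (hauptq 12 q + 2) = hauptq 6 q + 8" unfolding haupt_12_factors(3)[OF q] by algebra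
  hence "hauptq 12 q + 4 = (hauptq 6 q + 8) / (hauptq 12 q + 2)" using nz by (simp add: nonzero_eq_divide_eq)
  also have "\<dots> = 4 * eul (q ^ 4) ^ 3 * eul (q ^ 3) / (eul q ^ 3 * eul (q ^ 12))"
    unfolding haupt_12_factors(2)[OF q] haupt_6_factors[OF q] using q by (simp add: field_simps; algebra)
  finally show ?thesis .
qed

lemma haupt_4_12:
  assumes q: "norm q < 1" "q \<noteq> 0"
  defines "t \<equiv> hauptq 12 q"
  shows "hauptq 4 q = t * (t + 4) ^ 3 / (t + 3)" "hauptq 4 (q ^ 3) = t ^ 3 * (t + 4) / (t + 3) ^ 3"
proof -
  show "hauptq 4 q = t * (t + 4) ^ 3 / (t + 3)"
    unfolding t_def haupt_12_factors(1)[OF q] haupt_12_factor_4[OF q] using q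
    by (simp add: hauptq_simps power_mult_distrib power_divide field_simps flip: power_mult; algebra)
  show "hauptq 4 (q ^ 3) = t ^ 3 * (t + 4) / (t + 3) ^ 3"
    unfolding t_def haupt_12_factors(1)[OF q] haupt_12_factor_4[OF q] using q
    by (simp add: hauptq_simps power_mult_distrib power_divide field_simps flip: power_mult; algebra)
qed

section \<open>The modular invariant as a rational function of a Hauptmodul\<close>

lemma nome_in_disc:
  assumes "Im \<tau> > 0"
  shows "norm (nome \<tau>) < 1" "nome \<tau> \<noteq> 0"
  using assms by (simp_all add: nome_def)

lemma nome_of_nat: "nome (of_nat n * \<tau>) = nome \<tau> ^ n"
  unfolding nome_def exp_of_nat_mult [symmetric] by (simp add: mult_ac)

definition nome_root :: "complex \<Rightarrow> complex" where
  "nome_root \<tau> = exp (2 * of_real pi * \<i> * \<tau> / 24)"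

lemma nome_root_nonzero [simp]: "nome_root \<tau> \<noteq> 0"
  by (simp add: nome_root_def)

lemma nome_root_power: "nome_root \<tau> ^ 24 = nome \<tau>"
  unfolding nome_def nome_root_def exp_of_nat_mult [symmetric] by (simp add: mult_ac)

lemma dedekind_eta_of_nat:
  assumes "Im \<tau> > 0" "m > 0"
  shows "dedekind_eta (of_nat m * \<tau>) = nome_root \<tau> ^ m * eul (nome \<tau> ^ m)"
  unfolding dedekind_eta_def nome_root_def nome_of_nat eul_def qpoch_def exp_of_nat_mult [symmetric]
  by (simp add: mult_ac)

lemma dedekind_eta_eul: "Im \<tau> > 0 \<Longrightarrow> dedekind_eta \<tau> = nome_root \<tau> * eul (nome \<tau>)"
  using dedekind_eta_of_nat[of \<tau> 1] by simp

lemma hauptmodul_eq: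
  assumes \<tau>: "Im \<tau> > 0" and N: "N \<in> {2, 3, 4, 5, 6, 8, 9, 10, 12, 16, 18, 25}"
  shows "hauptmodul N \<tau> = hauptq N (nome \<tau>)"
proof -
  \<comment> \<open>With a 24th root of the nome every eta value is a power of \<open>s\<close>
    times an Euler product; in each Hauptmodul these powers combine to
    \<open>s ^ 24\<close>.\<close>
  define s where "s = nome_root \<tau>"
  have s: "s \<noteq> 0" "nome \<tau> = s ^ 24" by (simp_all add: s_def nome_root_power)
  have e: "dedekind_eta (numeral k * \<tau>) = s ^ numeral k * eul (s ^ (24 * numeral k))"
      "dedekind_eta \<tau> = s * eul (s ^ 24)" for k
    using dedekind_eta_of_nat[OF \<tau>, of "numeral k"] dedekind_eta_eul[OF \<tau>]
    by (simp_all add: s(2) flip: s_def power_mult)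
  have "norm s < 1"
    using nome_in_disc(1)[OF \<tau>] unfolding s(2) norm_power by (simp add: power_less_one_iff)
  with N s(1) show ?thesis unfolding s(2)
    by (elim insertE emptyE; simp add: hauptmodul_def hauptq_simps e Let_def flip: power_mult;
        simp add: power_mult_distrib field_simps flip: power_mult power_add; simp flip: power_Suc)
qed

text \<open>A divisor \<open>d\<close> of \<open>n + 1\<close> is paired with its codivisor. All
  indices are shifted by one, since the Lambert series counts from 0.\<close>

lemma bij_betw_divisor_pairs:
  "bij_betw (\<lambda>(n, d). (Suc n div d - 1, d - 1)) (SIGMA n:UNIV. {d. d dvd Suc n}) (UNIV :: (nat \<times> nat) set)"
proof (rule bij_betwI[where g = "\<lambda>(n, k). (Suc n * Suc k - 1, Suc k)"])
  show "(\<lambda>(n, k). (Suc n * Suc k - 1, Suc k)) \<in> UNIV \<rightarrow> (SIGMA n:UNIV. {d. d dvd Suc n})"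
    by (auto simp del: mult_Suc mult_Suc_right)
  fix x assume x: "x \<in> (SIGMA n:UNIV. {d. d dvd Suc n})"
  obtain n d where nd: "x = (n, d)" by force
  then obtain m where m: "Suc n = d * m" using x by (auto simp: dvd_def)
  hence "d > 0" "m > 0" by (auto intro: Nat.gr0I)
  thus "(\<lambda>(n, k). (Suc n * Suc k - 1, Suc k)) ((\<lambda>(n, d). (Suc n div d - 1, d - 1)) x) = x"
    using m by (simp add: nd mult.commute del: mult_Suc mult_Suc_right)
next
  fix y :: "nat \<times> nat"
  obtain n k where "y = (n, k)" by force
  thus "(\<lambda>(n, d). (Suc n div d - 1, d - 1)) ((\<lambda>(n, k). (Suc n * Suc k - 1, Suc k)) y) = y"
    by (simp del: mult_Suc mult_Suc_right)
qed auto

lemma eisenstein_E4_eq: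
  assumes \<tau>: "Im \<tau> > 0"
  shows "eisenstein_E4 \<tau> = euler_E4 (nome \<tau>)"
proof -
  define q where "q = nome \<tau>"
  have q: "norm q < 1" "q \<noteq> 0" using nome_in_disc[OF \<tau>] by (simp_all add: q_def)
  have "(lambert_term 4 q 0 has_sum lambert 4 q 0) UNIV"
    by (rule lambert_has_sum) (use q in auto)
  hence "((\<lambda>x. lambert_term 4 q 0 (case x of (n, d) \<Rightarrow> (Suc n div d - 1, d - 1))) has_sum lambert 4 q 0)
     (SIGMA n:UNIV. {d. d dvd Suc n})"
    by (subst has_sum_reindex_bij_betw[OF bij_betw_divisor_pairs])
  also have "?this \<longleftrightarrow> ((\<lambda>(n, d). - (of_nat d ^ 3 * q ^ Suc n)) has_sum lambert 4 q 0) (SIGMA n:UNIV. {d. d dvd Suc n})"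
  proof (rule has_sum_cong)
    fix x :: "nat \<times> nat" assume x: "x \<in> (SIGMA n:UNIV. {d. d dvd Suc n})"
    obtain n d where nd: "x = (n, d)" by force
    then obtain m where m: "Suc n = d * m" using x by (auto simp: dvd_def)
    hence pos: "d > 0" "m > 0" by (auto intro: Nat.gr0I)
    hence "Suc (Suc n div d - 1) * Suc (d - 1) = Suc n" "Suc (d - 1) = d" using m by simp_all
    moreover have "of_nat d ^ 4 / of_nat d = (of_nat d ^ 3 :: complex)" using pos by (simp add: eval_nat_numeral)
    ultimately show "lambert_term 4 q 0 (case x of (n, d) \<Rightarrow> (Suc n div d - 1, d - 1)) = (case x of (n, d) \<Rightarrow> - (of_nat d ^ 3 * q ^ Suc n))"
      unfolding nd lambert_term_def prod.case by (simp only: mult_zero_right exp_zero times_divide_eq_right[symmetric] mult.commute mult_zero_left) simp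
  qed
  finally have *: "((\<lambda>(n, d). - (of_nat d ^ 3 * q ^ Suc n)) has_sum lambert 4 q 0) (SIGMA n:UNIV. {d. d dvd Suc n})" .
  have "((\<lambda>n. - (of_nat (\<Sum>d | d dvd Suc n. d ^ 3) * q ^ Suc n)) has_sum lambert 4 q 0) UNIV"
  proof (rule has_sum_SigmaD[OF *])
    fix n
    have "((\<lambda>d. - (of_nat d ^ 3 * q ^ Suc n)) has_sum (\<Sum>d | d dvd Suc n. - (of_nat d ^ 3 * q ^ Suc n))) {d. d dvd Suc n}"
      by (rule has_sum_finite) simp
    thus "((\<lambda>y. case (n, y) of (n, d) \<Rightarrow> - (of_nat d ^ 3 * q ^ Suc n)) has_sum - (of_nat (\<Sum>d | d dvd Suc n. d ^ 3) * q ^ Suc n)) {d. d dvd Suc n}"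
      by (simp add: sum_negf sum_distrib_right del: power_Suc)
  qed
  hence "(\<lambda>n. - (of_nat (\<Sum>d | d dvd Suc n. d ^ 3) * q ^ Suc n)) sums lambert 4 q 0"
    by (rule has_sum_imp_sums)
  hence "(\<lambda>n. of_nat (\<Sum>d | d dvd Suc n. d ^ 3) * q ^ Suc n) sums (- lambert 4 q 0)"
    using sums_minus by fastforce
  hence "(\<Sum>n. of_nat (\<Sum>d | d dvd Suc n. d ^ 3) * q ^ Suc n) = - lambert 4 q 0" by (rule sums_unique[symmetric])
  thus ?thesis by (simp add: eisenstein_E4_def euler_E4_def q_def)
qed

lemma modular_j_E4:
  assumes \<tau>: "Im \<tau> > 0"
  shows "modular_j \<tau> = euler_E4 (nome \<tau>) ^ 3 / (nome \<tau> * eul (nome \<tau>) ^ 24)"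
  by (simp add: modular_j_def eisenstein_E4_eq[OF \<tau>] dedekind_eta_eul[OF \<tau>] power_mult_distrib nome_root_power)

lemma euler_E4_haupt_2:
  assumes q: "norm q < 1" "q \<noteq> 0"
  shows "euler_E4 q = eul q ^ 16 / eul (q ^ 2) ^ 8 * (1 + hauptq 2 q / 16)"
proof -
  have "256 * q * b ^ 16 / a ^ 8 = a ^ 16 / b ^ 8 * (4096 * q * b ^ 24 / a ^ 24 / 16)" if "a \<noteq> 0" "b \<noteq> 0" for a b :: complex
    using that by (simp add: field_simps)
  from this[of "eul q" "eul (q ^ 2)"] show ?thesis
    unfolding euler_E4_eq[OF q] hauptq_simps using q by (simp add: distrib_left)
qed

text \<open>The left side is \<open>j\<close>. In level 2 the eta factors of
  \<open>E4^3 / \<Delta>\<close> combine to \<open>1 / t\<close>; the other levels are all deduced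
  from this one.\<close>

lemma euler_E4_cube:
  assumes q: "norm q < 1" "q \<noteq> 0"
  shows "euler_E4 q ^ 3 / (q * eul q ^ 24) = (hauptq 2 q + 16) ^ 3 / hauptq 2 q"
proof -
  define t where "t = hauptq 2 q"
  have "euler_E4 q = eul q ^ 16 / eul (q ^ 2) ^ 8 * (t + 16) / 16"
    unfolding euler_E4_haupt_2[OF q] t_def by (simp add: distrib_left distrib_right add_divide_distrib)
  moreover have "(a ^ 16 / b ^ 8 * s / 16) ^ 3 / (q * a ^ 24) = s ^ 3 * (a ^ 24 / (4096 * q * b ^ 24))" for a b s :: complex
    by (simp add: power_mult_distrib power_divide flip: power_mult) (simp add: divide_simps)
  ultimately have "euler_E4 q ^ 3 / (q * eul q ^ 24) = (t + 16) ^ 3 * (eul q ^ 24 / (4096 * q * eul (q ^ 2) ^ 24))"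
    by simp
  also have "eul q ^ 24 / (4096 * q * eul (q ^ 2) ^ 24) = 1 / t" by (simp add: t_def hauptq_simps)
  finally show ?thesis by (simp add: t_def)
qed

lemma hauptmodul_of_nat_eq:
  assumes \<tau>: "Im \<tau> > 0" and "n > 0" and N: "N \<in> {2, 3, 4, 5, 6, 8, 9, 10, 12, 16, 18, 25}"
  shows "hauptmodul N (of_nat n * \<tau>) = hauptq N (nome \<tau> ^ n)"
  using hauptmodul_eq[of "of_nat n * \<tau>" N] assms by (simp add: nome_of_nat)

lemma nome_surj:
  assumes "norm q < 1" "q \<noteq> 0"
  obtains \<tau> where "Im \<tau> > 0" "nome \<tau> = q"
proof
  define \<tau> where "\<tau> = Ln q / (2 * of_real pi * \<i>)"
  have "\<tau> = - \<i> * Ln q / of_real (2 * pi)" by (simp add: \<tau>_def field_simps)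
  hence "Im \<tau> = - ln (norm q) / (2 * pi)" using assms by (simp add: Im_divide_of_real)
  thus "Im \<tau> > 0" using assms by (simp add: divide_neg_pos)
  show "nome \<tau> = q" using assms by (simp add: nome_def \<tau>_def)
qed

lemma hauptq_0 [simp]: "hauptq N 0 = 0"
  by (simp add: hauptq_def)

lemma
  assumes N: "N \<in> {2, 3, 4, 5, 6, 8, 9, 10, 12, 16, 18, 25}"
  shows holomorphic_hauptq: "hauptq N holomorphic_on ball 0 1"
    and hauptq_nonzero: "norm q < 1 \<Longrightarrow> q \<noteq> 0 \<Longrightarrow> hauptq N q \<noteq> 0"
proof -
  note eq = hauptq_simps[abs_def]
  show "hauptq N holomorphic_on ball 0 1"
    using N by (elim insertE emptyE; simp only: eq; auto intro!: holomorphic_intros holomorphic_eul)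
  show "hauptq N q \<noteq> 0" if q: "norm q < 1" "q \<noteq> 0"
    using N q by (elim insertE emptyE; simp add: hauptq_simps)
qed

text \<open>The open mapping theorem: the image of a small disc in \<open>q\<close> is a
  neighbourhood of \<open>t = 0\<close>.\<close>

lemma eventually_hauptq:
  assumes N: "N \<in> {2, 3, 4, 5, 6, 8, 9, 10, 12, 16, 18, 25}"
    and P: "eventually (\<lambda>q. P (hauptq N q)) (nhds 0)"
  shows "eventually P (nhds 0)"
proof -
  from P obtain e where e: "e > 0" "\<And>q. norm q < e \<Longrightarrow> P (hauptq N q)"
    unfolding eventually_nhds_metric by auto
  let ?U = "ball 0 (min e 1) :: complex set"
  have "open (hauptq N ` ?U)"
  proof (rule open_mapping_thm[OF holomorphic_hauptq[OF N]])
    show "\<not> hauptq N constant_on ball 0 1"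
    proof
      assume "hauptq N constant_on ball 0 1"
      then obtain c where "\<And>q. norm q < 1 \<Longrightarrow> hauptq N q = c" unfolding constant_on_def by auto
      from this[of 0] this[of "1 / 2"] show False using hauptq_nonzero[OF N, of "1 / 2"] by simp
    qed
  qed auto
  moreover have "0 \<in> hauptq N ` ?U" using e(1) by (force intro: image_eqI[of _ _ 0])
  moreover have "P t" if "t \<in> hauptq N ` ?U" for t using that e(2) by auto
  ultimately show ?thesis unfolding eventually_nhds by blast
qed

section \<open>Uniqueness of the presentation of j\<close>

lemma coprime_polyI:
  fixes p r :: "complex poly"
  assumes "p \<noteq> 0" and nz: "\<And>x. poly p x = 0 \<Longrightarrow> poly r x \<noteq> 0"
  shows "coprime p r"
proof (rule coprimeI)
  fix d assume d: "d dvd p" "d dvd r"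
  have "d \<noteq> 0" using d(1) \<open>p \<noteq> 0\<close> by auto
  show "is_unit d"
  proof (rule ccontr)
    assume "\<not> is_unit d"
    hence "degree d \<noteq> 0" using \<open>d \<noteq> 0\<close> by (simp add: is_unit_iff_degree)
    then obtain x where "poly d x = 0" using alg_closed_imp_poly_has_root[of d] by auto
    hence "poly p x = 0" "poly r x = 0" using d by (auto elim!: dvdE)
    thus False using nz by blast
  qed
qed

text \<open>A nonzero element of least degree in the ideal generated by the two polynomials divides
  both.\<close>

lemma coprime_poly_bezout:
  fixes p r :: "'a :: field poly"
  assumes "p \<noteq> 0" "coprime p r"
  obtains a b where "a * p + b * r = 1"
proof -
  define I where "I = {a * p + b * r | a b. True}"
  have "p = 1 * p + 0 * r" "r = 0 * p + 1 * r" by simp_all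
  hence "p \<in> I" "r \<in> I" unfolding I_def by blast+
  then obtain d where d: "d \<in> I" "d \<noteq> 0" and least: "\<And>e. e \<in> I \<Longrightarrow> e \<noteq> 0 \<Longrightarrow> degree d \<le> degree e"
    using ex_has_least_nat[of "\<lambda>d. d \<in> I \<and> d \<noteq> 0" p degree] assms(1) by auto
  obtain a b where ab: "d = a * p + b * r" using d(1) by (auto simp: I_def)
  have dvd: "d dvd e" if "e \<in> I" for e
  proof -
    obtain a' b' where e: "e = a' * p + b' * r" using \<open>e \<in> I\<close> by (auto simp: I_def)
    have "e mod d = e - e div d * d" by (simp add: minus_div_mult_eq_mod)
    also have "\<dots> = (a' - e div d * a) * p + (b' - e div d * b) * r"
      by (subst (2) ab) (simp add: e algebra_simps)
    finally have "e mod d \<in> I" unfolding I_def by blast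
    hence "e mod d = 0" using least[of "e mod d"] degree_mod_less[OF d(2), of e] by fastforce
    thus ?thesis by auto
  qed
  have "is_unit d" using dvd \<open>p \<in> I\<close> \<open>r \<in> I\<close> assms(2) coprime_common_divisor by blast
  then obtain k where "1 = d * k" ..
  hence "(a * k) * p + (b * k) * r = 1" by (simp add: ab algebra_simps)
  thus thesis by (rule that)
qed

lemma j_presentationI:
  assumes M: "M \<in> {2, 3, 4, 5, 6, 8, 9}"
    and 0: "poly P 0 \<noteq> 0" and cop: "\<And>x. poly Q x = 0 \<Longrightarrow> poly P x \<noteq> 0"
    and j: "\<And>q. norm q < 1 \<Longrightarrow> q \<noteq> 0 \<Longrightarrow> poly Q (hauptq M q) \<noteq> 0 \<and>
      (hauptq 2 q + 16) ^ 3 / hauptq 2 q = poly P (hauptq M q) / poly Q (hauptq M q)"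
  shows "j_presentation M P Q"
  unfolding j_presentation_def
proof (intro conjI allI impI)
  have "P \<noteq> 0" using 0 by auto
  thus "coprime P Q" by (rule coprime_polyI) (use cop in blast)
  fix \<tau> assume \<tau>: "Im \<tau> > 0"
  have "hauptmodul M \<tau> = hauptq M (nome \<tau>)" using M by (intro hauptmodul_eq[OF \<tau>]) auto
  thus "poly Q (hauptmodul M \<tau>) \<noteq> 0" "modular_j \<tau> = poly P (hauptmodul M \<tau>) / poly Q (hauptmodul M \<tau>)"
    using j[OF nome_in_disc[OF \<tau>]] by (simp_all add: modular_j_E4[OF \<tau>] euler_E4_cube[OF nome_in_disc[OF \<tau>]])
qed

text \<open>The nome takes every value in the punctured disc, so \<open>P Q' = P' Q\<close> holds at
  infinitely many points and hence identically. Coprimality of both pairs then leaves only a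
  unit.\<close>

lemma j_presentation_unique:
  assumes M: "M \<in> {2, 3, 4, 5, 6, 8, 9}" and P0: "poly P 0 \<noteq> 0"
    and pres: "j_presentation M P Q" "j_presentation M P' Q'"
  obtains c where "c \<noteq> 0" "P' = smult c P" "Q' = smult c Q"
proof -
  have M': "M \<in> {2, 3, 4, 5, 6, 8, 9, 10, 12, 16, 18, 25}" using M by auto
  have "poly (P * Q') (hauptq M q) = poly (P' * Q) (hauptq M q)" if q: "norm q < 1" "q \<noteq> 0" for q
  proof -
    obtain \<tau> where \<tau>: "Im \<tau> > 0" "nome \<tau> = q" using nome_surj[OF q] .
    have "hauptmodul M \<tau> = hauptq M q" using hauptmodul_eq[OF \<tau>(1) M'] \<tau>(2) by simp
    with pres \<tau>(1) show ?thesis unfolding j_presentation_def by (metis frac_eq_eq poly_mult)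
  qed
  hence "eventually (\<lambda>q. q \<noteq> 0 \<longrightarrow> poly (P * Q') (hauptq M q) = poly (P' * Q) (hauptq M q)) (nhds 0)"
    by (intro eventually_nhds_metric[THEN iffD2] exI[of _ 1]) auto
  hence "eventually (\<lambda>q. hauptq M q \<noteq> 0 \<longrightarrow> poly (P * Q') (hauptq M q) = poly (P' * Q) (hauptq M q)) (nhds 0)"
    by (rule eventually_mono) (metis hauptq_0)
  hence "eventually (\<lambda>t. t \<noteq> 0 \<longrightarrow> poly (P * Q') t = poly (P' * Q) t) (nhds 0)"
    by (rule eventually_hauptq[OF M'])
  then obtain e where e: "e > 0" "\<And>t. norm t < e \<Longrightarrow> t \<noteq> 0 \<Longrightarrow> poly (P * Q') t = poly (P' * Q) t"
    unfolding eventually_nhds_metric by auto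
  have eq: "P * Q' = P' * Q"
  proof (rule ccontr)
    assume "P * Q' \<noteq> P' * Q"
    hence "finite {t. poly (P * Q' - P' * Q) t = 0}" by (intro poly_roots_finite) simp
    moreover have "ball 0 e - {0} \<subseteq> {t. poly (P * Q' - P' * Q) t = 0}" using e(2) by auto
    ultimately have "finite (ball (0 :: complex) e - {0})" by (rule rev_finite_subset)
    hence "countable (ball (0 :: complex) e)" by (simp add: countable_finite)
    thus False using e(1) uncountable_ball by blast
  qed
  have cop: "coprime P Q" "coprime P' Q'" using pres by (auto simp: j_presentation_def)
  have "P dvd P' * Q" unfolding eq[symmetric] by simp
  have Pnz: "P \<noteq> 0" using P0 by auto
  obtain a b where ab: "a * P + b * Q = 1" using coprime_poly_bezout[OF Pnz cop(1)] .
  have "P dvd P * (a * P') + b * (P' * Q)" by (rule dvd_add[OF dvd_triv_left dvd_mult[OF \<open>P dvd P' * Q\<close>]])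
  also have "P * (a * P') + b * (P' * Q) = (a * P + b * Q) * P'" by (simp only: distrib_left distrib_right mult_ac)
  finally have "P dvd P'" unfolding ab by simp
  then obtain K where K: "P' = P * K" ..
  have Q': "Q' = K * Q" using eq Pnz unfolding K by (simp add: mult.assoc)
  have "K dvd P'" "K dvd Q'" unfolding K Q' by simp_all
  hence "is_unit K" using cop(2) by (meson coprime_common_divisor)
  then obtain c where c: "K = [:c:]" "c dvd 1" by (auto simp: is_unit_poly_iff)
  hence "c \<noteq> 0" by (metis dvd_0_left zero_neq_one)
  with c(1) show thesis by (intro that[of c]) (simp_all add: K Q')
qed

text \<open>The pair chosen in \<open>j_polys\<close> differs from an explicit presentation by a
  constant factor, which cancels in both quotients.\<close>

lemma h_eq:
  assumes M: "M \<in> {2, 3, 4, 5, 6, 8, 9}" and P0: "poly P 0 \<noteq> 0" and pres: "j_presentation M P Q"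
  shows "h M t = (poly P t / poly P 0) powr (- 1 / 12) * hyp2f1 (1 / 12) (5 / 12) 1 (12 ^ 3 * poly Q t / poly P t)"
proof -
  have "case j_polys M of (P, Q) \<Rightarrow> j_presentation M P Q"
    unfolding j_polys_def by (rule someI[of _ "(P, Q)"]) (use pres in simp)
  hence "j_presentation M (j_num M) (j_den M)" by (simp add: j_num_def j_den_def case_prod_unfold)
  from j_presentation_unique[OF M P0 pres this] obtain c
    where "c \<noteq> 0" "j_num M = smult c P" "j_den M = smult c Q" .
  thus ?thesis by (simp add: h_def)
qed

section \<open>Explicit presentations of j at each level\<close>

lemma j_presentation_2: "j_presentation 2 ([:16, 1:] ^ 3) [:0, 1:]"
  by (rule j_presentationI) (auto simp: hauptq_nonzero add.commute)

lemma j_division: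
  fixes T D :: complex
  assumes "T * D = N" "(T + 16) * D = K" "D \<noteq> 0"
  shows "(T + 16) ^ 3 / T = K ^ 3 / (N * D ^ 2)"
proof -
  have "N * D ^ 2 = T * D ^ 3" "K ^ 3 = (T + 16) ^ 3 * D ^ 3"
    unfolding assms(1,2)[symmetric] by (simp_all add: power_mult_distrib eval_nat_numeral)
  thus ?thesis using assms(3) by simp
qed

lemma j_presentation_4: "j_presentation 4 ([:16, 16, 1:] ^ 3) ([:0, 1:] * [:16, 1:])"
proof (rule j_presentationI)
  show "poly ([:16, 16, 1:] ^ 3) x \<noteq> 0" if "poly ([:0, 1:] * [:16, 1:]) x = 0" for x :: complex
  proof -
    have "x = 0 \<or> x = - 16" using that by (auto simp: eq_neg_iff_add_eq_0 add.commute)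
    thus ?thesis by auto
  qed
  fix q :: complex assume q: "norm q < 1" "q \<noteq> 0"
  define t where "t = hauptq 4 q"
  have nz: "hauptq 2 q \<noteq> 0" using hauptq_nonzero[of 2 q] q by simp
  have t2: "hauptq 2 q = t * (t + 16)" using haupt_2_4[OF q] by (simp add: t_def)
  have "poly [:16, 16, 1:] t = hauptq 2 q + 16" unfolding t2 by (simp add: algebra_simps)
  moreover have "poly ([:0, 1:] * [:16, 1:]) t = hauptq 2 q" unfolding t2 by (simp add: algebra_simps)
  ultimately show "poly ([:0, 1:] * [:16, 1:]) (hauptq 4 q) \<noteq> 0 \<and> (hauptq 2 q + 16) ^ 3 / hauptq 2 q =
      poly ([:16, 16, 1:] ^ 3) (hauptq 4 q) / poly ([:0, 1:] * [:16, 1:]) (hauptq 4 q)"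
    unfolding t_def[symmetric] using nz by (simp add: add.commute)
qed auto

lemma j_presentation_8:
  "j_presentation 8 ([:16, 128, 80, 16, 1:] ^ 3) ([:0, 1:] * [:8, 1:] * [:4, 1:] ^ 2)"
proof (rule j_presentationI)
  show "poly ([:16, 128, 80, 16, 1:] ^ 3) x \<noteq> 0" if "poly ([:0, 1:] * [:8, 1:] * [:4, 1:] ^ 2) x = 0" for x :: complex
  proof -
    have "x * (x + 8) * (x + 4) ^ 2 = 0" using that by (simp add: algebra_simps)
    hence "x = 0 \<or> x = - 8 \<or> x = - 4" by (auto simp: eq_neg_iff_add_eq_0 add.commute)
    thus ?thesis by auto
  qed
  fix q :: complex assume q: "norm q < 1" "q \<noteq> 0"
  define t where "t = hauptq 8 q"
  have nz: "hauptq 2 q \<noteq> 0" using hauptq_nonzero[of 2 q] q by simp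
  have t2: "hauptq 2 q = t * (t + 8) * (t * (t + 8) + 16)"
    using haupt_2_4[OF q] haupt_4_8[OF q] by (simp add: t_def)
  have "poly [:16, 128, 80, 16, 1:] t = hauptq 2 q + 16" unfolding t2 by (simp; algebra)
  moreover have "poly ([:0, 1:] * [:8, 1:] * [:4, 1:] ^ 2) t = hauptq 2 q" unfolding t2 by (simp; algebra)
  ultimately show "poly ([:0, 1:] * [:8, 1:] * [:4, 1:] ^ 2) (hauptq 8 q) \<noteq> 0 \<and> (hauptq 2 q + 16) ^ 3 / hauptq 2 q =
      poly ([:16, 128, 80, 16, 1:] ^ 3) (hauptq 8 q) / poly ([:0, 1:] * [:8, 1:] * [:4, 1:] ^ 2) (hauptq 8 q)"
    unfolding t_def[symmetric] poly_power using nz by (simp add: add.commute)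
qed auto

lemma j_haupt_6:
  assumes q: "norm q < 1" "q \<noteq> 0"
  defines "t \<equiv> hauptq 6 q"
  shows "t \<noteq> 0" "t + 8 \<noteq> 0" "t + 9 \<noteq> 0"
    "(hauptq 2 q + 16) ^ 3 / hauptq 2 q =
      ((t + 6) * (t ^ 3 + 18 * t ^ 2 + 84 * t + 24)) ^ 3 / (t * (t + 8) ^ 3 * (t + 9) ^ 2)"
proof -
  show nz: "t \<noteq> 0" "t + 8 \<noteq> 0" "t + 9 \<noteq> 0"
    using hauptq_nonzero[of 6 q] q by (simp_all add: t_def haupt_6_factors)
  have "hauptq 2 q * (t + 9) = t * (t + 8) ^ 3" using haupt_2_6[OF q] nz by (simp add: t_def)
  moreover from this have "(hauptq 2 q + 16) * (t + 9) = (t + 6) * (t ^ 3 + 18 * t ^ 2 + 84 * t + 24)" by algebra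
  ultimately show "(hauptq 2 q + 16) ^ 3 / hauptq 2 q =
      ((t + 6) * (t ^ 3 + 18 * t ^ 2 + 84 * t + 24)) ^ 3 / (t * (t + 8) ^ 3 * (t + 9) ^ 2)"
    using nz(3) by (rule j_division)
qed

lemma j_presentation_6:
  "j_presentation 6 (([:6, 1:] * [:24, 84, 18, 1:]) ^ 3) ([:0, 1:] * [:8, 1:] ^ 3 * [:9, 1:] ^ 2)"
proof (rule j_presentationI)
  show "poly (([:6, 1:] * [:24, 84, 18, 1:]) ^ 3) x \<noteq> 0" if "poly ([:0, 1:] * [:8, 1:] ^ 3 * [:9, 1:] ^ 2) x = 0" for x :: complex
  proof -
    have "x = 0 \<or> x = - 8 \<or> x = - 9" using that by (auto simp: eq_neg_iff_add_eq_0 add.commute)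
    thus ?thesis by auto
  qed
  fix q :: complex assume q: "norm q < 1" "q \<noteq> 0"
  define t where "t = hauptq 6 q"
  have "poly ([:6, 1:] * [:24, 84, 18, 1:]) t = (t + 6) * (t ^ 3 + 18 * t ^ 2 + 84 * t + 24)" by (simp; algebra)
  moreover have "poly ([:0, 1:] * [:8, 1:] ^ 3 * [:9, 1:] ^ 2) t = t * (t + 8) ^ 3 * (t + 9) ^ 2" by (simp add: add.commute)
  ultimately show "poly ([:0, 1:] * [:8, 1:] ^ 3 * [:9, 1:] ^ 2) (hauptq 6 q) \<noteq> 0 \<and> (hauptq 2 q + 16) ^ 3 / hauptq 2 q =
      poly (([:6, 1:] * [:24, 84, 18, 1:]) ^ 3) (hauptq 6 q) / poly ([:0, 1:] * [:8, 1:] ^ 3 * [:9, 1:] ^ 2) (hauptq 6 q)"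
    unfolding poly_power[of _ 3] j_haupt_6(4)[OF q] using j_haupt_6(1-3)[OF q] unfolding t_def[symmetric] by simp
qed auto

text \<open>Level 3 does not lie above level 2; both sides are pulled back to level 6 and compared
  there.\<close>

lemma j_haupt_3:
  assumes q: "norm q < 1" "q \<noteq> 0"
  defines "T \<equiv> hauptq 3 q"
  shows "(hauptq 2 q + 16) ^ 3 / hauptq 2 q = (T + 27) * (T + 3) ^ 3 / T"
proof -
  define t where "t = hauptq 6 q"
  note nz = j_haupt_6(1-3)[OF q, folded t_def]
  have T: "T * (t + 8) = t * (t + 9) ^ 2" using haupt_3_6[OF q] nz by (simp add: t_def T_def)
  define K where "K = t ^ 3 + 18 * t ^ 2 + 84 * t + 24"
  have T3: "(T + 3) * (t + 8) = K" unfolding K_def using T by algebra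
  have T27: "(T + 27) * (t + 8) = (t + 6) ^ 3" using T by algebra
  have "(T + 27) * (T + 3) ^ 3 / T = (((T + 27) * (t + 8)) * ((T + 3) * (t + 8)) ^ 3) / ((T * (t + 8)) * (t + 8) ^ 3)"
    using nz(2) by (simp add: power_mult_distrib)
  also have "\<dots> = ((t + 6) * K) ^ 3 / (t * (t + 8) ^ 3 * (t + 9) ^ 2)"
    unfolding T T3 T27 by (simp add: power_mult_distrib mult_ac)
  finally show ?thesis using j_haupt_6(4)[OF q] by (simp add: K_def t_def)
qed

lemma j_presentation_3: "j_presentation 3 ([:27, 1:] * [:3, 1:] ^ 3) [:0, 1:]"
proof (rule j_presentationI)
  fix q :: complex assume q: "norm q < 1" "q \<noteq> 0"
  show "poly [:0, 1:] (hauptq 3 q) \<noteq> 0 \<and> (hauptq 2 q + 16) ^ 3 / hauptq 2 q =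
      poly ([:27, 1:] * [:3, 1:] ^ 3) (hauptq 3 q) / poly [:0, 1:] (hauptq 3 q)"
    unfolding j_haupt_3[OF q] poly_mult[of "[:27, 1:]"] using hauptq_nonzero[of 3 q] q by (simp del: mult_pCons_left add: add.commute)
qed auto

lemma j_presentation_9: "j_presentation 9 (([:3, 1:] * [:3, 27, 9, 1:]) ^ 3) ([:0, 1:] * [:27, 9, 1:])"
proof (rule j_presentationI)
  show "poly (([:3, 1:] * [:3, 27, 9, 1:]) ^ 3) x \<noteq> 0" if "poly ([:0, 1:] * [:27, 9, 1:]) x = 0" for x :: complex
  proof -
    have x: "x * (x ^ 2 + 9 * x + 27) = 0" using that by (simp add: algebra_simps power2_eq_square)
    \<comment> \<open>The cubic exceeds the denominator by 3, so the two have no common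
      zero.\<close>
    have 3: "poly [:3, 27, 9, 1:] x = x * (x ^ 2 + 9 * x + 27) + 3" by (simp; algebra)
    have "poly [:3, 27, 9, 1:] x \<noteq> 0" unfolding 3 x by simp
    moreover have "poly [:3, 1:] x \<noteq> 0"
    proof
      assume "poly [:3, 1:] x = 0"
      hence "x = - 3" by (simp add: eq_neg_iff_add_eq_0 add.commute)
      with x show False by simp
    qed
    ultimately show ?thesis by (simp only: poly_power poly_mult) simp
  qed
  fix q :: complex assume q: "norm q < 1" "q \<noteq> 0"
  define t where "t = hauptq 9 q"
  define T where "T = hauptq 3 q"
  have T: "T = t * (t ^ 2 + 9 * t + 27)" using haupt_3_9[OF q] by (simp add: t_def T_def)
  have nz: "T \<noteq> 0" using hauptq_nonzero[of 3 q] q by (simp add: T_def)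
  have T3: "T + 3 = poly [:3, 27, 9, 1:] t" unfolding T by (simp; algebra)
  have T27: "T + 27 = poly [:3, 1:] t ^ 3" unfolding T by (simp; algebra)
  have TQ: "poly ([:0, 1:] * [:27, 9, 1:]) t = T" unfolding T by (simp; algebra)
  have "(hauptq 2 q + 16) ^ 3 / hauptq 2 q = (T + 27) * (T + 3) ^ 3 / T" unfolding T_def by (rule j_haupt_3[OF q])
  thus "poly ([:0, 1:] * [:27, 9, 1:]) (hauptq 9 q) \<noteq> 0 \<and> (hauptq 2 q + 16) ^ 3 / hauptq 2 q =
      poly (([:3, 1:] * [:3, 27, 9, 1:]) ^ 3) (hauptq 9 q) / poly ([:0, 1:] * [:27, 9, 1:]) (hauptq 9 q)"
    unfolding t_def[symmetric] TQ poly_power poly_mult[of "[:3, 1:]"] T3 T27 using nz by (simp only: power_mult_distrib) simp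
qed auto

text \<open>The comparison with level 2 takes place on the common cover of level 10.\<close>

lemma j_presentation_5: "j_presentation 5 ([:5, 10, 1:] ^ 3) [:0, 1:]"
proof (rule j_presentationI)
  fix q :: complex assume q: "norm q < 1" "q \<noteq> 0"
  define t where "t = hauptq 10 q"
  define T where "T = hauptq 5 q"
  have nz: "t + 4 \<noteq> 0" "t + 5 \<noteq> 0" "T \<noteq> 0"
    using hauptq_nonzero[of 5 q] q by (simp_all add: t_def T_def haupt_10_factors)
  have T: "T * (t + 4) = t * (t + 5) ^ 2" using haupt_5_10[OF q] nz by (simp add: t_def T_def)
  have S: "hauptq 2 q * (t + 5) = t * (t + 4) ^ 5" using haupt_2_10[OF q] nz by (simp add: t_def)
  have K: "(hauptq 2 q + 16) * (t + 5) = (T ^ 2 + 10 * T + 5) * (t + 4) ^ 2" using S T by algebra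
  have "(hauptq 2 q + 16) ^ 3 / hauptq 2 q = ((T ^ 2 + 10 * T + 5) * (t + 4) ^ 2) ^ 3 / (t * (t + 4) ^ 5 * (t + 5) ^ 2)"
    by (rule j_division[OF S K nz(2)])
  also have "t * (t + 4) ^ 5 * (t + 5) ^ 2 = T * (t + 4) ^ 6" using T by algebra
  also have "((T ^ 2 + 10 * T + 5) * (t + 4) ^ 2) ^ 3 / (T * (t + 4) ^ 6) = (T ^ 2 + 10 * T + 5) ^ 3 / T"
    using nz by (simp add: power_mult_distrib flip: power_mult)
  also have "T ^ 2 + 10 * T + 5 = poly [:5, 10, 1:] T" by (simp; algebra)
  finally show "poly [:0, 1:] (hauptq 5 q) \<noteq> 0 \<and> (hauptq 2 q + 16) ^ 3 / hauptq 2 q =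
      poly ([:5, 10, 1:] ^ 3) (hauptq 5 q) / poly [:0, 1:] (hauptq 5 q)"
    unfolding T_def[symmetric] using nz by simp
qed auto

section \<open>The hypergeometric equation\<close>

definition gauss_fps :: "complex fps" where
  "gauss_fps = fps_hypergeo [1 / 12, 5 / 12] [1] 1"

text \<open>Euler's operator \<open>\<theta> = z d/dz\<close>. In terms of it the recurrence of the
  coefficients is the equation
  \<open>\<theta>^2 f = z (\<theta> + 1/12) (\<theta> + 5/12) f\<close>.\<close>

definition fps_theta :: "complex fps \<Rightarrow> complex fps" where
  "fps_theta f = fps_X * fps_deriv f"

lemma fps_theta_nth: "fps_nth (fps_theta f) n = of_nat n * fps_nth f n"
  by (cases n) (simp_all add: fps_theta_def)

lemma gauss_fps_Suc:
  "fps_nth gauss_fps (Suc n) * of_nat (Suc n) ^ 2 = (of_nat n + 1 / 12) * (of_nat n + 5 / 12) * fps_nth gauss_fps n"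
proof -
  have "1 + of_nat n = (of_nat (Suc n) :: complex)" by simp
  moreover have "of_nat (Suc n) \<noteq> (0 :: complex)" by (simp del: of_nat_Suc)
  ultimately show ?thesis
    unfolding gauss_fps_def fps_hypergeo_rec by (simp add: power2_eq_square add.commute del: of_nat_Suc)
qed

lemma gauss_fps_0: "fps_nth gauss_fps 0 = 1"
  by (simp add: gauss_fps_def)

lemma gauss_fps_ode:
  "fps_theta (fps_theta gauss_fps) =
     fps_X * (fps_theta (fps_theta gauss_fps) + fps_const (1 / 2) * fps_theta gauss_fps + fps_const (5 / 144) * gauss_fps)"
proof (rule fps_ext)
  fix n
  show "fps_nth (fps_theta (fps_theta gauss_fps)) n = fps_nth (fps_X * (fps_theta (fps_theta gauss_fps)
      + fps_const (1 / 2) * fps_theta gauss_fps + fps_const (5 / 144) * gauss_fps)) n"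
  proof (cases n)
    case (Suc m)
    have "(x + 1 / 12) * (x + 5 / 12) = x * x + 1 / 2 * x + 5 / 144" for x :: complex
      by algebra
    hence "fps_nth gauss_fps (Suc m) * of_nat (Suc m) ^ 2
      = (of_nat m * of_nat m + 1 / 2 * of_nat m + 5 / 144) * fps_nth gauss_fps m"
      unfolding gauss_fps_Suc by simp
    thus ?thesis
      by (simp add: Suc fps_theta_nth power2_eq_square distrib_left distrib_right mult_ac del: of_nat_Suc)
  qed (simp add: fps_theta_nth)
qed

text \<open>The ratio of consecutive coefficients, \<open>(n + 1/12) (n + 5/12) / (n + 1)^2\<close>,
  never exceeds 1.\<close>

lemma norm_gauss_fps_le: "norm (fps_nth gauss_fps n) \<le> 1"
proof (induction n)
  case (Suc n)
  have eq: "of_nat (Suc n) ^ 2 = complex_of_real (real (Suc n) ^ 2)"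
    "(of_nat n + 1 / 12) * (of_nat n + 5 / 12) = complex_of_real ((real n + 1 / 12) * (real n + 5 / 12))"
    by simp_all
  have "norm (fps_nth gauss_fps (Suc n)) * real (Suc n) ^ 2 = norm (fps_nth gauss_fps (Suc n) * of_nat (Suc n) ^ 2)"
    unfolding norm_mult eq norm_of_real by (simp del: of_nat_Suc)
  also have "\<dots> = norm ((of_nat n + 1 / 12) * (of_nat n + 5 / 12) * fps_nth gauss_fps n)"
    by (simp only: gauss_fps_Suc)
  also have "\<dots> = (real n + 1 / 12) * (real n + 5 / 12) * norm (fps_nth gauss_fps n)"
    unfolding eq(2) norm_mult[of "of_real r" for r] norm_of_real by (simp add: abs_mult)
  also have "\<dots> \<le> real (Suc n) ^ 2 * 1"
  proof (rule mult_mono[OF _ Suc.IH])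
    show "(real n + 1 / 12) * (real n + 5 / 12) \<le> real (Suc n) ^ 2"
      unfolding power2_eq_square by (intro mult_mono) auto
  qed auto
  finally show ?case by (simp add: mult.commute)
qed (simp add: gauss_fps_0)

lemma fps_conv_radius_gauss: "fps_conv_radius gauss_fps \<ge> 1"
  unfolding fps_conv_radius_def
proof (rule conv_radius_geI_ex')
  fix r :: real assume r: "0 < r" "ereal r < 1"
  show "summable (\<lambda>n. fps_nth gauss_fps n * of_real r ^ n)"
  proof (rule summable_comparison_test[OF _ summable_geometric[of r]])
    show "\<exists>N. \<forall>n\<ge>N. norm (fps_nth gauss_fps n * of_real r ^ n) \<le> r ^ n"
      using norm_gauss_fps_le r(1) by (auto simp: norm_mult norm_power mult_left_le_one_le)
  qed (use r in auto)
qed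

lemma fps_conv_radius_theta: "fps_conv_radius f \<ge> 1 \<Longrightarrow> fps_conv_radius (fps_theta f) \<ge> 1"
  unfolding fps_theta_def
  by (rule order.trans[OF _ fps_conv_radius_mult]) (use fps_conv_radius_deriv[of f] in auto)

lemma eval_fps_theta_derivative:
  assumes f: "fps_conv_radius f \<ge> 1" and z: "norm z < 1" "z \<noteq> 0"
  shows "(eval_fps f has_field_derivative eval_fps (fps_theta f) z / z) (at z)"
proof -
  have "ereal (norm z) < fps_conv_radius f" using z f by (metis ereal_less(3) less_le_trans)
  moreover from this have "ereal (norm z) < fps_conv_radius (fps_deriv f)"
    using fps_conv_radius_deriv[of f] by (rule less_le_trans)
  ultimately show ?thesis
    using has_field_derivative_eval_fps[of z f] z by (simp add: fps_theta_def eval_fps_mult)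
qed

definition gauss_F where "gauss_F = eval_fps gauss_fps"
definition gauss_F1 where "gauss_F1 = eval_fps (fps_theta gauss_fps)"
definition gauss_F2 where "gauss_F2 = eval_fps (fps_theta (fps_theta gauss_fps))"

lemma gauss_F_eq: "hyp2f1 (1 / 12) (5 / 12) 1 = gauss_F"
  by (simp add: fun_eq_iff hyp2f1_def gauss_F_def gauss_fps_def)

lemma gauss_F_holomorphic [holomorphic_intros]:
  "gauss_F holomorphic_on ball 0 1" "gauss_F1 holomorphic_on ball 0 1"
  unfolding gauss_F_def gauss_F1_def
  using fps_conv_radius_gauss fps_conv_radius_theta[OF fps_conv_radius_gauss]
  by (metis holomorphic_on_eval_fps ball_eball_mono one_ereal_def)+

lemma gauss_F_0: "gauss_F 0 = 1" "gauss_F1 0 = 0"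
  by (simp_all add: gauss_F_def gauss_F1_def eval_fps_at_0 gauss_fps_0 fps_theta_nth)

lemma gauss_F_derivative:
  assumes "norm z < 1" "z \<noteq> 0"
  shows "(gauss_F has_field_derivative gauss_F1 z / z) (at z)" "(gauss_F1 has_field_derivative gauss_F2 z / z) (at z)"
  unfolding gauss_F_def gauss_F1_def gauss_F2_def
  using eval_fps_theta_derivative[OF _ assms] fps_conv_radius_gauss fps_conv_radius_theta[OF fps_conv_radius_gauss] by blast+

lemma gauss_ode:
  assumes z: "norm z < 1"
  shows "gauss_F2 z = z * (gauss_F2 z + gauss_F1 z / 2 + 5 / 144 * gauss_F z)"
proof -
  have r: "ereal (norm z) < fps_conv_radius f" if "fps_conv_radius f \<ge> 1" for f :: "complex fps"
    using z that by (metis ereal_less(3) less_le_trans)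
  note c0 = fps_conv_radius_gauss
  note c1 = fps_conv_radius_theta[OF c0]
  note c2 = fps_conv_radius_theta[OF c1]
  have m: "fps_conv_radius (fps_const c * f) \<ge> 1" if "fps_conv_radius f \<ge> 1" for c and f :: "complex fps"
    by (rule order.trans[OF _ fps_conv_radius_mult]) (use that in simp)
  have a: "fps_conv_radius (f + g) \<ge> 1" if "fps_conv_radius f \<ge> 1" "fps_conv_radius g \<ge> 1" for f g :: "complex fps"
    by (rule order.trans[OF _ fps_conv_radius_add]) (use that in simp)
  show ?thesis unfolding gauss_F2_def
    by (subst gauss_fps_ode)
      (simp add: eval_fps_mult eval_fps_add r m a c0 c1 c2 gauss_F_def gauss_F1_def)
qed

section \<open>Comparison of the Gauss series with the Eisenstein series\<close>

context
begin

private definition t2 where "t2 = hauptq 2"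
private definition G2 where "G2 q = 2 * euler_P (q ^ 2) - euler_P q"
private definition w2 where "w2 q = eul q ^ 16 / eul (q ^ 2) ^ 8"
text \<open>Classically \<open>s\<close> is \<open>E6 / E4\<close>, the logarithmic derivative of
  \<open>u = 1728 / j\<close>, and \<open>L\<close> is \<open>(P - E6 / E4) / 3\<close>, the
  logarithmic derivative of \<open>E4\<close>. The series of weight 6 itself is avoided by the
  closed form in level 2.\<close>

private definition s where "s q = G2 q * (16 - 2 * t2 q) / (t2 q + 16)"
private definition u where "u q = 1728 * t2 q / (t2 q + 16) ^ 3"
private definition L where "L q = (euler_P q - s q) / 3"
text \<open>Here \<open>E4\<close> has no zeros, as it equals \<open>t2 + 16\<close> up to a
  nonvanishing factor.\<close>

private definition S0 where "S0 = ball 0 1 \<inter> (\<lambda>q. t2 q + 16) -` (- {0})"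

private lemma t_hol: "t2 holomorphic_on ball 0 1" unfolding t2_def by (rule holomorphic_hauptq) simp

private definition e where "e q = w2 q * (t2 q + 16) / 16"

private lemma w_hol: "w2 holomorphic_on ball 0 1"
  unfolding w2_def[abs_def] by (auto intro!: holomorphic_intros holomorphic_eul)

private lemma e_hol: "e holomorphic_on ball 0 1"
  unfolding e_def[abs_def] by (intro holomorphic_intros w_hol t_hol) auto

private lemma e_eq: "norm q < 1 \<Longrightarrow> q \<noteq> 0 \<Longrightarrow> euler_E4 q = e q"
  by (simp add: euler_E4_haupt_2 e_def w2_def t2_def add_divide_distrib distrib_left)

private lemma G_hol: "G2 holomorphic_on ball 0 1"
proof -
  have "(\<lambda>q. euler_P (q ^ 2)) holomorphic_on ball 0 1"
    by (rule holomorphic_on_compose_gen[OF _ holomorphic_euler_P, unfolded o_def])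
      (auto intro!: holomorphic_intros simp: norm_power power_less_one_iff)
  thus ?thesis unfolding G2_def[abs_def] by (intro holomorphic_intros holomorphic_euler_P)
qed

private lemma S0: "open S0" "0 \<in> S0" "S0 \<subseteq> ball 0 1" "q \<in> S0 \<Longrightarrow> t2 q + 16 \<noteq> 0"
proof -
  show "open S0" unfolding S0_def
    by (rule continuous_open_preimage)
      (auto intro!: holomorphic_on_imp_continuous_on holomorphic_intros t_hol)
qed (auto simp: S0_def t2_def)

private lemma s_hol: "s holomorphic_on S0" and u_hol: "u holomorphic_on S0"
  unfolding s_def[abs_def] u_def[abs_def]
  by (intro holomorphic_intros G_hol[THEN holomorphic_on_subset] t_hol[THEN holomorphic_on_subset]; use S0 in auto)+

private lemma euler_P_0: "euler_P 0 = 1" by (simp add: euler_P_def dlog_eul_def)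

private lemma at_0: "t2 0 = 0" "G2 0 = 1" "w2 0 = 1" "s 0 = 1" "u 0 = 0" "L 0 = 0" "e 0 = 1"
  by (simp_all add: t2_def G2_def w2_def s_def u_def L_def e_def euler_P_0)

private lemma small_disc:
  "\<exists>r>0. r \<le> 1 \<and> ball 0 r \<subseteq> S0 \<and> (\<forall>q. norm q < r \<longrightarrow> s q \<noteq> 0 \<and> norm (u q) < 1 \<and> e q \<noteq> 0)"
proof -
  define S1 where "S1 = ((S0 \<inter> s -` (- {0})) \<inter> (S0 \<inter> u -` ball 0 1)) \<inter> (ball 0 1 \<inter> e -` (- {0}))"
  have "open S1" unfolding S1_def
    by (intro open_Int continuous_open_preimage holomorphic_on_imp_continuous_on s_hol u_hol e_hol S0 open_ball) auto
  moreover have "0 \<in> S1" using S0(2) by (simp add: S1_def at_0)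
  ultimately obtain r where r: "r > 0" "ball 0 r \<subseteq> S1" using open_contains_ball by blast
  have "s q \<noteq> 0 \<and> norm (u q) < 1 \<and> e q \<noteq> 0 \<and> q \<in> S0" if "norm q < min r 1" for q
  proof -
    have "q \<in> S1" using that r(2) by auto
    thus ?thesis by (auto simp: S1_def)
  qed
  thus ?thesis using r(1) by (intro exI[of _ "min r 1"]) auto
qed

private lemma t_deriv:
  assumes q: "norm q < 1" "q \<noteq> 0"
  shows "(t2 has_field_derivative t2 q * G2 q / q) (at q)"
proof -
  have "has_ldv t2 (0 + 1 + of_nat 24 * (of_nat 2 * dlog_eul (q ^ 2)) - of_nat 24 * dlog_eul q) q"
    unfolding t2_def hauptq_simps[abs_def] using q by (intro ldv_intros) auto
  thus ?thesis by (simp add: has_ldv_def G2_def euler_P_def add_diff_eq)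
qed

private lemma t_16_ldv:
  assumes q: "norm q < 1" "q \<noteq> 0" "t2 q + 16 \<noteq> 0"
  shows "has_ldv (\<lambda>q. t2 q + 16) (t2 q * G2 q / (t2 q + 16)) q"
  using DERIV_add[OF t_deriv[OF q(1,2)] DERIV_const[of 16]] q(3) by (simp add: has_ldv_def)

private lemma u_deriv:
  assumes q: "norm q < 1" "q \<noteq> 0" "t2 q + 16 \<noteq> 0"
  shows "(u has_field_derivative u q * s q / q) (at q)"
proof -
  have "has_ldv t2 (G2 q) q" using t_deriv[OF q(1,2)] by (simp add: has_ldv_def)
  hence "has_ldv u (0 + G2 q - of_nat 3 * (t2 q * G2 q / (t2 q + 16))) q"
    unfolding u_def[abs_def] using q t_16_ldv[OF q] by (intro ldv_intros) auto
  also have "0 + G2 q - of_nat 3 * (t2 q * G2 q / (t2 q + 16)) = s q"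
    using q(3) by (simp add: s_def field_simps)
  finally show ?thesis by (simp add: has_ldv_def)
qed

private lemma e_deriv:
  assumes q: "norm q < 1" "q \<noteq> 0" "t2 q + 16 \<noteq> 0"
  shows "(e has_field_derivative e q * L q / q) (at q)"
proof -
  have "has_ldv w2 (of_nat 16 * dlog_eul q - of_nat 8 * (of_nat 2 * dlog_eul (q ^ 2))) q"
    unfolding w2_def[abs_def] using q by (intro ldv_intros) auto
  hence "has_ldv e (of_nat 16 * dlog_eul q - of_nat 8 * (of_nat 2 * dlog_eul (q ^ 2)) + t2 q * G2 q / (t2 q + 16) - 0) q"
    unfolding e_def[abs_def] using q t_16_ldv[OF q] by (intro ldv_intros) auto
  also have "of_nat 16 * dlog_eul q - of_nat 8 * (of_nat 2 * dlog_eul (q ^ 2)) + t2 q * G2 q / (t2 q + 16) - 0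
      = (euler_P q - G2 q) / 3 + t2 q * G2 q / (t2 q + 16)"
    by (simp add: G2_def euler_P_def)
  also have "\<dots> = L q" using q(3) by (simp add: L_def s_def field_simps)
  finally show ?thesis by (simp add: has_ldv_def)
qed

text \<open>This is \<open>E6^2 = E4^3 - 1728 \<Delta>\<close> divided by \<open>E4^2\<close>. The
  cubic \<open>(T + 16)^3 - 1728 T\<close> has the double root 8, which is the zero of
  \<open>16 - 2 T\<close>.\<close>

private lemma s_square:
  assumes q: "norm q < 1" "q \<noteq> 0" "t2 q + 16 \<noteq> 0"
  shows "s q ^ 2 = e q * (1 - u q)"
proof -
  define N where "N = (t2 q + 64) * (t2 q - 8) ^ 2"
  have 1: "G2 q ^ 2 = w2 q * (1 + t2 q / 64)"
    using euler_P_2_square[OF q(1,2)] by (simp add: G2_def w2_def t2_def hauptq_simps)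
  have 2: "(t2 q + 16) ^ 3 - 1728 * t2 q = N" unfolding N_def by algebra
  have "(1 + t2 q / 64) * (16 - 2 * t2 q) ^ 2 = (1 + t2 q / 64) * 4 * (t2 q - 8) ^ 2" by algebra
  also have "(1 + t2 q / 64) * 4 = (t2 q + 64) / 16" by simp
  finally have 3: "(1 + t2 q / 64) * (16 - 2 * t2 q) ^ 2 = N / 16" by (simp add: N_def)
  have "1 - u q = ((t2 q + 16) ^ 3 - 1728 * t2 q) / (t2 q + 16) ^ 3"
    using q(3) by (simp add: u_def diff_divide_distrib)
  hence "e q * (1 - u q) = w2 q * ((t2 q + 16) / 16 * (N / (t2 q + 16) ^ 3))" by (simp add: e_def 2)
  also have "(t2 q + 16) / 16 * (N / (t2 q + 16) ^ 3) = N / 16 / (t2 q + 16) ^ 2"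
    using q(3) by (simp add: power3_eq_cube power2_eq_square)
  also have "w2 q * (N / 16 / (t2 q + 16) ^ 2) = s q ^ 2"
    unfolding 3[symmetric] by (simp add: s_def power_divide power_mult_distrib 1)
  finally show ?thesis ..
qed

text \<open>Up to a factor \<open>E\<^sub>4\<^sup>1\<^sup>/\<^sup>4\<close>, the Wronskian of \<open>E\<^sub>4\<^sup>1\<^sup>/\<^sup>4\<close> and the hypergeometric function at \<open>u = 1728/j\<close>.\<close>

private definition om where "om q = gauss_F1 (u q) * s q - gauss_F (u q) * L q / 4"

text \<open>The formula for \<open>s ^ 2\<close> is differentiated and divided by
  \<open>2 * s\<close>; differentiability is known beforehand from holomorphy.\<close>

private lemma s_deriv:
  assumes q: "norm q < 1" "q \<noteq> 0" "q \<in> S0" "s q \<noteq> 0"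
  shows "(s has_field_derivative (L q * s q - e q * u q) / 2 / q) (at q)"
proof -
  obtain s' where s': "(s has_field_derivative s') (at q)"
    using s_hol S0(1) q(3) by (metis holomorphic_derivI)
  have op: "open (S0 - {0})" "q \<in> S0 - {0}" using S0(1) q by auto
  have "((\<lambda>q. s q ^ 2) has_field_derivative 2 * s q * s') (at q)"
    by (auto intro!: derivative_eq_intros s')
  moreover have "((\<lambda>q. e q * (1 - u q)) has_field_derivative e q * L q / q * (1 - u q) - e q * (u q * s q / q)) (at q)"
    using q S0 by (auto intro!: derivative_eq_intros e_deriv u_deriv)
  hence "((\<lambda>q. s q ^ 2) has_field_derivative e q * L q / q * (1 - u q) - e q * (u q * s q / q)) (at q)"
    by (rule has_field_derivative_transform_within_open[OF _ op]) (use s_square S0 in auto)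
  ultimately have "2 * s q * s' = e q * L q / q * (1 - u q) - e q * (u q * s q / q)" by (rule DERIV_unique)
  also have "\<dots> = ((e q * (1 - u q)) * L q - e q * u q * s q) / q" using q(2) by (simp add: field_simps)
  also have "e q * (1 - u q) = s q ^ 2" using s_square[OF q(1,2)] S0(4)[OF q(3)] by simp
  also have "(s q ^ 2 * L q - e q * u q * s q) / q = 2 * s q * ((L q * s q - e q * u q) / 2 / q)"
    using q(2) by (simp add: field_simps power2_eq_square)
  finally have "s' = (L q * s q - e q * u q) / 2 / q" using q(4) by (simp only: mult_cancel_left) simp
  with s' show ?thesis by simp
qed

text \<open>A Riccati equation: \<open>L / 4\<close> is the logarithmic derivative of
  \<open>E4^(1/4)\<close>, and the equation says that this root satisfies the hypergeometric
  equation pulled back along \<open>u\<close>.\<close>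

private lemma L_deriv:
  assumes q: "norm q < 1" "q \<noteq> 0" "q \<in> S0" "s q \<noteq> 0"
  shows "(L has_field_derivative (L q ^ 2 / 4 + 5 / 36 * e q * u q) / q) (at q)"
proof -
  have "(L has_field_derivative (deriv euler_P q - (L q * s q - e q * u q) / 2 / q) / 3) (at q)"
    unfolding L_def[abs_def]
    by (intro DERIV_cdivide DERIV_diff euler_P_has_field_derivative[OF q(1)] s_deriv[OF q, unfolded L_def])
  also have "(deriv euler_P q - (L q * s q - e q * u q) / 2 / q) / 3 = (L q ^ 2 / 4 + 5 / 36 * e q * u q) / q"
  proof -
    have 1: "12 * (q * deriv euler_P q) = euler_P q ^ 2 - e q" using ramanujan_P[OF q(1,2)] e_eq[OF q(1,2)] by simp
    have 2: "s q ^ 2 = e q * (1 - u q)" using s_square[OF q(1,2)] S0(4)[OF q(3)] by simp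
    have 3: "euler_P q = 3 * L q + s q" by (simp add: L_def diff_divide_distrib)
    have eq: "36 * (q * deriv euler_P q) - 18 * (L q * s q - e q * u q) = 27 * L q ^ 2 + 15 * e q * u q"
      using 1 2 unfolding 3 by algebra
    have "(A - Y / 2) / 3 = (36 * A - 18 * Y) / 108" for A Y :: complex by (simp add: diff_divide_distrib)
    hence "(q * deriv euler_P q - (L q * s q - e q * u q) / 2) / 3 = (27 * L q ^ 2 + 15 * e q * u q) / 108"
      unfolding eq[symmetric] .
    also have "\<dots> = L q ^ 2 / 4 + 5 / 36 * e q * u q" by (simp add: add_divide_distrib)
    finally have "(q * deriv euler_P q - (L q * s q - e q * u q) / 2) / 3 = L q ^ 2 / 4 + 5 / 36 * e q * u q" .
    moreover have "(x - y / 2 / q) / 3 = ((q * x - y / 2) / 3) / q" for x y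
      using q(2) by (simp add: divide_simps)
    ultimately show ?thesis by (simp only:)
  qed
  finally show ?thesis .
qed

private lemma F_deriv:
  assumes q: "norm q < 1" "q \<noteq> 0" "q \<in> S0" "norm (u q) < 1"
  shows "((\<lambda>q. gauss_F (u q)) has_field_derivative gauss_F1 (u q) * s q / q) (at q)"
    "((\<lambda>q. gauss_F1 (u q)) has_field_derivative gauss_F2 (u q) * s q / q) (at q)"
proof -
  have nz: "u q \<noteq> 0" using hauptq_nonzero[of 2 q] q S0(4)[OF q(3)] by (simp add: u_def t2_def)
  note ud = u_deriv[OF q(1,2) S0(4)[OF q(3)]]
  show "((\<lambda>q. gauss_F (u q)) has_field_derivative gauss_F1 (u q) * s q / q) (at q)"
    using DERIV_chain2[OF gauss_F_derivative(1)[OF q(4) nz] ud] nz by simp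
  show "((\<lambda>q. gauss_F1 (u q)) has_field_derivative gauss_F2 (u q) * s q / q) (at q)"
    using DERIV_chain2[OF gauss_F_derivative(2)[OF q(4) nz] ud] nz by simp
qed

text \<open>The hypergeometric equation eliminates \<open>gauss_F2\<close>; the Wronskian then obeys
  the first-order equation of \<open>E4^(1/4)\<close>.\<close>

private lemma om_deriv:
  assumes q: "norm q < 1" "q \<noteq> 0" "q \<in> S0" "norm (u q) < 1" "s q \<noteq> 0"
  shows "(om has_field_derivative om q * L q / 4 / q) (at q)"
proof -
  have "(om has_field_derivative (gauss_F1 (u q) * ((L q * s q - e q * u q) / 2 / q) + gauss_F2 (u q) * s q / q * s q)
     - (gauss_F (u q) * ((L q ^ 2 / 4 + 5 / 36 * e q * u q) / q) + gauss_F1 (u q) * s q / q * L q) / 4) (at q)"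
    unfolding om_def[abs_def]
    by (intro DERIV_diff DERIV_cdivide DERIV_mult' F_deriv[OF q(1-4)] s_deriv[OF q(1-3,5)] L_deriv[OF q(1-3,5)])
  also have "(gauss_F1 (u q) * ((L q * s q - e q * u q) / 2 / q) + gauss_F2 (u q) * s q / q * s q)
     - (gauss_F (u q) * ((L q ^ 2 / 4 + 5 / 36 * e q * u q) / q) + gauss_F1 (u q) * s q / q * L q) / 4
     = (gauss_F2 (u q) * s q ^ 2 + gauss_F1 (u q) * ((L q * s q - e q * u q) / 2)
        - gauss_F1 (u q) * s q * L q / 4 - gauss_F (u q) * (L q ^ 2 / 4 + 5 / 36 * e q * u q) / 4) / q"
  proof -
    have "(b * (c / 2 / q) + a * S / q * S) - (g * (d / q) + b * S / q * l) / 4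
        = (a * S ^ 2 + b * (c / 2) - b * S * l / 4 - g * d / 4) / q" for a b c d g l S
      by (simp add: add_divide_distrib diff_divide_distrib power2_eq_square mult_ac)
    thus ?thesis .
  qed
  also have "gauss_F2 (u q) * s q ^ 2 = e q * u q * (gauss_F1 (u q) / 2 + 5 / 144 * gauss_F (u q))"
  proof -
    have "s q ^ 2 = e q * (1 - u q)" using s_square[OF q(1,2)] S0(4)[OF q(3)] by simp
    hence "gauss_F2 (u q) * s q ^ 2 = e q * (gauss_F2 (u q) - u q * gauss_F2 (u q))" by algebra
    also have "gauss_F2 (u q) - u q * gauss_F2 (u q) = u q * (gauss_F1 (u q) / 2 + 5 / 144 * gauss_F (u q))"
      using gauss_ode[OF q(4)] by (simp add: algebra_simps)
    finally show ?thesis by simp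
  qed
  also have "(e q * u q * (gauss_F1 (u q) / 2 + 5 / 144 * gauss_F (u q)) + gauss_F1 (u q) * ((L q * s q - e q * u q) / 2)
        - gauss_F1 (u q) * s q * L q / 4 - gauss_F (u q) * (L q ^ 2 / 4 + 5 / 36 * e q * u q) / 4) = om q * L q / 4"
  proof -
    have "E * U * (b / 2 + 5 / 144 * g) + b * ((l * S - E * U) / 2) - b * S * l / 4 - g * (l ^ 2 / 4 + 5 / 36 * E * U) / 4
        = (b * S - g * l / 4) * l / 4" for E U b g l S :: complex
      by (simp add: field_simps power2_eq_square)
    thus ?thesis by (simp only: om_def)
  qed
  finally show ?thesis .
qed

text \<open>Passing to fourth powers avoids a choice of branch for \<open>E4^(1/4)\<close>.\<close>

private lemma zero_ldv:
  assumes "has_ldv f (L q / 4) q" "has_ldv e (L q) q" "e q \<noteq> 0"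
  shows "((\<lambda>q. f q ^ 4 / e q) has_field_derivative 0) (at q)"
  using has_ldv_divide[OF has_ldv_power[OF assms(1), of 4] assms(2,3)] by (simp add: has_ldv_def)

text \<open>\<open>om ^ 4 / e\<close> is constant and 0 at the origin, so \<open>om\<close>
  vanishes. Then \<open>L / 4\<close> is also the logarithmic derivative of
  \<open>gauss_F (u q)\<close>, so \<open>gauss_F (u q) ^ 4 / e\<close> is constant, with value 1 at
  the origin.\<close>

lemma gauss_F_power_12:
  "\<forall>\<^sub>F q in nhds 0. q \<noteq> 0 \<longrightarrow> gauss_F (1728 * hauptq 2 q / (hauptq 2 q + 16) ^ 3) ^ 12 = euler_E4 q ^ 3"
proof -
  obtain r where r: "0 < r" "r \<le> 1" "ball 0 r \<subseteq> S0"
    and rr: "\<And>q. norm q < r \<Longrightarrow> s q \<noteq> 0 \<and> norm (u q) < 1 \<and> e q \<noteq> 0"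
    using small_disc by blast
  \<comment> \<open>The differential equations are available only for \<open>q \<noteq> 0\<close>;
    continuity bridges the exceptional point.\<close>
  have const: "f q = f 0" if f: "f holomorphic_on ball 0 r" and q: "norm q < r"
    and d: "\<And>q. norm q < r \<Longrightarrow> q \<noteq> 0 \<Longrightarrow> (f has_field_derivative 0) (at q)" for f :: "complex \<Rightarrow> complex" and q
  proof -
    obtain c where "\<And>q. q \<in> ball 0 r \<Longrightarrow> f q = c"
      by (rule DERIV_zero_connected_constant[of "ball 0 r" "{0}" f])
        (use d holomorphic_on_imp_continuous_on[OF f] in auto)
    thus ?thesis using q r(1) by simp
  qed
  have sub: "ball 0 r \<subseteq> (ball 0 1 :: complex set)" using r(2) by auto
  have uh: "u holomorphic_on ball 0 r" and sh: "s holomorphic_on ball 0 r"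
    using u_hol s_hol r(3) holomorphic_on_subset by blast+
  have eh: "e holomorphic_on ball 0 r" and Ph: "euler_P holomorphic_on ball 0 r"
    using e_hol holomorphic_euler_P sub holomorphic_on_subset by blast+
  have Lh: "L holomorphic_on ball 0 r" unfolding L_def[abs_def] by (intro holomorphic_intros Ph sh) auto
  have u1: "u ` ball 0 r \<subseteq> ball 0 1" using rr by auto
  have Fh: "(\<lambda>q. gauss_F (u q)) holomorphic_on ball 0 r" "(\<lambda>q. gauss_F1 (u q)) holomorphic_on ball 0 r"
    using holomorphic_on_compose_gen[OF uh gauss_F_holomorphic(1) u1] holomorphic_on_compose_gen[OF uh gauss_F_holomorphic(2) u1]
    by (simp_all add: o_def)
  have omh: "om holomorphic_on ball 0 r" unfolding om_def[abs_def] by (intro holomorphic_intros Lh sh Fh) auto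
  have om_0: "om q = 0" if q: "norm q < r" for q
  proof -
    have "om q ^ 4 / e q = om 0 ^ 4 / e 0"
    proof (rule const[OF _ q])
      show "(\<lambda>q. om q ^ 4 / e q) holomorphic_on ball 0 r" by (intro holomorphic_intros omh eh) (use rr in auto)
      fix q :: complex assume q: "norm q < r" "q \<noteq> 0"
      have q': "norm q < 1" "q \<in> S0" "norm (u q) < 1" "s q \<noteq> 0" "e q \<noteq> 0" using q r rr[OF q(1)] by auto
      show "((\<lambda>q. om q ^ 4 / e q) has_field_derivative 0) (at q)"
        using om_deriv[OF q'(1) q(2) q'(2-4)] e_deriv[OF q'(1) q(2) S0(4)[OF q'(2)]] q'(5)
        by (intro zero_ldv[of om]) (simp_all add: has_ldv_def)
    qed
    also have "om 0 = 0" by (simp add: om_def at_0 gauss_F_0)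
    finally show ?thesis using rr[OF q] by simp
  qed
  have F4: "gauss_F (u q) ^ 4 = e q" if q: "norm q < r" for q
  proof -
    have "gauss_F (u q) ^ 4 / e q = gauss_F (u 0) ^ 4 / e 0"
    proof (rule const[OF _ q])
      show "(\<lambda>q. gauss_F (u q) ^ 4 / e q) holomorphic_on ball 0 r" by (intro holomorphic_intros Fh eh) (use rr in auto)
      fix q :: complex assume q: "norm q < r" "q \<noteq> 0"
      have q': "norm q < 1" "q \<in> S0" "norm (u q) < 1" "s q \<noteq> 0" "e q \<noteq> 0" using q r rr[OF q(1)] by auto
      have F1: "gauss_F1 (u q) * s q = gauss_F (u q) * L q / 4" using om_0[OF q(1)] by (simp add: om_def)
      have "((\<lambda>q. gauss_F (u q)) has_field_derivative gauss_F (u q) * L q / 4 / q) (at q)"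
        using F_deriv(1)[OF q'(1) q(2) q'(2,3)] unfolding F1 .
      thus "((\<lambda>q. gauss_F (u q) ^ 4 / e q) has_field_derivative 0) (at q)"
        using e_deriv[OF q'(1) q(2) S0(4)[OF q'(2)]] q'(5)
        by (intro zero_ldv[of "\<lambda>q. gauss_F (u q)"]) (simp_all add: has_ldv_def)
    qed
    thus ?thesis using rr[OF q] by (simp add: at_0 gauss_F_0)
  qed
  have "gauss_F (1728 * hauptq 2 q / (hauptq 2 q + 16) ^ 3) ^ 12 = euler_E4 q ^ 3" if q: "norm q < r" "q \<noteq> 0" for q
  proof -
    have "gauss_F (u q) ^ 12 = (gauss_F (u q) ^ 4) ^ 3" by (simp flip: power_mult)
    also have "\<dots> = euler_E4 q ^ 3" unfolding F4[OF q(1)] using e_eq[of q] q r by simp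
    finally show ?thesis by (simp add: u_def t2_def)
  qed
  thus ?thesis unfolding eventually_nhds_metric using r(1) by auto
qed

end

section \<open>The modular equations\<close>

lemma powr_neg_inverse_power:
  assumes "x \<noteq> (0 :: complex)" "n * k = m" "n > 0"
  shows "(x powr (- 1 / of_nat n)) ^ m = inverse (x ^ k)"
proof -
  have "(x powr (- 1 / of_nat n)) ^ m = ((x powr (- 1 / of_nat n)) ^ n) ^ k"
    using assms(2) by (simp flip: power_mult)
  also have "(x powr (- 1 / of_nat n)) ^ n = exp (of_nat n * (- 1 / of_nat n * ln x))"
    using assms(1) unfolding exp_of_nat_mult by (simp add: powr_def)
  also have "of_nat n * (- 1 / of_nat n * ln x) = - ln x" using assms(3) by simp
  finally show ?thesis using assms(1) by (simp add: exp_minus power_inverse)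
qed

lemma powr_neg_inverse_of_real:
  assumes "r > 0" "n > 0"
  shows "(complex_of_real r ^ n) powr (- 1 / of_nat n) = inverse (of_real r)"
proof -
  have "(complex_of_real r ^ n) powr (- 1 / of_nat n) = of_real ((r ^ n) powr (- 1 / real n))"
    using assms powr_of_real[of "r ^ n" "- 1 / real n"] by simp
  also have "(r ^ n) powr (- 1 / real n) = inverse r"
    using assms by (simp add: powr_realpow[symmetric] powr_powr powr_minus)
  finally show ?thesis by simp
qed

lemma isCont_eventually_neq:
  fixes f :: "complex \<Rightarrow> complex"
  assumes "isCont f z" "f z \<noteq> c"
  shows "\<forall>\<^sub>F x in nhds z. f x \<noteq> c"
  using continuous_at_avoid[OF assms] unfolding eventually_nhds_metric by (auto simp: dist_commute)

text \<open>The function \<open>h\<^sub>M(t\<^sub>M)\<^sup>1\<^sup>2\<close> of the nome, up to a constant factor.\<close>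

definition haupt_weight :: "nat \<Rightarrow> complex \<Rightarrow> complex" where
  "haupt_weight M q =
    (if M \<in> {2, 4, 8} then eul q ^ 48 / eul (q ^ 2) ^ 24
     else if M \<in> {3, 9} then eul q ^ 36 / eul (q ^ 3) ^ 12
     else if M = 5 then eul q ^ 30 / eul (q ^ 5) ^ 6
     else eul q ^ 72 * eul (q ^ 6) ^ 12 / (eul (q ^ 2) ^ 36 * eul (q ^ 3) ^ 24))"

text \<open>\<open>P\<close> in the prefactor cancels against \<open>E4^3 = j \<Delta>\<close>,
  leaving \<open>\<Delta> / Q\<close> with \<open>\<Delta> = q * eul q ^ 24\<close>. As
  \<open>Q\<close> vanishes at 0, the Gauss series is evaluated near 0, where it is
  analytic.\<close>

lemma
  assumes M: "M \<in> {2, 3, 4, 5, 6, 8, 9}" and pres: "j_presentation M P Q"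
    and P0: "poly P 0 \<noteq> 0" and Q0: "poly Q 0 = 0"
  shows h_analytic_of_presentation: "h M analytic_on {0}"
    and h_0_of_presentation: "h M 0 = 1"
    and h_power_12_of_presentation: "\<forall>\<^sub>F q in nhds 0. q \<noteq> 0 \<longrightarrow>
      h M (hauptq M q) ^ 12 = poly P 0 * (q * eul q ^ 24 / poly Q (hauptq M q))"
proof -
  have heq: "h M = (\<lambda>t. (poly P t / poly P 0) powr (- 1 / 12) * gauss_F (1728 * poly Q t / poly P t))"
    unfolding fun_eq_iff h_eq[OF M P0 pres] gauss_F_eq by simp
  have an_poly: "poly p analytic_on {0}" for p :: "complex poly"
    by (rule holomorphic_on_imp_analytic_at[of _ UNIV]) (auto intro!: holomorphic_intros)
  have F: "gauss_F analytic_on {0}"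
    by (rule holomorphic_on_imp_analytic_at[OF gauss_F_holomorphic(1)]) auto
  have "(\<lambda>t. 1728 * poly Q t / poly P t) analytic_on {0}"
    using P0 by (intro analytic_intros an_poly) auto
  hence "(\<lambda>t. gauss_F (1728 * poly Q t / poly P t)) analytic_on {0}"
    using analytic_on_compose_gen[OF _ F, of "\<lambda>t. 1728 * poly Q t / poly P t" "{0}"] Q0 by (simp add: o_def)
  thus "h M analytic_on {0}" unfolding heq using P0
    by (intro analytic_intros an_poly) auto
  show "h M 0 = 1" unfolding heq using P0 Q0 by (simp add: gauss_F_0)
  have M': "M \<in> {2, 3, 4, 5, 6, 8, 9, 10, 12, 16, 18, 25}" using M by auto
  have "isCont (\<lambda>q. poly P (hauptq M q)) 0"
  proof -
    have "isCont (hauptq M) 0"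
      using holomorphic_on_imp_continuous_on[OF holomorphic_hauptq[OF M']] by (simp add: continuous_on_eq_continuous_at)
    thus ?thesis by (intro continuous_intros)
  qed
  hence "\<forall>\<^sub>F q in nhds 0. poly P (hauptq M q) \<noteq> 0"
    using P0 by (intro isCont_eventually_neq) simp_all
  moreover have "\<forall>\<^sub>F q in nhds 0. norm (q :: complex) < 1"
    by (rule eventually_nhds_metric[THEN iffD2]) (auto intro!: exI[of _ 1])
  ultimately show "\<forall>\<^sub>F q in nhds 0. q \<noteq> 0 \<longrightarrow>
      h M (hauptq M q) ^ 12 = poly P 0 * (q * eul q ^ 24 / poly Q (hauptq M q))"
    using gauss_F_power_12
  proof eventually_elim
    case (elim q)
    show ?case
    proof
      assume "q \<noteq> 0"
      with elim have q: "norm q < 1" "q \<noteq> 0" by auto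
      define t where "t = hauptq M q"
      define T where "T = hauptq 2 q"
      obtain \<tau> where \<tau>: "Im \<tau> > 0" "nome \<tau> = q" using nome_surj[OF q] .
      have "hauptmodul M \<tau> = t" using hauptmodul_eq[OF \<tau>(1) M'] \<tau>(2) by (simp add: t_def)
      hence Qnz: "poly Q t \<noteq> 0" and "modular_j \<tau> = poly P t / poly Q t"
        using pres \<tau>(1) by (auto simp: j_presentation_def)
      hence j: "euler_E4 q ^ 3 / (q * eul q ^ 24) = poly P t / poly Q t" using modular_j_E4[OF \<tau>(1)] \<tau>(2) by simp
      have Pnz: "poly P t \<noteq> 0" using elim(1) by (simp add: t_def)
      have "1728 * poly Q t / poly P t = 1728 / (poly P t / poly Q t)" by simp
      also have "poly P t / poly Q t = (T + 16) ^ 3 / T" unfolding j[symmetric] T_def by (rule euler_E4_cube[OF q])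
      finally have "gauss_F (1728 * poly Q t / poly P t) ^ 12 = euler_E4 q ^ 3"
        using elim(3) q(2) by (simp add: T_def)
      also have "\<dots> = poly P t / poly Q t * (q * eul q ^ 24)"
        unfolding j[symmetric] using q by simp
      finally have "h M t ^ 12 = inverse (poly P t / poly P 0) * (poly P t / poly Q t * (q * eul q ^ 24))"
        using powr_neg_inverse_power[of "poly P t / poly P 0" 12 1 12] Pnz P0
        unfolding heq by (simp add: power_mult_distrib)
      thus "h M (hauptq M q) ^ 12 = poly P 0 * (q * eul q ^ 24 / poly Q (hauptq M q))"
        using Pnz by (simp add: t_def)
    qed
  qed
qed

text \<open>It remains to see that \<open>Q\<close> at the Hauptmodul is an eta quotient: at levels
  4 and 8 it is \<open>t_2\<close>, at level 9 it is \<open>t_3\<close>, at level 6 a product of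
  known factors, and otherwise \<open>t_M\<close> itself. The constants \<open>d\<close> are the
  numerical factors of these quotients.\<close>

lemma
  assumes M: "M \<in> {2, 3, 4, 5, 6, 8, 9}"
  shows h_analytic: "h M analytic_on {0}" and h_0: "h M 0 = 1"
    and h_power_12: "\<exists>c. c \<noteq> 0 \<and> (\<forall>\<^sub>F q in nhds 0. q \<noteq> 0 \<longrightarrow> h M (hauptq M q) ^ 12 = c * haupt_weight M q)"
proof -
  have "\<exists>P Q d. j_presentation M P Q \<and> poly P 0 \<noteq> 0 \<and> poly Q 0 = 0 \<and> d \<noteq> 0 \<and>
      (\<forall>q. norm q < 1 \<longrightarrow> q \<noteq> 0 \<longrightarrow> q * eul q ^ 24 / poly Q (hauptq M q) = haupt_weight M q / d)"
  proof -
    have W2: "q * eul q ^ 24 / hauptq 2 q = (eul q ^ 48 / eul (q ^ 2) ^ 24) / 4096" if "norm q < 1" "q \<noteq> 0" for q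
      using that by (simp add: hauptq_simps field_simps)
    have W3: "q * eul q ^ 24 / hauptq 3 q = (eul q ^ 36 / eul (q ^ 3) ^ 12) / 729" if "norm q < 1" "q \<noteq> 0" for q
      using that by (simp add: hauptq_simps field_simps)
    consider "M = 2" | "M = 3" | "M = 4" | "M = 5" | "M = 6" | "M = 8" | "M = 9" using M by auto
    thus ?thesis
    proof cases
      case 1
      show ?thesis unfolding 1 using j_presentation_2 W2
        by (intro exI[of _ "[:16, 1:] ^ 3"] exI[of _ "[:0, 1:]"] exI[of _ 4096]) (auto simp: haupt_weight_def)
    next
      case 2
      show ?thesis unfolding 2 using j_presentation_3 W3
        by (intro exI[of _ "[:27, 1:] * [:3, 1:] ^ 3"] exI[of _ "[:0, 1:]"] exI[of _ 729])
          (auto simp: haupt_weight_def simp del: mult_pCons_left)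
    next
      case 3
      have "poly ([:0, 1:] * [:16, 1:]) (hauptq 4 q) = hauptq 2 q" if "norm q < 1" "q \<noteq> 0" for q
        unfolding haupt_2_4[OF that] by (simp add: algebra_simps)
      thus ?thesis unfolding 3 using j_presentation_4 W2
        by (intro exI[of _ "[:16, 16, 1:] ^ 3"] exI[of _ "[:0, 1:] * [:16, 1:]"] exI[of _ 4096])
          (auto simp: haupt_weight_def simp del: mult_pCons_left)
    next
      case 4
      have "q * eul q ^ 24 / hauptq 5 q = (eul q ^ 30 / eul (q ^ 5) ^ 6) / 125" if "norm q < 1" "q \<noteq> 0" for q
        using that by (simp add: hauptq_simps field_simps)
      thus ?thesis unfolding 4 using j_presentation_5
        by (intro exI[of _ "[:5, 10, 1:] ^ 3"] exI[of _ "[:0, 1:]"] exI[of _ 125]) (auto simp: haupt_weight_def)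
    next
      case 5
      have Q: "poly ([:0, 1:] * [:8, 1:] ^ 3 * [:9, 1:] ^ 2) (hauptq 6 q) =
          hauptq 6 q * (hauptq 6 q + 8) ^ 3 * (hauptq 6 q + 9) ^ 2" for q
        by (simp add: add.commute)
      have W: "q * eul q ^ 24 / (hauptq 6 q * (hauptq 6 q + 8) ^ 3 * (hauptq 6 q + 9) ^ 2) =
          eul q ^ 72 * eul (q ^ 6) ^ 12 / (eul (q ^ 2) ^ 36 * eul (q ^ 3) ^ 24) / 2985984" if q: "norm q < 1" "q \<noteq> 0" for q
        unfolding haupt_6_factors[OF q] unfolding hauptq_simps using q
        by (simp add: power_mult_distrib power_divide field_simps flip: power_mult; algebra)
      have "q * eul q ^ 24 / poly ([:0, 1:] * [:8, 1:] ^ 3 * [:9, 1:] ^ 2) (hauptq 6 q) = haupt_weight 6 q / 2985984"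
        if "norm q < 1" "q \<noteq> 0" for q unfolding Q W[OF that] by (simp add: haupt_weight_def)
      thus ?thesis unfolding 5 using j_presentation_6
        by (intro exI[of _ "([:6, 1:] * [:24, 84, 18, 1:]) ^ 3"] exI[of _ "[:0, 1:] * [:8, 1:] ^ 3 * [:9, 1:] ^ 2"] exI[of _ 2985984] conjI allI impI)
          (assumption | simp)+
    next
      case 6
      have "poly ([:0, 1:] * [:8, 1:] * [:4, 1:] ^ 2) (hauptq 8 q) = hauptq 2 q" if "norm q < 1" "q \<noteq> 0" for q
        unfolding haupt_2_4(1)[OF that] haupt_4_8(1)[OF that] by (simp; algebra)
      thus ?thesis unfolding 6 using j_presentation_8 W2
        by (intro exI[of _ "[:16, 128, 80, 16, 1:] ^ 3"] exI[of _ "[:0, 1:] * [:8, 1:] * [:4, 1:] ^ 2"] exI[of _ 4096])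
          (auto simp: haupt_weight_def simp del: mult_pCons_left)
    next
      case 7
      have "poly ([:0, 1:] * [:27, 9, 1:]) (hauptq 9 q) = hauptq 3 q" if "norm q < 1" "q \<noteq> 0" for q
        unfolding haupt_3_9[OF that] by (simp; algebra)
      thus ?thesis unfolding 7 using j_presentation_9 W3
        by (intro exI[of _ "([:3, 1:] * [:3, 27, 9, 1:]) ^ 3"] exI[of _ "[:0, 1:] * [:27, 9, 1:]"] exI[of _ 729])
          (auto simp: haupt_weight_def simp del: mult_pCons_left)
    qed
  qed
  then obtain P Q d where PQ: "j_presentation M P Q" "poly P 0 \<noteq> 0" "poly Q 0 = 0" "d \<noteq> 0"
    and W: "\<And>q. norm q < 1 \<Longrightarrow> q \<noteq> 0 \<Longrightarrow> q * eul q ^ 24 / poly Q (hauptq M q) = haupt_weight M q / d" by blast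
  show "h M analytic_on {0}" "h M 0 = 1"
    by (rule h_analytic_of_presentation[OF M PQ(1-3)], rule h_0_of_presentation[OF M PQ(1-3)])
  have "\<forall>\<^sub>F q in nhds 0. norm (q :: complex) < 1"
    by (rule eventually_nhds_metric[THEN iffD2]) (auto intro!: exI[of _ 1])
  with h_power_12_of_presentation[OF M PQ(1-3)]
  have "\<forall>\<^sub>F q in nhds 0. q \<noteq> 0 \<longrightarrow> h M (hauptq M q) ^ 12 = poly P 0 / d * haupt_weight M q"
    by eventually_elim (auto simp: W)
  moreover have "poly P 0 / d \<noteq> 0" using PQ by simp
  ultimately show "\<exists>c. c \<noteq> 0 \<and> (\<forall>\<^sub>F q in nhds 0. q \<noteq> 0 \<longrightarrow> h M (hauptq M q) ^ 12 = c * haupt_weight M q)" by blast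
qed

text \<open>The cofactor of \<open>f - g\<close> in \<open>f^12 - g^12\<close> has the value 12 at
  0, so it does not vanish nearby.\<close>

lemma eventually_eq_of_power_eq:
  fixes f g :: "complex \<Rightarrow> complex"
  assumes fg: "isCont f 0" "isCont g 0" "f 0 = 1" "g 0 = 1" and ev: "\<forall>\<^sub>F t in nhds 0. f t ^ 12 = g t ^ 12"
  shows "\<forall>\<^sub>F t in nhds 0. f t = g t"
proof -
  have "isCont (\<lambda>t. \<Sum>i<12. g t ^ (12 - Suc i) * f t ^ i) 0" by (intro continuous_intros fg)
  hence "\<forall>\<^sub>F t in nhds 0. (\<Sum>i<12. g t ^ (12 - Suc i) * f t ^ i) \<noteq> 0"
    by (rule isCont_eventually_neq) (simp add: fg)
  with ev show ?thesis
  proof eventually_elim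
    case (elim t)
    have "(f t - g t) * (\<Sum>i<12. g t ^ (12 - Suc i) * f t ^ i) = 0"
      unfolding power_diff_sumr2[symmetric] using elim(1) by simp
    thus ?case using elim(2) by simp
  qed
qed

text \<open>By \<open>AB\<close> and \<open>W\<close> the twelfth powers of both sides agree along
  \<open>t = hauptq K q\<close>, hence for all small \<open>t\<close>. The multiplier
  \<open>c\<close> of the weight occurs on both sides and need not be known.\<close>

lemma modular_equationI:
  assumes M: "M \<in> {2, 3, 4, 5, 6, 8, 9}" and N: "N > 0"
    and K: "N * M = K" "K \<in> {2, 3, 4, 5, 6, 8, 9, 10, 12, 16, 18, 25}"
    and A: "A analytic_on {0}" "A 0 = 0" and B: "B analytic_on {0}" "B 0 = 0"
    and C: "C analytic_on {0}" "C 0 = 1"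
    and AB: "\<And>q. norm q < 1 \<Longrightarrow> q \<noteq> 0 \<Longrightarrow> hauptq M q = A (hauptq K q) \<and> hauptq M (q ^ N) = B (hauptq K q)"
    and W: "\<And>q. norm q < 1 \<Longrightarrow> q \<noteq> 0 \<Longrightarrow> C (hauptq K q) ^ 12 * haupt_weight M (q ^ N) = haupt_weight M q"
  shows "modular_equation M N A C B"
  unfolding modular_equation_def
proof (intro conjI allI impI)
  have M': "M \<in> {2, 3, 4, 5, 6, 8, 9, 10, 12, 16, 18, 25}" using M by auto
  fix \<tau> assume \<tau>: "Im \<tau> > 0"
  show "hauptmodul M \<tau> = A (hauptmodul (N * M) \<tau>)" "hauptmodul M (of_nat N * \<tau>) = B (hauptmodul (N * M) \<tau>)"
    using AB[OF nome_in_disc[OF \<tau>]] hauptmodul_eq[OF \<tau> M'] hauptmodul_eq[OF \<tau> K(2)] hauptmodul_of_nat_eq[OF \<tau> N M']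
    by (simp_all add: K(1))
next
  show "C analytic_on {0}" "C 0 = 1" by fact+
  have h': "h M analytic_on {0}" "h M 0 = 1" by (rule h_analytic[OF M], rule h_0[OF M])
  have cont: "isCont (\<lambda>t. h M (A t)) 0" "isCont (\<lambda>t. C t * h M (B t)) 0"
    using analytic_on_compose_gen[OF A(1) h'(1)] analytic_on_compose_gen[OF B(1) h'(1)] A(2) B(2)
    by (auto intro!: analytic_at_imp_isCont analytic_intros C(1) simp: o_def)
  obtain c where c: "\<forall>\<^sub>F q in nhds 0. q \<noteq> 0 \<longrightarrow> h M (hauptq M q) ^ 12 = c * haupt_weight M q"
    using h_power_12[OF M] by blast
  have "filterlim (\<lambda>q :: complex. q ^ N) (nhds 0) (nhds 0)"
    using N by (auto intro!: tendsto_eq_intros filterlim_ident simp: power_0_left)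
  from eventually_compose_filterlim[OF c this]
  have c': "\<forall>\<^sub>F q in nhds 0. q ^ N \<noteq> 0 \<longrightarrow> h M (hauptq M (q ^ N)) ^ 12 = c * haupt_weight M (q ^ N)" .
  have "\<forall>\<^sub>F q in nhds 0. norm (q :: complex) < 1"
    by (rule eventually_nhds_metric[THEN iffD2]) (auto intro!: exI[of _ 1])
  with c c' have "\<forall>\<^sub>F q in nhds 0. h M (A (hauptq K q)) ^ 12 = (C (hauptq K q) * h M (B (hauptq K q))) ^ 12"
  proof eventually_elim
    case (elim q)
    show ?case
    proof (cases "q = 0")
      case True
      thus ?thesis using A B C h' by simp
    next
      case False
      with elim have q: "norm q < 1" "q \<noteq> 0" "q ^ N \<noteq> 0" by auto
      have "h M (A (hauptq K q)) ^ 12 = c * haupt_weight M q" using elim(1) AB[OF q(1,2)] q by simp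
      also have "\<dots> = C (hauptq K q) ^ 12 * (c * haupt_weight M (q ^ N))" unfolding W[OF q(1,2), symmetric] by simp
      also have "c * haupt_weight M (q ^ N) = h M (B (hauptq K q)) ^ 12" using elim(2) AB[OF q(1,2)] q by simp
      finally show ?thesis by (simp add: power_mult_distrib)
    qed
  qed
  hence "\<forall>\<^sub>F t in nhds 0. h M (A t) ^ 12 = (C t * h M (B t)) ^ 12" by (rule eventually_hauptq[OF K(2)])
  from eventually_eq_of_power_eq[OF cont _ _ this]
  show "\<forall>\<^sub>F t in nhds 0. h M (A t) = C t * h M (B t)" by (simp add: A B C h')
qed

text \<open>At 0 the base is \<open>c ^ n\<close> with \<open>c\<close> positive, so its principal
  root is \<open>c\<close> and the prefactor starts at 1. With \<open>n * k = 12\<close> the twelfth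
  power of the root is \<open>b ^ k\<close>, free of branches.\<close>

lemma modular_equation_powrI:
  assumes M: "M \<in> {2, 3, 4, 5, 6, 8, 9}" and N: "N > 0"
    and K: "N * M = K" "K \<in> {2, 3, 4, 5, 6, 8, 9, 10, 12, 16, 18, 25}"
    and A: "A analytic_on {0}" "A 0 = 0" and B: "B analytic_on {0}" "B 0 = 0"
    and AB: "\<And>q. norm q < 1 \<Longrightarrow> q \<noteq> 0 \<Longrightarrow> hauptq M q = A (hauptq K q) \<and> hauptq M (q ^ N) = B (hauptq K q)"
    and r: "c = of_real r" "r > 0" and n: "a = - 1 / of_nat n" "n * k = 12" and b: "b analytic_on {0}" "b 0 = c ^ n"
    and nz: "\<And>q. norm q < 1 \<Longrightarrow> q \<noteq> 0 \<Longrightarrow> b (hauptq K q) \<noteq> 0"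
    and W: "\<And>q. norm q < 1 \<Longrightarrow> q \<noteq> 0 \<Longrightarrow> c ^ 12 * haupt_weight M (q ^ N) = haupt_weight M q * b (hauptq K q) ^ k"
  shows "modular_equation M N A (\<lambda>t. c * b t powr a) B"
proof (rule modular_equationI[OF M N K A B _ _ AB])
  have "n > 0" using n(2) by (auto intro: Nat.gr0I)
  have "b 0 = of_real (r ^ n)" using b(2) r(1) by simp
  moreover have "complex_of_real (r ^ n) \<notin> \<real>\<^sub>\<le>\<^sub>0" using zero_less_power[OF r(2), of n] by (simp only: complex_nonpos_Reals_iff Re_complex_of_real) simp
  ultimately show "(\<lambda>t. c * b t powr a) analytic_on {0}" by (intro analytic_intros b) auto
  show "c * b 0 powr a = 1"
    using powr_neg_inverse_of_real[OF r(2) \<open>n > 0\<close>] r by (simp add: b(2) n(1))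
  fix q :: complex assume q: "norm q < 1" "q \<noteq> 0"
  have "(b (hauptq K q) powr a) ^ 12 = inverse (b (hauptq K q) ^ k)"
    unfolding n(1) by (rule powr_neg_inverse_power[OF nz[OF q] n(2) \<open>n > 0\<close>])
  hence "(c * b (hauptq K q) powr a) ^ 12 * haupt_weight M (q ^ N) = c ^ 12 * haupt_weight M (q ^ N) / b (hauptq K q) ^ k"
    by (simp add: power_mult_distrib divide_inverse)
  thus "(c * b (hauptq K q) powr a) ^ 12 * haupt_weight M (q ^ N) = haupt_weight M q"
    unfolding W[OF q] using nz[OF q] by simp
qed (use AB in auto)

text \<open>The variant for integral exponents, in which no branch occurs.\<close>

lemma modular_equation_powiI:
  assumes M: "M \<in> {2, 3, 4, 5, 6, 8, 9}" and N: "N > 0"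
    and K: "N * M = K" "K \<in> {2, 3, 4, 5, 6, 8, 9, 10, 12, 16, 18, 25}"
    and A: "A analytic_on {0}" "A 0 = 0" and B: "B analytic_on {0}" "B 0 = 0"
    and AB: "\<And>q. norm q < 1 \<Longrightarrow> q \<noteq> 0 \<Longrightarrow> hauptq M q = A (hauptq K q) \<and> hauptq M (q ^ N) = B (hauptq K q)"
    and a: "a = - int n" "12 * n = k" and b: "b analytic_on {0}" "b 0 ^ n = c" "c \<noteq> 0"
    and nz: "\<And>q. norm q < 1 \<Longrightarrow> q \<noteq> 0 \<Longrightarrow> b (hauptq K q) \<noteq> 0"
    and W: "\<And>q. norm q < 1 \<Longrightarrow> q \<noteq> 0 \<Longrightarrow> c ^ 12 * haupt_weight M (q ^ N) = haupt_weight M q * b (hauptq K q) ^ k"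
  shows "modular_equation M N A (\<lambda>t. c * b t powi a) B"
proof (rule modular_equationI[OF M N K A B _ _ AB])
  have powi: "x powi a = inverse (x ^ n)" for x :: complex unfolding a(1) by (simp add: power_int_minus)
  have "b 0 ^ n \<noteq> 0" using b by simp
  thus "(\<lambda>t. c * b t powi a) analytic_on {0}" unfolding powi by (intro analytic_intros b) auto
  show "c * b 0 powi a = 1" unfolding powi b(2) using b(3) by simp
  fix q :: complex assume q: "norm q < 1" "q \<noteq> 0"
  have "(b (hauptq K q) powi a) ^ 12 = inverse (b (hauptq K q) ^ k)"
    unfolding powi a(2)[symmetric] by (simp add: power_inverse mult.commute flip: power_mult)
  hence "(c * b (hauptq K q) powi a) ^ 12 * haupt_weight M (q ^ N) = c ^ 12 * haupt_weight M (q ^ N) / b (hauptq K q) ^ k"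
    by (simp add: power_mult_distrib divide_inverse)
  thus "(c * b (hauptq K q) powi a) ^ 12 * haupt_weight M (q ^ N) = haupt_weight M q"
    unfolding W[OF q] using nz[OF q] by simp
qed (use AB in auto)

section \<open>Equations whose arguments are single substitutions\<close>

lemma modular_equation_2_2:
  "modular_equation 2 2
    (\<lambda>t. t * (t + 16))
    (\<lambda>t. 2 * (t + 16) powr (- 1 / 4))
    (\<lambda>t. t^2 / (t + 16))"
proof (rule modular_equation_powrI[where K = 4 and r = 2 and n = 4 and k = 3])
  fix q :: complex assume q: "norm q < 1" "q \<noteq> 0"
  define t where "t = hauptq 4 q"
  have b: "t + 16 = 16 * eul (q ^ 2) ^ 24 / (eul q ^ 16 * eul (q ^ 4) ^ 8)"
    unfolding t_def using haupt_4_8(3)[OF q] by simp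
  show "hauptq 4 q + 16 \<noteq> 0"
    using b q by (simp add: t_def)
  show "2 ^ 12 * haupt_weight 2 (q ^ 2) = haupt_weight 2 q * (hauptq 4 q + 16) ^ 3"
    unfolding b[unfolded t_def] using q
    by (simp add: haupt_weight_def power_mult_distrib power_divide field_simps flip: power_mult; algebra)
  show "hauptq 2 q = (\<lambda>t. t * (t + 16)) (hauptq 4 q) \<and> hauptq 2 (q ^ 2) = (\<lambda>t. t^2 / (t + 16)) (hauptq 4 q)"
    using haupt_2_4[OF q] by simp
qed (auto simp: o_def intro!: analytic_intros)

lemma modular_equation_2_3:
  "modular_equation 2 3
    (\<lambda>t. t * (t + 8)^3 / (t + 9))
    (\<lambda>t. 3 * (t + 9) powr (- 1 / 2))
    (\<lambda>t. t^3 * (t + 8) / (t + 9)^3)"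
proof (rule modular_equation_powrI[where K = 6 and r = 3 and n = 2 and k = 6])
  fix q :: complex assume q: "norm q < 1" "q \<noteq> 0"
  define t where "t = hauptq 6 q"
  have b: "t + 9 = 9 * eul (q ^ 3) ^ 8 * eul (q ^ 2) ^ 4 / (eul (q ^ 6) ^ 4 * eul q ^ 8)"
    unfolding t_def using haupt_6_factors[OF q] by simp
  show "hauptq 6 q + 9 \<noteq> 0"
    using b q by (simp add: t_def)
  show "3 ^ 12 * haupt_weight 2 (q ^ 3) = haupt_weight 2 q * (hauptq 6 q + 9) ^ 6"
    unfolding b[unfolded t_def] using q
    by (simp add: haupt_weight_def power_mult_distrib power_divide field_simps flip: power_mult; algebra)
  show "hauptq 2 q = (\<lambda>t. t * (t + 8)^3 / (t + 9)) (hauptq 6 q) \<and> hauptq 2 (q ^ 3) = (\<lambda>t. t^3 * (t + 8) / (t + 9)^3) (hauptq 6 q)"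
    using haupt_2_6[OF q] by simp
qed (auto simp: o_def intro!: analytic_intros)

lemma modular_equation_2_5:
  "modular_equation 2 5
    (\<lambda>t. t * (t + 4)^5 / (t + 5))
    (\<lambda>t. 5 * (t + 5) powi (- 1))
    (\<lambda>t. t^5 * (t + 4) / (t + 5)^5)"
proof (rule modular_equation_powiI[where K = 10 and n = 1 and k = 12])
  fix q :: complex assume q: "norm q < 1" "q \<noteq> 0"
  define t where "t = hauptq 10 q"
  have b: "t + 5 = 5 * eul (q ^ 2) ^ 2 * eul (q ^ 5) ^ 4 / (eul q ^ 4 * eul (q ^ 10) ^ 2)"
    unfolding t_def using haupt_10_factors[OF q] by simp
  show "hauptq 10 q + 5 \<noteq> 0"
    using b q by (simp add: t_def)
  show "5 ^ 12 * haupt_weight 2 (q ^ 5) = haupt_weight 2 q * (hauptq 10 q + 5) ^ 12"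
    unfolding b[unfolded t_def] using q
    by (simp add: haupt_weight_def power_mult_distrib power_divide field_simps flip: power_mult; algebra)
  show "hauptq 2 q = (\<lambda>t. t * (t + 4)^5 / (t + 5)) (hauptq 10 q) \<and> hauptq 2 (q ^ 5) = (\<lambda>t. t^5 * (t + 4) / (t + 5)^5) (hauptq 10 q)"
    using haupt_2_10[OF q] by simp
qed (auto simp: o_def intro!: analytic_intros)

lemma modular_equation_3_2:
  "modular_equation 3 2
    (\<lambda>t. t * (t + 9)^2 / (t + 8))
    (\<lambda>t. 2 * (t + 8) powr (- 1 / 3))
    (\<lambda>t. t^2 * (t + 9) / (t + 8)^2)"
proof (rule modular_equation_powrI[where K = 6 and r = 2 and n = 3 and k = 4])
  fix q :: complex assume q: "norm q < 1" "q \<noteq> 0"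
  define t where "t = hauptq 6 q"
  have b: "t + 8 = 8 * eul (q ^ 2) ^ 9 * eul (q ^ 3) ^ 3 / (eul q ^ 9 * eul (q ^ 6) ^ 3)"
    unfolding t_def using haupt_6_factors[OF q] by simp
  show "hauptq 6 q + 8 \<noteq> 0"
    using b q by (simp add: t_def)
  show "2 ^ 12 * haupt_weight 3 (q ^ 2) = haupt_weight 3 q * (hauptq 6 q + 8) ^ 4"
    unfolding b[unfolded t_def] using q
    by (simp add: haupt_weight_def power_mult_distrib power_divide field_simps flip: power_mult; algebra)
  show "hauptq 3 q = (\<lambda>t. t * (t + 9)^2 / (t + 8)) (hauptq 6 q) \<and> hauptq 3 (q ^ 2) = (\<lambda>t. t^2 * (t + 9) / (t + 8)^2) (hauptq 6 q)"
    using haupt_3_6[OF q] by simp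
qed (auto simp: o_def intro!: analytic_intros)

lemma modular_equation_3_3:
  "modular_equation 3 3
    (\<lambda>t. t * (t^2 + 9 * t + 27))
    (\<lambda>t. 3 * (t^2 + 9 * t + 27) powr (- 1 / 3))
    (\<lambda>t. t^3 / (t^2 + 9 * t + 27))"
proof (rule modular_equation_powrI[where K = 9 and r = 3 and n = 3 and k = 4])
  fix q :: complex assume q: "norm q < 1" "q \<noteq> 0"
  define t where "t = hauptq 9 q"
  have b: "t^2 + 9 * t + 27 = 27 * eul (q ^ 3) ^ 12 / (eul (q ^ 9) ^ 3 * eul q ^ 9)"
    unfolding t_def using haupt_9_18[OF q] by simp
  show "hauptq 9 q^2 + 9 * hauptq 9 q + 27 \<noteq> 0"
    using b q by (simp add: t_def)
  show "3 ^ 12 * haupt_weight 3 (q ^ 3) = haupt_weight 3 q * (hauptq 9 q^2 + 9 * hauptq 9 q + 27) ^ 4"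
    unfolding b[unfolded t_def] using q
    by (simp add: haupt_weight_def power_mult_distrib power_divide field_simps flip: power_mult; algebra)
  show "hauptq 3 q = (\<lambda>t. t * (t^2 + 9 * t + 27)) (hauptq 9 q) \<and> hauptq 3 (q ^ 3) = (\<lambda>t. t^3 / (t^2 + 9 * t + 27)) (hauptq 9 q)"
    using haupt_3_9[OF q] by simp
qed (auto simp: o_def intro!: analytic_intros)

lemma modular_equation_4_2:
  "modular_equation 4 2
    (\<lambda>t. t * (t + 8))
    (\<lambda>t. 2 * (t + 4) powr (- 1 / 2))
    (\<lambda>t. t^2 / (t + 4))"
proof (rule modular_equation_powrI[where K = 8 and r = 2 and n = 2 and k = 6])
  fix q :: complex assume q: "norm q < 1" "q \<noteq> 0"
  define t where "t = hauptq 8 q"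
  have b: "t + 4 = 4 * eul (q ^ 2) ^ 12 / (eul q ^ 8 * eul (q ^ 4) ^ 4)"
    unfolding t_def using haupt_8_factors[OF q] by simp
  show "hauptq 8 q + 4 \<noteq> 0"
    using b q by (simp add: t_def)
  show "2 ^ 12 * haupt_weight 4 (q ^ 2) = haupt_weight 4 q * (hauptq 8 q + 4) ^ 6"
    unfolding b[unfolded t_def] using q
    by (simp add: haupt_weight_def power_mult_distrib power_divide field_simps flip: power_mult; algebra)
  show "hauptq 4 q = (\<lambda>t. t * (t + 8)) (hauptq 8 q) \<and> hauptq 4 (q ^ 2) = (\<lambda>t. t^2 / (t + 4)) (hauptq 8 q)"
    using haupt_4_8[OF q] by simp
qed (auto simp: o_def intro!: analytic_intros)

lemma modular_equation_4_3:
  "modular_equation 4 3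
    (\<lambda>t. t * (t + 4)^3 / (t + 3))
    (\<lambda>t. 3 * (t + 3) powi (- 1))
    (\<lambda>t. t^3 * (t + 4) / (t + 3)^3)"
proof (rule modular_equation_powiI[where K = 12 and n = 1 and k = 12])
  fix q :: complex assume q: "norm q < 1" "q \<noteq> 0"
  define t where "t = hauptq 12 q"
  have b: "t + 3 = 3 * eul (q ^ 2) ^ 2 * eul (q ^ 3) ^ 4 / (eul q ^ 4 * eul (q ^ 6) ^ 2)"
    unfolding t_def using haupt_12_factors[OF q] by simp
  show "hauptq 12 q + 3 \<noteq> 0"
    using b q by (simp add: t_def)
  show "3 ^ 12 * haupt_weight 4 (q ^ 3) = haupt_weight 4 q * (hauptq 12 q + 3) ^ 12"
    unfolding b[unfolded t_def] using q
    by (simp add: haupt_weight_def power_mult_distrib power_divide field_simps flip: power_mult; algebra)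
  show "hauptq 4 q = (\<lambda>t. t * (t + 4)^3 / (t + 3)) (hauptq 12 q) \<and> hauptq 4 (q ^ 3) = (\<lambda>t. t^3 * (t + 4) / (t + 3)^3) (hauptq 12 q)"
    using haupt_4_12[OF q] by simp
qed (auto simp: o_def intro!: analytic_intros)

lemma modular_equation_5_2:
  "modular_equation 5 2
    (\<lambda>t. t * (t + 5)^2 / (t + 4))
    (\<lambda>t. 2 * (t + 4) powr (- 1 / 2))
    (\<lambda>t. t^2 * (t + 5) / (t + 4)^2)"
proof (rule modular_equation_powrI[where K = 10 and r = 2 and n = 2 and k = 6])
  fix q :: complex assume q: "norm q < 1" "q \<noteq> 0"
  define t where "t = hauptq 10 q"
  have b: "t + 4 = 4 * eul (q ^ 2) ^ 5 * eul (q ^ 5) / (eul q ^ 5 * eul (q ^ 10))"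
    unfolding t_def using haupt_10_factors[OF q] by simp
  show "hauptq 10 q + 4 \<noteq> 0"
    using b q by (simp add: t_def)
  show "2 ^ 12 * haupt_weight 5 (q ^ 2) = haupt_weight 5 q * (hauptq 10 q + 4) ^ 6"
    unfolding b[unfolded t_def] using q
    by (simp add: haupt_weight_def power_mult_distrib power_divide field_simps flip: power_mult; algebra)
  show "hauptq 5 q = (\<lambda>t. t * (t + 5)^2 / (t + 4)) (hauptq 10 q) \<and> hauptq 5 (q ^ 2) = (\<lambda>t. t^2 * (t + 5) / (t + 4)^2) (hauptq 10 q)"
    using haupt_5_10[OF q] by simp
qed (auto simp: o_def intro!: analytic_intros)

lemma modular_equation_5_5:
  "modular_equation 5 5
    (\<lambda>t. t * (t^4 + 5 * t^3 + 15 * t^2 + 25 * t + 25))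
    (\<lambda>t. 5 * (t^4 + 5 * t^3 + 15 * t^2 + 25 * t + 25) powr (- 1 / 2))
    (\<lambda>t. t^5 / (t^4 + 5 * t^3 + 15 * t^2 + 25 * t + 25))"
proof (rule modular_equation_powrI[where K = 25 and r = 5 and n = 2 and k = 6])
  fix q :: complex assume q: "norm q < 1" "q \<noteq> 0"
  define t where "t = hauptq 25 q"
  have b: "t^4 + 5 * t^3 + 15 * t^2 + 25 * t + 25 = 25 * eul (q ^ 5) ^ 6 / (eul q ^ 5 * eul (q ^ 25))"
    unfolding t_def using haupt_25_factor[OF q] by simp
  show "hauptq 25 q^4 + 5 * hauptq 25 q^3 + 15 * hauptq 25 q^2 + 25 * hauptq 25 q + 25 \<noteq> 0"
    using b q by (simp add: t_def)
  show "5 ^ 12 * haupt_weight 5 (q ^ 5) = haupt_weight 5 q * (hauptq 25 q^4 + 5 * hauptq 25 q^3 + 15 * hauptq 25 q^2 + 25 * hauptq 25 q + 25) ^ 6"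
    unfolding b[unfolded t_def] using q
    by (simp add: haupt_weight_def power_mult_distrib power_divide field_simps flip: power_mult; algebra)
  show "hauptq 5 q = (\<lambda>t. t * (t^4 + 5 * t^3 + 15 * t^2 + 25 * t + 25)) (hauptq 25 q) \<and> hauptq 5 (q ^ 5) = (\<lambda>t. t^5 / (t^4 + 5 * t^3 + 15 * t^2 + 25 * t + 25)) (hauptq 25 q)"
    using haupt_5_25[OF q] by simp
qed (auto simp: o_def intro!: analytic_intros)

lemma modular_equation_6_2:
  "modular_equation 6 2
    (\<lambda>t. t * (t + 6))
    (\<lambda>t. 2 * (t + 2) powi (- 1))
    (\<lambda>t. t^2 / (t + 2))"
proof (rule modular_equation_powiI[where K = 12 and n = 1 and k = 12])
  fix q :: complex assume q: "norm q < 1" "q \<noteq> 0"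
  define t where "t = hauptq 12 q"
  have b: "t + 2 = 2 * eul (q ^ 2) ^ 9 * eul (q ^ 3) ^ 2 * eul (q ^ 12) / (eul q ^ 6 * eul (q ^ 6) ^ 3 * eul (q ^ 4) ^ 3)"
    unfolding t_def using haupt_12_factors[OF q] by simp
  show "hauptq 12 q + 2 \<noteq> 0"
    using b q by (simp add: t_def)
  show "2 ^ 12 * haupt_weight 6 (q ^ 2) = haupt_weight 6 q * (hauptq 12 q + 2) ^ 12"
    unfolding b[unfolded t_def] using q
    by (simp add: haupt_weight_def power_mult_distrib power_divide field_simps flip: power_mult; algebra)
  show "hauptq 6 q = (\<lambda>t. t * (t + 6)) (hauptq 12 q) \<and> hauptq 6 (q ^ 2) = (\<lambda>t. t^2 / (t + 2)) (hauptq 12 q)"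
    using haupt_12_factors[OF q] by simp
qed (auto simp: o_def intro!: analytic_intros)

lemma modular_equation_8_2:
  "modular_equation 8 2
    (\<lambda>t. t * (t + 4))
    (\<lambda>t. 2 * (t + 2) powi (- 1))
    (\<lambda>t. t^2 / (t + 2))"
proof (rule modular_equation_powiI[where K = 16 and n = 1 and k = 12])
  fix q :: complex assume q: "norm q < 1" "q \<noteq> 0"
  define t where "t = hauptq 16 q"
  have b: "t + 2 = 2 * eul (q ^ 2) ^ 6 / (eul q ^ 4 * eul (q ^ 4) ^ 2)"
    unfolding t_def using haupt_16_factors[OF q] by simp
  show "hauptq 16 q + 2 \<noteq> 0"
    using b q by (simp add: t_def)
  show "2 ^ 12 * haupt_weight 8 (q ^ 2) = haupt_weight 8 q * (hauptq 16 q + 2) ^ 12"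
    unfolding b[unfolded t_def] using q
    by (simp add: haupt_weight_def power_mult_distrib power_divide field_simps flip: power_mult; algebra)
  show "hauptq 8 q = (\<lambda>t. t * (t + 4)) (hauptq 16 q) \<and> hauptq 8 (q ^ 2) = (\<lambda>t. t^2 / (t + 2)) (hauptq 16 q)"
    using haupt_8_factors[OF q] by simp
qed (auto simp: o_def intro!: analytic_intros)

lemma modular_equation_6_3:
  "modular_equation 6 3
    (\<lambda>t. t * (t^2 + 6 * t + 12))
    (\<lambda>t. 3 * (t^2 + 3 * t + 3) powi (- 1))
    (\<lambda>t. t^3 / (t^2 + 3 * t + 3))"
proof (rule modular_equation_powiI[where K = 18 and n = 1 and k = 12])
  fix q :: complex assume q: "norm q < 1" "q \<noteq> 0"
  define t where "t = hauptq 18 q"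
  have b: "t^2 + 3 * t + 3 = 3 * eul (q ^ 3) ^ 8 * eul (q ^ 18) * eul (q ^ 2) ^ 3 / (eul (q ^ 9) ^ 2 * eul (q ^ 6) ^ 4 * eul q ^ 6)"
    unfolding t_def using haupt_18_factors[OF q] by simp
  show "hauptq 18 q^2 + 3 * hauptq 18 q + 3 \<noteq> 0"
    using b q by (simp add: t_def)
  show "3 ^ 12 * haupt_weight 6 (q ^ 3) = haupt_weight 6 q * (hauptq 18 q^2 + 3 * hauptq 18 q + 3) ^ 12"
    unfolding b[unfolded t_def] using q
    by (simp add: haupt_weight_def power_mult_distrib power_divide field_simps flip: power_mult; algebra)
  show "hauptq 6 q = (\<lambda>t. t * (t^2 + 6 * t + 12)) (hauptq 18 q) \<and> hauptq 6 (q ^ 3) = (\<lambda>t. t^3 / (t^2 + 3 * t + 3)) (hauptq 18 q)"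
    using haupt_6_18[OF q] by simp
qed (auto simp: o_def intro!: analytic_intros)

lemma modular_equation_9_2:
  "modular_equation 9 2
    (\<lambda>t. t * (t + 3)^2 / (t + 2))
    (\<lambda>t. 2 * (t + 2) powi (- 1))
    (\<lambda>t. t^2 * (t + 3) / (t + 2)^2)"
proof (rule modular_equation_powiI[where K = 18 and n = 1 and k = 12])
  fix q :: complex assume q: "norm q < 1" "q \<noteq> 0"
  define t where "t = hauptq 18 q"
  have b: "t + 2 = 2 * eul (q ^ 2) ^ 3 * eul (q ^ 3) / (eul q ^ 3 * eul (q ^ 6))"
    unfolding t_def using haupt_18_factors[OF q] by simp
  show "hauptq 18 q + 2 \<noteq> 0"
    using b q by (simp add: t_def)
  show "2 ^ 12 * haupt_weight 9 (q ^ 2) = haupt_weight 9 q * (hauptq 18 q + 2) ^ 12"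
    unfolding b[unfolded t_def] using q
    by (simp add: haupt_weight_def power_mult_distrib power_divide field_simps flip: power_mult; algebra)
  show "hauptq 9 q = (\<lambda>t. t * (t + 3)^2 / (t + 2)) (hauptq 18 q) \<and> hauptq 9 (q ^ 2) = (\<lambda>t. t^2 * (t + 3) / (t + 2)^2) (hauptq 18 q)"
    using haupt_9_18[OF q] by simp
qed (auto simp: o_def intro!: analytic_intros)

section \<open>Equations whose arguments are composed substitutions\<close>

lemma modular_equation_2_4:
  "modular_equation 2 4
    ((\<lambda>t. t * (t + 16)) \<circ> (\<lambda>t. t * (t + 8)))
    (\<lambda>t. 4 * ((t + 4) * (t + 8)^2) powr (- 1 / 4))
    ((\<lambda>t. t^2 / (t + 16)) \<circ> (\<lambda>t. t^2 / (t + 4)))"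
proof (rule modular_equation_powrI[where K = 8 and r = 4 and n = 4 and k = 3])
  fix q :: complex assume q: "norm q < 1" "q \<noteq> 0"
  have q': "norm (q ^ 2) < 1" "q ^ 2 \<noteq> 0" using q by (simp_all add: norm_power_lt_1)
  define t where "t = hauptq 8 q"
  have b: "(t + 4) * (t + 8)^2 = (4 * eul (q ^ 2) ^ 12 / (eul q ^ 8 * eul (q ^ 4) ^ 4)) * (8 * eul (q ^ 4) ^ 10 / (eul q ^ 4 * eul (q ^ 2) ^ 2 * eul (q ^ 8) ^ 4)) ^ 2"
    unfolding t_def haupt_8_factors(1,2)[OF q] ..
  show "(hauptq 8 q + 4) * (hauptq 8 q + 8)^2 \<noteq> 0"
    using b q by (simp add: t_def)
  show "4 ^ 12 * haupt_weight 2 (q ^ 4) = haupt_weight 2 q * ((hauptq 8 q + 4) * (hauptq 8 q + 8)^2) ^ 3"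
    unfolding b[unfolded t_def] using q
    by (simp add: haupt_weight_def power_mult_distrib power_divide field_simps flip: power_mult; algebra)
  show "hauptq 2 q = ((\<lambda>t. t * (t + 16)) \<circ> (\<lambda>t. t * (t + 8))) (hauptq 8 q) \<and> hauptq 2 (q ^ 4) = ((\<lambda>t. t^2 / (t + 16)) \<circ> (\<lambda>t. t^2 / (t + 4))) (hauptq 8 q)"
    using haupt_2_4(1)[OF q] haupt_2_4(2)[OF q'] haupt_4_8[OF q] by (simp flip: power_mult)
qed (auto simp: o_def intro!: analytic_intros)

lemma modular_equation_2_6:
  "modular_equation 2 6
    ((\<lambda>t. t * (t + 8)^3 / (t + 9)) \<circ> (\<lambda>t. t * (t + 6)))
    (\<lambda>t. 6 * ((t + 2) * (t + 3) * (t + 6)^3) powr (- 1 / 4))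
    ((\<lambda>t. t^3 * (t + 8) / (t + 9)^3) \<circ> (\<lambda>t. t^2 / (t + 2)))"
proof (rule modular_equation_powrI[where K = 12 and r = 6 and n = 4 and k = 3])
  fix q :: complex assume q: "norm q < 1" "q \<noteq> 0"
  have q': "norm (q ^ 2) < 1" "q ^ 2 \<noteq> 0" using q by (simp_all add: norm_power_lt_1)
  \<comment> \<open>The cofactor of \<open>t\<close> in \<open>t_6 = t (t + 6)\<close>, so its eta
    quotient is found by division.\<close>
  have t6: "hauptq 12 q + 6 = 6 * eul (q ^ 4) * eul (q ^ 6) ^ 7 / (eul q ^ 2 * eul (q ^ 2) * eul (q ^ 3) ^ 2 * eul (q ^ 12) ^ 3)"
  proof -
    have "hauptq 12 q + 6 = hauptq 6 q / hauptq 12 q"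
      unfolding haupt_12_factors(3)[OF q] using hauptq_nonzero[of 12 q] q by simp
    also have "\<dots> = 6 * eul (q ^ 4) * eul (q ^ 6) ^ 7 / (eul q ^ 2 * eul (q ^ 2) * eul (q ^ 3) ^ 2 * eul (q ^ 12) ^ 3)"
      using q by (simp add: hauptq_simps field_simps; algebra)
    finally show ?thesis .
  qed
  define t where "t = hauptq 12 q"
  have b: "(t + 2) * (t + 3) * (t + 6)^3 = (2 * eul (q ^ 2) ^ 9 * eul (q ^ 3) ^ 2 * eul (q ^ 12) / (eul q ^ 6 * eul (q ^ 6) ^ 3 * eul (q ^ 4) ^ 3)) * (3 * eul (q ^ 2) ^ 2 * eul (q ^ 3) ^ 4 / (eul q ^ 4 * eul (q ^ 6) ^ 2)) * (6 * eul (q ^ 4) * eul (q ^ 6) ^ 7 / (eul q ^ 2 * eul (q ^ 2) * eul (q ^ 3) ^ 2 * eul (q ^ 12) ^ 3)) ^ 3"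
    unfolding t_def haupt_12_factors(1,2)[OF q] t6 ..
  show "(hauptq 12 q + 2) * (hauptq 12 q + 3) * (hauptq 12 q + 6)^3 \<noteq> 0"
    using b q by (simp add: t_def)
  show "6 ^ 12 * haupt_weight 2 (q ^ 6) = haupt_weight 2 q * ((hauptq 12 q + 2) * (hauptq 12 q + 3) * (hauptq 12 q + 6)^3) ^ 3"
    unfolding b[unfolded t_def] using q
    by (simp add: haupt_weight_def power_mult_distrib power_divide field_simps flip: power_mult; algebra)
  show "hauptq 2 q = ((\<lambda>t. t * (t + 8)^3 / (t + 9)) \<circ> (\<lambda>t. t * (t + 6))) (hauptq 12 q) \<and> hauptq 2 (q ^ 6) = ((\<lambda>t. t^3 * (t + 8) / (t + 9)^3) \<circ> (\<lambda>t. t^2 / (t + 2))) (hauptq 12 q)"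
    using haupt_2_6(1)[OF q] haupt_2_6(2)[OF q'] haupt_12_factors(3,4)[OF q] by (simp flip: power_mult)
qed (auto simp: o_def intro!: analytic_intros)

lemma modular_equation_2_8:
  "modular_equation 2 8
    ((\<lambda>t. t * (t + 16)) \<circ> (\<lambda>t. t * (t + 8)) \<circ> (\<lambda>t. t * (t + 4)))
    (\<lambda>t. 8 * ((t + 2) * (t + 4)^4 * (t^2 + 4 * t + 8)) powr (- 1 / 4))
    ((\<lambda>t. t^2 / (t + 16)) \<circ> (\<lambda>t. t^2 / (t + 4)) \<circ> (\<lambda>t. t^2 / (t + 2)))"
proof (rule modular_equation_powrI[where K = 16 and r = 8 and n = 4 and k = 3])
  fix q :: complex assume q: "norm q < 1" "q \<noteq> 0"
  have q': "norm (q ^ 4) < 1" "q ^ 4 \<noteq> 0" using q by (simp_all add: norm_power_lt_1)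
  have q2: "norm (q ^ 2) < 1" "q ^ 2 \<noteq> 0" using q by (simp_all add: norm_power_lt_1)
  define t where "t = hauptq 16 q"
  have b: "(t + 2) * (t + 4)^4 * (t^2 + 4 * t + 8) = (2 * eul (q ^ 2) ^ 6 / (eul q ^ 4 * eul (q ^ 4) ^ 2)) * (4 * eul (q ^ 8) ^ 5 * eul (q ^ 2) / (eul (q ^ 4) ^ 2 * eul (q ^ 16) ^ 2 * eul q ^ 2)) ^ 4 * (8 * eul (q ^ 4) ^ 10 / (eul q ^ 4 * eul (q ^ 2) ^ 2 * eul (q ^ 8) ^ 4))"
    unfolding t_def haupt_16_factors[OF q] ..
  show "(hauptq 16 q + 2) * (hauptq 16 q + 4)^4 * (hauptq 16 q^2 + 4 * hauptq 16 q + 8) \<noteq> 0"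
    using b q by (simp add: t_def)
  show "8 ^ 12 * haupt_weight 2 (q ^ 8) = haupt_weight 2 q * ((hauptq 16 q + 2) * (hauptq 16 q + 4)^4 * (hauptq 16 q^2 + 4 * hauptq 16 q + 8)) ^ 3"
    unfolding b[unfolded t_def] using q
    by (simp add: haupt_weight_def power_mult_distrib power_divide field_simps flip: power_mult; algebra)
  \<comment> \<open>The chain runs through the levels 2, 4, 8, 16. On the left each relation is used
    at \<open>q\<close>; on the right the relations from outside to inside are used at
    \<open>q ^ 4\<close>, \<open>q ^ 2\<close> and \<open>q\<close>.\<close>
  show "hauptq 2 q = ((\<lambda>t. t * (t + 16)) \<circ> (\<lambda>t. t * (t + 8)) \<circ> (\<lambda>t. t * (t + 4))) (hauptq 16 q) \<and> hauptq 2 (q ^ 8) = ((\<lambda>t. t^2 / (t + 16)) \<circ> (\<lambda>t. t^2 / (t + 4)) \<circ> (\<lambda>t. t^2 / (t + 2))) (hauptq 16 q)"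
    using haupt_2_4(1)[OF q] haupt_2_4(2)[OF q'] haupt_4_8(1)[OF q] haupt_4_8(2)[OF q2] haupt_8_factors(3,4)[OF q] by (simp flip: power_mult)
qed (auto simp: o_def intro!: analytic_intros)

lemma modular_equation_2_9:
  "modular_equation 2 9
    ((\<lambda>t. t * (t + 8)^3 / (t + 9)) \<circ> (\<lambda>t. t * (t^2 + 6 * t + 12)))
    (\<lambda>t. 9 * (t + 3) powi (- 2))
    ((\<lambda>t. t^3 * (t + 8) / (t + 9)^3) \<circ> (\<lambda>t. t^3 / (t^2 + 3 * t + 3)))"
proof (rule modular_equation_powiI[where K = 18 and n = 2 and k = 24])
  fix q :: complex assume q: "norm q < 1" "q \<noteq> 0"
  have q': "norm (q ^ 3) < 1" "q ^ 3 \<noteq> 0" using q by (simp_all add: norm_power_lt_1)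
  define t where "t = hauptq 18 q"
  have b: "t + 3 = 3 * eul (q ^ 2) * eul (q ^ 9) ^ 2 / (eul q ^ 2 * eul (q ^ 18))"
    unfolding t_def using haupt_18_factors[OF q] by simp
  show "hauptq 18 q + 3 \<noteq> 0"
    using b q by (simp add: t_def)
  show "9 ^ 12 * haupt_weight 2 (q ^ 9) = haupt_weight 2 q * (hauptq 18 q + 3) ^ 24"
    unfolding b[unfolded t_def] using q
    by (simp add: haupt_weight_def power_mult_distrib power_divide field_simps flip: power_mult; algebra)
  show "hauptq 2 q = ((\<lambda>t. t * (t + 8)^3 / (t + 9)) \<circ> (\<lambda>t. t * (t^2 + 6 * t + 12))) (hauptq 18 q) \<and> hauptq 2 (q ^ 9) = ((\<lambda>t. t^3 * (t + 8) / (t + 9)^3) \<circ> (\<lambda>t. t^3 / (t^2 + 3 * t + 3))) (hauptq 18 q)"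
    using haupt_2_6(1)[OF q] haupt_2_6(2)[OF q'] haupt_6_18[OF q] by (simp flip: power_mult)
qed (auto simp: o_def intro!: analytic_intros)

lemma modular_equation_3_4:
  "modular_equation 3 4
    ((\<lambda>t. t * (t + 9)^2 / (t + 8)) \<circ> (\<lambda>t. t * (t + 6)))
    (\<lambda>t. 4 * (t + 4) powi (- 1))
    ((\<lambda>t. t^2 * (t + 9) / (t + 8)^2) \<circ> (\<lambda>t. t^2 / (t + 2)))"
proof (rule modular_equation_powiI[where K = 12 and n = 1 and k = 12])
  fix q :: complex assume q: "norm q < 1" "q \<noteq> 0"
  have q': "norm (q ^ 2) < 1" "q ^ 2 \<noteq> 0" using q by (simp_all add: norm_power_lt_1)
  define t where "t = hauptq 12 q"
  have b: "t + 4 = 4 * eul (q ^ 4) ^ 3 * eul (q ^ 3) / (eul q ^ 3 * eul (q ^ 12))"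
    unfolding t_def using haupt_12_factor_4[OF q] by simp
  show "hauptq 12 q + 4 \<noteq> 0"
    using b q by (simp add: t_def)
  show "4 ^ 12 * haupt_weight 3 (q ^ 4) = haupt_weight 3 q * (hauptq 12 q + 4) ^ 12"
    unfolding b[unfolded t_def] using q
    by (simp add: haupt_weight_def power_mult_distrib power_divide field_simps flip: power_mult; algebra)
  show "hauptq 3 q = ((\<lambda>t. t * (t + 9)^2 / (t + 8)) \<circ> (\<lambda>t. t * (t + 6))) (hauptq 12 q) \<and> hauptq 3 (q ^ 4) = ((\<lambda>t. t^2 * (t + 9) / (t + 8)^2) \<circ> (\<lambda>t. t^2 / (t + 2))) (hauptq 12 q)"
    using haupt_3_6(1)[OF q] haupt_3_6(2)[OF q'] haupt_12_factors(3,4)[OF q] by (simp flip: power_mult)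
qed (auto simp: o_def intro!: analytic_intros)

lemma modular_equation_3_6:
  "modular_equation 3 6
    ((\<lambda>t. t * (t^2 + 9 * t + 27)) \<circ> (\<lambda>t. t * (t + 3)^2 / (t + 2)))
    (\<lambda>t. 6 * ((t^2 + 3 * t + 3) * (t^2 + 6 * t + 12)^2 / (t + 2)) powr (- 1 / 3))
    ((\<lambda>t. t^3 / (t^2 + 9 * t + 27)) \<circ> (\<lambda>t. t^2 * (t + 3) / (t + 2)^2))"
proof (rule modular_equation_powrI[where K = 18 and r = 6 and n = 3 and k = 4])
  fix q :: complex assume q: "norm q < 1" "q \<noteq> 0"
  have q': "norm (q ^ 2) < 1" "q ^ 2 \<noteq> 0" using q by (simp_all add: norm_power_lt_1)
  define t where "t = hauptq 18 q"
  have b: "(t^2 + 3 * t + 3) * (t^2 + 6 * t + 12)^2 / (t + 2) = (3 * eul (q ^ 3) ^ 8 * eul (q ^ 18) * eul (q ^ 2) ^ 3 / (eul (q ^ 9) ^ 2 * eul (q ^ 6) ^ 4 * eul q ^ 6)) * (12 * eul (q ^ 6) ^ 6 * eul (q ^ 9) / (eul (q ^ 18) ^ 2 * eul (q ^ 3) ^ 2 * eul q ^ 3)) ^ 2 / (2 * eul (q ^ 2) ^ 3 * eul (q ^ 3) / (eul q ^ 3 * eul (q ^ 6)))"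
    unfolding t_def haupt_18_factors[OF q] ..
  show "(hauptq 18 q^2 + 3 * hauptq 18 q + 3) * (hauptq 18 q^2 + 6 * hauptq 18 q + 12)^2 / (hauptq 18 q + 2) \<noteq> 0"
    using b q by (simp add: t_def)
  show "6 ^ 12 * haupt_weight 3 (q ^ 6) = haupt_weight 3 q * ((hauptq 18 q^2 + 3 * hauptq 18 q + 3) * (hauptq 18 q^2 + 6 * hauptq 18 q + 12)^2 / (hauptq 18 q + 2)) ^ 4"
    unfolding b[unfolded t_def] using q
    by (simp add: haupt_weight_def power_mult_distrib power_divide field_simps flip: power_mult; algebra)
  show "hauptq 3 q = ((\<lambda>t. t * (t^2 + 9 * t + 27)) \<circ> (\<lambda>t. t * (t + 3)^2 / (t + 2))) (hauptq 18 q) \<and> hauptq 3 (q ^ 6) = ((\<lambda>t. t^3 / (t^2 + 9 * t + 27)) \<circ> (\<lambda>t. t^2 * (t + 3) / (t + 2)^2)) (hauptq 18 q)"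
    using haupt_3_9(1)[OF q] haupt_3_9(2)[OF q'] haupt_9_18[OF q] by (simp flip: power_mult)
qed (auto simp: o_def intro!: analytic_intros)

lemma modular_equation_4_4:
  "modular_equation 4 4
    ((\<lambda>t. t * (t + 8)) \<circ> (\<lambda>t. t * (t + 4)))
    (\<lambda>t. 4 * ((t + 2) * (t^2 + 4 * t + 8)) powr (- 1 / 2))
    ((\<lambda>t. t^2 / (t + 4)) \<circ> (\<lambda>t. t^2 / (t + 2)))"
proof (rule modular_equation_powrI[where K = 16 and r = 4 and n = 2 and k = 6])
  fix q :: complex assume q: "norm q < 1" "q \<noteq> 0"
  have q': "norm (q ^ 2) < 1" "q ^ 2 \<noteq> 0" using q by (simp_all add: norm_power_lt_1)
  define t where "t = hauptq 16 q"
  have b: "(t + 2) * (t^2 + 4 * t + 8) = (2 * eul (q ^ 2) ^ 6 / (eul q ^ 4 * eul (q ^ 4) ^ 2)) * (8 * eul (q ^ 4) ^ 10 / (eul q ^ 4 * eul (q ^ 2) ^ 2 * eul (q ^ 8) ^ 4))"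
    unfolding t_def haupt_16_factors[OF q] ..
  show "(hauptq 16 q + 2) * (hauptq 16 q^2 + 4 * hauptq 16 q + 8) \<noteq> 0"
    using b q by (simp add: t_def)
  show "4 ^ 12 * haupt_weight 4 (q ^ 4) = haupt_weight 4 q * ((hauptq 16 q + 2) * (hauptq 16 q^2 + 4 * hauptq 16 q + 8)) ^ 6"
    unfolding b[unfolded t_def] using q
    by (simp add: haupt_weight_def power_mult_distrib power_divide field_simps flip: power_mult; algebra)
  show "hauptq 4 q = ((\<lambda>t. t * (t + 8)) \<circ> (\<lambda>t. t * (t + 4))) (hauptq 16 q) \<and> hauptq 4 (q ^ 4) = ((\<lambda>t. t^2 / (t + 4)) \<circ> (\<lambda>t. t^2 / (t + 2))) (hauptq 16 q)"
    using haupt_4_8(1)[OF q] haupt_4_8(2)[OF q'] haupt_8_factors(3,4)[OF q] by (simp flip: power_mult)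
qed (auto simp: o_def intro!: analytic_intros)

section \<open>Coincidence of the two compositions in degree 6\<close>

lemma same_rational_ratI:
  fixes p r :: "complex poly"
  assumes "r \<noteq> 0" and "\<And>t. poly r t \<noteq> 0 \<Longrightarrow> A t = B t"
  shows "same_rational A B"
proof -
  have "finite {t. poly r t = 0}" by (rule poly_roots_finite[OF assms(1)])
  moreover have "{t. A t \<noteq> B t} \<subseteq> {t. poly r t = 0}" using assms(2) by blast
  ultimately show ?thesis unfolding same_rational_def MOST_iff_cofinite by (rule finite_subset[rotated])
qed

text \<open>Both compositions become monomials in \<open>t\<close>, \<open>t + 2\<close>,
  \<open>t + 3\<close>, \<open>t + 4\<close>, \<open>t + 6\<close>, the linear factors belonging to
  the cusps of level 12.\<close>

lemma same_rational_6_1: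
  "same_rational
      ((\<lambda>t. t * (t + 8)^3 / (t + 9)) \<circ> (\<lambda>t. t * (t + 6)))
      ((\<lambda>t. t * (t + 16)) \<circ> (\<lambda>t. t * (t + 4)^3 / (t + 3)))"
proof (rule same_rational_ratI[of "[:3, 1:]"])
  fix t :: complex assume "poly [:3, 1:] t \<noteq> 0"
  hence nz: "t + 3 \<noteq> 0" by (simp add: add.commute)
  have 1: "t * (t + 6) + 9 = (t + 3) ^ 2" "t * (t + 6) + 8 = (t + 2) * (t + 4)" by algebra+
  have "t * (t + 4) ^ 3 + 16 * (t + 3) = (t + 6) * (t + 2) ^ 3" by algebra
  hence 2: "t * (t + 4) ^ 3 / (t + 3) + 16 = (t + 6) * (t + 2) ^ 3 / (t + 3)"
    unfolding add_frac_num[OF nz] by simp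
  show "((\<lambda>t. t * (t + 8)^3 / (t + 9)) \<circ> (\<lambda>t. t * (t + 6))) t
      = ((\<lambda>t. t * (t + 16)) \<circ> (\<lambda>t. t * (t + 4)^3 / (t + 3))) t"
    unfolding o_apply 1 2 by (simp add: power_mult_distrib power2_eq_square mult_ac)
qed simp

lemma same_rational_6_2:
  "same_rational
      ((\<lambda>t. t^3 * (t + 8) / (t + 9)^3) \<circ> (\<lambda>t. t^2 / (t + 2)))
      ((\<lambda>t. t^2 / (t + 16)) \<circ> (\<lambda>t. t^3 * (t + 4) / (t + 3)^3))"
proof (rule same_rational_ratI[of "[:2, 1:] * [:3, 1:] * [:6, 1:]"])
  fix t :: complex assume nz': "poly ([:2, 1:] * [:3, 1:] * [:6, 1:]) t \<noteq> 0"
  have "poly ([:2, 1:] * [:3, 1:] * [:6, 1:]) t = (t + 2) * (t + 3) * (t + 6)" by (simp; algebra)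
  with nz' have nz: "t + 2 \<noteq> 0" "t + 3 \<noteq> 0" "t + 6 \<noteq> 0" by auto
  have "t ^ 2 + 8 * (t + 2) = (t + 4) ^ 2" "t ^ 2 + 9 * (t + 2) = (t + 3) * (t + 6)" by algebra+
  hence 1: "t ^ 2 / (t + 2) + 8 = (t + 4) ^ 2 / (t + 2)" "t ^ 2 / (t + 2) + 9 = (t + 3) * (t + 6) / (t + 2)"
    unfolding add_frac_num[OF nz(1)] by simp_all
  have "t ^ 3 * (t + 4) + 16 * (t + 3) ^ 3 = (t + 2) * (t + 6) ^ 3" by algebra
  moreover have "(t + 3) ^ 3 \<noteq> 0" using nz by simp
  ultimately have 2: "t ^ 3 * (t + 4) / (t + 3) ^ 3 + 16 = (t + 2) * (t + 6) ^ 3 / (t + 3) ^ 3"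
    using add_frac_num[of "(t + 3) ^ 3" "t ^ 3 * (t + 4)" 16] by (simp only: simp_thms)
  \<comment> \<open>With the factors named, an identity of monomials remains. It holds also for
    \<open>E = 0\<close>, where both sides are 0 by the convention for division by zero.\<close>
  have "(t ^ 2 / A) ^ 3 * (F ^ 2 / A) / (B * E / A) ^ 3 = (t ^ 3 * F / B ^ 3) ^ 2 / (A * E ^ 3 / B ^ 3)"
    if "A \<noteq> 0" "B \<noteq> 0" for A B E F :: complex
    using that by (simp add: power_divide power_mult_distrib divide_simps flip: power_mult; algebra)
  from this[OF nz(1,2)] show "((\<lambda>t. t^3 * (t + 8) / (t + 9)^3) \<circ> (\<lambda>t. t^2 / (t + 2))) t
      = ((\<lambda>t. t^2 / (t + 16)) \<circ> (\<lambda>t. t^3 * (t + 4) / (t + 3)^3)) t"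
    unfolding o_apply 1 2 .
qed simp

lemma quadratic_fraction:
  fixes A u :: complex
  assumes "A \<noteq> 0"
  shows "(u / A) ^ 2 + 9 * (u / A) + 27 = (u ^ 2 + 9 * u * A + 27 * A ^ 2) / A ^ 2"
  using assms by (simp add: power_divide add_divide_distrib eval_nat_numeral)

lemma same_rational_6_3:
  "same_rational
      ((\<lambda>t. t * (t^2 + 9 * t + 27)) \<circ> (\<lambda>t. t * (t + 3)^2 / (t + 2)))
      ((\<lambda>t. t * (t + 9)^2 / (t + 8)) \<circ> (\<lambda>t. t * (t^2 + 6 * t + 12)))"
proof (rule same_rational_ratI[of "[:2, 1:]"])
  fix t :: complex assume "poly [:2, 1:] t \<noteq> 0"
  hence nz: "t + 2 \<noteq> 0" by (simp add: add.commute)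
  define u where "u = t * (t + 3) ^ 2"
  have 1: "t * (t ^ 2 + 6 * t + 12) + 8 = (t + 2) ^ 3"
    "t * (t ^ 2 + 6 * t + 12) + 9 = (t + 3) * (t ^ 2 + 3 * t + 3)" by algebra+
  have 2: "u ^ 2 + 9 * u * (t + 2) + 27 * (t + 2) ^ 2 = (t ^ 2 + 3 * t + 3) ^ 2 * (t ^ 2 + 6 * t + 12)"
    unfolding u_def by algebra
  have "u / (t + 2) * ((u / (t + 2)) ^ 2 + 9 * (u / (t + 2)) + 27)
      = u / (t + 2) * ((t ^ 2 + 3 * t + 3) ^ 2 * (t ^ 2 + 6 * t + 12) / (t + 2) ^ 2)"
    unfolding quadratic_fraction[OF nz] 2 ..
  also have "\<dots> = t * (t ^ 2 + 6 * t + 12) * ((t + 3) * (t ^ 2 + 3 * t + 3)) ^ 2 / (t + 2) ^ 3"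
    unfolding u_def by (simp only: times_divide_times_eq power_mult_distrib power2_eq_square power3_eq_cube mult_ac)
  finally show "((\<lambda>t. t * (t^2 + 9 * t + 27)) \<circ> (\<lambda>t. t * (t + 3)^2 / (t + 2))) t
      = ((\<lambda>t. t * (t + 9)^2 / (t + 8)) \<circ> (\<lambda>t. t * (t^2 + 6 * t + 12))) t"
    unfolding o_apply 1 u_def .
qed simp

lemma same_rational_6_4:
  "same_rational
      ((\<lambda>t. t^3 / (t^2 + 9 * t + 27)) \<circ> (\<lambda>t. t^2 * (t + 3) / (t + 2)^2))
      ((\<lambda>t. t^2 * (t + 9) / (t + 8)^2) \<circ> (\<lambda>t. t^3 / (t^2 + 3 * t + 3)))"
proof (rule same_rational_ratI[of "[:2, 1:] * [:3, 3, 1:]"])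
  fix t :: complex assume nz': "poly ([:2, 1:] * [:3, 3, 1:]) t \<noteq> 0"
  define D where "D = t ^ 2 + 3 * t + 3"
  define E where "E = t ^ 2 + 6 * t + 12"
  define u where "u = t ^ 2 * (t + 3)"
  have "poly ([:2, 1:] * [:3, 3, 1:]) t = (t + 2) * D" unfolding D_def by (simp; algebra)
  with nz' have nz: "t + 2 \<noteq> 0" "D \<noteq> 0" by auto
  have 1: "u ^ 2 + 9 * u * (t + 2) ^ 2 + 27 * (t + 2) ^ 4 = D * E ^ 2" unfolding u_def D_def E_def by algebra
  have 2: "t ^ 3 + 9 * D = (t + 3) ^ 3" "t ^ 3 + 8 * D = (t + 2) * E" unfolding D_def E_def by algebra+
  have "(t + 2) ^ 2 \<noteq> 0" "((t + 2) ^ 2) ^ 2 = (t + 2) ^ 4" using nz(1) by (simp_all flip: power_mult)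
  with quadratic_fraction[of "(t + 2) ^ 2" u]
  have "(u / (t + 2) ^ 2) ^ 2 + 9 * (u / (t + 2) ^ 2) + 27 = (u ^ 2 + 9 * u * (t + 2) ^ 2 + 27 * (t + 2) ^ 4) / (t + 2) ^ 4"
    by (simp only: simp_thms)
  hence 3: "(u / (t + 2) ^ 2) ^ 2 + 9 * (u / (t + 2) ^ 2) + 27 = D * E ^ 2 / (t + 2) ^ 4" unfolding 1 .
  have "t ^ 3 / D + 9 = (t ^ 3 + 9 * D) / D" "t ^ 3 / D + 8 = (t ^ 3 + 8 * D) / D"
    using nz(2) by (simp_all add: add_divide_distrib)
  hence 4: "t ^ 3 / D + 9 = (t + 3) ^ 3 / D" "t ^ 3 / D + 8 = (t + 2) * E / D" unfolding 2 .
  have "(u / (t + 2) ^ 2) ^ 3 / (D * E ^ 2 / (t + 2) ^ 4) = (t ^ 3 / D) ^ 2 * ((t + 3) ^ 3 / D) / ((t + 2) * E / D) ^ 2"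
  \<comment> \<open>Zeros of \<open>E\<close> are not among the excluded points; there both
    quotients are 0 by the convention for division by zero.\<close>
  proof (cases "E = 0")
    case False
    thus ?thesis using nz
      by (simp add: u_def power_divide power_mult_distrib divide_simps flip: power_mult; algebra)
  qed simp
  thus "((\<lambda>t. t^3 / (t^2 + 9 * t + 27)) \<circ> (\<lambda>t. t^2 * (t + 3) / (t + 2)^2)) t
      = ((\<lambda>t. t^2 * (t + 9) / (t + 8)^2) \<circ> (\<lambda>t. t^3 / (t^2 + 3 * t + 3))) t"
    unfolding o_apply D_def[symmetric] u_def[symmetric] 3 4 .
qed simp

theorem theorem8p2:
  shows "(\<forall>M\<in>{2, 3, 4, 5, 6, 8, 9}. h M analytic_on {0}) \<and>
    modular_equation 2 2
      (\<lambda>t. t * (t + 16))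
      (\<lambda>t. 2 * (t + 16) powr (- 1 / 4))
      (\<lambda>t. t^2 / (t + 16)) \<and>
    modular_equation 2 3
      (\<lambda>t. t * (t + 8)^3 / (t + 9))
      (\<lambda>t. 3 * (t + 9) powr (- 1 / 2))
      (\<lambda>t. t^3 * (t + 8) / (t + 9)^3) \<and>
    modular_equation 2 4
      ((\<lambda>t. t * (t + 16)) \<circ> (\<lambda>t. t * (t + 8)))
      (\<lambda>t. 4 * ((t + 4) * (t + 8)^2) powr (- 1 / 4))
      ((\<lambda>t. t^2 / (t + 16)) \<circ> (\<lambda>t. t^2 / (t + 4))) \<and>
    modular_equation 2 5
      (\<lambda>t. t * (t + 4)^5 / (t + 5))
      (\<lambda>t. 5 * (t + 5) powi (- 1))
      (\<lambda>t. t^5 * (t + 4) / (t + 5)^5) \<and>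
    modular_equation 2 6
      ((\<lambda>t. t * (t + 8)^3 / (t + 9)) \<circ> (\<lambda>t. t * (t + 6)))
      (\<lambda>t. 6 * ((t + 2) * (t + 3) * (t + 6)^3) powr (- 1 / 4))
      ((\<lambda>t. t^3 * (t + 8) / (t + 9)^3) \<circ> (\<lambda>t. t^2 / (t + 2))) \<and>
    same_rational
      ((\<lambda>t. t * (t + 8)^3 / (t + 9)) \<circ> (\<lambda>t. t * (t + 6)))
      ((\<lambda>t. t * (t + 16)) \<circ> (\<lambda>t. t * (t + 4)^3 / (t + 3))) \<and>
    same_rational
      ((\<lambda>t. t^3 * (t + 8) / (t + 9)^3) \<circ> (\<lambda>t. t^2 / (t + 2)))
      ((\<lambda>t. t^2 / (t + 16)) \<circ> (\<lambda>t. t^3 * (t + 4) / (t + 3)^3)) \<and>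
    modular_equation 2 8
      ((\<lambda>t. t * (t + 16)) \<circ> (\<lambda>t. t * (t + 8)) \<circ> (\<lambda>t. t * (t + 4)))
      (\<lambda>t. 8 * ((t + 2) * (t + 4)^4 * (t^2 + 4 * t + 8)) powr (- 1 / 4))
      ((\<lambda>t. t^2 / (t + 16)) \<circ> (\<lambda>t. t^2 / (t + 4)) \<circ> (\<lambda>t. t^2 / (t + 2))) \<and>
    modular_equation 2 9
      ((\<lambda>t. t * (t + 8)^3 / (t + 9)) \<circ> (\<lambda>t. t * (t^2 + 6 * t + 12)))
      (\<lambda>t. 9 * (t + 3) powi (- 2))
      ((\<lambda>t. t^3 * (t + 8) / (t + 9)^3) \<circ> (\<lambda>t. t^3 / (t^2 + 3 * t + 3))) \<and>
    modular_equation 3 2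
      (\<lambda>t. t * (t + 9)^2 / (t + 8))
      (\<lambda>t. 2 * (t + 8) powr (- 1 / 3))
      (\<lambda>t. t^2 * (t + 9) / (t + 8)^2) \<and>
    modular_equation 3 3
      (\<lambda>t. t * (t^2 + 9 * t + 27))
      (\<lambda>t. 3 * (t^2 + 9 * t + 27) powr (- 1 / 3))
      (\<lambda>t. t^3 / (t^2 + 9 * t + 27)) \<and>
    modular_equation 3 4
      ((\<lambda>t. t * (t + 9)^2 / (t + 8)) \<circ> (\<lambda>t. t * (t + 6)))
      (\<lambda>t. 4 * (t + 4) powi (- 1))
      ((\<lambda>t. t^2 * (t + 9) / (t + 8)^2) \<circ> (\<lambda>t. t^2 / (t + 2))) \<and>
    modular_equation 3 6
      ((\<lambda>t. t * (t^2 + 9 * t + 27)) \<circ> (\<lambda>t. t * (t + 3)^2 / (t + 2)))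
      (\<lambda>t. 6 * ((t^2 + 3 * t + 3) * (t^2 + 6 * t + 12)^2 / (t + 2)) powr (- 1 / 3))
      ((\<lambda>t. t^3 / (t^2 + 9 * t + 27)) \<circ> (\<lambda>t. t^2 * (t + 3) / (t + 2)^2)) \<and>
    same_rational
      ((\<lambda>t. t * (t^2 + 9 * t + 27)) \<circ> (\<lambda>t. t * (t + 3)^2 / (t + 2)))
      ((\<lambda>t. t * (t + 9)^2 / (t + 8)) \<circ> (\<lambda>t. t * (t^2 + 6 * t + 12))) \<and>
    same_rational
      ((\<lambda>t. t^3 / (t^2 + 9 * t + 27)) \<circ> (\<lambda>t. t^2 * (t + 3) / (t + 2)^2))
      ((\<lambda>t. t^2 * (t + 9) / (t + 8)^2) \<circ> (\<lambda>t. t^3 / (t^2 + 3 * t + 3))) \<and>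
    modular_equation 4 2
      (\<lambda>t. t * (t + 8))
      (\<lambda>t. 2 * (t + 4) powr (- 1 / 2))
      (\<lambda>t. t^2 / (t + 4)) \<and>
    modular_equation 4 3
      (\<lambda>t. t * (t + 4)^3 / (t + 3))
      (\<lambda>t. 3 * (t + 3) powi (- 1))
      (\<lambda>t. t^3 * (t + 4) / (t + 3)^3) \<and>
    modular_equation 4 4
      ((\<lambda>t. t * (t + 8)) \<circ> (\<lambda>t. t * (t + 4)))
      (\<lambda>t. 4 * ((t + 2) * (t^2 + 4 * t + 8)) powr (- 1 / 2))
      ((\<lambda>t. t^2 / (t + 4)) \<circ> (\<lambda>t. t^2 / (t + 2))) \<and>
    modular_equation 5 2
      (\<lambda>t. t * (t + 5)^2 / (t + 4))
      (\<lambda>t. 2 * (t + 4) powr (- 1 / 2))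
      (\<lambda>t. t^2 * (t + 5) / (t + 4)^2) \<and>
    modular_equation 5 5
      (\<lambda>t. t * (t^4 + 5 * t^3 + 15 * t^2 + 25 * t + 25))
      (\<lambda>t. 5 * (t^4 + 5 * t^3 + 15 * t^2 + 25 * t + 25) powr (- 1 / 2))
      (\<lambda>t. t^5 / (t^4 + 5 * t^3 + 15 * t^2 + 25 * t + 25)) \<and>
    modular_equation 6 2
      (\<lambda>t. t * (t + 6))
      (\<lambda>t. 2 * (t + 2) powi (- 1))
      (\<lambda>t. t^2 / (t + 2)) \<and>
    modular_equation 6 3
      (\<lambda>t. t * (t^2 + 6 * t + 12))
      (\<lambda>t. 3 * (t^2 + 3 * t + 3) powi (- 1))
      (\<lambda>t. t^3 / (t^2 + 3 * t + 3)) \<and>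
    modular_equation 8 2
      (\<lambda>t. t * (t + 4))
      (\<lambda>t. 2 * (t + 2) powi (- 1))
      (\<lambda>t. t^2 / (t + 2)) \<and>
    modular_equation 9 2
      (\<lambda>t. t * (t + 3)^2 / (t + 2))
      (\<lambda>t. 2 * (t + 2) powi (- 1))
      (\<lambda>t. t^2 * (t + 3) / (t + 2)^2)"
  using h_analytic modular_equation_2_2 modular_equation_2_3 modular_equation_2_4 modular_equation_2_5
    modular_equation_2_6 modular_equation_2_8 modular_equation_2_9 modular_equation_3_2 modular_equation_3_3
    modular_equation_3_4 modular_equation_3_6 modular_equation_4_2 modular_equation_4_3 modular_equation_4_4
    modular_equation_5_2 modular_equation_5_5 modular_equation_6_2 modular_equation_6_3 modular_equation_8_2
    modular_equation_9_2 same_rational_6_1 same_rational_6_2 same_rational_6_3 same_rational_6_4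
  by (intro conjI ballI) assumption+

end
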